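(* Let $s\in(0,1)$, $\mathsf f\in L^2(0,T;H^{-s}(\Omega))$, $\mathsf u_0\in L^2(\Omega)$, and assume $\mathsf a,\mathsf b\in H^1(0,T;L^2(\Omega))$. Then the optimal control $\bar{\mathsf z}$ and the optimal adjoint state $\bar{\mathsf p}$ satisfy $$\|\partial_t\bar{\mathsf z}\|_{L^2(Q)}+\|\partial_t\bar{\mathsf p}\|_{L^2(Q)}\le C\Big(\big(\|\mathsf u_0\|_{L^2(\Omega)}^2+\|\mathsf f\|_{L^2(0,T;H^{-s}(\Omega))}^2\big)^{1/2}+\|\mathsf u_d\|_{L^2(Q)}+\|\mathsf a\|_{H^1(0,T;L^2(\Omega))}+\|\mathsf b\|_{H^1(0,T;L^2(\Omega))}\Big),$$ with $C$ independent of the data and of the optimal variables.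
   Context: Setting: $n\ge1$, $\Omega\subset\mathbb R^n$ bounded open Lipschitz, $T>0$, $Q=\Omega\times(0,T)$; $\tilde H^s(\Omega)$ the closure of $C_0^\infty(\Omega)$ in $H^s(\mathbb R^n)$, $H^{-s}(\Omega)$ its dual; $\mathcal A(v,w)=\frac{C(n,s)}{2}\iint\frac{(v(x)-v(y))(w(x)-w(y))}{|x-y|^{n+2s}}dxdy$, $C(n,s)=\frac{2^{2s}s\Gamma(s+n/2)}{\pi^{n/2}\Gamma(1-s)}$; $\mathbb V=\{\mathsf v\in L^2(0,T;\tilde H^s(\Omega))\cap L^\infty(0,T;L^2(\Omega)):\partial_t\mathsf v\in L^2(0,T;H^{-s}(\Omega))\}$. $\mathsf u_d\in L^2(Q)$, $\mu>0$, $\mathsf a\le\mathsf b$ a.e.; $\mathsf Z_{ad}=\{\mathsf w\in L^2(Q):\mathsf a\le\mathsf w\le\mathsf b\text{ a.e.}\}$. $\mathbf S\mathsf z$ is the $\mathsf u\in\mathbb V$ with $\mathsf u(0)=\mathsf u_0$, $\langle\partial_t\mathsf u,\phi\rangle+\mathcal A(\mathsf u,\phi)=\langle\mathsf f+\mathsf z,\phi\rangle$ for all $\phi\in\tilde H^s(\Omega)$, a.e. $t$. The optimal control $\bar{\mathsf z}$ is the unique minimizer over $\mathsf Z_{ad}$ of $\frac12\|\mathbf S\mathsf z-\mathsf u_d\|_{L^2(Q)}^2+\frac\mu2\|\mathsf z\|_{L^2(Q)}^2$, $\bar{\mathsf u}=\mathbf S\bar{\mathsf z}$, and $\bar{\mathsf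 p}\in\mathbb V$ solves $\bar{\mathsf p}(T)=0$, $-\langle\partial_t\bar{\mathsf p},\phi\rangle+\mathcal A(\bar{\mathsf p},\phi)=(\bar{\mathsf u}-\mathsf u_d,\phi)_{L^2(\Omega)}$ for all $\phi\in\tilde H^s(\Omega)$, a.e. $t$. *)

theory Defs
  imports "HOL-Analysis.Analysis"
begin

coinductive smooth :: "('a::euclidean_space \<Rightarrow> real) \<Rightarrow> bool" where
  "(\<forall>x. f differentiable (at x)) \<Longrightarrow>
   (\<forall>i\<in>Basis. smooth (\<lambda>x. frechet_derivative f (at x) i)) \<Longrightarrow> smooth f"

definition test_fn :: "'a::euclidean_space set \<Rightarrow> ('a \<Rightarrow> real) \<Rightarrow> bool" where
  "test_fn U \<phi> \<longleftrightarrow> smooth \<phi> \<and> compact (closure {x. \<phi> x \<noteq> 0})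
     \<and> closure {x. \<phi> x \<noteq> 0} \<subseteq> U"

definition lipschitz_domain :: "(real^'n) set \<Rightarrow> bool" where
  "lipschitz_domain \<Omega> \<longleftrightarrow> bounded \<Omega> \<and> open \<Omega> \<and>
    (\<forall>x\<in>frontier \<Omega>. \<exists>r>0. \<exists>(e::real^'n) (g::real^'n \<Rightarrow> real) L.
        norm e = 1 \<and>
        (\<forall>y z. y \<bullet> e = 0 \<longrightarrow> z \<bullet> e = 0 \<longrightarrow> \<bar>g y - g z\<bar> \<le> L * norm (y - z)) \<and>
        \<Omega> \<inter> ball x r = {y \<in> ball x r. y \<bullet> e < g (y - (y \<bullet> e) *\<^sub>R e)})"

definition Cns :: "nat \<Rightarrow> real \<Rightarrow> real" where
  "Cns n s = 2 powr (2 * s) * s * Gamma (s + real n / 2) / (pi powr (real n / 2) * Gamma (1 - s))"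

definition frac_form :: "real \<Rightarrow> (real^'n \<Rightarrow> real) \<Rightarrow> (real^'n \<Rightarrow> real) \<Rightarrow> real" where
  "frac_form s v w = Cns CARD('n) s / 2 *
     (\<integral>p. (v (fst p) - v (snd p)) * (w (fst p) - w (snd p))
            / norm (fst p - snd p) powr (real CARD('n) + 2 * s) \<partial>lebesgue)"

definition gagliardo_sq :: "real \<Rightarrow> (real^'n \<Rightarrow> real) \<Rightarrow> ennreal" where
  "gagliardo_sq s v = (\<integral>\<^sup>+p. ennreal ((v (fst p) - v (snd p))\<^sup>2
            / norm (fst p - snd p) powr (real CARD('n) + 2 * s)) \<partial>lebesgue)"

definition in_Hs :: "real \<Rightarrow> (real^'n \<Rightarrow> real) \<Rightarrow> bool" where
  "in_Hs s v \<longleftrightarrow> v \<in> borel_measurable lebesgue \<and>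
     (\<integral>\<^sup>+x. ennreal ((v x)\<^sup>2) \<partial>lebesgue) < \<infinity> \<and> gagliardo_sq s v < \<infinity>"

definition Hs_norm :: "real \<Rightarrow> (real^'n \<Rightarrow> real) \<Rightarrow> real" where
  "Hs_norm s v = sqrt (enn2real (\<integral>\<^sup>+x. ennreal ((v x)\<^sup>2) \<partial>lebesgue) + enn2real (gagliardo_sq s v))"

definition tHs :: "(real^'n) set \<Rightarrow> real \<Rightarrow> (real^'n \<Rightarrow> real) set" where
  "tHs \<Omega> s = {v. in_Hs s v \<and> (\<exists>\<phi>::nat \<Rightarrow> real^'n \<Rightarrow> real. (\<forall>k. test_fn \<Omega> (\<phi> k)) \<and>
        (\<lambda>k. Hs_norm s (\<lambda>x. \<phi> k x - v x)) \<longlonglongrightarrow> 0)}"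

definition in_Hms :: "(real^'n) set \<Rightarrow> real \<Rightarrow> ((real^'n \<Rightarrow> real) \<Rightarrow> real) \<Rightarrow> bool" where
  "in_Hms \<Omega> s g \<longleftrightarrow>
     (\<forall>v\<in>tHs \<Omega> s. \<forall>w\<in>tHs \<Omega> s. g (\<lambda>x. v x + w x) = g v + g w) \<and>
     (\<forall>v\<in>tHs \<Omega> s. \<forall>c. g (\<lambda>x. c * v x) = c * g v) \<and>
     (\<exists>M. \<forall>v\<in>tHs \<Omega> s. \<bar>g v\<bar> \<le> M * Hs_norm s v)"

definition Hms_norm :: "(real^'n) set \<Rightarrow> real \<Rightarrow> ((real^'n \<Rightarrow> real) \<Rightarrow> real) \<Rightarrow> real" where
  "Hms_norm \<Omega> s g = Sup {\<bar>g v\<bar> | v. v \<in> tHs \<Omega> s \<and> Hs_norm s v \<le> 1}"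

definition cyl :: "real \<Rightarrow> (real^'n) set \<Rightarrow> (real \<times> (real^'n)) set" where
  "cyl T \<Omega> = {0<..<T} \<times> \<Omega>"

definition L2_Omega_norm :: "(real^'n) set \<Rightarrow> (real^'n \<Rightarrow> real) \<Rightarrow> real" where
  "L2_Omega_norm \<Omega> v = sqrt (enn2real (\<integral>\<^sup>+x\<in>\<Omega>. ennreal ((v x)\<^sup>2) \<partial>lebesgue))"

definition in_L2_Omega :: "(real^'n) set \<Rightarrow> (real^'n \<Rightarrow> real) \<Rightarrow> bool" where
  "in_L2_Omega \<Omega> v \<longleftrightarrow> set_borel_measurable lebesgue \<Omega> v \<and>
     (\<integral>\<^sup>+x\<in>\<Omega>. ennreal ((v x)\<^sup>2) \<partial>lebesgue) < \<infinity>"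

definition in_L2Q :: "real \<Rightarrow> (real^'n) set \<Rightarrow> (real \<Rightarrow> real^'n \<Rightarrow> real) \<Rightarrow> bool" where
  "in_L2Q T \<Omega> z \<longleftrightarrow> set_borel_measurable lebesgue (cyl T \<Omega>) (\<lambda>p. z (fst p) (snd p)) \<and>
     (\<integral>\<^sup>+p\<in>cyl T \<Omega>. ennreal ((z (fst p) (snd p))\<^sup>2) \<partial>lebesgue) < \<infinity>"

definition L2Q_norm :: "real \<Rightarrow> (real^'n) set \<Rightarrow> (real \<Rightarrow> real^'n \<Rightarrow> real) \<Rightarrow> real" where
  "L2Q_norm T \<Omega> z = sqrt (enn2real (\<integral>\<^sup>+p\<in>cyl T \<Omega>. ennreal ((z (fst p) (snd p))\<^sup>2) \<partial>lebesgue))"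

definition has_dt_L2 :: "real \<Rightarrow> (real^'n) set \<Rightarrow> (real \<Rightarrow> real^'n \<Rightarrow> real)
     \<Rightarrow> (real \<Rightarrow> real^'n \<Rightarrow> real) \<Rightarrow> bool" where
  "has_dt_L2 T \<Omega> z dz \<longleftrightarrow> (\<forall>\<psi> \<phi>. test_fn {0<..<T} \<psi> \<longrightarrow> test_fn \<Omega> \<phi> \<longrightarrow>
     (\<integral>p\<in>cyl T \<Omega>. z (fst p) (snd p) * deriv \<psi> (fst p) * \<phi> (snd p) \<partial>lebesgue)
       = - (\<integral>p\<in>cyl T \<Omega>. dz (fst p) (snd p) * \<psi> (fst p) * \<phi> (snd p) \<partial>lebesgue))"

definition in_H1L2 :: "real \<Rightarrow> (real^'n) set \<Rightarrow> (real \<Rightarrow> real^'n \<Rightarrow> real) \<Rightarrow> bool" where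
  "in_H1L2 T \<Omega> a \<longleftrightarrow> in_L2Q T \<Omega> a \<and> (\<exists>da. in_L2Q T \<Omega> da \<and> has_dt_L2 T \<Omega> a da)"

definition H1L2_norm :: "real \<Rightarrow> (real^'n) set \<Rightarrow> (real \<Rightarrow> real^'n \<Rightarrow> real) \<Rightarrow> real" where
  "H1L2_norm T \<Omega> a = sqrt ((L2Q_norm T \<Omega> a)\<^sup>2 +
      (L2Q_norm T \<Omega> (SOME da. in_L2Q T \<Omega> da \<and> has_dt_L2 T \<Omega> a da))\<^sup>2)"

definition in_L2_tHs :: "real \<Rightarrow> (real^'n) set \<Rightarrow> real \<Rightarrow> (real \<Rightarrow> real^'n \<Rightarrow> real) \<Rightarrow> bool" where
  "in_L2_tHs T \<Omega> s u \<longleftrightarrow>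
     (AE t in lebesgue. t \<in> {0<..<T} \<longrightarrow> u t \<in> tHs \<Omega> s) \<and>
     set_borel_measurable lebesgue (cyl T \<Omega>) (\<lambda>p. u (fst p) (snd p)) \<and>
     set_borel_measurable lebesgue {0<..<T} (\<lambda>t. Hs_norm s (u t)) \<and>
     (\<integral>\<^sup>+t\<in>{0<..<T}. ennreal ((Hs_norm s (u t))\<^sup>2) \<partial>lebesgue) < \<infinity>"

definition in_Linf_L2 :: "real \<Rightarrow> (real^'n) set \<Rightarrow> (real \<Rightarrow> real^'n \<Rightarrow> real) \<Rightarrow> bool" where
  "in_Linf_L2 T \<Omega> u \<longleftrightarrow> (\<exists>M. AE t in lebesgue. t \<in> {0<..<T} \<longrightarrow> L2_Omega_norm \<Omega> (u t) \<le> M)"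

definition in_L2_Hms :: "real \<Rightarrow> (real^'n) set \<Rightarrow> real
     \<Rightarrow> (real \<Rightarrow> (real^'n \<Rightarrow> real) \<Rightarrow> real) \<Rightarrow> bool" where
  "in_L2_Hms T \<Omega> s g \<longleftrightarrow>
     (AE t in lebesgue. t \<in> {0<..<T} \<longrightarrow> in_Hms \<Omega> s (g t)) \<and>
     (\<forall>v\<in>tHs \<Omega> s. set_borel_measurable lebesgue {0<..<T} (\<lambda>t. g t v)) \<and>
     (\<integral>\<^sup>+t\<in>{0<..<T}. ennreal ((Hms_norm \<Omega> s (g t))\<^sup>2) \<partial>lebesgue) < \<infinity>"

definition L2_Hms_norm :: "real \<Rightarrow> (real^'n) set \<Rightarrow> real
     \<Rightarrow> (real \<Rightarrow> (real^'n \<Rightarrow> real) \<Rightarrow> real) \<Rightarrow> real" where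
  "L2_Hms_norm T \<Omega> s g =
     sqrt (enn2real (\<integral>\<^sup>+t\<in>{0<..<T}. ennreal ((Hms_norm \<Omega> s (g t))\<^sup>2) \<partial>lebesgue))"

text \<open>Weak time derivative of u (with values in L^2 subset H^{-s}) equal to g in L^2(0,T;H^{-s}).\<close>
definition has_dt_Hms :: "real \<Rightarrow> (real^'n) set \<Rightarrow> real \<Rightarrow> (real \<Rightarrow> real^'n \<Rightarrow> real)
     \<Rightarrow> (real \<Rightarrow> (real^'n \<Rightarrow> real) \<Rightarrow> real) \<Rightarrow> bool" where
  "has_dt_Hms T \<Omega> s u g \<longleftrightarrow> (\<forall>\<phi>\<in>tHs \<Omega> s. \<forall>\<psi>. test_fn {0<..<T} \<psi> \<longrightarrow>
     (\<integral>t\<in>{0<..<T}. (\<integral>x\<in>\<Omega>. u t x * \<phi> x \<partial>lebesgue) * deriv \<psi> t \<partial>lebesgue)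
       = - (\<integral>t\<in>{0<..<T}. g t \<phi> * \<psi> t \<partial>lebesgue))"

definition in_V_with :: "real \<Rightarrow> (real^'n) set \<Rightarrow> real \<Rightarrow> (real \<Rightarrow> real^'n \<Rightarrow> real)
     \<Rightarrow> (real \<Rightarrow> (real^'n \<Rightarrow> real) \<Rightarrow> real) \<Rightarrow> bool" where
  "in_V_with T \<Omega> s u g \<longleftrightarrow> in_L2_tHs T \<Omega> s u \<and> in_Linf_L2 T \<Omega> u \<and>
     in_L2_Hms T \<Omega> s g \<and> has_dt_Hms T \<Omega> s u g"

text \<open>Value of u at time t0 in the sense of its continuous representative in C([0,T];L^2(Omega)).\<close>
definition value_at :: "real \<Rightarrow> (real^'n) set \<Rightarrow> (real \<Rightarrow> real^'n \<Rightarrow> real) \<Rightarrow> real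
     \<Rightarrow> (real^'n \<Rightarrow> real) \<Rightarrow> bool" where
  "value_at T \<Omega> u t0 v \<longleftrightarrow> (\<exists>w. (\<forall>t\<in>{0..T}. in_L2_Omega \<Omega> (w t)) \<and>
     (AE t in lebesgue. t \<in> {0<..<T} \<longrightarrow> (AE x in lebesgue. x \<in> \<Omega> \<longrightarrow> u t x = w t x)) \<and>
     (\<forall>t1\<in>{0..T}. ((\<lambda>t. L2_Omega_norm \<Omega> (\<lambda>x. w t x - w t1 x)) \<longlongrightarrow> 0) (at t1 within {0..T})) \<and>
     L2_Omega_norm \<Omega> (\<lambda>x. w t0 x - v x) = 0)"

definition is_state :: "real \<Rightarrow> (real^'n) set \<Rightarrow> real \<Rightarrow> (real \<Rightarrow> (real^'n \<Rightarrow> real) \<Rightarrow> real)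
     \<Rightarrow> (real^'n \<Rightarrow> real) \<Rightarrow> (real \<Rightarrow> real^'n \<Rightarrow> real) \<Rightarrow> (real \<Rightarrow> real^'n \<Rightarrow> real) \<Rightarrow> bool" where
  "is_state T \<Omega> s f u0 z u \<longleftrightarrow> (\<exists>g. in_V_with T \<Omega> s u g \<and>
     (AE t in lebesgue. t \<in> {0<..<T} \<longrightarrow> (\<forall>\<phi>\<in>tHs \<Omega> s.
        g t \<phi> + frac_form s (u t) \<phi> = f t \<phi> + (\<integral>x\<in>\<Omega>. z t x * \<phi> x \<partial>lebesgue)))) \<and>
     value_at T \<Omega> u 0 u0"

definition is_adjoint :: "real \<Rightarrow> (real^'n) set \<Rightarrow> real \<Rightarrow> (real \<Rightarrow> real^'n \<Rightarrow> real)
     \<Rightarrow> (real \<Rightarrow> real^'n \<Rightarrow> real) \<Rightarrow> (real \<Rightarrow> real^'n \<Rightarrow> real) \<Rightarrow> bool" where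
  "is_adjoint T \<Omega> s u ud p \<longleftrightarrow> (\<exists>g. in_V_with T \<Omega> s p g \<and>
     (AE t in lebesgue. t \<in> {0<..<T} \<longrightarrow> (\<forall>\<phi>\<in>tHs \<Omega> s.
        - g t \<phi> + frac_form s (p t) \<phi> = (\<integral>x\<in>\<Omega>. (u t x - ud t x) * \<phi> x \<partial>lebesgue)))) \<and>
     value_at T \<Omega> p T (\<lambda>x. 0)"

definition Zad :: "real \<Rightarrow> (real^'n) set \<Rightarrow> (real \<Rightarrow> real^'n \<Rightarrow> real)
     \<Rightarrow> (real \<Rightarrow> real^'n \<Rightarrow> real) \<Rightarrow> (real \<Rightarrow> real^'n \<Rightarrow> real) set" where
  "Zad T \<Omega> a b = {w. in_L2Q T \<Omega> w \<and>
     (AE p in lebesgue. p \<in> cyl T \<Omega> \<longrightarrow>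
        a (fst p) (snd p) \<le> w (fst p) (snd p) \<and> w (fst p) (snd p) \<le> b (fst p) (snd p))}"

definition cost :: "real \<Rightarrow> (real^'n) set \<Rightarrow> real \<Rightarrow> (real \<Rightarrow> real^'n \<Rightarrow> real)
     \<Rightarrow> (real \<Rightarrow> real^'n \<Rightarrow> real) \<Rightarrow> (real \<Rightarrow> real^'n \<Rightarrow> real) \<Rightarrow> real" where
  "cost T \<Omega> \<mu> ud u z = (L2Q_norm T \<Omega> (\<lambda>t x. u t x - ud t x))\<^sup>2 / 2 + \<mu> / 2 * (L2Q_norm T \<Omega> z)\<^sup>2"

definition is_optimal :: "real \<Rightarrow> (real^'n) set \<Rightarrow> real \<Rightarrow> real
     \<Rightarrow> (real \<Rightarrow> (real^'n \<Rightarrow> real) \<Rightarrow> real) \<Rightarrow> (real^'n \<Rightarrow> real) \<Rightarrow> (real \<Rightarrow> real^'n \<Rightarrow> real)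
     \<Rightarrow> (real \<Rightarrow> real^'n \<Rightarrow> real) \<Rightarrow> (real \<Rightarrow> real^'n \<Rightarrow> real)
     \<Rightarrow> (real \<Rightarrow> real^'n \<Rightarrow> real) \<Rightarrow> (real \<Rightarrow> real^'n \<Rightarrow> real) \<Rightarrow> bool" where
  "is_optimal T \<Omega> s \<mu> f u0 ud a b zbar ubar \<longleftrightarrow>
     zbar \<in> Zad T \<Omega> a b \<and> is_state T \<Omega> s f u0 zbar ubar \<and>
     (\<forall>z u. z \<in> Zad T \<Omega> a b \<longrightarrow> is_state T \<Omega> s f u0 z u \<longrightarrow>
        cost T \<Omega> \<mu> ud ubar zbar \<le> cost T \<Omega> \<mu> ud u z)"

end

(* Integrating the state and adjoint equations once in time turns them into identities
   fst X . Theta1 + kappa * (J (snd X) . Theta2) = J zeta . Theta1 in the Hilbert space L^2(0,T; V),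
   where J is the Volterra operator and an element v of the fractional space is represented by the pair
   of v and its difference quotient (v(x) - v(y)) / |x - y|^(n/2+s). Since J is nonnegative and commutes
   with time shifts, testing with a shifted difference bounds the difference of the solution by
   h * norm zeta; for the adjoint equation this gives the bound on the time derivative of p by the norm of
   u - ud, which the energy estimate controls by the data. The variational inequality, for which
   perturbed states are constructed by a Riesz argument, identifies the control with the projection
   of -p / mu to [a, b]. The projection is 1-Lipschitz, so time differences of z are controlled by those
   of a, b and p. *)

theory Submission
  imports Defs
begin

text \<open>Testing either equation with its own solution would require a chain rule for a time
  derivative that is dual valued and known only weakly. After one integration in time every term is
  an inner product in L^2, the initial value becomes an element constant in time, and the end value
  \<open>0\<close> of the adjoint state is what makes extension by zero beyond \<open>T\<close>
  compatible with its equation. Hence truncated shifts give a Lipschitz bound for the adjoint state,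
  while a state with general \<open>u0\<close> and \<open>f\<close> only gets an energy bound.
  Optimality compares actual states, and the existence of states for other controls is not assumed.
  A competitor must be built together with its dual-valued derivative and its continuous trace; it
  arises by adding to the optimal state an increment with zero initial value and a source in L^2, to
  which the Lipschitz bound applies again. Vector-valued integrals are replaced by scalar integrals
  against fixed vectors and the Riesz theorem. The constant is built from \<open>T\<close>,
  \<open>\<mu>\<close>, the normalisation of the form and a Poincare constant of
  \<open>\<Omega>\<close>.\<close>

section \<open>The Riesz representation on a not necessarily closed subspace\<close>

text \<open>Minimising \<open>J i = |M i|^2 / 2 - l i\<close> works on any subspace of indices: the
  parallelogram law makes the images of a minimising sequence Cauchy, and only the limit of the
  images is needed. \<open>M\<close> may fail to be injective and its range need not be closed,
  which suits functionals known only through indices: on a graph, on the elements with a measurable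
  pairing, on the vectors along which a sequence converges.\<close>

lemma riesz_indexed:
  fixes M :: "'i::real_vector \<Rightarrow> 'h::{real_inner,complete_space}" and l :: "'i \<Rightarrow> real"
  assumes I: "subspace I"
    and M_add: "\<And>i j. i \<in> I ==> j \<in> I ==> M (i + j) = M i + M j"
    and M_scale: "\<And>i c. i \<in> I ==> M (c *\<^sub>R i) = c *\<^sub>R M i"
    and l_add: "\<And>i j. i \<in> I ==> j \<in> I ==> l (i + j) = l i + l j"
    and l_scale: "\<And>i c. i \<in> I ==> l (c *\<^sub>R i) = c * l i"
    and bound: "\<And>i. i \<in> I ==> \<bar>l i\<bar> \<le> C * norm (M i)"
  shows "\<exists>v. v \<in> closure (M ` I) \<and> norm v \<le> \<bar>C\<bar> \<and> (\<forall>i\<in>I. v \<bullet> M i = l i)"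
proof -
  define J where "J i = (norm (M i))\<^sup>2 / 2 - l i" for i
  have J_lower: "- (C\<^sup>2 / 2) \<le> J i" if "i \<in> I" for i
  proof -
    have "0 \<le> (norm (M i) - C)\<^sup>2" by simp
    then have "2 * (C * norm (M i)) \<le> (norm (M i))\<^sup>2 + C\<^sup>2" by (simp add: power2_eq_square algebra_simps)
    then show ?thesis using bound[OF that] unfolding J_def by simp
  qed
  have zI: "0 \<in> I" using I by (simp add: subspace_0)
  define m where "m = Inf (J ` I)"
  have bdd: "bdd_below (J ` I)" using J_lower by (auto intro!: bdd_belowI2)
  have m_le: "m \<le> J i" if "i \<in> I" for i unfolding m_def using that bdd by (simp add: cINF_lower)
  have "\<exists>i\<in>I. J i < m + 1 / (real n + 1)" for n :: nat
  proof -
    have "Inf (J ` I) < m + 1 / (real n + 1)" unfolding m_def by simp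
    then show ?thesis using cInf_less_iff[of "J ` I"] bdd zI by auto
  qed
  then obtain x where xI: "\<And>n. x n \<in> I" and xJ: "\<And>n. J (x n) < m + 1 / (real n + 1)" by metis
  have para: "(norm (M i - M j))\<^sup>2 \<le> 4 * ((J i - m) + (J j - m))" if ij: "i \<in> I" "j \<in> I" for i j
  proof -
    have s: "i + j \<in> I" and h: "(1/2) *\<^sub>R (i + j) \<in> I" using ij I by (auto simp: subspace_add subspace_scale)
    have "M ((1/2) *\<^sub>R (i + j)) = (1/2) *\<^sub>R (M i + M j)" using M_scale[OF s] M_add[OF ij] by simp
    moreover have "l ((1/2) *\<^sub>R (i + j)) = (l i + l j) / 2" using l_scale[OF s] l_add[OF ij] by simp
    ultimately have "J ((1/2) *\<^sub>R (i + j)) = (norm (M i + M j))\<^sup>2 / 8 - (l i + l j) / 2"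
      unfolding J_def by (simp add: power_divide)
    moreover have "(norm (M i + M j))\<^sup>2 + (norm (M i - M j))\<^sup>2 = 2 * (norm (M i))\<^sup>2 + 2 * (norm (M j))\<^sup>2"
      by (simp add: power2_norm_eq_inner inner_add_left inner_add_right inner_diff_left inner_diff_right)
    ultimately have "(norm (M i - M j))\<^sup>2 = 4 * (J i + J j - 2 * J ((1/2) *\<^sub>R (i + j)))"
      unfolding J_def by (simp add: field_simps)
    then show ?thesis using m_le[OF h] by simp
  qed
  have "Cauchy (\<lambda>n. M (x n))"
  proof (rule metric_CauchyI)
    fix e :: real assume e: "e > 0"
    obtain N :: nat where N: "8 / e\<^sup>2 < real N" using reals_Archimedean2 by blast
    show "\<exists>N. \<forall>p\<ge>N. \<forall>q\<ge>N. dist (M (x p)) (M (x q)) < e"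
    proof (intro exI allI impI)
      fix p q assume pq: "p \<ge> N" "q \<ge> N"
      have le: "1 / (real k + 1) \<le> 1 / (real N + 1)" if "k \<ge> N" for k using that by (simp add: frac_le)
      have "(norm (M (x p) - M (x q)))\<^sup>2 \<le> 4 * (1 / (real p + 1) + 1 / (real q + 1))"
        using para[OF xI[of p] xI[of q]] xJ[of p] xJ[of q] by simp
      also have "\<dots> \<le> 8 / (real N + 1)" using le[OF pq(1)] le[OF pq(2)] by simp
      also have "\<dots> < e\<^sup>2"
      proof -
        have "8 < real N * e\<^sup>2" using N e by (simp add: field_simps)
        also have "\<dots> \<le> (real N + 1) * e\<^sup>2" by (simp add: mult_right_mono)
        finally show ?thesis by (simp add: field_simps)
      qed
      finally show "dist (M (x p)) (M (x q)) < e" using e by (simp add: dist_norm power2_less_imp_less)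
    qed
  qed
  then obtain v where v: "(\<lambda>n. M (x n)) \<longlonglongrightarrow> v" using Cauchy_convergent_iff convergent_def by blast
  have inv: "(\<lambda>n. 1 / (real n + 1)) \<longlonglongrightarrow> 0"
    using LIMSEQ_inverse_real_of_nat by (simp add: inverse_eq_divide add.commute)
  have rep: "v \<bullet> M k = l k" if k: "k \<in> I" for k
  proof -
    have ge: "0 \<le> t * (v \<bullet> M k - l k) + t\<^sup>2 / 2 * (norm (M k))\<^sup>2" for t
    proof (rule LIMSEQ_le_const)
      show "(\<lambda>n. 1 / (real n + 1) + t * (M (x n) \<bullet> M k - l k) + t\<^sup>2 / 2 * (norm (M k))\<^sup>2)
          \<longlonglongrightarrow> t * (v \<bullet> M k - l k) + t\<^sup>2 / 2 * (norm (M k))\<^sup>2"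
        by (rule tendsto_eq_intros inv v refl)+ simp
      show "\<exists>N. \<forall>n\<ge>N. 0 \<le> 1 / (real n + 1) + t * (M (x n) \<bullet> M k - l k) + t\<^sup>2 / 2 * (norm (M k))\<^sup>2"
      proof (intro exI allI impI)
        fix n
        have tk: "t *\<^sub>R k \<in> I" using I k by (simp add: subspace_scale)
        have "J (x n + t *\<^sub>R k) = J (x n) + t * (M (x n) \<bullet> M k - l k) + t\<^sup>2 / 2 * (norm (M k))\<^sup>2"
          unfolding J_def using M_add[OF xI tk] l_add[OF xI tk] M_scale[OF k] l_scale[OF k]
          unfolding power2_norm_eq_inner
          by (simp add: inner_add_left inner_add_right inner_commute power2_eq_square field_simps)
        moreover have "m \<le> J (x n + t *\<^sub>R k)" using I xI tk by (intro m_le) (simp add: subspace_add)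
        ultimately show "0 \<le> 1 / (real n + 1) + t * (M (x n) \<bullet> M k - l k) + t\<^sup>2 / 2 * (norm (M k))\<^sup>2"
          using xJ[of n] by linarith
      qed
    qed
    \<comment> \<open>The choice \<open>t = - d / N\<close> nearly minimises the quadratic in
      \<open>t\<close>; adding \<open>1\<close> to the squared norm keeps \<open>N\<close> positive
      when \<open>M k = 0\<close>.\<close>
    define d where "d = v \<bullet> M k - l k"
    define N where "N = (norm (M k))\<^sup>2 + 1"
    have N: "N > 0" unfolding N_def by (simp add: add_nonneg_pos)
    have "0 \<le> (- d / N) * d + (- d / N)\<^sup>2 / 2 * (norm (M k))\<^sup>2"
      using ge[of "- d / N"] unfolding d_def[symmetric] .
    also have "\<dots> \<le> (- d / N) * d + (- d / N)\<^sup>2 / 2 * N"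
      unfolding N_def by (intro add_left_mono mult_left_mono) auto
    finally have "0 \<le> (- d / N) * d + (- d / N)\<^sup>2 / 2 * N" .
    then have "0 \<le> - (d\<^sup>2) / (2 * N)" using N by (simp add: power2_eq_square field_simps)
    then have "d\<^sup>2 \<le> 0" using N by (simp add: field_simps)
    then show ?thesis unfolding d_def by simp
  qed
  have "norm v * norm v \<le> \<bar>C\<bar> * norm v"
  proof (rule LIMSEQ_le)
    show "(\<lambda>n. v \<bullet> M (x n)) \<longlonglongrightarrow> norm v * norm v"
      using tendsto_inner[OF tendsto_const v, of v] by (simp add: norm_eq_sqrt_inner)
    show "(\<lambda>n. \<bar>C\<bar> * norm (M (x n))) \<longlonglongrightarrow> \<bar>C\<bar> * norm v" by (intro tendsto_intros v)
    have "v \<bullet> M (x n) \<le> \<bar>C\<bar> * norm (M (x n))" for n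
      using rep[OF xI[of n]] bound[OF xI[of n]] mult_right_mono[OF abs_ge_self[of C] norm_ge_zero[of "M (x n)"]] by linarith
    then show "\<exists>N. \<forall>n\<ge>N. v \<bullet> M (x n) \<le> \<bar>C\<bar> * norm (M (x n))" by blast
  qed
  then have "norm v \<le> \<bar>C\<bar>" by (cases "norm v = 0") auto
  moreover have "v \<in> closure (M ` I)"
    unfolding closure_sequential using v xI by (intro exI[of _ "\<lambda>n. M (x n)"]) auto
  ultimately show ?thesis using rep by blast
qed

lemma orthogonal_projection_exists:
  fixes W :: "'h::{real_inner,complete_space} set"
  assumes "subspace W" "closed W"
  shows "\<exists>v\<in>W. \<forall>y\<in>W. v \<bullet> y = x \<bullet> y"
proof -
  have "\<exists>v. v \<in> closure ((\<lambda>x. x) ` W) \<and> norm v \<le> \<bar>norm x\<bar> \<and> (\<forall>i\<in>W. v \<bullet> i = x \<bullet> i)"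
    by (rule riesz_indexed) (auto simp: assms inner_add_right intro: Cauchy_Schwarz_ineq2)
  then show ?thesis using assms by (auto simp: closure_closed)
qed

text \<open>The difference of \<open>x\<close> and its projection is orthogonal to \<open>W\<close>,
  hence to \<open>x\<close>, hence to itself. The criterion puts an integral of vectors of
  \<open>W\<close> into \<open>W\<close> when that integral is known only through its inner
  products.\<close>

lemma mem_subspace_if_orthogonal_to_complement:
  fixes W :: "'h::{real_inner,complete_space} set"
  assumes "subspace W" "closed W" and orth: "\<And>y. (\<forall>w\<in>W. y \<bullet> w = 0) ==> y \<bullet> x = 0"
  shows "x \<in> W"
proof -
  obtain v where v: "v \<in> W" "\<And>y. y \<in> W ==> v \<bullet> y = x \<bullet> y"
    using orthogonal_projection_exists[OF assms(1,2)] by blast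
  have o: "\<forall>w\<in>W. (x - v) \<bullet> w = 0" using v by (simp add: inner_diff_left)
  have "(x - v) \<bullet> (x - v) = 0" using orth[OF o] o v(1) by (simp add: inner_diff_right)
  then show ?thesis using v by simp
qed

section \<open>The Hilbert space of square integrable functions\<close>

text \<open>Measurability is Lebesgue, as in the notions of the problem, while the integral is over
  \<open>lborel\<close>, where product measures and Fubini are at hand; completion does not change
  the integral.\<close>

definition sqi :: "('a::euclidean_space \<Rightarrow> real) \<Rightarrow> bool" where
  "sqi f \<longleftrightarrow> f \<in> borel_measurable lebesgue \<and> (\<integral>\<^sup>+x. ennreal ((f x)\<^sup>2) \<partial>lborel) < \<infinity>"

text \<open>The choice predicate sees \<open>f\<close> only up to null sets, so functions that agree
  almost everywhere get the same representative. The space of classes can then be a set of canonical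
  Borel functions rather than a quotient.\<close>

definition borel_rep :: "('a::euclidean_space \<Rightarrow> real) \<Rightarrow> 'a \<Rightarrow> real" where
  "borel_rep f = (SOME g. g \<in> borel_measurable borel \<and> (AE x in lborel. g x = f x))"

lemma borel_rep:
  assumes "f \<in> borel_measurable lebesgue"
  shows borel_rep_measurable: "borel_rep f \<in> borel_measurable borel"
    and borel_rep_AE: "AE x in lborel. borel_rep f x = f x"
proof -
  obtain g where "g \<in> borel_measurable borel" "AE x in lborel. f x = g x"
    using completion_ex_borel_measurable_real[OF assms] by auto
  then have "\<exists>g. g \<in> borel_measurable borel \<and> (AE x in lborel. g x = f x)"
    by (intro exI[of _ g]) (auto elim: eventually_mono)
  from someI_ex[OF this] show "borel_rep f \<in> borel_measurable borel"
    "AE x in lborel. borel_rep f x = f x" unfolding borel_rep_def by auto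
qed

lemma borel_rep_cong:
  assumes "AE x in lborel. f x = g x"
  shows "borel_rep f = borel_rep g"
proof -
  have "(\<lambda>h. h \<in> borel_measurable borel \<and> (AE x in lborel. h x = f x)) =
        (\<lambda>h. h \<in> borel_measurable borel \<and> (AE x in lborel. h x = g x))"
  proof (intro ext conj_cong refl)
    fix h :: "'a \<Rightarrow> real"
    show "(AE x in lborel. h x = f x) = (AE x in lborel. h x = g x)"
      using assms by (intro iffI; elim AE_mp) (auto elim: eventually_mono)
  qed
  then show ?thesis unfolding borel_rep_def by simp
qed

lemma lebesgue_measurable_cong_AE:
  fixes f :: "'a::euclidean_space \<Rightarrow> real"
  assumes f: "f \<in> borel_measurable lebesgue" and eq: "AE x in lborel. f x = g x"
  shows "g \<in> borel_measurable lebesgue"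
proof (rule measurableI)
  fix S :: "real set" assume S: "S \<in> sets borel"
  have "AE x in lebesgue. x \<in> f -` S \<longleftrightarrow> x \<in> g -` S"
    using eq by (auto simp: AE_completion_iff elim: eventually_mono)
  moreover have "f -` S \<in> sets lebesgue" using measurable_sets[OF f S] by simp
  ultimately have "g -` S \<in> sets lebesgue" by (rule completion.in_sets_AE) simp
  then show "g -` S \<inter> space lebesgue \<in> sets lebesgue" by simp
qed simp

lemma sqi_cong_AE:
  assumes "sqi f" "AE x in lborel. g x = f x"
  shows "sqi g"
proof -
  have "g \<in> borel_measurable lebesgue"
    using assms by (intro lebesgue_measurable_cong_AE[of f g]) (auto simp: sqi_def)
  moreover have "(\<integral>\<^sup>+x. ennreal ((g x)\<^sup>2) \<partial>lborel) = (\<integral>\<^sup>+x. ennreal ((f x)\<^sup>2) \<partial>lborel)"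
    by (rule nn_integral_cong_AE) (use assms(2) in auto)
  ultimately show ?thesis using assms(1) unfolding sqi_def by simp
qed

lemma sqi_borelI:
  "f \<in> borel_measurable borel ==> (\<integral>\<^sup>+x. ennreal ((f x)\<^sup>2) \<partial>lborel) < \<infinity> ==> sqi f"
  unfolding sqi_def by (auto intro: measurable_completion)

typedef (overloaded) 'a lsq = "{f::'a::euclidean_space \<Rightarrow> real. sqi f \<and> borel_rep f = f}"
  morphisms fn abs_lsq
proof
  have "sqi (\<lambda>x::'a. 0)" unfolding sqi_def by simp
  then have "AE x in lborel. borel_rep (\<lambda>x::'a. 0) x = 0" by (intro borel_rep_AE) (simp add: sqi_def)
  then have "sqi (borel_rep (\<lambda>x::'a. 0))" "borel_rep (borel_rep (\<lambda>x::'a. 0)) = borel_rep (\<lambda>x::'a. 0)"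
    using \<open>sqi (\<lambda>x::'a. 0)\<close> by (auto intro: sqi_cong_AE borel_rep_cong)
  then show "borel_rep (\<lambda>x::'a. 0) \<in> {f. sqi f \<and> borel_rep f = f}" by simp
qed

lemma fn_sqi: "sqi (fn X)" and borel_rep_fn: "borel_rep (fn X) = fn X"
  using fn[of X] by auto

lemma fn_borel [measurable]: "fn X \<in> borel_measurable borel"
  using borel_rep_measurable[of "fn X"] fn_sqi[of X] unfolding borel_rep_fn sqi_def by blast

text \<open>Equals the class of 0 on functions that are not square integrable.\<close>
definition cls :: "('a::euclidean_space \<Rightarrow> real) \<Rightarrow> 'a lsq" where
  "cls f = abs_lsq (borel_rep (if sqi f then f else (\<lambda>_. 0)))"

lemma fn_cls:
  assumes "sqi f"
  shows "AE x in lborel. fn (cls f) x = f x"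
proof -
  have b: "AE x in lborel. borel_rep f x = f x" using assms by (intro borel_rep_AE) (simp add: sqi_def)
  then have "sqi (borel_rep f)" "borel_rep (borel_rep f) = borel_rep f"
    using assms by (auto intro: sqi_cong_AE borel_rep_cong)
  then have "fn (cls f) = borel_rep f" unfolding cls_def using assms by (simp add: abs_lsq_inverse)
  then show ?thesis using b by simp
qed

lemma lsq_eqI:
  assumes "AE x in lborel. fn X x = fn Y x"
  shows "X = Y"
  using borel_rep_cong[OF assms] by (simp add: borel_rep_fn fn_inject)

lemma lsq_eq_iff: "X = Y \<longleftrightarrow> (AE x in lborel. fn X x = fn Y x)"
  using lsq_eqI by auto

lemma cls_eqI:
  assumes "sqi f" "AE x in lborel. fn X x = f x"
  shows "cls f = X"
  by (rule lsq_eqI) (use fn_cls[OF assms(1)] assms(2) in auto)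

lemma cls_fn [simp]: "cls (fn X) = X"
  by (rule cls_eqI) (auto simp: fn_sqi)

lemma cls_cong:
  assumes "sqi f" "AE x in lborel. g x = f x"
  shows "cls g = cls f"
  by (rule cls_eqI[OF sqi_cong_AE[OF assms]]) (use fn_cls[OF assms(1)] assms(2) in auto)

lemma fn_square_integrable: "integrable lborel (\<lambda>x. (fn X x)\<^sup>2)"
  using fn_sqi[of X] unfolding integrable_iff_bounded sqi_def by simp

lemma sqi_iff_integrable:
  assumes "f \<in> borel_measurable borel"
  shows "sqi f \<longleftrightarrow> integrable lborel (\<lambda>x. (f x)\<^sup>2)"
  using assms unfolding integrable_iff_bounded sqi_def by (auto intro: measurable_completion)

lemma fn_mult_integrable: "integrable lborel (\<lambda>x. fn X x * fn Y x)"
proof (rule Bochner_Integration.integrable_bound)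
  show "integrable lborel (\<lambda>x. (fn X x)\<^sup>2 + (fn Y x)\<^sup>2)"
    by (intro Bochner_Integration.integrable_add fn_square_integrable)
  have "\<bar>a * b\<bar> \<le> a\<^sup>2 + b\<^sup>2" for a b :: real
  proof -
    have "\<bar>a * b\<bar> \<le> 2 * \<bar>a\<bar> * \<bar>b\<bar>" by (simp add: abs_mult)
    also have "\<dots> \<le> a\<^sup>2 + b\<^sup>2" using sum_squares_bound[of "\<bar>a\<bar>" "\<bar>b\<bar>"] by simp
    finally show ?thesis .
  qed
  then show "AE x in lborel. norm (fn X x * fn Y x) \<le> norm ((fn X x)\<^sup>2 + (fn Y x)\<^sup>2)" by simp
qed simp

lemma sqi_mult_left:
  assumes "sqi f"
  shows "sqi (\<lambda>x. c * f x)"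
proof -
  have m [measurable]: "f \<in> borel_measurable lebesgue" using assms by (auto simp: sqi_def)
  have "(\<integral>\<^sup>+x. ennreal ((c * f x)\<^sup>2) \<partial>lebesgue) = ennreal (c\<^sup>2) * (\<integral>\<^sup>+x. ennreal ((f x)\<^sup>2) \<partial>lebesgue)"
    by (subst nn_integral_cmult[symmetric]) (simp_all add: power_mult_distrib ennreal_mult)
  then show ?thesis using assms by (simp add: sqi_def nn_integral_completion ennreal_mult_less_top)
qed

lemma sqi_add:
  assumes "sqi f" "sqi g"
  shows "sqi (\<lambda>x. f x + g x)"
proof -
  have m [measurable]: "f \<in> borel_measurable lebesgue" "g \<in> borel_measurable lebesgue"
    using assms by (auto simp: sqi_def)
  have "(\<integral>\<^sup>+x. ennreal ((f x + g x)\<^sup>2) \<partial>lebesgue)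
      \<le> (\<integral>\<^sup>+x. 2 * ennreal ((f x)\<^sup>2) + 2 * ennreal ((g x)\<^sup>2) \<partial>lebesgue)"
  proof (rule nn_integral_mono)
    fix x
    have "(f x + g x)\<^sup>2 \<le> 2 * (f x)\<^sup>2 + 2 * (g x)\<^sup>2"
      using zero_le_power2[of "f x - g x"] by (simp add: power2_eq_square algebra_simps)
    then have "ennreal ((f x + g x)\<^sup>2) \<le> ennreal (2 * (f x)\<^sup>2 + 2 * (g x)\<^sup>2)" by (rule ennreal_leI)
    then show "ennreal ((f x + g x)\<^sup>2) \<le> 2 * ennreal ((f x)\<^sup>2) + 2 * ennreal ((g x)\<^sup>2)"
      by (simp add: ennreal_plus ennreal_mult)
  qed
  also have "\<dots> = 2 * (\<integral>\<^sup>+x. ennreal ((f x)\<^sup>2) \<partial>lebesgue) + 2 * (\<integral>\<^sup>+x. ennreal ((g x)\<^sup>2) \<partial>lebesgue)"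
    by (simp add: nn_integral_add nn_integral_cmult)
  also have "\<dots> < \<infinity>" using assms by (auto simp: sqi_def nn_integral_completion ennreal_mult_less_top)
  finally show ?thesis by (simp add: sqi_def nn_integral_completion)
qed

lemma sqi_diff: "sqi f ==> sqi g ==> sqi (\<lambda>x. f x - g x)"
  using sqi_add[OF _ sqi_mult_left[of g "-1"], of f] by simp

instantiation lsq :: (euclidean_space) real_inner
begin

definition "0 = cls (\<lambda>_. 0)"
definition "X + Y = cls (\<lambda>x. fn X x + fn Y x)"
definition "- X = cls (\<lambda>x. - 1 * fn X x)"
definition "X - Y = cls (\<lambda>x. fn X x - fn Y x)"
definition "c *\<^sub>R X = cls (\<lambda>x. c * fn X x)"
definition "X \<bullet> Y = (LINT x|lborel. fn X x * fn Y x)"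
definition "norm X = sqrt (X \<bullet> X)" for X :: "'a::euclidean_space lsq"
definition "sgn X = inverse (norm X) *\<^sub>R X" for X :: "'a::euclidean_space lsq"
definition "dist X Y = norm (X - Y)" for X Y :: "'a::euclidean_space lsq"
definition "(uniformity :: ('a::euclidean_space lsq \<times> 'a lsq) filter) = (INF e\<in>{0 <..}. principal {(X, Y). dist X Y < e})"
definition "open (U :: 'a::euclidean_space lsq set) \<longleftrightarrow> (\<forall>x\<in>U. eventually (\<lambda>(x', y). x' = x \<longrightarrow> y \<in> U) uniformity)"

lemma fn_zero: "AE x in lborel. fn 0 x = 0"
  unfolding zero_lsq_def by (rule fn_cls) (simp add: sqi_def)

lemma fn_add: "AE x in lborel. fn (X + Y) x = fn X x + fn Y x"
  unfolding plus_lsq_def by (rule fn_cls) (intro sqi_add fn_sqi)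

lemma fn_scale: "AE x in lborel. fn (c *\<^sub>R X) x = c * fn X x"
  unfolding scaleR_lsq_def by (rule fn_cls) (intro sqi_mult_left fn_sqi)

lemma fn_uminus: "AE x in lborel. fn (- X) x = - fn X x"
  using fn_cls[OF sqi_mult_left[OF fn_sqi[of X], of "-1"]] unfolding uminus_lsq_def by simp

lemma fn_diff: "AE x in lborel. fn (X - Y) x = fn X x - fn Y x"
  unfolding minus_lsq_def by (rule fn_cls) (intro sqi_diff fn_sqi)

instance
proof
  fix X Y Z :: "'a lsq" and a b :: real
  show "X + Y + Z = X + (Y + Z)"
    by (rule lsq_eqI) (use fn_add[of "X + Y" Z] fn_add[of X Y] fn_add[of X "Y + Z"] fn_add[of Y Z] in auto)
  show "X + Y = Y + X" by (rule lsq_eqI) (use fn_add[of X Y] fn_add[of Y X] in auto)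
  show "0 + X = X" by (rule lsq_eqI) (use fn_add[of 0 X] fn_zero in auto)
  show "- X + X = 0" by (rule lsq_eqI) (use fn_add[of "- X" X] fn_uminus[of X] fn_zero in auto)
  show "X - Y = X + - Y" by (rule lsq_eqI) (use fn_diff[of X Y] fn_uminus[of Y] fn_add[of X "- Y"] in auto)
  show "a *\<^sub>R (X + Y) = a *\<^sub>R X + a *\<^sub>R Y"
    by (rule lsq_eqI) (use fn_scale[of a "X + Y"] fn_add[of X Y] fn_add[of "a *\<^sub>R X" "a *\<^sub>R Y"]
        fn_scale[of a X] fn_scale[of a Y] in \<open>auto simp: algebra_simps\<close>)
  show "(a + b) *\<^sub>R X = a *\<^sub>R X + b *\<^sub>R X"
    by (rule lsq_eqI) (use fn_scale[of "a + b" X] fn_add[of "a *\<^sub>R X" "b *\<^sub>R X"]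
        fn_scale[of a X] fn_scale[of b X] in \<open>auto simp: algebra_simps\<close>)
  show "a *\<^sub>R b *\<^sub>R X = (a * b) *\<^sub>R X"
    by (rule lsq_eqI) (use fn_scale[of a "b *\<^sub>R X"] fn_scale[of b X] fn_scale[of "a * b" X] in auto)
  show "1 *\<^sub>R X = X" by (rule lsq_eqI) (use fn_scale[of 1 X] in auto)
  show "dist X Y = norm (X - Y)" by (rule dist_lsq_def)
  show "sgn X = inverse (norm X) *\<^sub>R X" by (rule sgn_lsq_def)
  show "(uniformity :: ('a lsq \<times> 'a lsq) filter) = (INF e\<in>{0 <..}. principal {(X, Y). dist X Y < e})"
    by (rule uniformity_lsq_def)
  show "open U \<longleftrightarrow> (\<forall>x\<in>U. eventually (\<lambda>(x', y). x' = x \<longrightarrow> y \<in> U) uniformity)" for U :: "'a lsq set"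
    by (rule open_lsq_def)
  show "X \<bullet> Y = Y \<bullet> X" unfolding inner_lsq_def by (simp add: mult.commute)
  have "(X + Y) \<bullet> Z = (LINT x|lborel. fn X x * fn Z x + fn Y x * fn Z x)" unfolding inner_lsq_def
    by (rule integral_cong_AE) (use fn_add[of X Y] in \<open>auto simp: algebra_simps\<close>)
  then show "(X + Y) \<bullet> Z = X \<bullet> Z + Y \<bullet> Z" unfolding inner_lsq_def by (simp add: fn_mult_integrable)
  have "(a *\<^sub>R X) \<bullet> Y = (LINT x|lborel. a * (fn X x * fn Y x))" unfolding inner_lsq_def
    by (rule integral_cong_AE) (use fn_scale[of a X] in auto)
  then show "(a *\<^sub>R X) \<bullet> Y = a * (X \<bullet> Y)" unfolding inner_lsq_def by simp
  show "0 \<le> X \<bullet> X" unfolding inner_lsq_def by simp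
  have "X \<bullet> X = 0 \<longleftrightarrow> (AE x in lborel. (fn X x)\<^sup>2 = 0)"
    unfolding inner_lsq_def using integral_nonneg_eq_0_iff_AE[OF fn_square_integrable[of X]]
    by (simp add: power2_eq_square)
  also have "\<dots> \<longleftrightarrow> X = 0" unfolding lsq_eq_iff using fn_zero by (auto elim: AE_mp)
  finally show "X \<bullet> X = 0 \<longleftrightarrow> X = 0" .
  show "norm X = sqrt (X \<bullet> X)" by (rule norm_lsq_def)
qed

end

lemma norm_sq_lsq: "(norm X)\<^sup>2 = (LINT x|lborel. (fn X x)\<^sup>2)" for X :: "'a::euclidean_space lsq"
  unfolding power2_norm_eq_inner by (simp add: inner_lsq_def power2_eq_square)

lemma norm_sq_lsq_nn: "ennreal ((norm X)\<^sup>2) = (\<integral>\<^sup>+x. ennreal ((fn X x)\<^sup>2) \<partial>lborel)"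
  for X :: "'a::euclidean_space lsq"
  unfolding norm_sq_lsq by (rule nn_integral_eq_integral[symmetric]) (auto simp: fn_square_integrable)

lemma norm_cls_nn:
  assumes "sqi f"
  shows "ennreal ((norm (cls f))\<^sup>2) = (\<integral>\<^sup>+x. ennreal ((f x)\<^sup>2) \<partial>lborel)"
  unfolding norm_sq_lsq_nn by (rule nn_integral_cong_AE) (use fn_cls[OF assms] in auto)

lemma norm_cls_abs: "norm (cls (\<lambda>x. \<bar>fn X x\<bar>)) = norm X"
proof -
  have "sqi (\<lambda>x. \<bar>fn X x\<bar>)" by (subst sqi_iff_integrable) (auto simp: fn_square_integrable)
  then have "ennreal ((norm (cls (\<lambda>x. \<bar>fn X x\<bar>)))\<^sup>2) = ennreal ((norm X)\<^sup>2)"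
    by (simp add: norm_cls_nn norm_sq_lsq_nn[of X])
  then show ?thesis by (simp add: power2_eq_iff_nonneg)
qed

lemma inner_cls:
  assumes "sqi f" "sqi g"
  shows "cls f \<bullet> cls g = (LINT x|lebesgue. f x * g x)"
proof -
  have m: "f \<in> borel_measurable lebesgue" "g \<in> borel_measurable lebesgue" using assms by (auto simp: sqi_def)
  have "cls f \<bullet> cls g = (LINT x|lebesgue. fn (cls f) x * fn (cls g) x)"
    unfolding inner_lsq_def by (rule integral_completion[symmetric]) simp
  also have "\<dots> = (LINT x|lebesgue. f x * g x)" by (rule integral_cong_AE)
      (use fn_cls[OF assms(1)] fn_cls[OF assms(2)] m in
        \<open>auto simp: AE_completion_iff intro!: borel_measurable_times intro: measurable_completion\<close>)
  finally show ?thesis .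
qed

lemma inner_fn_cls:
  assumes "sqi g" "g \<in> borel_measurable borel"
  shows "X \<bullet> cls g = (LINT x|lborel. fn X x * g x)"
  unfolding inner_lsq_def by (rule integral_cong_AE) (use fn_cls[OF assms(1)] assms(2) in auto)

lemma cls_add:
  assumes "sqi f" "sqi g"
  shows "cls (\<lambda>x. f x + g x) = cls f + cls g"
  by (rule cls_eqI[OF sqi_add[OF assms]])
    (use fn_add[of "cls f" "cls g"] fn_cls[OF assms(1)] fn_cls[OF assms(2)] in auto)

lemma cls_scale:
  assumes "sqi f"
  shows "cls (\<lambda>x. c * f x) = c *\<^sub>R cls f"
  by (rule cls_eqI[OF sqi_mult_left[OF assms]]) (use fn_scale[of c "cls f"] fn_cls[OF assms] in auto)

lemma cls_diff:
  assumes "sqi f" "sqi g"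
  shows "cls (\<lambda>x. f x - g x) = cls f - cls g"
  by (rule cls_eqI[OF sqi_diff[OF assms]])
    (use fn_diff[of "cls f" "cls g"] fn_cls[OF assms(1)] fn_cls[OF assms(2)] in auto)

lemma lsq_tendsto_AE_subseq:
  fixes X :: "nat \<Rightarrow> 'a::euclidean_space lsq"
  assumes "X \<longlonglongrightarrow> Y"
  shows "\<exists>r::nat\<Rightarrow>nat. strict_mono r \<and> (AE x in lborel. (\<lambda>n. fn (X (r n)) x) \<longlonglongrightarrow> fn Y x)"
proof -
  have "(\<lambda>n. norm (X n - Y)) \<longlonglongrightarrow> 0" using assms by (simp add: tendsto_norm_zero LIM_zero)
  then have l: "(\<lambda>n. (norm (X n - Y))\<^sup>2) \<longlonglongrightarrow> 0" using tendsto_power[of _ 0 _ 2] by fastforce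
  have "\<exists>r::nat\<Rightarrow>nat. strict_mono r \<and> (AE x in lborel. (\<lambda>n. (fn (X (r n) - Y) x)\<^sup>2) \<longlonglongrightarrow> 0)"
    by (rule tendsto_L1_AE_subseq) (use l in \<open>auto simp: fn_square_integrable norm_sq_lsq\<close>)
  then obtain r :: "nat \<Rightarrow> nat" where r: "strict_mono r"
    and ae: "AE x in lborel. (\<lambda>n. (fn (X (r n) - Y) x)\<^sup>2) \<longlonglongrightarrow> 0" by blast
  have "AE x in lborel. \<forall>n. fn (X (r n) - Y) x = fn (X (r n)) x - fn Y x"
    unfolding AE_all_countable using fn_diff by blast
  then have "AE x in lborel. (\<lambda>n. fn (X (r n)) x) \<longlonglongrightarrow> fn Y x" using ae
  proof eventually_elim
    case (elim x)
    then have "(\<lambda>n. sqrt ((fn (X (r n)) x - fn Y x)\<^sup>2)) \<longlonglongrightarrow> sqrt 0" by (intro tendsto_intros) simp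
    then have "(\<lambda>n. fn (X (r n)) x - fn Y x) \<longlonglongrightarrow> 0" by (simp add: tendsto_rabs_zero_iff)
    then show ?case by (simp add: LIM_zero_iff)
  qed
  then show ?thesis using r by blast
qed

text \<open>Riesz-Fischer. The space has infinite measure, so a Cauchy sequence in L^2 need not be
  Cauchy in L^1; multiplied by a fixed positive square integrable weight \<open>w\<close> it is, and
  dividing the a.e. limit by \<open>w\<close> gives the candidate. Fatou's lemma then yields
  convergence in norm.\<close>

instance lsq :: (euclidean_space) complete_space
proof
  fix X :: "nat \<Rightarrow> 'a lsq" assume X: "Cauchy X"
  obtain f0 :: "'a \<Rightarrow> real" where f0: "f0 \<in> borel_measurable lborel" "\<And>x. f0 x > 0" "integrable lborel f0"
    using sigma_finite_measure.obtain_positive_integrable_function[OF sigma_finite_lborel] by metis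
  define w where "w x = sqrt (f0 x)" for x
  have [measurable]: "w \<in> borel_measurable borel" using f0(1) unfolding w_def by simp
  have wpos: "w x > 0" for x using f0(2) unfolding w_def by simp
  have "(w x)\<^sup>2 = f0 x" for x using f0(2)[of x] unfolding w_def by simp
  then have w: "sqi w" using f0(3) by (subst sqi_iff_integrable) auto
  define W where "W = cls w"
  have W: "AE x in lborel. fn W x = w x" unfolding W_def using w by (rule fn_cls)
  obtain r where r: "strict_mono r" and ae: "AE x in lborel. Cauchy (\<lambda>i. fn W x * fn (X (r i)) x)"
  proof (rule cauchy_L1_AE_cauchy_subseq)
    show "integrable lborel (\<lambda>x. fn W x * fn (X n) x)" for n by (rule fn_mult_integrable)
    fix e :: real assume e: "e > 0"
    obtain N where N: "\<And>i j. i \<ge> N ==> j \<ge> N ==> dist (X i) (X j) < e / (norm W + 1)"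
      using metric_CauchyD[OF X, of "e / (norm W + 1)"] e by (auto simp: add_nonneg_pos)
    have "(LINT x|lborel. norm (fn W x * fn (X i) x - fn W x * fn (X j) x)) < e"
      if "i \<ge> N" "j \<ge> N" for i j
    proof -
      define A where "A = cls (\<lambda>x. \<bar>fn W x\<bar>)"
      define B where "B = cls (\<lambda>x. \<bar>fn (X i - X j) x\<bar>)"
      have sA: "sqi (\<lambda>x. \<bar>fn W x\<bar>)" and sB: "sqi (\<lambda>x. \<bar>fn (X i - X j) x\<bar>)"
        by (auto simp: sqi_iff_integrable fn_square_integrable)
      have nA: "norm A = norm W" "norm B = norm (X i - X j)" unfolding A_def B_def by (rule norm_cls_abs)+
      have "(LINT x|lborel. norm (fn W x * fn (X i) x - fn W x * fn (X j) x)) = A \<bullet> B"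
        unfolding inner_lsq_def A_def B_def by (rule integral_cong_AE)
          (use fn_diff[of "X i" "X j"] fn_cls[OF sA] fn_cls[OF sB] in \<open>auto simp: abs_mult[symmetric] right_diff_distrib\<close>)
      also have "\<dots> \<le> norm W * norm (X i - X j)" using norm_cauchy_schwarz[of A B] nA by simp
      also have "\<dots> \<le> norm W * (e / (norm W + 1))"
        using N[OF that] by (intro mult_left_mono) (auto simp: dist_norm)
      also have "\<dots> < e"
      proof -
        have "norm W * e < e * (norm W + 1)" using e by (simp add: algebra_simps)
        then show ?thesis by (simp add: divide_less_eq add_nonneg_pos)
      qed
      finally show ?thesis .
    qed
    then show "\<exists>N. \<forall>i\<ge>N. \<forall>j\<ge>N. LINT x|lborel. norm (fn W x * fn (X i) x - fn W x * fn (X j) x) < e" by blast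
  qed
  define f where "f x = lim (\<lambda>i. fn (X (r i)) x)" for x
  have [measurable]: "f \<in> borel_measurable borel" unfolding f_def by measurable
  have lim: "AE x in lborel. (\<lambda>i. fn (X (r i)) x) \<longlonglongrightarrow> f x" using ae W
  proof eventually_elim
    case (elim x)
    then obtain L where "(\<lambda>i. fn W x * fn (X (r i)) x) \<longlonglongrightarrow> L" using Cauchy_convergent_iff convergent_def by blast
    then have "(\<lambda>i. fn W x * fn (X (r i)) x / w x) \<longlonglongrightarrow> L / w x" using wpos[of x] by (intro tendsto_intros) auto
    then have "(\<lambda>i. fn (X (r i)) x) \<longlonglongrightarrow> L / w x" using elim wpos[of x] by simp
    then show ?case unfolding f_def using limI by metis
  qed
  have est: "(\<integral>\<^sup>+x. ennreal ((f x - fn (X n) x)\<^sup>2) \<partial>lborel) \<le> ennreal (e\<^sup>2)"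
    if e: "e > 0" and N: "\<And>i. i \<ge> N ==> norm (X i - X n) \<le> e" for e n N
  proof -
    have "(\<integral>\<^sup>+x. ennreal ((f x - fn (X n) x)\<^sup>2) \<partial>lborel)
        = (\<integral>\<^sup>+x. liminf (\<lambda>i. ennreal ((fn (X (r i)) x - fn (X n) x)\<^sup>2)) \<partial>lborel)"
    proof (rule nn_integral_cong_AE, use lim in eventually_elim)
      case (elim x)
      then have "(\<lambda>i. ennreal ((fn (X (r i)) x - fn (X n) x)\<^sup>2)) \<longlonglongrightarrow> ennreal ((f x - fn (X n) x)\<^sup>2)"
        by (intro tendsto_intros)
      then show ?case by (intro lim_imp_Liminf[symmetric]) simp_all
    qed
    also have "\<dots> \<le> liminf (\<lambda>i. \<integral>\<^sup>+x. ennreal ((fn (X (r i)) x - fn (X n) x)\<^sup>2) \<partial>lborel)"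
      by (rule nn_integral_liminf) simp
    also have "\<dots> \<le> ennreal (e\<^sup>2)"
    proof (rule Liminf_le)
      show "\<forall>\<^sub>F i in sequentially. (\<integral>\<^sup>+x. ennreal ((fn (X (r i)) x - fn (X n) x)\<^sup>2) \<partial>lborel) \<le> ennreal (e\<^sup>2)"
        unfolding eventually_sequentially
      proof (intro exI allI impI)
        fix i assume "i \<ge> N"
        then have "r i \<ge> N" using r seq_suble le_trans by blast
        have "(\<integral>\<^sup>+x. ennreal ((fn (X (r i)) x - fn (X n) x)\<^sup>2) \<partial>lborel) = ennreal ((norm (X (r i) - X n))\<^sup>2)"
          unfolding norm_sq_lsq_nn by (rule nn_integral_cong_AE) (use fn_diff[of "X (r i)" "X n"] in auto)
        also have "\<dots> \<le> ennreal (e\<^sup>2)" using N[OF \<open>r i \<ge> N\<close>] by (intro ennreal_leI power_mono) auto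
        finally show "(\<integral>\<^sup>+x. ennreal ((fn (X (r i)) x - fn (X n) x)\<^sup>2) \<partial>lborel) \<le> ennreal (e\<^sup>2)" .
      qed
    qed simp
    finally show ?thesis .
  qed
  have CN: "\<exists>N. \<forall>i\<ge>N. \<forall>j\<ge>N. norm (X i - X j) \<le> e" if "e > 0" for e
    using metric_CauchyD[OF X that] by (auto simp: dist_norm intro: less_imp_le)
  obtain N1 where N1: "\<forall>i\<ge>N1. \<forall>j\<ge>N1. norm (X i - X j) \<le> 1" using CN[of 1] by auto
  have "sqi (\<lambda>x. f x - fn (X N1) x)"
    by (rule sqi_borelI, simp, rule le_less_trans[OF est[of 1 N1 N1]]) (use N1 in auto)
  from sqi_add[OF this fn_sqi[of "X N1"]] have sf: "sqi f" by simp
  have "X \<longlonglongrightarrow> cls f"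
  proof (rule metric_LIMSEQ_I)
    fix e :: real assume e: "e > 0"
    obtain N where N: "\<forall>i\<ge>N. \<forall>j\<ge>N. norm (X i - X j) \<le> e / 2" using CN[of "e / 2"] e by auto
    show "\<exists>N. \<forall>n\<ge>N. dist (X n) (cls f) < e"
    proof (intro exI allI impI)
      fix n assume n: "n \<ge> N"
      have "ennreal ((norm (cls f - X n))\<^sup>2) = (\<integral>\<^sup>+x. ennreal ((f x - fn (X n) x)\<^sup>2) \<partial>lborel)"
        unfolding norm_sq_lsq_nn
        by (rule nn_integral_cong_AE) (use fn_diff[of "cls f" "X n"] fn_cls[OF sf] in auto)
      also have "\<dots> \<le> ennreal ((e / 2)\<^sup>2)" by (rule est[of _ N]) (use N n e in auto)
      finally have "(norm (cls f - X n))\<^sup>2 \<le> (e / 2)\<^sup>2" by (simp add: e)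
      then have "norm (cls f - X n) \<le> e / 2" by (rule power2_le_imp_le) (use e in simp)
      then show "dist (X n) (cls f) < e" using e by (simp add: dist_norm norm_minus_commute)
    qed
  qed
  then show "convergent X" by (auto simp: convergent_def)
qed

section \<open>Slices and kernel operators in the time variable\<close>

lemma borel_fst [measurable]: "(fst :: 'a::euclidean_space \<times> 'b::euclidean_space \<Rightarrow> 'a) \<in> borel_measurable borel"
  and borel_snd [measurable]: "(snd :: 'a::euclidean_space \<times> 'b::euclidean_space \<Rightarrow> 'b) \<in> borel_measurable borel"
  by (auto intro!: borel_measurable_continuous_onI continuous_intros)

lemma borel_measurable_lborel_pair:
  fixes f :: "'a::euclidean_space \<times> 'b::euclidean_space \<Rightarrow> 'c::topological_space"
  shows "f \<in> borel_measurable (lborel \<Otimes>\<^sub>M lborel) \<longleftrightarrow> f \<in> borel_measurable borel"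
  by (simp add: lborel_prod)

lemma nn_integral_lborel_pair:
  fixes f :: "'a::euclidean_space \<times> 'b::euclidean_space \<Rightarrow> ennreal"
  assumes "f \<in> borel_measurable borel"
  shows "(\<integral>\<^sup>+p. f p \<partial>lborel) = (\<integral>\<^sup>+x. \<integral>\<^sup>+y. f (x, y) \<partial>lborel \<partial>lborel)"
    and "(\<integral>\<^sup>+p. f p \<partial>lborel) = (\<integral>\<^sup>+y. \<integral>\<^sup>+x. f (x, y) \<partial>lborel \<partial>lborel)"
  using assms lborel.nn_integral_fst[of f lborel] lborel_pair.nn_integral_snd[of f]
  by (simp_all add: borel_measurable_lborel_pair lborel_prod)

lemma AE_lborel_pair:
  fixes Q :: "'a::euclidean_space \<times> 'b::euclidean_space \<Rightarrow> bool"
  assumes "AE p in lborel. Q p"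
  shows "AE x in lborel. AE y in lborel. Q (x, y)"
  using assms by (intro lborel_pair.AE_pair) (unfold lborel_prod)

lemma AE_lborel_pairI:
  fixes Q :: "'a::euclidean_space \<times> 'b::euclidean_space \<Rightarrow> bool"
  assumes "{p. Q p} \<in> sets borel" "AE x in lborel. AE y in lborel. Q (x, y)"
  shows "AE p in lborel. Q p"
proof -
  have "AE p in lborel \<Otimes>\<^sub>M lborel. Q p"
  proof (rule lborel_pair.AE_pair_measure)
    show "{p \<in> space (lborel \<Otimes>\<^sub>M lborel). Q p} \<in> sets (lborel \<Otimes>\<^sub>M lborel)"
      unfolding lborel_prod using assms(1) by simp
  qed (rule assms(2))
  then show ?thesis by (unfold lborel_prod)
qed

lemma lborel_pair_integrable:
  fixes f :: "'a::euclidean_space \<times> 'b::euclidean_space \<Rightarrow> real"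
  assumes "integrable lborel f"
  shows "AE x in lborel. integrable lborel (\<lambda>y. f (x, y))"
    and "integrable lborel (\<lambda>x. LINT y|lborel. f (x, y))"
    and "(LINT x|lborel. LINT y|lborel. f (x, y)) = (LINT p|lborel. f p)"
    and "AE y in lborel. integrable lborel (\<lambda>x. f (x, y))"
    and "integrable lborel (\<lambda>y. LINT x|lborel. f (x, y))"
    and "(LINT y|lborel. LINT x|lborel. f (x, y)) = (LINT p|lborel. f p)"
proof -
  have i: "integrable (lborel \<Otimes>\<^sub>M lborel) f" "integrable (lborel \<Otimes>\<^sub>M lborel) (case_prod (\<lambda>x y. f (x, y)))"
    using assms by (simp_all add: lborel_prod)
  show "AE x in lborel. integrable lborel (\<lambda>y. f (x, y))"
    "integrable lborel (\<lambda>x. LINT y|lborel. f (x, y))"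
    "AE y in lborel. integrable lborel (\<lambda>x. f (x, y))"
    "integrable lborel (\<lambda>y. LINT x|lborel. f (x, y))"
    using lborel_pair.AE_integrable_fst'[OF i(1)] lborel_pair.integrable_fst'[OF i(1)]
      lborel_pair.AE_integrable_snd[OF i(2)] lborel_pair.integrable_snd[OF i(2)] by simp_all
  show "(LINT x|lborel. LINT y|lborel. f (x, y)) = (LINT p|lborel. f p)"
    using lborel_pair.integral_fst'[OF i(1)] by (simp add: lborel_prod)
  show "(LINT y|lborel. LINT x|lborel. f (x, y)) = (LINT p|lborel. f p)"
    using lborel_pair.integral_snd[OF i(2)] by (simp add: lborel_prod)
qed

lemma lborel_pair_integrableI:
  fixes f :: "'a::euclidean_space \<times> 'b::euclidean_space \<Rightarrow> real"
  assumes [measurable]: "f \<in> borel_measurable borel"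
    and "(\<integral>\<^sup>+x. \<integral>\<^sup>+y. ennreal \<bar>f (x, y)\<bar> \<partial>lborel \<partial>lborel) < \<infinity>"
  shows "integrable lborel f"
  using assms(2) by (intro integrableI_bounded) (simp_all add: nn_integral_lborel_pair(1))

lemma lborel_Fubini:
  fixes f :: "'a::euclidean_space \<times> 'b::euclidean_space \<Rightarrow> real"
  assumes "f \<in> borel_measurable borel"
    and "(\<integral>\<^sup>+x. \<integral>\<^sup>+y. ennreal \<bar>f (x, y)\<bar> \<partial>lborel \<partial>lborel) < \<infinity>"
  shows "(LINT x|lborel. LINT y|lborel. f (x, y)) = (LINT y|lborel. LINT x|lborel. f (x, y))"
  using lborel_pair_integrable(3,6)[OF lborel_pair_integrableI[OF assms]] by simp

lemma AE_lborel_translate: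
  fixes P :: "real \<Rightarrow> bool"
  assumes "AE x in lborel. P x"
  shows "AE x in lborel. P (x + c)"
proof -
  obtain N where N: "{x. \<not> P x} \<subseteq> N" "N \<in> null_sets lborel" using assms by (auto elim!: AE_E simp: null_sets_def)
  have "AE x in lborel. c + 1 * x \<notin> N"
    by (rule AE_borel_affine) (use N(2) AE_not_in[OF N(2)] in \<open>auto simp: pred_def null_sets_def\<close>)
  then show ?thesis using N(1) by (auto simp: add.commute elim!: eventually_mono)
qed

lemma sqi_cong:
  assumes "AE x in lborel. g x = f x"
  shows "sqi f \<longleftrightarrow> sqi g"
proof -
  have "AE x in lborel. f x = g x" using assms by eventually_elim simp
  then show ?thesis using assms sqi_cong_AE by blast
qed

lemma cls_cong_AE:
  assumes "AE x in lborel. g x = f x"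
  shows "cls g = cls f"
  using cls_cong[OF _ assms] sqi_cong[OF assms] unfolding cls_def by (cases "sqi f") auto

lemma cls_not_sqi: "\<not> sqi f ==> cls f = 0"
  unfolding cls_def zero_lsq_def by simp

lemma sqi_borel_iff:
  "f \<in> borel_measurable borel ==> sqi f \<longleftrightarrow> (\<integral>\<^sup>+x. ennreal ((f x)\<^sup>2) \<partial>lborel) < \<infinity>"
  by (auto simp: sqi_def intro: measurable_completion)

lemma cauchy_schwarz_set:
  fixes h :: "'a::euclidean_space \<Rightarrow> real"
  assumes [measurable]: "D \<in> sets borel" "h \<in> borel_measurable borel"
    and D: "emeasure lborel D \<le> ennreal A" and A: "A \<ge> 0"
  shows "ennreal ((LINT x|lborel. indicator D x * h x)\<^sup>2) \<le> ennreal A * (\<integral>\<^sup>+x. indicator D x * ennreal ((h x)\<^sup>2) \<partial>lborel)"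
proof (cases "(\<integral>\<^sup>+x. indicator D x * ennreal ((h x)\<^sup>2) \<partial>lborel) = \<infinity>")
  case True
  show ?thesis
  \<comment> \<open>With an infinite right-hand integral the bound is trivial unless
    \<open>A = 0\<close>, where \<open>0 * \<infinity> = 0\<close> turns it into a claim about the
    null set \<open>D\<close>.\<close>
  proof (cases "A = 0")
    case True
    then have "D \<in> null_sets lborel" using D by (auto simp: null_sets_def)
    then have "AE x in lborel. indicator D x * h x = 0" by (auto dest!: AE_not_in elim!: eventually_mono)
    then have "(LINT x|lborel. indicator D x * h x) = 0" by (rule integral_eq_zero_AE)
    then show ?thesis by simp
  next
    case False
    then show ?thesis using A True by (simp add: ennreal_mult_top)
  qed
next
  case False
  have sq: "ennreal ((indicator D x * h x)\<^sup>2) = indicator D x * ennreal ((h x)\<^sup>2)" for x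
    by (auto split: split_indicator)
  have s1: "sqi (\<lambda>x. indicator D x * h x)" by (subst sqi_borel_iff) (use False in \<open>auto simp: sq less_top\<close>)
  have sq2: "ennreal ((indicator D x :: real)\<^sup>2) = indicator D x" for x by (auto split: split_indicator)
  have fin: "emeasure lborel D < \<infinity>" using D le_less_trans by fastforce
  have s2: "sqi (indicator D :: 'a \<Rightarrow> real)" by (subst sqi_borel_iff) (use fin in \<open>auto simp: sq2\<close>)
  have "(LINT x|lborel. indicator D x * h x) = (LINT x|lborel. indicator D x * (indicator D x * h x))"
    by (rule Bochner_Integration.integral_cong) (auto split: split_indicator)
  also have "\<dots> = cls (indicator D) \<bullet> cls (\<lambda>x. indicator D x * h x)"
    using s1 s2 by (subst inner_cls) (auto simp: integral_completion)
  finally have eq: "(LINT x|lborel. indicator D x * h x) = cls (indicator D) \<bullet> cls (\<lambda>x. indicator D x * h x)" .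
  have "ennreal ((LINT x|lborel. indicator D x * h x)\<^sup>2)
      \<le> ennreal ((norm (cls (indicator D :: 'a \<Rightarrow> real)))\<^sup>2 * (norm (cls (\<lambda>x. indicator D x * h x)))\<^sup>2)"
    unfolding eq by (intro ennreal_leI) (metis Cauchy_Schwarz_ineq power2_norm_eq_inner)
  also have "\<dots> = emeasure lborel D * (\<integral>\<^sup>+x. indicator D x * ennreal ((h x)\<^sup>2) \<partial>lborel)"
    using s1 s2 by (simp add: ennreal_mult norm_cls_nn sq sq2)
  also have "\<dots> \<le> ennreal A * (\<integral>\<^sup>+x. indicator D x * ennreal ((h x)\<^sup>2) \<partial>lborel)" by (intro mult_right_mono D) simp
  finally show ?thesis .
qed

section \<open>Slices at a fixed time\<close>

definition slice :: "(real \<times> 'b::euclidean_space) lsq \<Rightarrow> real \<Rightarrow> 'b lsq" where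
  "slice X t = cls (\<lambda>\<xi>. fn X (t, \<xi>))"

lemma fn_section_borel [measurable]:
  "(\<lambda>\<xi>. fn (X :: (real \<times> 'b::euclidean_space) lsq) (t, \<xi>)) \<in> borel_measurable borel"
  by measurable

lemma nn_integral_slice:
  "(\<integral>\<^sup>+t. \<integral>\<^sup>+\<xi>. ennreal ((fn X (t, \<xi>))\<^sup>2) \<partial>lborel \<partial>lborel) = ennreal ((norm X)\<^sup>2)"
  for X :: "(real \<times> 'b::euclidean_space) lsq"
  unfolding norm_sq_lsq_nn by (subst nn_integral_lborel_pair(1)) simp_all

lemma AE_slice_sqi: "AE t in lborel. sqi (\<lambda>\<xi>. fn X (t, \<xi>))"
  for X :: "(real \<times> 'b::euclidean_space) lsq"
proof -
  have "AE t in lborel. (\<integral>\<^sup>+\<xi>. ennreal ((fn X (t, \<xi>))\<^sup>2) \<partial>lborel) \<noteq> \<infinity>"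
    by (rule nn_integral_PInf_AE) (simp_all add: nn_integral_slice)
  then show ?thesis by eventually_elim (simp add: sqi_borel_iff less_top)
qed

lemma slice_cls:
  assumes "sqi g"
  shows "AE t in lborel. slice (cls g) t = cls (\<lambda>\<xi>. g (t, \<xi>))"
  using AE_lborel_pair[OF fn_cls[OF assms]] unfolding slice_def by eventually_elim (rule cls_cong_AE)

lemma fn_slice: "AE t in lborel. AE \<xi> in lborel. fn (slice X t) \<xi> = fn X (t, \<xi>)"
  using AE_slice_sqi[of X] by eventually_elim (auto simp: slice_def intro: fn_cls)

text \<open>\<open>cls\<close> sends a section that is not square integrable to \<open>0\<close>, so
  \<open>slice\<close> is total. The explicit case distinction makes inner products of slices
  measurable in both times, since finiteness of a section integral is a measurable
  condition.\<close>

lemma inner_slice_eq: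
  "slice X t \<bullet> slice Y s = (if sqi (\<lambda>\<xi>. fn X (t, \<xi>)) \<and> sqi (\<lambda>\<xi>. fn Y (s, \<xi>))
     then LINT \<xi>|lborel. fn X (t, \<xi>) * fn Y (s, \<xi>) else 0)"
  unfolding slice_def by (auto simp: inner_cls integral_completion cls_not_sqi)

lemma inner_slice_measurable [measurable]:
  fixes X Y :: "(real \<times> 'b::euclidean_space) lsq"
  assumes [measurable]: "u \<in> borel_measurable M" "v \<in> borel_measurable M"
  shows "(\<lambda>x. slice X (u x) \<bullet> slice Y (v x)) \<in> borel_measurable M"
  unfolding inner_slice_eq sqi_borel_iff[OF fn_section_borel] by measurable

lemma inner_slice_left_eq:
  "slice X t \<bullet> y = (if sqi (\<lambda>\<xi>. fn X (t, \<xi>)) then LINT \<xi>|lborel. fn X (t, \<xi>) * fn y \<xi> else 0)"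
  unfolding slice_def by (auto simp: inner_fn_cls inner_commute[of "cls _"] mult.commute cls_not_sqi)

lemma inner_slice_left_measurable [measurable]:
  fixes X :: "(real \<times> 'b::euclidean_space) lsq"
  assumes [measurable]: "u \<in> borel_measurable M"
  shows "(\<lambda>x. slice X (u x) \<bullet> y) \<in> borel_measurable M"
  unfolding inner_slice_left_eq sqi_borel_iff[OF fn_section_borel] by measurable

lemma norm_slice_measurable [measurable]:
  fixes X :: "(real \<times> 'b::euclidean_space) lsq"
  assumes [measurable]: "u \<in> borel_measurable M"
  shows "(\<lambda>x. norm (slice X (u x))) \<in> borel_measurable M"
  unfolding norm_eq_sqrt_inner by measurable

lemma norm_slice_nn: "(\<integral>\<^sup>+t. ennreal ((norm (slice X t))\<^sup>2) \<partial>lborel) = ennreal ((norm X)\<^sup>2)"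
  for X :: "(real \<times> 'b::euclidean_space) lsq"
  unfolding nn_integral_slice[symmetric]
  by (rule nn_integral_cong_AE, use AE_slice_sqi[of X] in eventually_elim) (simp add: slice_def norm_cls_nn)

lemma norm_slice_integrable: "integrable lborel (\<lambda>t. (norm (slice X t))\<^sup>2)"
  for X :: "(real \<times> 'b::euclidean_space) lsq"
  by (rule integrableI_bounded) (simp_all add: norm_slice_nn)

lemma inner_slice_integrable: "integrable lborel (\<lambda>t. slice X t \<bullet> slice Y t)"
  for X Y :: "(real \<times> 'b::euclidean_space) lsq"
proof (rule Bochner_Integration.integrable_bound)
  show "integrable lborel (\<lambda>t. (norm (slice X t))\<^sup>2 + (norm (slice Y t))\<^sup>2)"
    by (intro Bochner_Integration.integrable_add norm_slice_integrable)
  have "\<bar>slice X t \<bullet> slice Y t\<bar> \<le> (norm (slice X t))\<^sup>2 + (norm (slice Y t))\<^sup>2" for t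
    using Cauchy_Schwarz_ineq2[of "slice X t" "slice Y t"]
      sum_squares_bound[of "norm (slice X t)" "norm (slice Y t)"]
      mult_nonneg_nonneg[OF norm_ge_zero norm_ge_zero, of "slice X t" "slice Y t"] by linarith
  then show "AE t in lborel. norm (slice X t \<bullet> slice Y t) \<le> norm ((norm (slice X t))\<^sup>2 + (norm (slice Y t))\<^sup>2)"
    by simp
qed measurable

lemma inner_eq_integral_slice: "X \<bullet> Y = (LINT t|lborel. slice X t \<bullet> slice Y t)"
  for X Y :: "(real \<times> 'b::euclidean_space) lsq"
proof -
  have "X \<bullet> Y = (LINT t|lborel. LINT \<xi>|lborel. fn X (t, \<xi>) * fn Y (t, \<xi>))"
    unfolding inner_lsq_def by (rule lborel_pair_integrable(3)[OF fn_mult_integrable, symmetric])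
  also have "\<dots> = (LINT t|lborel. slice X t \<bullet> slice Y t)"
  proof (rule integral_cong_AE)
    show "AE t in lborel. (LINT \<xi>|lborel. fn X (t, \<xi>) * fn Y (t, \<xi>)) = slice X t \<bullet> slice Y t"
      using AE_slice_sqi[of X] AE_slice_sqi[of Y] by eventually_elim (simp add: inner_slice_eq)
  qed measurable
  finally show ?thesis .
qed

lemma slice_add: "AE t in lborel. slice (X + Y) t = slice X t + slice Y t"
  for X Y :: "(real \<times> 'b::euclidean_space) lsq"
  using AE_lborel_pair[OF fn_add[of X Y]] AE_slice_sqi[of X] AE_slice_sqi[of Y]
proof eventually_elim
  case (elim t)
  have "slice (X + Y) t = cls (\<lambda>\<xi>. fn X (t, \<xi>) + fn Y (t, \<xi>))"
    unfolding slice_def by (rule cls_cong_AE) (use elim in simp)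
  then show ?case using elim by (simp add: cls_add slice_def)
qed

lemma slice_scale: "AE t in lborel. slice (c *\<^sub>R X) t = c *\<^sub>R slice X t"
  for X :: "(real \<times> 'b::euclidean_space) lsq"
  using AE_lborel_pair[OF fn_scale[of c X]] AE_slice_sqi[of X]
proof eventually_elim
  case (elim t)
  have "slice (c *\<^sub>R X) t = cls (\<lambda>\<xi>. c * fn X (t, \<xi>))"
    unfolding slice_def by (rule cls_cong_AE) (use elim in simp)
  then show ?case using elim by (simp add: cls_scale slice_def)
qed

lemma slice_diff: "AE t in lborel. slice (X - Y) t = slice X t - slice Y t"
  for X Y :: "(real \<times> 'b::euclidean_space) lsq"
  using slice_add[of X "(-1) *\<^sub>R Y"] slice_scale[of "-1" Y] by eventually_elim simp

lemma slice_zero: "AE t in lborel. slice 0 t = (0 :: 'b::euclidean_space lsq)"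
  using slice_scale[of 0 "0 :: (real \<times> 'b) lsq"] by simp

lemma lsq_eqI_slice:
  fixes X Y :: "(real \<times> 'b::euclidean_space) lsq"
  assumes "AE t in lborel. slice X t = slice Y t"
  shows "X = Y"
proof -
  have "(\<integral>\<^sup>+t. ennreal ((norm (slice (X - Y) t))\<^sup>2) \<partial>lborel) = (\<integral>\<^sup>+t. 0 \<partial>(lborel :: real measure))"
    by (rule nn_integral_cong_AE, use assms slice_diff[of X Y] in eventually_elim) simp
  then show ?thesis by (simp add: norm_slice_nn)
qed

lemma inner_eqI: "(\<And>y. x \<bullet> y = x' \<bullet> y) ==> x = (x'::'a::real_inner)"
  by (metis inner_diff_left inner_eq_zero_iff right_minus_eq)

subsection \<open>Tensor products\<close>

definition tens :: "(real \<Rightarrow> real) \<Rightarrow> 'b::euclidean_space lsq \<Rightarrow> (real \<times> 'b) lsq" where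
  "tens \<psi> y = cls (\<lambda>p. \<psi> (fst p) * fn y (snd p))"

lemma tens:
  fixes y :: "'b::euclidean_space lsq"
  assumes \<psi>: "sqi \<psi>" and [measurable]: "\<psi> \<in> borel_measurable borel"
  shows sqi_tens: "sqi (\<lambda>p. \<psi> (fst p) * fn y (snd p))"
    and slice_tens: "AE t in lborel. slice (tens \<psi> y) t = \<psi> t *\<^sub>R y"
    and norm_tens: "(norm (tens \<psi> y))\<^sup>2 = (LINT t|lborel. (\<psi> t)\<^sup>2) * (norm y)\<^sup>2"
proof -
  have "(\<integral>\<^sup>+p. ennreal ((\<psi> (fst p) * fn y (snd p))\<^sup>2) \<partial>lborel)
      = (\<integral>\<^sup>+t. \<integral>\<^sup>+\<xi>. ennreal ((\<psi> t)\<^sup>2) * ennreal ((fn y \<xi>)\<^sup>2) \<partial>lborel \<partial>lborel)"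
    by (subst nn_integral_lborel_pair(1)) (simp_all add: power_mult_distrib ennreal_mult)
  also have "\<dots> = (\<integral>\<^sup>+t. ennreal ((\<psi> t)\<^sup>2) \<partial>lborel) * ennreal ((norm y)\<^sup>2)"
    by (simp add: nn_integral_cmult nn_integral_multc norm_sq_lsq_nn)
  finally have n: "(\<integral>\<^sup>+p. ennreal ((\<psi> (fst p) * fn y (snd p))\<^sup>2) \<partial>lborel)
      = (\<integral>\<^sup>+t. ennreal ((\<psi> t)\<^sup>2) \<partial>lborel) * ennreal ((norm y)\<^sup>2)" .
  show s: "sqi (\<lambda>p. \<psi> (fst p) * fn y (snd p))"
    by (rule sqi_borelI, measurable) (use \<psi> in \<open>auto simp: n sqi_def ennreal_mult_less_top\<close>)
  show "AE t in lborel. slice (tens \<psi> y) t = \<psi> t *\<^sub>R y"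
    unfolding tens_def using slice_cls[OF s] by eventually_elim (simp add: cls_scale fn_sqi)
  have "ennreal ((norm (tens \<psi> y))\<^sup>2) = ennreal ((LINT t|lborel. (\<psi> t)\<^sup>2) * (norm y)\<^sup>2)"
    unfolding tens_def norm_cls_nn[OF s] n using \<psi>
    by (simp add: nn_integral_eq_integral sqi_iff_integrable ennreal_mult)
  then show "(norm (tens \<psi> y))\<^sup>2 = (LINT t|lborel. (\<psi> t)\<^sup>2) * (norm y)\<^sup>2" by (subst (asm) ennreal_inj) auto
qed

lemma inner_tens:
  fixes y :: "'b::euclidean_space lsq"
  assumes "sqi \<psi>" "\<psi> \<in> borel_measurable borel"
  shows "X \<bullet> tens \<psi> y = (LINT t|lborel. \<psi> t * (slice X t \<bullet> y))"
  unfolding inner_eq_integral_slice by (rule integral_cong_AE) (use slice_tens[OF assms, of y] assms(2) in auto)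

subsection \<open>Kernel operators\<close>

text \<open>Both families of sections of the kernel set have measure at most \<open>A\<close>; this is the
  hypothesis of the Schur test.\<close>
definition kset :: "real \<Rightarrow> (real \<times> real) set \<Rightarrow> bool" where
  "kset A E \<longleftrightarrow> E \<in> sets borel \<and> 0 \<le> A \<and> (\<forall>t. emeasure lborel {\<tau>. (t, \<tau>) \<in> E} \<le> ennreal A) \<and>
     (\<forall>\<tau>. emeasure lborel {t. (t, \<tau>) \<in> E} \<le> ennreal A)"

text \<open>The time integral is taken for each fixed value of the second coordinate, so no
  vector-valued integral is needed. A point of \<open>E\<close> is a pair of the time of evaluation
  and the time of integration; Volterra integration, bands and delays are all instances.\<close>

definition kfun :: "(real \<times> real) set \<Rightarrow> (real \<times> 'b::euclidean_space) lsq \<Rightarrow> real \<times> 'b \<Rightarrow> real" where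
  "kfun E X p = (LINT \<tau>|lborel. indicator E (fst p, \<tau>) * fn X (\<tau>, snd p))"

definition kop :: "(real \<times> real) set \<Rightarrow> (real \<times> 'b::euclidean_space) lsq \<Rightarrow> (real \<times> 'b) lsq" where
  "kop E X = cls (kfun E X)"

lemma kset_section:
  assumes "kset A E"
  shows "{\<tau>. (t, \<tau>) \<in> E} \<in> sets borel" "emeasure lborel {\<tau>. (t, \<tau>) \<in> E} \<le> ennreal A"
    "{t. (t, \<tau>) \<in> E} \<in> sets borel" "emeasure lborel {t. (t, \<tau>) \<in> E} \<le> ennreal A"
proof -
  have [measurable]: "E \<in> sets borel" using assms by (simp add: kset_def)
  show "{\<tau>. (t, \<tau>) \<in> E} \<in> sets borel" "{t. (t, \<tau>) \<in> E} \<in> sets borel" by measurable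
qed (use assms in \<open>auto simp: kset_def\<close>)

lemma kfun_borel [measurable]:
  assumes [measurable]: "E \<in> sets borel"
  shows "kfun E X \<in> borel_measurable borel"
  unfolding kfun_def by measurable

text \<open>Schur test for a kernel with values \<open>0\<close> and \<open>1\<close>:
  Cauchy-Schwarz over a section in \<open>\<tau>\<close> costs one factor \<open>A\<close>, and
  after exchanging the integrals the section in \<open>t\<close> costs the other.\<close>

lemma kfun_bound:
  fixes X :: "(real \<times> 'b::euclidean_space) lsq"
  assumes E: "kset A E"
  shows "(\<integral>\<^sup>+p. ennreal ((kfun E X p)\<^sup>2) \<partial>lborel) \<le> ennreal ((A * norm X)\<^sup>2)"
proof -
  have [measurable]: "E \<in> sets borel" and A: "A \<ge> 0" using E by (auto simp: kset_def)
  have ind: "indicator {\<tau>. (t, \<tau>) \<in> E} \<tau> = indicator E (t, \<tau>)"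
    "indicator {t. (t, \<tau>) \<in> E} t = indicator E (t, \<tau>)" for t \<tau>
    by (auto split: split_indicator)
  have "(\<integral>\<^sup>+p. ennreal ((kfun E X p)\<^sup>2) \<partial>lborel) = (\<integral>\<^sup>+\<xi>. \<integral>\<^sup>+t. ennreal ((kfun E X (t, \<xi>))\<^sup>2) \<partial>lborel \<partial>lborel)"
    by (rule nn_integral_lborel_pair(2)) measurable
  also have "\<dots> \<le> (\<integral>\<^sup>+\<xi>. \<integral>\<^sup>+t. ennreal A * (\<integral>\<^sup>+\<tau>. indicator E (t, \<tau>) * ennreal ((fn X (\<tau>, \<xi>))\<^sup>2) \<partial>lborel) \<partial>lborel \<partial>lborel)"
  proof (intro nn_integral_mono)
    fix \<xi> t
    show "ennreal ((kfun E X (t, \<xi>))\<^sup>2) \<le> ennreal A * (\<integral>\<^sup>+\<tau>. indicator E (t, \<tau>) * ennreal ((fn X (\<tau>, \<xi>))\<^sup>2) \<partial>lborel)"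
      using cauchy_schwarz_set[OF kset_section(1)[OF E, of t] _ kset_section(2)[OF E] A, of "\<lambda>\<tau>. fn X (\<tau>, \<xi>)"]
      unfolding kfun_def by (simp add: ind)
  qed
  also have "\<dots> = (\<integral>\<^sup>+\<xi>. ennreal A * (\<integral>\<^sup>+t. \<integral>\<^sup>+\<tau>. indicator E (t, \<tau>) * ennreal ((fn X (\<tau>, \<xi>))\<^sup>2) \<partial>lborel \<partial>lborel) \<partial>lborel)"
    by (intro nn_integral_cong nn_integral_cmult) measurable
  also have "\<dots> = (\<integral>\<^sup>+\<xi>. ennreal A * (\<integral>\<^sup>+\<tau>. \<integral>\<^sup>+t. indicator E (t, \<tau>) * ennreal ((fn X (\<tau>, \<xi>))\<^sup>2) \<partial>lborel \<partial>lborel) \<partial>lborel)"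
    by (intro nn_integral_cong arg_cong2[where f = "(*)"] refl lborel_pair.Fubini') measurable
  also have "\<dots> \<le> (\<integral>\<^sup>+\<xi>. ennreal A * (\<integral>\<^sup>+\<tau>. ennreal A * ennreal ((fn X (\<tau>, \<xi>))\<^sup>2) \<partial>lborel) \<partial>lborel)"
  proof (intro nn_integral_mono mult_left_mono)
    fix \<xi> \<tau>
    have "(\<integral>\<^sup>+t. indicator E (t, \<tau>) * ennreal ((fn X (\<tau>, \<xi>))\<^sup>2) \<partial>lborel)
        = (\<integral>\<^sup>+t. indicator {t. (t, \<tau>) \<in> E} t \<partial>lborel) * ennreal ((fn X (\<tau>, \<xi>))\<^sup>2)"
      unfolding ind by (rule nn_integral_multc) measurable
    also have "\<dots> = emeasure lborel {t. (t, \<tau>) \<in> E} * ennreal ((fn X (\<tau>, \<xi>))\<^sup>2)"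
      using kset_section(3)[OF E, of \<tau>] by simp
    also have "\<dots> \<le> ennreal A * ennreal ((fn X (\<tau>, \<xi>))\<^sup>2)" by (intro mult_right_mono kset_section(4)[OF E]) simp
    finally show "(\<integral>\<^sup>+t. indicator E (t, \<tau>) * ennreal ((fn X (\<tau>, \<xi>))\<^sup>2) \<partial>lborel)
        \<le> ennreal A * ennreal ((fn X (\<tau>, \<xi>))\<^sup>2)" .
  qed simp
  also have "\<dots> = ennreal A * ennreal A * (\<integral>\<^sup>+\<xi>. \<integral>\<^sup>+\<tau>. ennreal ((fn X (\<tau>, \<xi>))\<^sup>2) \<partial>lborel \<partial>lborel)"
    by (simp add: nn_integral_cmult mult.assoc)
  also have "\<dots> = ennreal A * ennreal A * ennreal ((norm X)\<^sup>2)"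
    unfolding norm_sq_lsq_nn by (subst nn_integral_lborel_pair(2)[of "\<lambda>p. ennreal ((fn X p)\<^sup>2)"]) simp_all
  also have "\<dots> = ennreal ((A * norm X)\<^sup>2)"
    using A by (simp add: power_mult_distrib ennreal_mult power2_eq_square mult.assoc mult.left_commute)
  finally show ?thesis .
qed

lemma sqi_kfun: "kset A E ==> sqi (kfun E X)"
  by (rule sqi_borelI) (auto simp: kset_def intro: le_less_trans[OF kfun_bound])

lemma norm_kop:
  assumes "kset A E"
  shows "norm (kop E X) \<le> A * norm X"
proof -
  have A: "A \<ge> 0" using assms by (simp add: kset_def)
  have "ennreal ((norm (kop E X))\<^sup>2) \<le> ennreal ((A * norm X)\<^sup>2)"
    unfolding kop_def norm_cls_nn[OF sqi_kfun[OF assms]] by (rule kfun_bound[OF assms])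
  then have "(norm (kop E X))\<^sup>2 \<le> (A * norm X)\<^sup>2" by simp
  then show ?thesis by (rule power2_le_imp_le) (use A in simp)
qed

text \<open>The exceptional set of times is fixed before \<open>y\<close> is chosen: it only
  concerns the square integrability of the sections of \<open>kfun E X\<close> and their agreement
  with the slices. Hence the identity determines the slice itself through \<open>inner_eqI\<close>,
  which replaces a vector-valued integral of \<open>slice X\<close>.\<close>

lemma slice_kop:
  fixes X :: "(real \<times> 'b::euclidean_space) lsq"
  assumes E: "kset A E"
  shows "AE t in lborel. \<forall>y. slice (kop E X) t \<bullet> y = (LINT \<tau>|lborel. indicator E (t, \<tau>) * (slice X \<tau> \<bullet> y))"
proof -
  have [measurable]: "E \<in> sets borel" using E by (auto simp: kset_def)
  have s: "AE t in lborel. sqi (\<lambda>\<xi>. kfun E X (t, \<xi>))"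
    using AE_slice_sqi[of "kop E X"] AE_lborel_pair[OF fn_cls[OF sqi_kfun[OF E, of X]]]
    unfolding kop_def by eventually_elim (simp add: sqi_cong)
  show ?thesis using slice_cls[OF sqi_kfun[OF E, of X]] s
  proof eventually_elim
    case (elim t)
    show ?case
    proof
      fix y
      have "slice (kop E X) t \<bullet> y = (LINT \<xi>|lborel. kfun E X (t, \<xi>) * fn y \<xi>)" using elim unfolding kop_def
        by (simp add: inner_fn_cls inner_commute[of "cls _"] mult.commute)
      also have "\<dots> = (LINT \<xi>|lborel. LINT \<tau>|lborel. indicator E (t, \<tau>) * fn X (\<tau>, \<xi>) * fn y \<xi>)"
        unfolding kfun_def by simp
      also have "\<dots> = (LINT \<tau>|lborel. LINT \<xi>|lborel. indicator E (t, \<tau>) * fn X (\<tau>, \<xi>) * fn y \<xi>)"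
      proof (rule lborel_Fubini[where f = "\<lambda>(\<tau>, \<xi>). indicator E (t, \<tau>) * fn X (\<tau>, \<xi>) * fn y \<xi>",
            unfolded split_conv, symmetric])
        have "(\<integral>\<^sup>+\<tau>. \<integral>\<^sup>+\<xi>. ennreal \<bar>indicator E (t, \<tau>) * fn X (\<tau>, \<xi>) * fn y \<xi>\<bar> \<partial>lborel \<partial>lborel)
            \<le> (\<integral>\<^sup>+\<tau>. \<integral>\<^sup>+\<xi>. ennreal ((fn X (\<tau>, \<xi>))\<^sup>2) + indicator E (t, \<tau>) * ennreal ((fn y \<xi>)\<^sup>2) \<partial>lborel \<partial>lborel)"
        proof (intro nn_integral_mono)
          fix \<tau> \<xi>
          have "\<bar>a * b\<bar> \<le> a\<^sup>2 + b\<^sup>2" for a b :: real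
          proof -
            have "\<bar>a * b\<bar> \<le> 2 * \<bar>a\<bar> * \<bar>b\<bar>" by (simp add: abs_mult)
            also have "\<dots> \<le> a\<^sup>2 + b\<^sup>2" using sum_squares_bound[of "\<bar>a\<bar>" "\<bar>b\<bar>"] by simp
            finally show ?thesis .
          qed
          then show "ennreal \<bar>indicator E (t, \<tau>) * fn X (\<tau>, \<xi>) * fn y \<xi>\<bar>
              \<le> ennreal ((fn X (\<tau>, \<xi>))\<^sup>2) + indicator E (t, \<tau>) * ennreal ((fn y \<xi>)\<^sup>2)"
            by (auto split: split_indicator simp flip: ennreal_plus intro!: ennreal_leI)
        qed
        also have "\<dots> = ennreal ((norm X)\<^sup>2) + emeasure lborel {\<tau>. (t, \<tau>) \<in> E} * ennreal ((norm y)\<^sup>2)"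
        proof -
          have ind: "indicator E (t, \<tau>) = indicator {\<tau>. (t, \<tau>) \<in> E} \<tau>" for \<tau> by (auto split: split_indicator)
          show ?thesis using kset_section(1)[OF E, of t]
            by (simp add: nn_integral_add nn_integral_slice nn_integral_cmult nn_integral_multc norm_sq_lsq_nn ind)
        qed
        also have "\<dots> < \<infinity>"
          using le_less_trans[OF kset_section(2)[OF E, of t]] by (auto simp: ennreal_mult_less_top)
        finally show "(\<integral>\<^sup>+\<tau>. \<integral>\<^sup>+\<xi>. ennreal \<bar>indicator E (t, \<tau>) * fn X (\<tau>, \<xi>) * fn y \<xi>\<bar> \<partial>lborel \<partial>lborel) < \<infinity>" .
      qed measurable
      also have "\<dots> = (LINT \<tau>|lborel. indicator E (t, \<tau>) * (LINT \<xi>|lborel. fn X (\<tau>, \<xi>) * fn y \<xi>))"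
        by (simp add: mult.assoc)
      also have "\<dots> = (LINT \<tau>|lborel. indicator E (t, \<tau>) * (slice X \<tau> \<bullet> y))"
      proof (rule integral_cong_AE)
        show "AE \<tau> in lborel. indicator E (t, \<tau>) * (LINT \<xi>|lborel. fn X (\<tau>, \<xi>) * fn y \<xi>) =
            indicator E (t, \<tau>) * (slice X \<tau> \<bullet> y)"
          using AE_slice_sqi[of X] by eventually_elim (simp add: inner_slice_left_eq)
      qed measurable
      finally show "slice (kop E X) t \<bullet> y = (LINT \<tau>|lborel. indicator E (t, \<tau>) * (slice X \<tau> \<bullet> y))" .
    qed
  qed
qed

text \<open>Bounding the inner product by \<open>|X(\<tau>)|^2 + |Y(t)|^2\<close> leaves one
  integral per direction of section, each finite by the measure bound \<open>A\<close>. This is the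
  hypothesis of Fubini when kernel integrals are exchanged later.\<close>

lemma kernel_pairing_nn:
  fixes X Y :: "(real \<times> 'b::euclidean_space) lsq"
  assumes E: "kset A E"
  shows "(\<integral>\<^sup>+t. \<integral>\<^sup>+\<tau>. ennreal \<bar>indicator E (t, \<tau>) * (slice X \<tau> \<bullet> slice Y t)\<bar> \<partial>lborel \<partial>lborel) < \<infinity>"
proof -
  have [measurable]: "E \<in> sets borel" using E by (auto simp: kset_def)
  have ind: "indicator E (t, \<tau>) = indicator {\<tau>. (t, \<tau>) \<in> E} \<tau>"
    "indicator E (t, \<tau>) = indicator {t. (t, \<tau>) \<in> E} t" for t \<tau>
    by (auto split: split_indicator)
  have "(\<integral>\<^sup>+t. \<integral>\<^sup>+\<tau>. ennreal \<bar>indicator E (t, \<tau>) * (slice X \<tau> \<bullet> slice Y t)\<bar> \<partial>lborel \<partial>lborel)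
      \<le> (\<integral>\<^sup>+t. \<integral>\<^sup>+\<tau>. indicator E (t, \<tau>) * ennreal ((norm (slice X \<tau>))\<^sup>2)
          + indicator E (t, \<tau>) * ennreal ((norm (slice Y t))\<^sup>2) \<partial>lborel \<partial>lborel)"
  proof (intro nn_integral_mono)
    fix t \<tau>
    have "\<bar>slice X \<tau> \<bullet> slice Y t\<bar> \<le> (norm (slice X \<tau>))\<^sup>2 + (norm (slice Y t))\<^sup>2"
      using Cauchy_Schwarz_ineq2[of "slice X \<tau>" "slice Y t"]
        sum_squares_bound[of "norm (slice X \<tau>)" "norm (slice Y t)"]
        mult_nonneg_nonneg[OF norm_ge_zero norm_ge_zero, of "slice X \<tau>" "slice Y t"] by linarith
    then show "ennreal \<bar>indicator E (t, \<tau>) * (slice X \<tau> \<bullet> slice Y t)\<bar>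
        \<le> indicator E (t, \<tau>) * ennreal ((norm (slice X \<tau>))\<^sup>2)
          + indicator E (t, \<tau>) * ennreal ((norm (slice Y t))\<^sup>2)"
      by (auto split: split_indicator simp flip: ennreal_plus intro!: ennreal_leI)
  qed
  also have "\<dots> = (\<integral>\<^sup>+t. \<integral>\<^sup>+\<tau>. indicator E (t, \<tau>) * ennreal ((norm (slice X \<tau>))\<^sup>2) \<partial>lborel \<partial>lborel)
      + (\<integral>\<^sup>+t. \<integral>\<^sup>+\<tau>. indicator E (t, \<tau>) * ennreal ((norm (slice Y t))\<^sup>2) \<partial>lborel \<partial>lborel)"
    by (simp add: nn_integral_add)
  also have "(\<integral>\<^sup>+t. \<integral>\<^sup>+\<tau>. indicator E (t, \<tau>) * ennreal ((norm (slice X \<tau>))\<^sup>2) \<partial>lborel \<partial>lborel)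
      = (\<integral>\<^sup>+\<tau>. \<integral>\<^sup>+t. indicator E (t, \<tau>) * ennreal ((norm (slice X \<tau>))\<^sup>2) \<partial>lborel \<partial>lborel)"
    by (rule lborel_pair.Fubini') measurable
  also have "\<dots> = (\<integral>\<^sup>+\<tau>. emeasure lborel {t. (t, \<tau>) \<in> E} * ennreal ((norm (slice X \<tau>))\<^sup>2) \<partial>lborel)"
    using kset_section(3)[OF E] by (intro nn_integral_cong) (simp add: ind(2) nn_integral_multc)
  also have "\<dots> \<le> (\<integral>\<^sup>+\<tau>. ennreal A * ennreal ((norm (slice X \<tau>))\<^sup>2) \<partial>lborel)"
    by (intro nn_integral_mono mult_right_mono kset_section(4)[OF E]) simp
  also have "(\<integral>\<^sup>+t. \<integral>\<^sup>+\<tau>. indicator E (t, \<tau>) * ennreal ((norm (slice Y t))\<^sup>2) \<partial>lborel \<partial>lborel)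
      = (\<integral>\<^sup>+t. emeasure lborel {\<tau>. (t, \<tau>) \<in> E} * ennreal ((norm (slice Y t))\<^sup>2) \<partial>lborel)"
    using kset_section(1)[OF E] by (intro nn_integral_cong) (simp add: ind(1) nn_integral_multc)
  also have "\<dots> \<le> (\<integral>\<^sup>+t. ennreal A * ennreal ((norm (slice Y t))\<^sup>2) \<partial>lborel)"
    by (intro nn_integral_mono mult_right_mono kset_section(2)[OF E]) simp
  finally show ?thesis
    by (rule le_less_trans) (auto simp: nn_integral_cmult norm_slice_nn ennreal_mult_less_top add_mono)
qed

lemma inner_kop:
  fixes X Y :: "(real \<times> 'b::euclidean_space) lsq"
  assumes E: "kset A E"
  shows "kop E X \<bullet> Y = (LINT t|lborel. LINT \<tau>|lborel. indicator E (t, \<tau>) * (slice X \<tau> \<bullet> slice Y t))"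
proof -
  have [measurable]: "E \<in> sets borel" using E by (auto simp: kset_def)
  show ?thesis unfolding inner_eq_integral_slice
    by (rule integral_cong_AE) (measurable, use slice_kop[OF E, of X] in eventually_elim, blast)
qed

lemma kset_converse: "kset A E ==> kset A (E\<inverse>)"
proof -
  assume E: "kset A E"
  have [measurable]: "E \<in> sets borel" using E by (auto simp: kset_def)
  have "E\<inverse> = {p. (snd p, fst p) \<in> E}" by auto
  also have "\<dots> \<in> sets borel" by measurable
  finally show ?thesis using E by (auto simp: kset_def)
qed

lemma kop_adjoint:
  fixes X Y :: "(real \<times> 'b::euclidean_space) lsq"
  assumes E: "kset A E"
  shows "kop E X \<bullet> Y = X \<bullet> kop (E\<inverse>) Y"
proof -
  have [measurable]: "E \<in> sets borel" using E by (auto simp: kset_def)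
  have ind: "indicator (E\<inverse>) (\<tau>, t) = (indicator E (t, \<tau>) :: real)" for t \<tau> by (auto split: split_indicator)
  have "kop E X \<bullet> Y = (LINT \<tau>|lborel. LINT t|lborel. indicator E (t, \<tau>) * (slice X \<tau> \<bullet> slice Y t))"
    unfolding inner_kop[OF E]
    by (rule lborel_Fubini[where f = "\<lambda>(t, \<tau>). indicator E (t, \<tau>) * (slice X \<tau> \<bullet> slice Y t)", unfolded split_conv])
      (measurable, rule kernel_pairing_nn[OF E])
  also have "\<dots> = kop (E\<inverse>) Y \<bullet> X" unfolding inner_kop[OF kset_converse[OF E]] ind by (simp add: inner_commute)
  finally show ?thesis by (simp add: inner_commute)
qed

text \<open>A formal adjoint determines the map weakly, so additivity and homogeneity are inherited
  from the inner product and need not be checked on kernels.\<close>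

lemma linear_if_adjoint:
  fixes F G :: "'a::real_inner \<Rightarrow> 'a"
  assumes "\<And>x y. F x \<bullet> y = x \<bullet> G y"
  shows "linear F"
  by (rule linearI; rule inner_eqI) (simp_all add: assms inner_add_left)

lemma kop_Un:
  assumes "kset A E" "kset B F" "kset C (E \<union> F)" "E \<inter> F = {}"
  shows "kop (E \<union> F) X = kop E X + kop F X"
proof (rule inner_eqI)
  fix Y
  have [measurable]: "E \<in> sets borel" "F \<in> sets borel" using assms by (auto simp: kset_def)
  have i: "integrable lborel (\<lambda>(t, \<tau>). indicator E (t, \<tau>) * (slice X \<tau> \<bullet> slice Y t))"
    if "kset A E" for A E
  proof (rule lborel_pair_integrableI)
    have [measurable]: "E \<in> sets borel" using that by (auto simp: kset_def)
    show "(\<lambda>(t, \<tau>). indicator E (t, \<tau>) * (slice X \<tau> \<bullet> slice Y t)) \<in> borel_measurable borel" by measurable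
  qed (use kernel_pairing_nn[OF that] in simp)
  have k: "kop E X \<bullet> Y = (LINT p|lborel. indicator E p * (slice X (snd p) \<bullet> slice Y (fst p)))" if "kset A E" for A E
    using lborel_pair_integrable(3)[OF i[OF that]] inner_kop[OF that, of X Y] by (simp add: case_prod_beta)
  have "kop (E \<union> F) X \<bullet> Y = (LINT p|lborel. indicator E p * (slice X (snd p) \<bullet> slice Y (fst p))
      + indicator F p * (slice X (snd p) \<bullet> slice Y (fst p)))"
    unfolding k[OF assms(3)] using assms(4)
    by (intro Bochner_Integration.integral_cong) (auto split: split_indicator)
  also have "\<dots> = kop E X \<bullet> Y + kop F X \<bullet> Y"
    using i[OF assms(1)] i[OF assms(2)] unfolding k[OF assms(1)] k[OF assms(2)] case_prod_beta by simp
  finally show "kop (E \<union> F) X \<bullet> Y = (kop E X + kop F X) \<bullet> Y" by (simp add: inner_add_left)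
qed

subsection \<open>Truncated time shifts\<close>

text \<open>Both the time and the shifted time are cut off to \<open>(0, T)\<close>. The cutoff is
  symmetric, so the adjoint of the shift by \<open>h\<close> is the shift by \<open>- h\<close>, and
  whatever would be shifted in from outside is replaced by \<open>0\<close>.\<close>

definition shift :: "real \<Rightarrow> real \<Rightarrow> (real \<times> 'b::euclidean_space) lsq \<Rightarrow> (real \<times> 'b) lsq" where
  "shift T h X = cls (\<lambda>p. indicator {0<..<T} (fst p) * (indicator {0<..<T} (fst p - h) * fn X (fst p - h, snd p)))"

lemma sqi_shift:
  fixes X :: "(real \<times> 'b::euclidean_space) lsq"
  shows "sqi (\<lambda>p. indicator {0<..<T} (fst p) * (indicator {0<..<T} (fst p - h) * fn X (fst p - h, snd p)))"
proof (rule sqi_borelI)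
  have "(\<integral>\<^sup>+p. ennreal ((indicator {0<..<T} (fst p) * (indicator {0<..<T} (fst p - h) * fn X (fst p - h, snd p)))\<^sup>2) \<partial>lborel)
      \<le> (\<integral>\<^sup>+p. ennreal ((fn X (fst p - h, snd p))\<^sup>2) \<partial>lborel)"
    by (rule nn_integral_mono) (auto split: split_indicator)
  also have "\<dots> = (\<integral>\<^sup>+\<xi>. \<integral>\<^sup>+t. ennreal ((fn X (t - h, \<xi>))\<^sup>2) \<partial>lborel \<partial>lborel)"
    by (subst nn_integral_lborel_pair(2)) simp_all
  also have "\<dots> = (\<integral>\<^sup>+\<xi>. \<integral>\<^sup>+t. ennreal ((fn X (t, \<xi>))\<^sup>2) \<partial>lborel \<partial>lborel)"
    by (rule nn_integral_cong, subst nn_integral_real_affine[of _ 1 h])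
      (simp_all add: algebra_simps)
  also have "\<dots> = (\<integral>\<^sup>+p. ennreal ((fn X p)\<^sup>2) \<partial>lborel)" by (rule nn_integral_lborel_pair(2)[symmetric]) simp
  also have "\<dots> < \<infinity>" unfolding norm_sq_lsq_nn[symmetric] by simp
  finally show "(\<integral>\<^sup>+p. ennreal ((indicator {0<..<T} (fst p) * (indicator {0<..<T} (fst p - h) * fn X (fst p - h, snd p)))\<^sup>2) \<partial>lborel) < \<infinity>" .
qed measurable

lemma slice_shift:
  fixes X :: "(real \<times> 'b::euclidean_space) lsq"
  shows "AE t in lborel. slice (shift T h X) t = (if t \<in> {0<..<T} \<and> t - h \<in> {0<..<T} then slice X (t - h) else 0)"
  unfolding shift_def using slice_cls[OF sqi_shift[of T h X]]
  by eventually_elim (auto simp: slice_def zero_lsq_def)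

lemma inner_shift:
  fixes X Y :: "(real \<times> 'b::euclidean_space) lsq"
  shows "shift T h X \<bullet> Y = (LINT t|lborel. indicator {0<..<T} t * indicator {0<..<T} (t - h) * (slice X (t - h) \<bullet> slice Y t))"
  unfolding inner_eq_integral_slice
  by (rule integral_cong_AE) (measurable, use slice_shift[of T h X] in eventually_elim, auto)

lemma shift_adjoint:
  fixes X Y :: "(real \<times> 'b::euclidean_space) lsq"
  shows "shift T h X \<bullet> Y = X \<bullet> shift T (- h) Y"
proof -
  have "shift T h X \<bullet> Y = (LINT t|lborel. indicator {0<..<T} (h + t) * indicator {0<..<T} t * (slice X t \<bullet> slice Y (h + t)))"
    unfolding inner_shift by (subst lborel_integral_real_affine[of 1 _ h]) auto
  also have "\<dots> = shift T (- h) Y \<bullet> X"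
    unfolding inner_shift by (simp add: inner_commute mult.commute add.commute mult.left_commute)
  finally show ?thesis by (simp add: inner_commute)
qed

lemma norm_shift: "norm (shift T h X) \<le> norm X" for X :: "(real \<times> 'b::euclidean_space) lsq"
proof -
  have "ennreal ((norm (shift T h X))\<^sup>2) = (\<integral>\<^sup>+t. ennreal ((norm (slice (shift T h X) t))\<^sup>2) \<partial>lborel)"
    by (simp add: norm_slice_nn)
  also have "\<dots> \<le> (\<integral>\<^sup>+t. ennreal ((norm (slice X (t - h)))\<^sup>2) \<partial>lborel)"
    by (rule nn_integral_mono_AE, use slice_shift[of T h X] in eventually_elim) auto
  also have "\<dots> = ennreal ((norm X)\<^sup>2)"
    unfolding norm_slice_nn[symmetric] by (subst (2) nn_integral_real_affine[of _ 1 "- h"]) simp_all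
  finally have "(norm (shift T h X))\<^sup>2 \<le> (norm X)\<^sup>2" by simp
  then show ?thesis by (rule power2_le_imp_le) simp
qed

lemma lsq_eqI_slice_inner:
  fixes X Y :: "(real \<times> 'b::euclidean_space) lsq"
  assumes "AE t in lborel. \<forall>y. slice X t \<bullet> y = slice Y t \<bullet> y"
  shows "X = Y"
  by (rule lsq_eqI_slice, use assms in eventually_elim) (auto intro: inner_eqI)

text \<open>Shifting the output moves the kernel set in its first variable, as
  \<open>kop_shift\<close> does in the second. For the Volterra set both produce the same delayed
  triangle, which is how commutation with shifts is obtained.\<close>

lemma shift_kop:
  fixes X :: "(real \<times> 'b::euclidean_space) lsq"
  assumes E: "kset A E" and F: "kset B F"
    and EF: "\<And>t \<tau>. (t, \<tau>) \<in> F \<longleftrightarrow> t \<in> {0<..<T} \<and> t - h \<in> {0<..<T} \<and> (t - h, \<tau>) \<in> E"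
  shows "shift T h (kop E X) = kop F X"
proof (rule lsq_eqI_slice_inner)
  show "AE t in lborel. \<forall>y. slice (shift T h (kop E X)) t \<bullet> y = slice (kop F X) t \<bullet> y"
    using slice_shift[of T h "kop E X"] slice_kop[OF F, of X]
      AE_lborel_translate[OF slice_kop[OF E, of X], of "- h"]
  proof eventually_elim
    case (elim t)
    have "indicator F (t, \<tau>) = (if t \<in> {0<..<T} \<and> t - h \<in> {0<..<T} then indicator E (t - h, \<tau>) else (0::real))" for \<tau>
      using EF[of t \<tau>] by (auto split: split_indicator)
    note ind = this
    show ?case
    proof (cases "t \<in> {0<..<T} \<and> t - h \<in> {0<..<T}")
      case True
      then have "indicator F (t, \<tau>) = (indicator E (t - h, \<tau>) :: real)" for \<tau> using ind[of \<tau>] by simp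
      then show ?thesis using elim True by simp
    next
      case False
      then have "indicator F (t, \<tau>) = (0 :: real)" for \<tau> using ind[of \<tau>] by auto
      then show ?thesis using elim False by auto
    qed
  qed
qed

lemma kop_shift:
  fixes X :: "(real \<times> 'b::euclidean_space) lsq"
  assumes E: "kset A E" and F: "kset B F"
    and EF: "\<And>t \<tau>. (t, \<tau>) \<in> F \<longleftrightarrow> \<tau> + h \<in> {0<..<T} \<and> \<tau> \<in> {0<..<T} \<and> (t, \<tau> + h) \<in> E"
  shows "kop E (shift T h X) = kop F X"
proof (rule lsq_eqI_slice_inner)
  have [measurable]: "E \<in> sets borel" using E by (auto simp: kset_def)
  show "AE t in lborel. \<forall>y. slice (kop E (shift T h X)) t \<bullet> y = slice (kop F X) t \<bullet> y"
    using slice_kop[OF F, of X] slice_kop[OF E, of "shift T h X"]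
  proof eventually_elim
    case (elim t)
    show ?case
    proof
      fix y
      have "slice (kop E (shift T h X)) t \<bullet> y = (LINT \<tau>|lborel. indicator E (t, \<tau>) * (slice (shift T h X) \<tau> \<bullet> y))"
        using elim by blast
      also have "\<dots> = (LINT \<tau>|lborel. indicator E (t, \<tau>) *
          (indicator {0<..<T} \<tau> * indicator {0<..<T} (\<tau> - h) * (slice X (\<tau> - h) \<bullet> y)))"
        by (rule integral_cong_AE) (measurable, use slice_shift[of T h X] in eventually_elim, auto)
      also have "\<dots> = (LINT \<tau>|lborel. indicator E (t, h + \<tau>) *
          (indicator {0<..<T} (h + \<tau>) * indicator {0<..<T} \<tau> * (slice X \<tau> \<bullet> y)))"
        by (subst lborel_integral_real_affine[of 1 _ h]) auto
      also have "\<dots> = (LINT \<tau>|lborel. indicator F (t, \<tau>) * (slice X \<tau> \<bullet> y))"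
        by (rule Bochner_Integration.integral_cong) (use EF[of t] in \<open>auto simp: add.commute split: split_indicator\<close>)
      also have "\<dots> = slice (kop F X) t \<bullet> y" using elim by simp
      finally show "slice (kop E (shift T h X)) t \<bullet> y = slice (kop F X) t \<bullet> y" .
    qed
  qed
qed

subsection \<open>The Volterra operator\<close>

text \<open>The strict triangle below the diagonal: \<open>kop\<close> of it integrates from
  \<open>0\<close> to \<open>t\<close>, \<open>kop\<close> of its converse from \<open>t\<close> to
  \<open>T\<close>. For \<open>h \<ge> 0\<close> it is the disjoint union of the band
  \<open>Kband T h\<close> and the delayed triangle \<open>Kdelay T h\<close>.\<close>

definition Klow :: "real \<Rightarrow> (real \<times> real) set" where
  "Klow T = {(t, \<tau>). 0 < \<tau> \<and> \<tau> < t \<and> t < T}"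

definition Kband :: "real \<Rightarrow> real \<Rightarrow> (real \<times> real) set" where
  "Kband T h = {(t, \<tau>). 0 < \<tau> \<and> t - h \<le> \<tau> \<and> \<tau> < t \<and> t < T}"

definition Kdelay :: "real \<Rightarrow> real \<Rightarrow> (real \<times> real) set" where
  "Kdelay T h = {(t, \<tau>). 0 < \<tau> \<and> \<tau> < t - h \<and> t < T}"

definition volt :: "real \<Rightarrow> (real \<times> 'b::euclidean_space) lsq \<Rightarrow> (real \<times> 'b) lsq" where
  "volt T = kop (Klow T)"

definition volt' :: "real \<Rightarrow> (real \<times> 'b::euclidean_space) lsq \<Rightarrow> (real \<times> 'b) lsq" where
  "volt' T = kop ((Klow T)\<inverse>)"

lemma kset_if_sections:
  assumes E: "E \<in> sets borel" and A: "0 \<le> A"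
    and t: "\<And>t. \<exists>a. {\<tau>. (t, \<tau>) \<in> E} \<subseteq> {a..a + A}"
    and \<tau>: "\<And>\<tau>. \<exists>a. {t. (t, \<tau>) \<in> E} \<subseteq> {a..a + A}"
  shows "kset A E"
  unfolding kset_def
proof (intro conjI allI E A)
  note [measurable] = E
  fix t
  obtain a where "{\<tau>. (t, \<tau>) \<in> E} \<subseteq> {a..a + A}" using t by blast
  then have "emeasure lborel {\<tau>. (t, \<tau>) \<in> E} \<le> emeasure lborel {a..a + A}" by (rule emeasure_mono) simp
  then show "emeasure lborel {\<tau>. (t, \<tau>) \<in> E} \<le> ennreal A" using A by simp
  obtain a where "{\<tau>. (\<tau>, t) \<in> E} \<subseteq> {a..a + A}" using \<tau> by blast
  then have "emeasure lborel {\<tau>. (\<tau>, t) \<in> E} \<le> emeasure lborel {a..a + A}" by (rule emeasure_mono) simp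
  then show "emeasure lborel {\<tau>. (\<tau>, t) \<in> E} \<le> ennreal A" using A by simp
qed

lemma kset_Klow: "0 \<le> T ==> kset T (Klow T)"
proof (rule kset_if_sections)
  have "Klow T = {p. 0 < snd p \<and> snd p < fst p \<and> fst p < T}" by (auto simp: Klow_def)
  also have "\<dots> \<in> sets borel" by measurable
  finally show "Klow T \<in> sets borel" .
qed (auto simp: Klow_def intro!: exI[of _ 0])

lemma kset_Kdelay: "0 \<le> T ==> 0 \<le> h ==> kset T (Kdelay T h)"
proof (rule kset_if_sections)
  have "Kdelay T h = {p. 0 < snd p \<and> snd p < fst p - h \<and> fst p < T}" by (auto simp: Kdelay_def)
  also have "\<dots> \<in> sets borel" by measurable
  finally show "Kdelay T h \<in> sets borel" .
qed (auto simp: Kdelay_def intro!: exI[of _ 0])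

lemma kset_Kband: "0 \<le> h ==> kset h (Kband T h)"
proof (rule kset_if_sections)
  have "Kband T h = {p. 0 < snd p \<and> fst p - h \<le> snd p \<and> snd p < fst p \<and> fst p < T}" by (auto simp: Kband_def)
  also have "\<dots> \<in> sets borel" by measurable
  finally show "Kband T h \<in> sets borel" .
  show "\<exists>a. {\<tau>. (t, \<tau>) \<in> Kband T h} \<subseteq> {a..a + h}" for t by (rule exI[of _ "t - h"]) (auto simp: Kband_def)
  show "\<exists>a. {t. (t, \<tau>) \<in> Kband T h} \<subseteq> {a..a + h}" for \<tau> by (rule exI[of _ "\<tau>"]) (auto simp: Kband_def)
qed

context
  fixes T :: real
  assumes T: "0 < T"
begin

lemma volt_adjoint: "volt T X \<bullet> Y = X \<bullet> volt' T Y"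
  unfolding volt_def volt'_def by (rule kop_adjoint[OF kset_Klow]) (use T in simp)

lemma linear_volt: "linear (volt T :: (real \<times> 'b::euclidean_space) lsq \<Rightarrow> _)"
  by (rule linear_if_adjoint) (rule volt_adjoint)

lemma linear_volt': "linear (volt' T :: (real \<times> 'b::euclidean_space) lsq \<Rightarrow> _)"
  by (rule linear_if_adjoint[of _ "volt T"]) (metis volt_adjoint inner_commute)

lemma norm_volt: "norm (volt T X) \<le> T * norm X"
  unfolding volt_def using T by (intro norm_kop kset_Klow) simp

lemma shift_volt: "0 \<le> h ==> shift T h (volt T X) = kop (Kdelay T h) X"
  unfolding volt_def using T by (intro shift_kop[OF kset_Klow kset_Kdelay]) (auto simp: Klow_def Kdelay_def)

lemma volt_shift: "0 \<le> h ==> volt T (shift T h X) = kop (Kdelay T h) X"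
  unfolding volt_def using T by (intro kop_shift[OF kset_Klow kset_Kdelay]) (auto simp: Klow_def Kdelay_def)

lemma shift_volt_commute: "0 \<le> h ==> shift T h (volt T X) = volt T (shift T h X)"
  by (simp add: shift_volt volt_shift)

text \<open>The delayed part cancels, and what is left integrates over the last \<open>h\<close>
  units of time. Its kernel has sections of length at most \<open>h\<close>, which is the source of
  the Lipschitz bounds in time.\<close>

lemma volt_diff_shift:
  assumes "0 \<le> h"
  shows "volt T X - shift T h (volt T X) = kop (Kband T h) X"
proof -
  have u: "Klow T = Kband T h \<union> Kdelay T h" using assms by (auto simp: Klow_def Kband_def Kdelay_def)
  have "volt T X = kop (Kband T h) X + kop (Kdelay T h) X" unfolding volt_def u
  proof (rule kop_Un)
    show "kset h (Kband T h)" using assms by (rule kset_Kband)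
    show "kset T (Kdelay T h)" using assms T by (intro kset_Kdelay) auto
    show "kset T (Kband T h \<union> Kdelay T h)" unfolding u[symmetric] using T by (intro kset_Klow) auto
    show "Kband T h \<inter> Kdelay T h = {}" by (auto simp: Kband_def Kdelay_def)
  qed
  then show ?thesis using shift_volt[OF assms, of X] by simp
qed

lemma norm_volt_diff_shift: "0 \<le> h ==> norm (volt T X - shift T h (volt T X)) \<le> h * norm X"
  unfolding volt_diff_shift by (intro norm_kop kset_Kband)

text \<open>Up to the diagonal the two triangles fill the square, so on \<open>(0, T)\<close> the
  sum is the constant vector \<open>m\<close>, the integral of \<open>X\<close>, and both sides
  equal \<open>T |m|^2\<close>. The identity gives the positivity of \<open>volt\<close> and later
  lets the energy estimate absorb a source in the second component.\<close>

lemma volt_full: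
  fixes X :: "(real \<times> 'b::euclidean_space) lsq"
  shows "(norm (volt T X + volt' T X))\<^sup>2 = T * ((volt T X + volt' T X) \<bullet> X)"
proof -
  define E where "E = Klow T \<union> (Klow T)\<inverse>"
  have Km: "Klow T \<in> sets borel" "(Klow T)\<inverse> \<in> sets borel"
    using kset_Klow[of T] kset_converse[OF kset_Klow[of T]] T by (auto simp: kset_def)
  have E: "kset T E"
  proof (rule kset_if_sections)
    show "E \<in> sets borel" unfolding E_def using Km by auto
  qed (use T in \<open>auto simp: E_def Klow_def intro!: exI[of _ 0]\<close>)
  note [measurable] = kset_def[THEN iffD1, OF E, THEN conjunct1]
  have K: "volt T X + volt' T X = kop E X" unfolding volt_def volt'_def E_def
    by (rule kop_Un[symmetric, OF kset_Klow kset_converse[OF kset_Klow] E[unfolded E_def]])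
      (use T in \<open>auto simp: Klow_def\<close>)
  have sl: "AE t in lborel. \<forall>y. slice (kop E X) t \<bullet> y
      = indicator {0<..<T} t * (LINT \<tau>|lborel. indicator {0<..<T} \<tau> * (slice X \<tau> \<bullet> y))"
    using slice_kop[OF E, of X]
  proof eventually_elim
    case (elim t)
    show ?case
    proof
      fix y
      have "(LINT \<tau>|lborel. indicator E (t, \<tau>) * (slice X \<tau> \<bullet> y))
          = (LINT \<tau>|lborel. indicator {0<..<T} t * (indicator {0<..<T} \<tau> * (slice X \<tau> \<bullet> y)))"
      proof (rule integral_cong_AE)
        show "AE \<tau> in lborel. indicator E (t, \<tau>) * (slice X \<tau> \<bullet> y)
            = indicator {0<..<T} t * (indicator {0<..<T} \<tau> * (slice X \<tau> \<bullet> y))"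
          using AE_lborel_singleton[of t] by eventually_elim (auto simp: E_def Klow_def split: split_indicator)
      qed measurable
      then show "slice (kop E X) t \<bullet> y
          = indicator {0<..<T} t * (LINT \<tau>|lborel. indicator {0<..<T} \<tau> * (slice X \<tau> \<bullet> y))"
        using elim by simp
    qed
  qed
  \<comment> \<open>Almost every slice is given by the same weak formula and \<open>(0, T)\<close>
    is not a null set, so the slice at one good time \<open>t0\<close> can serve as the vector
    \<open>m\<close>.\<close>
  have "\<not> (AE t in lborel. t \<notin> {0<..<T})" using T by (subst AE_iff_measurable[of "{0<..<T}"]) auto
  then obtain t0 where t0: "t0 \<in> {0<..<T}"
    "\<And>y. slice (kop E X) t0 \<bullet> y = indicator {0<..<T} t0 * (LINT \<tau>|lborel. indicator {0<..<T} \<tau> * (slice X \<tau> \<bullet> y))"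
  proof -
    have "\<exists>t0. t0 \<in> {0<..<T} \<and> (\<forall>y. slice (kop E X) t0 \<bullet> y
        = indicator {0<..<T} t0 * (LINT \<tau>|lborel. indicator {0<..<T} \<tau> * (slice X \<tau> \<bullet> y)))"
    proof (rule ccontr)
      assume "\<not> ?thesis"
      then have "AE t in lborel. t \<notin> {0<..<T}" using sl by (auto elim!: eventually_mono)
      then show False using \<open>\<not> (AE t in lborel. t \<notin> {0<..<T})\<close> by blast
    qed
    then show ?thesis using that by blast
  qed
  define m where "m = slice (kop E X) t0"
  have m: "m \<bullet> y = (LINT \<tau>|lborel. indicator {0<..<T} \<tau> * (slice X \<tau> \<bullet> y))" for y
    unfolding m_def using t0 by simp
  have slm: "AE t in lborel. slice (kop E X) t = indicator {0<..<T} t *\<^sub>R m"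
    using sl by eventually_elim (rule inner_eqI, simp add: m)
  have "kop E X \<bullet> kop E X = (LINT t|lborel. indicator {0<..<T} t * (m \<bullet> m))" unfolding inner_eq_integral_slice
    by (rule integral_cong_AE) (measurable, use slm in eventually_elim, auto split: split_indicator)
  then have 1: "(norm (kop E X))\<^sup>2 = T * (m \<bullet> m)" using T by (simp add: power2_norm_eq_inner)
  have "kop E X \<bullet> X = (LINT t|lborel. indicator {0<..<T} t * (slice X t \<bullet> m))" unfolding inner_eq_integral_slice
    by (rule integral_cong_AE) (measurable, use slm in eventually_elim, auto simp: inner_commute split: split_indicator)
  then have 2: "kop E X \<bullet> X = m \<bullet> m" by (simp add: m)
  show ?thesis unfolding K 1 2 by simp
qed

lemma volt_nonneg: "0 \<le> volt T X \<bullet> X"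
proof -
  have "volt' T X \<bullet> X = volt T X \<bullet> X" using volt_adjoint[of X X] by (simp add: inner_commute)
  then have "(norm (volt T X + volt' T X))\<^sup>2 = T * (2 * (volt T X \<bullet> X))"
    unfolding volt_full by (simp add: inner_add_left)
  then have "0 \<le> T * (2 * (volt T X \<bullet> X))" by (metis zero_le_power2)
  then show ?thesis using T by (simp add: zero_le_mult_iff)
qed

text \<open>With \<open>\<tau> = t - \<sigma>\<close> the band integral becomes the integral of
  \<open>shift T \<sigma> X\<close> over \<open>0 < \<sigma> \<le> h\<close>. The difference is thus
  \<open>h\<close> times an average of shifts and, paired with \<open>Y\<close>, deviates from
  \<open>h (X \<bullet> Y)\<close> by at most \<open>h\<close> times the worst single
  deviation.\<close>

lemma volt_average:
  fixes X Y :: "(real \<times> 'b::euclidean_space) lsq"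
  assumes h: "0 < h" and B: "\<And>\<sigma>. 0 < \<sigma> ==> \<sigma> \<le> h ==> \<bar>shift T \<sigma> X \<bullet> Y - X \<bullet> Y\<bar> \<le> B"
  shows "\<bar>(volt T X - shift T h (volt T X)) \<bullet> Y - h * (X \<bullet> Y)\<bar> \<le> h * B"
proof -
  have E: "kset h (Kband T h)" using h by (intro kset_Kband) simp
  have [measurable]: "Kband T h \<in> sets borel" using E by (auto simp: kset_def)
  let ?g = "\<lambda>t \<sigma>. indicator (Kband T h) (t, t - \<sigma>) * (slice X (t - \<sigma>) \<bullet> slice Y t) :: real"
  have nn: "(\<integral>\<^sup>+t. \<integral>\<^sup>+\<sigma>. ennreal \<bar>?g t \<sigma>\<bar> \<partial>lborel \<partial>lborel) < \<infinity>"
  proof -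
    have "(\<integral>\<^sup>+t. \<integral>\<^sup>+\<sigma>. ennreal \<bar>?g t \<sigma>\<bar> \<partial>lborel \<partial>lborel)
        = (\<integral>\<^sup>+t. \<integral>\<^sup>+\<tau>. ennreal \<bar>indicator (Kband T h) (t, \<tau>) * (slice X \<tau> \<bullet> slice Y t)\<bar> \<partial>lborel \<partial>lborel)"
    proof (rule nn_integral_cong)
      fix t
      show "(\<integral>\<^sup>+\<sigma>. ennreal \<bar>?g t \<sigma>\<bar> \<partial>lborel)
          = (\<integral>\<^sup>+\<tau>. ennreal \<bar>indicator (Kband T h) (t, \<tau>) * (slice X \<tau> \<bullet> slice Y t)\<bar> \<partial>lborel)"
        by (subst (2) nn_integral_real_affine[of _ "-1" t]) simp_all
    qed
    then show ?thesis using kernel_pairing_nn[OF E, of X Y] by simp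
  qed
  have gm: "(\<lambda>(t, \<sigma>). ?g t \<sigma>) \<in> borel_measurable borel" by measurable
  have int: "integrable lborel (\<lambda>(t, \<sigma>). ?g t \<sigma>)" by (rule lborel_pair_integrableI) (use gm nn in auto)
  have sec: "(LINT t|lborel. ?g t \<sigma>) = indicator {0<..h} \<sigma> * (shift T \<sigma> X \<bullet> Y)" for \<sigma>
  proof -
    have "(LINT t|lborel. ?g t \<sigma>) = (LINT t|lborel. indicator {0<..h} \<sigma> *
        (indicator {0<..<T} t * indicator {0<..<T} (t - \<sigma>) * (slice X (t - \<sigma>) \<bullet> slice Y t)))"
      by (rule Bochner_Integration.integral_cong) (auto simp: Kband_def split: split_indicator)
    then show ?thesis by (simp add: inner_shift)
  qed
  have i1: "integrable lborel (\<lambda>\<sigma>. indicator {0<..h} \<sigma> * (shift T \<sigma> X \<bullet> Y))"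
    using lborel_pair_integrable(5)[OF int] by (simp add: sec)
  have ih: "integrable lborel (\<lambda>\<sigma>. indicator {0<..h} \<sigma> * z)" for z :: real
    by (rule integrable_mult_left, rule integrable_real_indicator) (use h in auto)
  note i2 = ih[of "X \<bullet> Y"]
  have "kop (Kband T h) X \<bullet> Y = (LINT t|lborel. LINT \<sigma>|lborel. ?g t \<sigma>)" unfolding inner_kop[OF E]
    by (rule Bochner_Integration.integral_cong, simp, subst lborel_integral_real_affine[of "-1" _ t for t]) auto
  also have "\<dots> = (LINT \<sigma>|lborel. indicator {0<..h} \<sigma> * (shift T \<sigma> X \<bullet> Y))"
    using lborel_pair_integrable(3,6)[OF int] by (simp add: sec)
  finally have "kop (Kband T h) X \<bullet> Y - h * (X \<bullet> Y)
      = (LINT \<sigma>|lborel. indicator {0<..h} \<sigma> * (shift T \<sigma> X \<bullet> Y) - indicator {0<..h} \<sigma> * (X \<bullet> Y))"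
    using i1 i2 h by (subst Bochner_Integration.integral_diff) auto
  also have "\<bar>\<dots>\<bar> \<le> (LINT \<sigma>|lborel. indicator {0<..h} \<sigma> * B)"
  proof (rule order_trans[OF integral_abs_bound], rule integral_mono)
    fix \<sigma> :: real
    show "\<bar>indicator {0<..h} \<sigma> * (shift T \<sigma> X \<bullet> Y) - indicator {0<..h} \<sigma> * (X \<bullet> Y)\<bar>
        \<le> indicator {0<..h} \<sigma> * B"
      using B[of \<sigma>] by (auto split: split_indicator)
  qed (use i1 i2 ih in auto)
  also have "\<dots> = h * B" using h by simp
  finally show ?thesis using h by (simp add: volt_diff_shift)
qed

end

section \<open>Square integrable functions of time with values in a closed subspace\<close>

text \<open>Forcing the slices outside \<open>(0, T)\<close> to be zero, rather than leaving them
  free, identifies the set with \<open>L^2(0,T;V)\<close> and makes it invariant under truncated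
  shifts and Volterra operators.\<close>

definition VV :: "real \<Rightarrow> ('b::euclidean_space lsq \<times> 'c::euclidean_space lsq) set
    \<Rightarrow> ((real \<times> 'b) lsq \<times> (real \<times> 'c) lsq) set" where
  "VV T V = {X. AE t in lborel. (slice (fst X) t, slice (snd X) t) \<in> (if t \<in> {0<..<T} then V else {0})}"

lemma norm_prod_lsq_sq: "(norm X)\<^sup>2 = (norm (fst X))\<^sup>2 + (norm (snd X))\<^sup>2"
  by (simp add: norm_prod_def)

context
  fixes T :: real and V :: "('b::euclidean_space lsq \<times> 'c::euclidean_space lsq) set"
  assumes V: "subspace V" "closed V"
begin

lemma subspace_VV: "subspace (VV T V)"
proof (rule subspaceI)
  have V0: "0 \<in> V" using V by (simp add: subspace_0)
  show "0 \<in> VV T V" unfolding VV_def mem_Collect_eq using slice_zero slice_zero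
    by eventually_elim (use V0 in \<open>auto simp: zero_prod_def\<close>)
  fix X Y :: "(real \<times> 'b) lsq \<times> (real \<times> 'c) lsq" and c :: real
  assume X: "X \<in> VV T V"
  show "c *\<^sub>R X \<in> VV T V" using X slice_scale[of c "fst X"] slice_scale[of c "snd X"]
    unfolding VV_def mem_Collect_eq
  proof eventually_elim
    case (elim t)
    have eq: "(slice (fst (c *\<^sub>R X)) t, slice (snd (c *\<^sub>R X)) t) = c *\<^sub>R (slice (fst X) t, slice (snd X) t)"
      using elim by simp
    have sub: "subspace (if t \<in> {0<..<T} then V else {0})" using V(1) by simp
    show ?case unfolding eq by (rule subspace_scale[OF sub elim(1)])
  qed
  assume Y: "Y \<in> VV T V"
  show "X + Y \<in> VV T V" using X Y slice_add[of "fst X" "fst Y"] slice_add[of "snd X" "snd Y"]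
    unfolding VV_def mem_Collect_eq
  proof eventually_elim
    case (elim t)
    have eq: "(slice (fst (X + Y)) t, slice (snd (X + Y)) t)
        = (slice (fst X) t, slice (snd X) t) + (slice (fst Y) t, slice (snd Y) t)"
      using elim by simp
    have sub: "subspace (if t \<in> {0<..<T} then V else {0})" using V(1) by simp
    show ?case unfolding eq by (rule subspace_add[OF sub elim(1,2)])
  qed
qed

lemma VV_shift:
  assumes X: "X \<in> VV T V"
  shows "(shift T h (fst X), shift T h (snd X)) \<in> VV T V"
  using AE_lborel_translate[OF X[unfolded VV_def mem_Collect_eq], of "- h"]
    slice_shift[of T h "fst X"] slice_shift[of T h "snd X"]
  unfolding VV_def mem_Collect_eq by eventually_elim (use V in \<open>auto simp: zero_prod_def[symmetric] subspace_0\<close>)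

text \<open>For \<open>y\<close> orthogonal to \<open>V\<close> the weak formula for the slices
  integrates zero, so almost every slice pair is orthogonal to the complement of \<open>V\<close>
  and lies in the closed space \<open>V\<close>.\<close>

lemma VV_kop:
  assumes X: "X \<in> VV T V" and E: "kset A E" and ET: "E \<subseteq> {0<..<T} \<times> {0<..<T}"
  shows "(kop E (fst X), kop E (snd X)) \<in> VV T V"
  using slice_kop[OF E, of "fst X"] slice_kop[OF E, of "snd X"] unfolding VV_def mem_Collect_eq
proof eventually_elim
  case (elim t)
  have [measurable]: "E \<in> sets borel" using E by (auto simp: kset_def)
  show ?case
  proof (cases "t \<in> {0<..<T}")
    case True
    have "(slice (kop E (fst X)) t, slice (kop E (snd X)) t) \<in> V"
    proof (rule mem_subspace_if_orthogonal_to_complement[OF V])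
      fix y :: "'b lsq \<times> 'c lsq" assume y: "\<forall>w\<in>V. y \<bullet> w = 0"
      have intg: "integrable lborel (\<lambda>\<tau>. indicator E (t, \<tau>) * (slice Z \<tau> \<bullet> z))"
        for Z :: "(real \<times> 'd::euclidean_space) lsq" and z
      proof (rule Bochner_Integration.integrable_bound)
        have "integrable lborel (indicator {\<tau>. (t, \<tau>) \<in> E} :: real \<Rightarrow> real)"
          using kset_section[OF E, of t] le_less_trans by (intro integrable_real_indicator) fastforce+
        then show "integrable lborel (\<lambda>\<tau>. (norm (slice Z \<tau>))\<^sup>2 + indicator {\<tau>. (t, \<tau>) \<in> E} \<tau> * (norm z)\<^sup>2)"
          by (intro Bochner_Integration.integrable_add norm_slice_integrable integrable_mult_left) simp
        have "\<bar>slice Z \<tau> \<bullet> z\<bar> \<le> (norm (slice Z \<tau>))\<^sup>2 + (norm z)\<^sup>2" for \<tau>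
          using Cauchy_Schwarz_ineq2[of "slice Z \<tau>" z]
            sum_squares_bound[of "norm (slice Z \<tau>)" "norm z"]
            mult_nonneg_nonneg[OF norm_ge_zero norm_ge_zero, of "slice Z \<tau>" z] by linarith
        then show "AE \<tau> in lborel. norm (indicator E (t, \<tau>) * (slice Z \<tau> \<bullet> z))
            \<le> norm ((norm (slice Z \<tau>))\<^sup>2 + indicator {\<tau>. (t, \<tau>) \<in> E} \<tau> * (norm z)\<^sup>2)"
          by (auto split: split_indicator)
      qed measurable
      have "y \<bullet> (slice (kop E (fst X)) t, slice (kop E (snd X)) t)
          = slice (kop E (fst X)) t \<bullet> fst y + slice (kop E (snd X)) t \<bullet> snd y"
        by (simp add: inner_prod_def inner_commute)
      also have "\<dots> = (LINT \<tau>|lborel. indicator E (t, \<tau>) * (slice (fst X) \<tau> \<bullet> fst y)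
          + indicator E (t, \<tau>) * (slice (snd X) \<tau> \<bullet> snd y))"
        using elim intg[of "fst X" "fst y"] intg[of "snd X" "snd y"] by simp
      also have "\<dots> = 0"
      proof (rule integral_eq_zero_AE)
        show "AE \<tau> in lborel. indicator E (t, \<tau>) * (slice (fst X) \<tau> \<bullet> fst y)
            + indicator E (t, \<tau>) * (slice (snd X) \<tau> \<bullet> snd y) = 0"
          using X unfolding VV_def mem_Collect_eq
        proof eventually_elim
          case (elim \<tau>)
          show ?case
          proof (cases "(t, \<tau>) \<in> E")
            case True
            then have "y \<bullet> (slice (fst X) \<tau>, slice (snd X) \<tau>) = 0" using elim ET y by (auto split: if_splits)
            then show ?thesis by (simp add: inner_prod_def inner_commute True)
          qed simp
        qed
      qed
      finally show "y \<bullet> (slice (kop E (fst X)) t, slice (kop E (snd X)) t) = 0" .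
    qed
    then show ?thesis using True by simp
  next
    case False
    then have "indicator E (t, \<tau>) = (0::real)" for \<tau> using ET by (auto split: split_indicator)
    then have "slice (kop E (fst X)) t = 0" "slice (kop E (snd X)) t = 0" using elim by (auto intro: inner_eqI)
    then show ?thesis using False by (auto simp: zero_prod_def)
  qed
qed

lemma VV_volt: "0 < T ==> X \<in> VV T V ==> (volt T (fst X), volt T (snd X)) \<in> VV T V"
  unfolding volt_def by (rule VV_kop[OF _ kset_Klow]) (auto simp: Klow_def)

lemma VV_volt': "0 < T ==> X \<in> VV T V ==> (volt' T (fst X), volt' T (snd X)) \<in> VV T V"
  unfolding volt'_def by (rule VV_kop[OF _ kset_converse[OF kset_Klow]]) (auto simp: Klow_def)

text \<open>Convergence in norm is L^1 convergence of the squared slice distances \<open>d n\<close>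
  to zero. Along a subsequence almost all slice pairs converge, and closedness of \<open>V\<close>
  applies time by time.\<close>

lemma closed_VV: "closed (VV T V)"
  unfolding closed_sequential_limits
proof (intro allI impI)
  fix X :: "nat \<Rightarrow> (real \<times> 'b) lsq \<times> (real \<times> 'c) lsq" and Y
  assume "(\<forall>n. X n \<in> VV T V) \<and> X \<longlonglongrightarrow> Y"
  then have X: "\<And>n. X n \<in> VV T V" and lim: "X \<longlonglongrightarrow> Y" by auto
  define d where "d n t = (norm (slice (fst (X n - Y)) t))\<^sup>2 + (norm (slice (snd (X n - Y)) t))\<^sup>2" for n t
  have d_int: "integrable lborel (d n)" for n
    unfolding d_def by (intro Bochner_Integration.integrable_add norm_slice_integrable)
  have d_norm: "(LINT t|lborel. d n t) = (norm (X n - Y))\<^sup>2" for n unfolding d_def norm_prod_lsq_sq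
    by (subst Bochner_Integration.integral_add[OF norm_slice_integrable norm_slice_integrable])
      (simp add: power2_norm_eq_inner inner_eq_integral_slice del: fst_diff snd_diff)
  have "(\<lambda>n. norm (X n - Y)) \<longlonglongrightarrow> 0" using lim by (simp add: tendsto_norm_zero LIM_zero)
  then have "(\<lambda>n. (norm (X n - Y))\<^sup>2) \<longlonglongrightarrow> 0" using tendsto_power[of _ 0 _ 2] by fastforce
  moreover have "(LINT t|lborel. norm (d n t)) = (norm (X n - Y))\<^sup>2" for n
    unfolding d_norm[symmetric] by (rule Bochner_Integration.integral_cong) (auto simp: d_def)
  ultimately have "\<exists>r::nat\<Rightarrow>nat. strict_mono r \<and> (AE t in lborel. (\<lambda>n. d (r n) t) \<longlonglongrightarrow> 0)"
    by (intro tendsto_L1_AE_subseq d_int) simp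
  then obtain r :: "nat \<Rightarrow> nat" where r: "AE t in lborel. (\<lambda>n. d (r n) t) \<longlonglongrightarrow> 0" by blast
  have all: "AE t in lborel. \<forall>n. (slice (fst (X n)) t, slice (snd (X n)) t) \<in> (if t \<in> {0<..<T} then V else {0})"
    unfolding AE_all_countable using X by (simp add: VV_def)
  have all2: "AE t in lborel. \<forall>n. slice (fst (X n - Y)) t = slice (fst (X n)) t - slice (fst Y) t
      \<and> slice (snd (X n - Y)) t = slice (snd (X n)) t - slice (snd Y) t"
    unfolding AE_all_countable
  proof
    fix n
    show "AE t in lborel. slice (fst (X n - Y)) t = slice (fst (X n)) t - slice (fst Y) t
      \<and> slice (snd (X n - Y)) t = slice (snd (X n)) t - slice (snd Y) t"
      using slice_diff[of "fst (X n)" "fst Y"] slice_diff[of "snd (X n)" "snd Y"] by eventually_elim simp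
  qed
  show "Y \<in> VV T V" unfolding VV_def mem_Collect_eq using r all all2
  proof eventually_elim
    case (elim t)
    let ?Z = "\<lambda>n. (slice (fst (X (r n))) t, slice (snd (X (r n))) t)"
    let ?y = "(slice (fst Y) t, slice (snd Y) t)"
    have sq: "(\<lambda>n. sqrt (d (r n) t)) \<longlonglongrightarrow> 0" using tendsto_real_sqrt[OF elim(1)] by simp
    have eq: "sqrt (d (r n) t) = norm (?Z n - ?y)" for n
      using elim(3) unfolding d_def by (simp add: norm_prod_def)
    have "(\<lambda>n. norm (?Z n - ?y)) \<longlonglongrightarrow> 0" using sq by (simp only: eq)
    then have lim: "?Z \<longlonglongrightarrow> ?y" by (rule LIM_zero_cancel[OF tendsto_norm_zero_cancel])
    have cl: "closed (if t \<in> {0<..<T} then V else {0})" using V by simp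
    have mem: "?Z n \<in> (if t \<in> {0<..<T} then V else {0})" for n using elim(2) by (rule spec)
    show ?case by (rule closed_sequentially[OF cl mem lim])
  qed
qed

lemma VV_poincare:
  assumes P: "\<And>v. v \<in> V ==> norm (fst v) \<le> P * norm (snd v)" "0 \<le> P" and X: "X \<in> VV T V"
  shows "norm (fst X) \<le> P * norm (snd X)"
proof -
  have "ennreal ((norm (fst X))\<^sup>2) \<le> (\<integral>\<^sup>+t. ennreal (P\<^sup>2) * ennreal ((norm (slice (snd X) t))\<^sup>2) \<partial>lborel)"
    unfolding norm_slice_nn[symmetric]
  proof (rule nn_integral_mono_AE, use X[unfolded VV_def mem_Collect_eq] in eventually_elim)
    case (elim t)
    then have "norm (slice (fst X) t) \<le> P * norm (slice (snd X) t)"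
      using P(1)[of "(slice (fst X) t, slice (snd X) t)"] P(2) by (auto simp: zero_prod_def split: if_splits)
    then have "(norm (slice (fst X) t))\<^sup>2 \<le> (P * norm (slice (snd X) t))\<^sup>2" by (intro power_mono) auto
    then show ?case by (simp add: power_mult_distrib ennreal_mult[symmetric])
  qed
  also have "\<dots> = ennreal ((P * norm (snd X))\<^sup>2)"
    by (simp add: nn_integral_cmult norm_slice_nn ennreal_mult power_mult_distrib)
  finally have "(norm (fst X))\<^sup>2 \<le> (P * norm (snd X))\<^sup>2" by simp
  then show ?thesis by (rule power2_le_imp_le) (use P in simp)
qed

lemma tens_VV:
  assumes v: "v \<in> V" and \<psi>: "sqi \<psi>" "\<psi> \<in> borel_measurable borel" "\<And>t. t \<notin> {0<..<T} ==> \<psi> t = 0"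
  shows "(tens \<psi> (fst v), tens \<psi> (snd v)) \<in> VV T V"
  unfolding VV_def mem_Collect_eq using slice_tens[OF \<psi>(1,2), of "fst v"] slice_tens[OF \<psi>(1,2), of "snd v"]
proof eventually_elim
  case (elim t)
  have "(slice (tens \<psi> (fst v)) t, slice (tens \<psi> (snd v)) t) = \<psi> t *\<^sub>R v" using elim by (simp add: prod_eq_iff)
  then show ?case using v V(1) \<psi>(3)[of t] by (auto simp: subspace_scale)
qed

lemma VV_weak_if_pointwise:
  assumes eq: "AE t in lborel. t \<in> {0<..<T} \<longrightarrow> (\<forall>v\<in>V. slice A t \<bullet> fst v + slice B t \<bullet> snd v = slice C t \<bullet> fst v + slice D t \<bullet> snd v)"
    and X: "X \<in> VV T V"
  shows "A \<bullet> fst X + B \<bullet> snd X = C \<bullet> fst X + D \<bullet> snd X"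
proof -
  have "A \<bullet> fst X + B \<bullet> snd X = (LINT t|lborel. slice A t \<bullet> slice (fst X) t + slice B t \<bullet> slice (snd X) t)"
    by (simp add: inner_eq_integral_slice inner_slice_integrable)
  also have "\<dots> = (LINT t|lborel. slice C t \<bullet> slice (fst X) t + slice D t \<bullet> slice (snd X) t)"
  proof (rule integral_cong_AE)
    show "AE t in lborel. slice A t \<bullet> slice (fst X) t + slice B t \<bullet> slice (snd X) t
        = slice C t \<bullet> slice (fst X) t + slice D t \<bullet> slice (snd X) t"
      using eq X[unfolded VV_def mem_Collect_eq]
    proof eventually_elim
      case (elim t)
      then show ?case by (cases "t \<in> {0<..<T}") (force simp: zero_prod_def)+
    qed
  qed measurable
  also have "\<dots> = C \<bullet> fst X + D \<bullet> snd X" by (simp add: inner_eq_integral_slice inner_slice_integrable)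
  finally show ?thesis .
qed

end

section \<open>The time integrated evolution equation\<close>

text \<open>Test with \<open>D - S' D\<close> for \<open>D = X - S X\<close>. Moving
  \<open>S'\<close> to the other factor gives \<open>|fst D|^2\<close> from the first term and,
  because \<open>J2\<close> commutes with \<open>S2\<close>, a nonnegative multiple of
  \<open>J2 (snd D) \<bullet> snd D\<close> from the second; only
  \<open>J1 \<zeta> - S1 (J1 \<zeta>)\<close> remains on the right. Abstract operators cover forward
  and backward shifts alike.\<close>

lemma regularity_by_differences:
  fixes J1 S1 S1' :: "'h1::real_inner \<Rightarrow> 'h1" and J2 S2 S2' :: "'h2::real_inner \<Rightarrow> 'h2"
    and W :: "('h1 \<times> 'h2) set"
  assumes W: "subspace W" and X: "X \<in> W"
    and W_S: "\<And>Y. Y \<in> W ==> (S1 (fst Y), S2 (snd Y)) \<in> W"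
    and W_S': "\<And>Y. Y \<in> W ==> (S1' (fst Y), S2' (snd Y)) \<in> W"
    and adj: "\<And>x y. S1 x \<bullet> y = x \<bullet> S1' y" "\<And>x y. S2 x \<bullet> y = x \<bullet> S2' y"
    and J2: "linear J2" "\<And>x. S2 (J2 x) = J2 (S2 x)" "\<And>x. 0 \<le> J2 x \<bullet> x"
    and J1: "norm (J1 \<zeta> - S1 (J1 \<zeta>)) \<le> c"
    and \<kappa>: "0 \<le> \<kappa>"
    and eq: "\<And>\<Theta>. \<Theta> \<in> W ==> fst X \<bullet> fst \<Theta> + \<kappa> * (J2 (snd X) \<bullet> snd \<Theta>) = J1 \<zeta> \<bullet> fst \<Theta>"
  shows "norm (fst X - S1 (fst X)) \<le> c"
proof -
  define D where "D = X - (S1 (fst X), S2 (snd X))"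
  have D: "D \<in> W" unfolding D_def using W X W_S by (simp add: subspace_diff)
  have \<Theta>: "D - (S1' (fst D), S2' (snd D)) \<in> W" using W D W_S' by (simp add: subspace_diff)
  have d: "x \<bullet> (y - S1' y) = (x - S1 x) \<bullet> y" "x' \<bullet> (y' - S2' y') = (x' - S2 x') \<bullet> y'" for x y x' y'
    by (simp_all add: inner_diff_left inner_diff_right adj)
  have "J2 (snd X) - S2 (J2 (snd X)) = J2 (snd D)" unfolding J2(2) D_def using J2(1) by (simp add: linear_diff)
  then have "fst D \<bullet> fst D + \<kappa> * (J2 (snd D) \<bullet> snd D) = (J1 \<zeta> - S1 (J1 \<zeta>)) \<bullet> fst D"
    using eq[OF \<Theta>] by (simp add: d) (simp add: D_def)
  moreover have "0 \<le> \<kappa> * (J2 (snd D) \<bullet> snd D)" using J2(3) \<kappa> by simp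
  ultimately have "fst D \<bullet> fst D \<le> (J1 \<zeta> - S1 (J1 \<zeta>)) \<bullet> fst D" by linarith
  also have "\<dots> \<le> norm (J1 \<zeta> - S1 (J1 \<zeta>)) * norm (fst D)" by (rule norm_cauchy_schwarz)
  also have "\<dots> \<le> c * norm (fst D)" by (intro mult_right_mono J1) simp
  finally have "norm (fst D) * norm (fst D) \<le> c * norm (fst D)" by (simp add: norm_eq_sqrt_inner)
  moreover have "0 \<le> c" using J1 norm_ge_zero order_trans by blast
  ultimately have "norm (fst D) \<le> c" by (cases "norm (fst D) = 0") auto
  then show ?thesis by (simp add: D_def)
qed

text \<open>A substitute for weak sequential compactness that selects no subsequence: the vectors
  along which \<open>q n\<close> converges form a subspace, the limit is a functional bounded by
  \<open>c\<close> there, and Riesz represents it by \<open>d\<close>.\<close>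

lemma weak_cluster_point:
  fixes q :: "nat \<Rightarrow> 'h::{real_inner,complete_space}"
  assumes qn: "\<And>n. norm (q n) \<le> c"
  shows "\<exists>d. norm d \<le> c \<and> (\<forall>\<eta> L. (\<lambda>n. q n \<bullet> \<eta>) \<longlonglongrightarrow> L \<longrightarrow> d \<bullet> \<eta> = L)"
proof -
  define I where "I = {\<eta>. convergent (\<lambda>n. q n \<bullet> \<eta>)}"
  have "\<exists>v. v \<in> closure ((\<lambda>x. x) ` I) \<and> norm v \<le> \<bar>c\<bar> \<and> (\<forall>\<eta>\<in>I. v \<bullet> \<eta> = lim (\<lambda>n. q n \<bullet> \<eta>))"
  proof (rule riesz_indexed)
    show "subspace I"
      unfolding I_def by (rule subspaceI) (auto simp: inner_add_right intro: convergent_add convergent_const convergent_mult)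
    show "lim (\<lambda>n. q n \<bullet> (i + j)) = lim (\<lambda>n. q n \<bullet> i) + lim (\<lambda>n. q n \<bullet> j)" if "i \<in> I" "j \<in> I" for i j
      using that unfolding I_def by (auto simp: inner_add_right convergent_LIMSEQ_iff intro!: limI tendsto_add)
    show "lim (\<lambda>n. q n \<bullet> (a *\<^sub>R i)) = a * lim (\<lambda>n. q n \<bullet> i)" if "i \<in> I" for i a using that unfolding I_def
      by (auto simp: convergent_LIMSEQ_iff intro!: limI tendsto_mult)
    show "\<bar>lim (\<lambda>n. q n \<bullet> i)\<bar> \<le> c * norm i" if "i \<in> I" for i
    proof (rule LIMSEQ_le_const2)
      show "(\<lambda>n. \<bar>q n \<bullet> i\<bar>) \<longlonglongrightarrow> \<bar>lim (\<lambda>n. q n \<bullet> i)\<bar>"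
        using that unfolding I_def by (intro tendsto_rabs) (simp add: convergent_LIMSEQ_iff)
      have "\<bar>q n \<bullet> i\<bar> \<le> c * norm i" for n
        using Cauchy_Schwarz_ineq2[of "q n" i] mult_right_mono[OF qn[of n] norm_ge_zero[of i]] by linarith
      then show "\<exists>N. \<forall>n\<ge>N. \<bar>q n \<bullet> i\<bar> \<le> c * norm i" by blast
    qed
  qed auto
  then obtain d where d: "norm d \<le> \<bar>c\<bar>" "\<And>\<eta>. \<eta> \<in> I ==> d \<bullet> \<eta> = lim (\<lambda>n. q n \<bullet> \<eta>)" by auto
  show ?thesis
  proof (intro exI[of _ d] conjI allI impI)
    have "0 \<le> c" using order_trans[OF norm_ge_zero qn[of 0]] .
    then show "norm d \<le> c" using d(1) by simp
    fix \<eta> L assume L: "(\<lambda>n. q n \<bullet> \<eta>) \<longlonglongrightarrow> L"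
    then have "\<eta> \<in> I" unfolding I_def convergent_def by blast
    then show "d \<bullet> \<eta> = L" using d(2) limI[OF L] by simp
  qed
qed

text \<open>If \<open>x\<close> exceeded the bound it would exceed \<open>N\<close>, so one factor
  \<open>N\<close> of the last term may be replaced by \<open>x\<close> and a factor
  \<open>x\<close> cancelled.\<close>

lemma real_quadratic_bound:
  fixes x N a b :: real
  assumes "x\<^sup>2 \<le> a * N * x + b * N\<^sup>2" "0 \<le> x" "0 \<le> N" "0 \<le> a" "0 \<le> b"
  shows "x \<le> (a + b + 1) * N"
proof (rule ccontr)
  assume "\<not> ?thesis"
  then have gt: "(a + b + 1) * N < x" by simp
  have "N \<le> (a + b + 1) * N" using assms mult_right_mono[of 1 "a + b + 1" N] by simp
  then have Nx: "N < x" using gt by simp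
  then have xpos: "0 < x" using assms by simp
  have "x * x \<le> a * N * x + b * N * N" using assms(1) by (simp add: power2_eq_square mult.assoc)
  also have "b * N * N \<le> b * N * x" using Nx assms by (intro mult_left_mono) auto
  finally have "x * x \<le> ((a + b) * N) * x" by (simp add: algebra_simps)
  then have "x \<le> (a + b) * N" using xpos by simp
  also have "\<dots> \<le> (a + b + 1) * N" using assms by (intro mult_right_mono) auto
  finally show False using gt by simp
qed

section \<open>Backward operators and elements that are Lipschitz in time\<close>

context
  fixes T :: real
  assumes T: "0 < T"
begin

lemma volt'_nonneg: "0 \<le> volt' T X \<bullet> X"
  using volt_nonneg[OF T, of X] volt_adjoint[OF T, of X X] by (simp add: inner_commute)

lemma shift_volt'_commute:
  assumes h: "0 \<le> h"
  shows "shift T (- h) (volt' T X) = volt' T (shift T (- h) X)"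
proof (rule inner_eqI)
  fix Y
  have "shift T (- h) (volt' T X) \<bullet> Y = Y \<bullet> shift T (- h) (volt' T X)" by (rule inner_commute)
  also have "\<dots> = volt T (shift T h Y) \<bullet> X" unfolding shift_adjoint[symmetric] volt_adjoint[OF T] by (rule refl)
  also have "\<dots> = shift T h (volt T Y) \<bullet> X" by (simp add: shift_volt_commute[OF T h])
  also have "\<dots> = Y \<bullet> volt' T (shift T (- h) X)" by (simp add: shift_adjoint volt_adjoint[OF T])
  also have "\<dots> = volt' T (shift T (- h) X) \<bullet> Y" by (rule inner_commute)
  finally show "shift T (- h) (volt' T X) \<bullet> Y = volt' T (shift T (- h) X) \<bullet> Y" .
qed

text \<open>By duality from the forward bound: the difference is paired with itself and both
  operators are moved to the other factor.\<close>

lemma norm_volt'_diff_shift: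
  assumes h: "0 \<le> h"
  shows "norm (volt' T X - shift T (- h) (volt' T X)) \<le> h * norm X"
proof -
  define y where "y = volt' T X - shift T (- h) (volt' T X)"
  have a: "volt' T X \<bullet> z = X \<bullet> volt T z" for z using volt_adjoint[OF T, of z X] by (simp add: inner_commute)
  have b: "shift T (- h) (volt' T X) \<bullet> y = X \<bullet> shift T h (volt T y)"
    using shift_adjoint[of T "- h" "volt' T X" y] by (simp add: a shift_volt_commute[OF T h])
  have "y \<bullet> y = volt' T X \<bullet> y - shift T (- h) (volt' T X) \<bullet> y" by (subst (1) y_def) (rule inner_diff_left)
  also have "\<dots> = X \<bullet> (volt T y - shift T h (volt T y))" by (simp add: a b inner_diff_right)
  also have "\<dots> \<le> norm X * (h * norm y)"
    by (rule order_trans[OF norm_cauchy_schwarz mult_left_mono[OF norm_volt_diff_shift[OF T h]]]) simp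
  finally have "norm y * norm y \<le> (h * norm X) * norm y" by (simp add: norm_eq_sqrt_inner mult.commute mult.left_commute)
  then have "norm y \<le> h * norm X" using h by (cases "norm y = 0") auto
  then show ?thesis by (simp add: y_def)
qed

text \<open>The shift brings in zeros at the start of the interval, so the hypothesis contains a
  zero initial value. The difference quotients are bounded by \<open>c\<close>; paired with
  \<open>volt' T y\<close> they become averages of shifts of \<open>X\<close> and tend to
  \<open>X \<bullet> y\<close>, so a weak cluster point \<open>d\<close> satisfies
  \<open>d \<bullet> volt' T y = X \<bullet> y\<close> for all \<open>y\<close>.\<close>

lemma volt_range_if_lipschitz:
  fixes X :: "(real \<times> 'b::euclidean_space) lsq"
  assumes lip: "\<And>\<sigma>. 0 < \<sigma> ==> norm (X - shift T \<sigma> X) \<le> c * \<sigma>" and c: "0 \<le> c"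
  shows "\<exists>d. X = volt T d \<and> norm d \<le> c"
proof -
  define h where "h n = 1 / (real n + 1)" for n
  have h: "h n > 0" for n unfolding h_def by simp
  have h0: "h \<longlonglongrightarrow> 0" unfolding h_def using LIMSEQ_inverse_real_of_nat by (simp add: inverse_eq_divide add.commute)
  define q where "q n = (1 / h n) *\<^sub>R (X - shift T (h n) X)" for n
  have qn: "norm (q n) \<le> c" for n
    using lip[OF h, of n] h[of n] unfolding q_def norm_scaleR by (simp add: field_simps)
  obtain d where d: "norm d \<le> c" "\<And>\<eta> L. (\<lambda>n. q n \<bullet> \<eta>) \<longlonglongrightarrow> L ==> d \<bullet> \<eta> = L"
    using weak_cluster_point[of q, OF qn] by blast
  have "X \<bullet> y = volt T d \<bullet> y" for y
  proof -
    have lim: "(\<lambda>n. q n \<bullet> volt' T y) \<longlonglongrightarrow> X \<bullet> y"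
    proof (rule LIM_zero_cancel, rule Lim_null_comparison)
      show "(\<lambda>n. h n * (c * norm y)) \<longlonglongrightarrow> 0" using tendsto_mult_right[OF h0, of "c * norm y"] by simp
      have "\<bar>q n \<bullet> volt' T y - X \<bullet> y\<bar> \<le> h n * (c * norm y)" for n
      proof -
        have "q n \<bullet> volt' T y = (1 / h n) * ((volt T X - shift T (h n) (volt T X)) \<bullet> y)"
          unfolding q_def shift_volt_commute[OF T less_imp_le[OF h]]
          by (simp add: volt_adjoint[OF T] inner_diff_left)
        then have "q n \<bullet> volt' T y - X \<bullet> y
            = (1 / h n) * ((volt T X - shift T (h n) (volt T X)) \<bullet> y - h n * (X \<bullet> y))"
          using h[of n] by (simp add: field_simps)
        also have "\<bar>\<dots>\<bar> \<le> (1 / h n) * (h n * (c * h n * norm y))"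
        proof -
          have "\<bar>shift T \<sigma> X \<bullet> y - X \<bullet> y\<bar> \<le> c * h n * norm y" if \<sigma>: "0 < \<sigma>" "\<sigma> \<le> h n" for \<sigma>
          proof -
            have "\<bar>shift T \<sigma> X \<bullet> y - X \<bullet> y\<bar> = \<bar>(X - shift T \<sigma> X) \<bullet> y\<bar>"
              by (simp add: inner_diff_left abs_minus_commute)
            also have "\<dots> \<le> norm (X - shift T \<sigma> X) * norm y" by (rule Cauchy_Schwarz_ineq2)
            also have "\<dots> \<le> c * h n * norm y"
              using lip[OF \<sigma>(1)] mult_left_mono[OF \<sigma>(2) c] by (intro mult_right_mono) auto
            finally show ?thesis .
          qed
          from volt_average[OF T h this]
          show ?thesis unfolding abs_mult using h[of n] by (intro mult_mono) auto
        qed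
        also have "\<dots> = h n * (c * norm y)" using h[of n] by simp
        finally show ?thesis .
      qed
      then show "\<forall>\<^sub>F n in sequentially. norm (q n \<bullet> volt' T y - X \<bullet> y) \<le> h n * (c * norm y)" by simp
    qed
    then have "d \<bullet> volt' T y = X \<bullet> y" by (rule d(2))
    then show ?thesis by (simp add: volt_adjoint[OF T])
  qed
  then have "X = volt T d" by (rule inner_eqI)
  then show ?thesis using d(1) by blast
qed

section \<open>The evolution equation over a subspace with a Poincare inequality\<close>

context
  fixes V :: "('b::euclidean_space lsq \<times> 'c::euclidean_space lsq) set" and P \<kappa> :: real
  assumes V: "subspace V" "closed V"
    and P: "\<And>v. v \<in> V ==> norm (fst v) \<le> P * norm (snd v)" "0 \<le> P"
    and \<kappa>: "0 < \<kappa>"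
begin

text \<open>Lions' method: the equation is an identity \<open>\<langle>X, M \<Theta>\<rangle> = l \<Theta>\<close> in which \<open>M \<Theta>\<close> controls
  \<open>volt' \<Theta>\<close>; testing \<open>M \<Theta>\<close> with \<open>volt' \<Theta>\<close> shows this.\<close>
lemma evolution_exists:
  "\<exists>X\<in>VV T V. \<forall>\<Theta>\<in>VV T V. fst X \<bullet> fst \<Theta> + \<kappa> * (volt T (snd X) \<bullet> snd \<Theta>) = volt T \<zeta> \<bullet> fst \<Theta>"
proof -
  \<comment> \<open>A pair consists of a test element and the representative, inside
    \<open>VV T V\<close>, of the form applied to it. Keeping the representative in
    \<open>VV T V\<close> puts the closure of \<open>snd\<close> applied to \<open>I\<close>, and
    with it the solution, into that space; \<open>riesz_indexed\<close> is used with
    \<open>M = snd\<close>.\<close>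
  define I where "I = {i. fst i \<in> VV T V \<and> snd i \<in> VV T V \<and>
    (\<forall>y\<in>VV T V. snd i \<bullet> y = fst (fst i) \<bullet> fst y + \<kappa> * (volt' T (snd (fst i)) \<bullet> snd y))}"
  define l where "l i = \<zeta> \<bullet> volt' T (fst (fst i))" for i :: "((real \<times> 'b) lsq \<times> (real \<times> 'c) lsq) \<times> ((real \<times> 'b) lsq \<times> (real \<times> 'c) lsq)"
  note W = subspace_VV[OF V, of T]
  note lin = linear_volt'[OF T]
  have "\<exists>v. v \<in> closure (snd ` I) \<and> norm v \<le> \<bar>norm \<zeta> * P * ((1 + P) / \<kappa>)\<bar> \<and> (\<forall>i\<in>I. v \<bullet> snd i = l i)"
  proof (rule riesz_indexed)
    show "subspace I"
    proof (rule subspaceI)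
      have "(0, 0) \<in> I" unfolding I_def using subspace_0[OF W] by (simp add: linear_0[OF lin])
      then show "0 \<in> I" by (simp add: zero_prod_def)
      show "x + y \<in> I" if "x \<in> I" "y \<in> I" for x y using that unfolding I_def
        by (auto simp: subspace_add[OF W] inner_add_left linear_add[OF lin] distrib_left)
      show "c *\<^sub>R x \<in> I" if "x \<in> I" for c x using that unfolding I_def
        by (auto simp: subspace_scale[OF W] linear_scale[OF lin] distrib_left)
    qed
    show "l (i + j) = l i + l j" for i j unfolding l_def by (simp add: linear_add[OF lin] inner_add_right)
    show "l (c *\<^sub>R i) = c * l i" for i c unfolding l_def by (simp add: linear_scale[OF lin])
    show "\<bar>l i\<bar> \<le> norm \<zeta> * P * ((1 + P) / \<kappa>) * norm (snd i)" if i: "i \<in> I" for i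
    proof -
      obtain \<Theta> m where im: "i = (\<Theta>, m)" by (rule prod.exhaust)
      have \<Theta>: "\<Theta> \<in> VV T V" and meq: "\<And>y. y \<in> VV T V ==> m \<bullet> y = fst \<Theta> \<bullet> fst y + \<kappa> * (volt' T (snd \<Theta>) \<bullet> snd y)"
        using i unfolding I_def im by simp_all
      define \<Phi> where "\<Phi> = (volt' T (fst \<Theta>), volt' T (snd \<Theta>))"
      have \<Phi>: "\<Phi> \<in> VV T V" unfolding \<Phi>_def by (rule VV_volt'[OF V T \<Theta>])
      have p: "norm (fst \<Phi>) \<le> P * norm (snd \<Phi>)" by (rule VV_poincare[OF V P \<Phi>])
      have "\<kappa> * (norm (snd \<Phi>))\<^sup>2 \<le> m \<bullet> \<Phi>" using meq[OF \<Phi>] volt'_nonneg[of "fst \<Theta>"]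
        by (simp add: \<Phi>_def power2_norm_eq_inner inner_commute)
      also have "\<dots> \<le> norm m * norm \<Phi>" by (rule norm_cauchy_schwarz)
      also have "\<dots> \<le> norm m * ((1 + P) * norm (snd \<Phi>))"
      proof (rule mult_left_mono)
        have "norm \<Phi> \<le> norm (fst \<Phi>) + norm (snd \<Phi>)" by (metis norm_Pair_le prod.collapse)
        then show "norm \<Phi> \<le> (1 + P) * norm (snd \<Phi>)" using p by (simp add: algebra_simps)
      qed simp
      finally have "norm (snd \<Phi>) * (\<kappa> * norm (snd \<Phi>)) \<le> norm (snd \<Phi>) * ((1 + P) * norm m)"
        by (simp add: power2_eq_square algebra_simps)
      then have "\<kappa> * norm (snd \<Phi>) \<le> (1 + P) * norm m" using P(2) by (cases "norm (snd \<Phi>) = 0") auto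
      then have s: "norm (snd \<Phi>) \<le> (1 + P) / \<kappa> * norm m" using \<kappa> by (simp add: field_simps)
      have "\<bar>l i\<bar> \<le> norm \<zeta> * norm (fst \<Phi>)" unfolding l_def im \<Phi>_def by (simp add: Cauchy_Schwarz_ineq2)
      also have "\<dots> \<le> norm \<zeta> * (P * ((1 + P) / \<kappa> * norm m))"
        using p mult_left_mono[OF s P(2)] by (intro mult_left_mono) auto
      finally show ?thesis by (simp add: im mult.assoc)
    qed
  qed auto
  then obtain v where v: "v \<in> closure (snd ` I)" "\<And>i. i \<in> I ==> v \<bullet> snd i = l i" by blast
  have "snd ` I \<subseteq> VV T V" unfolding I_def by auto
  then have vV: "v \<in> VV T V" using v(1) closure_minimal[OF _ closed_VV[OF V]] by blast
  show ?thesis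
  proof (rule bexI[OF _ vV], rule ballI)
    fix \<Theta> assume \<Theta>: "\<Theta> \<in> VV T V"
    obtain m where m: "m \<in> VV T V" "\<And>y. y \<in> VV T V ==> m \<bullet> y = (fst \<Theta>, \<kappa> *\<^sub>R volt' T (snd \<Theta>)) \<bullet> y"
      using orthogonal_projection_exists[OF W closed_VV[OF V], of "(fst \<Theta>, \<kappa> *\<^sub>R volt' T (snd \<Theta>))"] by blast
    have "(\<Theta>, m) \<in> I" unfolding I_def using \<Theta> m by (auto simp: inner_prod_def)
    from v(2)[OF this] have "v \<bullet> m = \<zeta> \<bullet> volt' T (fst \<Theta>)" by (simp add: l_def)
    moreover have "v \<bullet> m = fst v \<bullet> fst \<Theta> + \<kappa> * (snd v \<bullet> volt' T (snd \<Theta>))"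
      using m(2)[OF vV] by (simp add: inner_prod_def inner_commute)
    ultimately show "fst v \<bullet> fst \<Theta> + \<kappa> * (volt T (snd v) \<bullet> snd \<Theta>) = volt T \<zeta> \<bullet> fst \<Theta>"
      by (simp add: volt_adjoint[OF T])
  qed
qed

lemma evolution_regularity:
  assumes X: "X \<in> VV T V" and h: "0 \<le> h"
    and eq: "\<And>\<Theta>. \<Theta> \<in> VV T V ==> fst X \<bullet> fst \<Theta> + \<kappa> * (volt T (snd X) \<bullet> snd \<Theta>) = volt T \<zeta> \<bullet> fst \<Theta>"
  shows "norm (fst X - shift T h (fst X)) \<le> norm \<zeta> * h"
proof (rule regularity_by_differences[where ?S1.0 = "shift T h" and ?S2.0 = "shift T h" and S1' = "shift T (- h)"
      and S2' = "shift T (- h)" and ?J1.0 = "volt T" and ?J2.0 = "volt T" and W = "VV T V" and \<kappa> = \<kappa>])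
  show "norm (volt T \<zeta> - shift T h (volt T \<zeta>)) \<le> norm \<zeta> * h"
    using norm_volt_diff_shift[OF T h, of \<zeta>] by (simp add: mult.commute)
qed (use \<kappa> X eq in \<open>auto simp: shift_volt_commute[OF T h] volt_nonneg[OF T] shift_adjoint linear_volt[OF T]
      intro: VV_shift[OF V] subspace_VV[OF V]\<close>)

lemma evolution_regularity_backward:
  assumes X: "X \<in> VV T V" and h: "0 \<le> h"
    and eq: "\<And>\<Theta>. \<Theta> \<in> VV T V ==> fst X \<bullet> fst \<Theta> + \<kappa> * (volt' T (snd X) \<bullet> snd \<Theta>) = volt' T \<zeta> \<bullet> fst \<Theta>"
  shows "norm (fst X - shift T (- h) (fst X)) \<le> norm \<zeta> * h"
proof (rule regularity_by_differences[where ?S1.0 = "shift T (- h)" and ?S2.0 = "shift T (- h)" and S1' = "shift T h"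
      and S2' = "shift T h" and ?J1.0 = "volt' T" and ?J2.0 = "volt' T" and W = "VV T V" and \<kappa> = \<kappa>])
  show "norm (volt' T \<zeta> - shift T (- h) (volt' T \<zeta>)) \<le> norm \<zeta> * h"
    using norm_volt'_diff_shift[OF h, of \<zeta>] by (simp add: mult.commute)
qed (use \<kappa> X eq in \<open>auto simp: shift_volt'_commute[OF h] volt'_nonneg shift_adjoint linear_volt'[OF T]
      intro: VV_shift[OF V] subspace_VV[OF V]\<close>)

text \<open>Here \<open>e\<close> stands for the initial value and \<open>r1\<close>,
  \<open>r2\<close> for the sources. Two tests are needed since \<open>snd X\<close> itself is not
  bounded by the data. Testing with the integrated solution bounds
  \<open>y = norm (volt T (snd X))\<close>. Testing with \<open>X\<close> leaves
  \<open>volt T r2 \<bullet> snd X\<close>, which is written as \<open>r2\<close> against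
  \<open>volt T (snd X) + volt' T (snd X)\<close> minus \<open>r2\<close> against
  \<open>volt T (snd X)\<close>. The last term is bounded through \<open>y\<close>; for the other,
  Young's inequality produces a square that \<open>volt_full\<close> turns into the nonnegative term
  \<open>q\<close> of the left-hand side.\<close>

lemma evolution_energy:
  assumes X: "X \<in> VV T V"
    and eq: "\<And>\<Theta>. \<Theta> \<in> VV T V ==> fst X \<bullet> fst \<Theta> + \<kappa> * (volt T (snd X) \<bullet> snd \<Theta>)
        = e \<bullet> fst \<Theta> + volt T r1 \<bullet> fst \<Theta> + volt T r2 \<bullet> snd \<Theta>"
  shows "norm (fst X) \<le> ((1 + T) + ((P + T * P + T) / \<kappa> + T / (2 * \<kappa>)) + 1) * (norm e + norm r1 + norm r2)"
proof -
  define N where "N = norm e + norm r1 + norm r2"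
  define y where "y = norm (volt T (snd X))"
  have N: "0 \<le> N" "norm e \<le> N" "norm r1 \<le> N" "norm r2 \<le> N" unfolding N_def by auto
  have JX: "(volt T (fst X), volt T (snd X)) \<in> VV T V" by (rule VV_volt[OF V T X])
  have pJ: "norm (volt T (fst X)) \<le> P * y" using VV_poincare[OF V P JX] by (simp add: y_def)
  have cs: "u \<bullet> v \<le> a * b" if "norm u \<le> a" "norm v \<le> b" for u v :: "'z::real_inner" and a b
  proof -
    have "0 \<le> a" using that(1) norm_ge_zero order_trans by blast
    then show ?thesis using norm_cauchy_schwarz[of u v] mult_mono[OF that] by fastforce
  qed
  have v1: "norm (volt T r1) \<le> T * N" using norm_volt[OF T, of r1] mult_left_mono[OF N(3), of T] T by linarith
  have v2: "norm (volt T r2) \<le> T * N" using norm_volt[OF T, of r2] mult_left_mono[OF N(4), of T] T by linarith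
  have "\<kappa> * (y * y) \<le> e \<bullet> volt T (fst X) + volt T r1 \<bullet> volt T (fst X) + volt T r2 \<bullet> volt T (snd X)"
    using eq[OF JX] volt_nonneg[OF T, of "fst X"] by (simp add: y_def norm_eq_sqrt_inner inner_commute)
  also have "\<dots> \<le> N * (P * y) + (T * N) * (P * y) + (T * N) * y"
    by (intro add_mono cs N pJ v1 v2) (simp add: y_def)
  also have "\<dots> = ((P + T * P + T) * N) * y" by (simp add: algebra_simps)
  finally have "y * (\<kappa> * y) \<le> y * ((P + T * P + T) * N)" by (simp add: algebra_simps)
  then have "\<kappa> * y \<le> (P + T * P + T) * N" using N P(2) T by (cases "y = 0") (auto simp: y_def)
  then have yb: "y \<le> (P + T * P + T) / \<kappa> * N" using \<kappa> by (simp add: field_simps)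
  define q where "q = volt T (snd X) \<bullet> snd X"
  define k where "k = norm (volt T (snd X) + volt' T (snd X))"
  have k2: "k\<^sup>2 = T * (2 * q)"
  proof -
    have "volt' T (snd X) \<bullet> snd X = q" unfolding q_def volt_adjoint[OF T] by (rule inner_commute)
    then show ?thesis unfolding k_def volt_full[OF T] by (simp add: inner_add_left q_def)
  qed
  have "volt T r2 \<bullet> snd X = r2 \<bullet> (volt T (snd X) + volt' T (snd X)) - r2 \<bullet> volt T (snd X)"
    by (simp add: volt_adjoint[OF T] inner_add_right)
  also have "\<dots> \<le> N * k + N * y"
    using cs[OF N(4), of "volt T (snd X) + volt' T (snd X)" k] cs[of "- r2" N "volt T (snd X)" y] N(4)
    by (simp add: k_def y_def)
  also have "N * k \<le> \<kappa> * q + T / (2 * \<kappa>) * N\<^sup>2"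
  proof -
    \<comment> \<open>The weights in Young's inequality are chosen so that
      \<open>\<kappa> * k^2 / (2 * T)\<close> equals \<open>\<kappa> * q\<close> exactly and cancels
      against the left-hand side.\<close>
    have "0 \<le> (\<kappa> * k - T * N)\<^sup>2 / (2 * \<kappa> * T)" using \<kappa> T by simp
    also have "\<dots> = \<kappa> * k\<^sup>2 / (2 * T) - N * k + T / (2 * \<kappa>) * N\<^sup>2"
      using \<kappa> T by (simp add: field_simps power2_eq_square)
    also have "\<kappa> * k\<^sup>2 / (2 * T) = \<kappa> * q" unfolding k2 using T by simp
    finally show ?thesis by simp
  qed
  finally have v3: "volt T r2 \<bullet> snd X \<le> \<kappa> * q + T / (2 * \<kappa>) * N\<^sup>2 + N * y" by simp
  have "(norm (fst X))\<^sup>2 + \<kappa> * q = e \<bullet> fst X + volt T r1 \<bullet> fst X + volt T r2 \<bullet> snd X"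
    using eq[OF X] by (simp add: q_def power2_norm_eq_inner)
  also have "\<dots> \<le> N * norm (fst X) + (T * N) * norm (fst X) + (\<kappa> * q + T / (2 * \<kappa>) * N\<^sup>2 + N * y)"
    by (intro add_mono cs N v1 v3) auto
  also have "N * y \<le> N * ((P + T * P + T) / \<kappa> * N)" by (intro mult_left_mono yb N)
  finally have "(norm (fst X))\<^sup>2 \<le> (1 + T) * N * norm (fst X) + ((P + T * P + T) / \<kappa> + T / (2 * \<kappa>)) * N\<^sup>2"
    by (simp add: algebra_simps power2_eq_square)
  then show ?thesis unfolding N_def[symmetric] by (rule real_quadratic_bound) (use N T P(2) \<kappa> in auto)
qed

text \<open>The equations are only available in time integrated form, so they are tested with
  difference quotients of each other's solution, and the step is sent to zero.\<close>
lemma evolution_duality: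
  assumes X: "X \<in> VV T V" and Y: "Y \<in> VV T V"
    and eqX: "\<And>\<Theta>. \<Theta> \<in> VV T V ==> fst X \<bullet> fst \<Theta> + \<kappa> * (volt T (snd X) \<bullet> snd \<Theta>) = volt T \<zeta> \<bullet> fst \<Theta>"
    and eqY: "\<And>\<Theta>. \<Theta> \<in> VV T V ==> fst Y \<bullet> fst \<Theta> + \<kappa> * (volt' T (snd Y) \<bullet> snd \<Theta>) = volt' T F \<bullet> fst \<Theta>"
  shows "F \<bullet> fst X = \<zeta> \<bullet> fst Y"
proof -
  have key: "\<bar>F \<bullet> fst X - \<zeta> \<bullet> fst Y\<bar> \<le> h * (2 * (norm \<zeta> * norm F))" if h: "0 < h" for h
  proof -
    have D: "X - (shift T h (fst X), shift T h (snd X)) \<in> VV T V"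
      "Y - (shift T (- h) (fst Y), shift T (- h) (snd Y)) \<in> VV T V"
      using X Y VV_shift[OF V] subspace_VV[OF V] by (auto intro: subspace_diff)
    have s: "x \<bullet> (y - shift T (- h) y) = (x - shift T h x) \<bullet> y" for x y :: "(real \<times> 'd::euclidean_space) lsq"
      by (simp add: inner_diff_left inner_diff_right shift_adjoint)
    have vs: "volt T x - shift T h (volt T x) = volt T (x - shift T h x)" for x :: "(real \<times> 'd::euclidean_space) lsq"
      using h by (simp add: shift_volt_commute[OF T] linear_diff[OF linear_volt[OF T]])
    \<comment> \<open>The left-hand sides of the two tested equations coincide, so the right-hand
      sides agree. Each of these is an average over shifts and differs from \<open>h\<close> times
      its expected limit by a term of order \<open>h^2\<close>.\<close>
    have 1: "(fst X - shift T h (fst X)) \<bullet> fst Y + \<kappa> * ((snd X - shift T h (snd X)) \<bullet> volt' T (snd Y))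
        = (volt T \<zeta> - shift T h (volt T \<zeta>)) \<bullet> fst Y"
      using eqX[OF D(2)] by (simp add: s) (simp add: vs volt_adjoint[OF T])
    have 2: "fst Y \<bullet> (fst X - shift T h (fst X)) + \<kappa> * (volt' T (snd Y) \<bullet> (snd X - shift T h (snd X)))
        = F \<bullet> (volt T (fst X) - shift T h (volt T (fst X)))"
    proof -
      have "volt' T F \<bullet> z = F \<bullet> volt T z" for z using volt_adjoint[OF T, of z F] by (simp add: inner_commute)
      then show ?thesis using eqY[OF D(1)] by (simp add: vs)
    qed
    have cX: "norm (fst X - shift T \<sigma> (fst X)) \<le> norm \<zeta> * h" if "0 < \<sigma>" "\<sigma> \<le> h" for \<sigma>
      using evolution_regularity[OF X _ eqX, of \<sigma>] that mult_left_mono[OF that(2), of "norm \<zeta>"] by simp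
    have cY: "norm (fst Y - shift T (- \<sigma>) (fst Y)) \<le> norm F * h" if "0 < \<sigma>" "\<sigma> \<le> h" for \<sigma>
      using evolution_regularity_backward[OF Y _ eqY, of \<sigma>] that mult_left_mono[OF that(2), of "norm F"] by simp
    have a: "\<bar>(volt T (fst X) - shift T h (volt T (fst X))) \<bullet> F - h * (fst X \<bullet> F)\<bar> \<le> h * (h * (norm \<zeta> * norm F))"
    proof (rule volt_average[OF T h])
      fix \<sigma> assume \<sigma>: "0 < \<sigma>" "\<sigma> \<le> h"
      have "\<bar>shift T \<sigma> (fst X) \<bullet> F - fst X \<bullet> F\<bar> = \<bar>(fst X - shift T \<sigma> (fst X)) \<bullet> F\<bar>"
        by (simp add: inner_diff_left abs_minus_commute)
      also have "\<dots> \<le> norm (fst X - shift T \<sigma> (fst X)) * norm F" by (rule Cauchy_Schwarz_ineq2)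
      also have "\<dots> \<le> (norm \<zeta> * h) * norm F" by (intro mult_right_mono cX \<sigma>) simp
      finally show "\<bar>shift T \<sigma> (fst X) \<bullet> F - fst X \<bullet> F\<bar> \<le> h * (norm \<zeta> * norm F)" by (simp add: algebra_simps)
    qed
    \<comment> \<open>Nothing is known about the regularity of \<open>\<zeta>\<close> in time; the
      shift is moved to \<open>fst Y\<close>, which is Lipschitz by the backward estimate.\<close>
    have b: "\<bar>(volt T \<zeta> - shift T h (volt T \<zeta>)) \<bullet> fst Y - h * (\<zeta> \<bullet> fst Y)\<bar> \<le> h * (h * (norm \<zeta> * norm F))"
    proof (rule volt_average[OF T h])
      fix \<sigma> assume \<sigma>: "0 < \<sigma>" "\<sigma> \<le> h"
      have "\<bar>shift T \<sigma> \<zeta> \<bullet> fst Y - \<zeta> \<bullet> fst Y\<bar> = \<bar>\<zeta> \<bullet> (fst Y - shift T (- \<sigma>) (fst Y))\<bar>"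
        by (simp add: inner_diff_right shift_adjoint abs_minus_commute)
      also have "\<dots> \<le> norm \<zeta> * norm (fst Y - shift T (- \<sigma>) (fst Y))" by (rule Cauchy_Schwarz_ineq2)
      also have "\<dots> \<le> norm \<zeta> * (norm F * h)" by (intro mult_left_mono cY \<sigma>) simp
      finally show "\<bar>shift T \<sigma> \<zeta> \<bullet> fst Y - \<zeta> \<bullet> fst Y\<bar> \<le> h * (norm \<zeta> * norm F)" by (simp add: algebra_simps)
    qed
    have "(volt T (fst X) - shift T h (volt T (fst X))) \<bullet> F = (volt T \<zeta> - shift T h (volt T \<zeta>)) \<bullet> fst Y"
      using 1 2 by (simp add: inner_commute)
    then have "\<bar>h * (fst X \<bullet> F) - h * (\<zeta> \<bullet> fst Y)\<bar> \<le> h * (h * (2 * (norm \<zeta> * norm F)))"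
      using a b by (simp add: abs_le_iff)
    then have "h * \<bar>fst X \<bullet> F - \<zeta> \<bullet> fst Y\<bar> \<le> h * (h * (2 * (norm \<zeta> * norm F)))"
      using h by (simp add: right_diff_distrib[symmetric] abs_mult)
    then show ?thesis using h by (simp add: inner_commute)
  qed
  define M where "M = 2 * (norm \<zeta> * norm F)"
  have M: "0 \<le> M" unfolding M_def by simp
  show ?thesis
  proof (rule ccontr)
    assume "F \<bullet> fst X \<noteq> \<zeta> \<bullet> fst Y"
    then have d: "0 < \<bar>F \<bullet> fst X - \<zeta> \<bullet> fst Y\<bar>" by simp
    have "\<bar>F \<bullet> fst X - \<zeta> \<bullet> fst Y\<bar> \<le> \<bar>F \<bullet> fst X - \<zeta> \<bullet> fst Y\<bar> / (M + 1) * M"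
      using key[of "\<bar>F \<bullet> fst X - \<zeta> \<bullet> fst Y\<bar> / (M + 1)"] d M unfolding M_def[symmetric]
      by (simp add: divide_pos_pos)
    then have "\<bar>F \<bullet> fst X - \<zeta> \<bullet> fst Y\<bar> * (M + 1) \<le> \<bar>F \<bullet> fst X - \<zeta> \<bullet> fst Y\<bar> * M"
      using M by (simp add: field_simps)
    then show False using d by (simp add: algebra_simps)
  qed
qed

end

end

section \<open>Smooth functions and test functions\<close>

lemma smooth_differentiable: "smooth f ==> f differentiable (at x)"
  by (erule smooth.cases) simp

lemma smooth_partial: "smooth f ==> i \<in> Basis ==> smooth (\<lambda>x. frechet_derivative f (at x) i)"
  by (erule smooth.cases) simp

lemma smooth_continuous: "smooth f ==> continuous_on S f"
  by (meson continuous_at_imp_continuous_on differentiable_imp_continuous_within smooth_differentiable)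

lemma frechet_derivative_eqI: "(f has_derivative f') (at x) ==> frechet_derivative f (at x) = f'"
  by (rule frechet_derivative_at[symmetric])

lemma smooth_add:
  assumes "smooth f" "smooth g"
  shows "smooth (\<lambda>x. f x + g x)"
proof -
  define X where "X h \<longleftrightarrow> (\<exists>f g. smooth f \<and> smooth g \<and> h = (\<lambda>x. f x + g x))" for h :: "'a \<Rightarrow> real"
  have "X (\<lambda>x. f x + g x)" unfolding X_def using assms by blast
  then show ?thesis
  proof (rule smooth.coinduct[of X])
    fix h assume "X h"
    then obtain f g where fg: "smooth f" "smooth g" "h = (\<lambda>x. f x + g x)" unfolding X_def by blast
    have "(h has_derivative (\<lambda>v. frechet_derivative f (at x) v + frechet_derivative g (at x) v)) (at x)" for x
      unfolding fg(3) using smooth_differentiable[OF fg(1)] smooth_differentiable[OF fg(2)]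
      by (intro has_derivative_add) (auto simp: frechet_derivative_works)
    note d = this
    have "X (\<lambda>x. frechet_derivative h (at x) i)" if "i \<in> Basis" for i
      unfolding X_def frechet_derivative_eqI[OF d]
      using smooth_partial[OF fg(1) that] smooth_partial[OF fg(2) that] by blast
    then show "\<exists>f. h = f \<and> (\<forall>x. f differentiable (at x)) \<and>
        (\<forall>i\<in>Basis. X (\<lambda>x. frechet_derivative f (at x) i) \<or> smooth (\<lambda>x. frechet_derivative f (at x) i))"
      using d by (auto simp: differentiable_def)
  qed
qed

lemma smooth_scale:
  assumes "smooth f"
  shows "smooth (\<lambda>x. c * f x)"
proof -
  define X where "X h \<longleftrightarrow> (\<exists>f. smooth f \<and> h = (\<lambda>x. c * f x))" for h :: "'a \<Rightarrow> real"
  have "X (\<lambda>x. c * f x)" unfolding X_def using assms by blast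
  then show ?thesis
  proof (rule smooth.coinduct[of X])
    fix h assume "X h"
    then obtain f where f: "smooth f" "h = (\<lambda>x. c * f x)" unfolding X_def by blast
    have "(h has_derivative (\<lambda>v. c * frechet_derivative f (at x) v)) (at x)" for x
      unfolding f(2) using smooth_differentiable[OF f(1)]
      by (intro has_derivative_mult_right) (auto simp: frechet_derivative_works)
    note d = this
    have "X (\<lambda>x. frechet_derivative h (at x) i)" if "i \<in> Basis" for i
      unfolding X_def frechet_derivative_eqI[OF d] using smooth_partial[OF f(1) that] by blast
    then show "\<exists>f. h = f \<and> (\<forall>x. f differentiable (at x)) \<and>
        (\<forall>i\<in>Basis. X (\<lambda>x. frechet_derivative f (at x) i) \<or> smooth (\<lambda>x. frechet_derivative f (at x) i))"
      using d by (auto simp: differentiable_def)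
  qed
qed

lemma test_fn_add:
  assumes "test_fn U f" "test_fn U g"
  shows "test_fn U (\<lambda>x. f x + g x)"
proof -
  have "closure {x. f x + g x \<noteq> 0} \<subseteq> closure {x. f x \<noteq> 0} \<union> closure {x. g x \<noteq> 0}"
    unfolding closure_Un[symmetric] by (rule closure_mono) auto
  moreover have "bounded (closure {x. f x \<noteq> 0} \<union> closure {x. g x \<noteq> 0})"
    using assms by (auto simp: test_fn_def compact_imp_bounded)
  ultimately have "bounded (closure {x. f x + g x \<noteq> 0})" "closure {x. f x + g x \<noteq> 0} \<subseteq> U"
    using assms bounded_subset by (blast, auto simp: test_fn_def)
  then show ?thesis using assms unfolding test_fn_def by (auto intro: smooth_add simp: compact_eq_bounded_closed)
qed

lemma test_fn_scale:
  assumes "test_fn U f"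
  shows "test_fn U (\<lambda>x. c * f x)"
proof -
  have "closure {x. c * f x \<noteq> 0} \<subseteq> closure {x. f x \<noteq> 0}" by (rule closure_mono) auto
  then show ?thesis using assms unfolding test_fn_def
    by (auto intro: smooth_scale simp: compact_eq_bounded_closed intro: bounded_subset)
qed

lemma test_fn_outside:
  assumes "test_fn U f" "x \<notin> U"
  shows "f x = 0"
  using assms closure_subset[of "{x. f x \<noteq> 0}"] unfolding test_fn_def by auto

lemma test_fn_borel: "test_fn U f ==> f \<in> borel_measurable borel"
  unfolding test_fn_def by (intro borel_measurable_continuous_onI smooth_continuous) simp

lemma continuous_compact_support_bounded:
  fixes f :: "'a::euclidean_space \<Rightarrow> real"
  assumes "continuous_on UNIV f" "compact (closure {x. f x \<noteq> 0})"
  shows "\<exists>B\<ge>0. \<forall>x. \<bar>f x\<bar> \<le> B"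
proof -
  have "compact (f ` closure {x. f x \<noteq> 0})"
    using assms by (intro compact_continuous_image continuous_on_subset[OF assms(1)]) auto
  then have "bounded (f ` closure {x. f x \<noteq> 0})" by (rule compact_imp_bounded)
  then obtain B where B: "\<And>x. x \<in> closure {x. f x \<noteq> 0} ==> \<bar>f x\<bar> \<le> B" unfolding bounded_iff by auto
  show ?thesis
  proof (intro exI[of _ "max B 0"] conjI allI)
    fix x
    show "\<bar>f x\<bar> \<le> max B 0" using B[of x] closure_subset[of "{x. f x \<noteq> 0}"] by (cases "f x = 0") force+
  qed simp
qed

lemma test_fn_bounded: "test_fn U f ==> \<exists>B\<ge>0. \<forall>x. \<bar>f x\<bar> \<le> B"
  unfolding test_fn_def by (intro continuous_compact_support_bounded smooth_continuous) auto

lemma bounded_compact_support_sqi: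
  fixes f :: "'a::euclidean_space \<Rightarrow> real"
  assumes [measurable]: "f \<in> borel_measurable borel" and B: "\<And>x. \<bar>f x\<bar> \<le> B" and S: "bounded {x. f x \<noteq> 0}"
  shows "sqi f"
proof (rule sqi_borelI)
  obtain r where r: "{x. f x \<noteq> 0} \<subseteq> cball 0 r" using S bounded_subset_ballD[of _ 0] ball_subset_cball by (meson subset_trans)
  have le: "ennreal ((f x)\<^sup>2) \<le> ennreal (B\<^sup>2) * indicator (cball 0 r) x" for x
  proof (cases "f x = 0")
    case False
    have "(f x)\<^sup>2 \<le> B\<^sup>2" using power_mono[OF B[of x], of 2] by simp
    then show ?thesis using False r by (auto intro: ennreal_leI)
  qed simp
  have "(\<integral>\<^sup>+x. ennreal ((f x)\<^sup>2) \<partial>lborel) \<le> (\<integral>\<^sup>+x. ennreal (B\<^sup>2) * indicator (cball (0::'a) r) x \<partial>lborel)"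
    using le by (intro nn_integral_mono) simp
  also have "\<dots> < \<infinity>"
    using emeasure_bounded_finite[of "cball 0 r :: 'a set"] by (simp add: nn_integral_cmult_indicator ennreal_mult_less_top)
  finally show "(\<integral>\<^sup>+x. ennreal ((f x)\<^sup>2) \<partial>lborel) < \<infinity>" .
qed measurable

lemma test_fn_support_bounded: "test_fn U f ==> bounded {x. f x \<noteq> 0}"
  unfolding test_fn_def by (auto intro: bounded_subset[OF _ closure_subset] compact_imp_bounded)

lemma test_fn_sqi: "test_fn U f ==> sqi f"
  using bounded_compact_support_sqi[OF test_fn_borel _ test_fn_support_bounded] test_fn_bounded[of U f] by auto

lemma smooth_real_deriv:
  fixes \<psi> :: "real \<Rightarrow> real"
  assumes "smooth \<psi>"
  shows "(\<psi> has_real_derivative deriv \<psi> t) (at t)" "smooth (deriv \<psi>)"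
proof -
  have d: "\<psi> differentiable (at t)" for t by (rule smooth_differentiable[OF assms])
  then show D: "(\<psi> has_real_derivative deriv \<psi> t) (at t)" for t
    using DERIV_deriv_iff_real_differentiable by blast
  have "frechet_derivative \<psi> (at t) 1 = deriv \<psi> t" for t
    using frechet_derivative_eqI[OF D[of t, unfolded has_field_derivative_def]] by simp
  then show "smooth (deriv \<psi>)" using smooth_partial[OF assms, of 1] by simp
qed

lemma test_fn_deriv:
  fixes \<psi> :: "real \<Rightarrow> real"
  assumes "test_fn U \<psi>"
  shows "test_fn U (deriv \<psi>)"
proof -
  have "deriv \<psi> x = 0" if "x \<notin> closure {x. \<psi> x \<noteq> 0}" for x
  proof (rule DERIV_imp_deriv, rule has_field_derivative_transform_within_open)
    show "((\<lambda>x. 0) has_real_derivative 0) (at x)" by simp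
    show "open (- closure {x. \<psi> x \<noteq> 0})" by (intro open_Compl closed_closure)
    show "x \<in> - closure {x. \<psi> x \<noteq> 0}" using that by simp
    show "0 = \<psi> y" if "y \<in> - closure {x. \<psi> x \<noteq> 0}" for y using that closure_subset[of "{x. \<psi> x \<noteq> 0}"] by auto
  qed
  then have "{x. deriv \<psi> x \<noteq> 0} \<subseteq> closure {x. \<psi> x \<noteq> 0}" by blast
  then have sub: "closure {x. deriv \<psi> x \<noteq> 0} \<subseteq> closure {x. \<psi> x \<noteq> 0}" by (rule closure_minimal) simp
  have "compact (closure {x. deriv \<psi> x \<noteq> 0})"
    using assms sub unfolding test_fn_def compact_eq_bounded_closed by (auto intro: bounded_subset)
  then show ?thesis using sub assms smooth_real_deriv(2) unfolding test_fn_def by auto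
qed

text \<open>The functions \<open>y\<^sup>-\<^sup>k exp (- 1 / y)\<close>, extended by zero, are closed under differentiation up to
  linear combinations; polynomials in them with affine arguments are therefore smooth.\<close>
definition flat :: "nat \<Rightarrow> real \<Rightarrow> real" where
  "flat k y = (if 0 < y then exp (- 1 / y) / y ^ k else 0)"

text \<open>The term of order \<open>k + 2\<close> in the exponential series of \<open>1 / y\<close>
  beats the negative power of order \<open>k\<close> with a factor \<open>y^2\<close> to spare. The
  quadratic bound makes the derivative at the origin \<open>0\<close>.\<close>

lemma flat_le_square: "\<bar>flat k y\<bar> \<le> fact (k + 2) * y\<^sup>2"
proof (cases "0 < y")
  case True
  define m where "m = k + 2"
  have "(1 / y) ^ m / fact m \<le> exp (1 / y)"
  proof -
    obtain t where t: "exp (1 / y) = (\<Sum>i<Suc m. (1 / y) ^ i / fact i) + exp t / fact (Suc m) * (1 / y) ^ Suc m"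
      using Maclaurin_exp_le[of "1 / y" "Suc m"] by blast
    have "(1 / y) ^ m / fact m \<le> (\<Sum>i<Suc m. (1 / y) ^ i / fact i)" by (rule member_le_sum) (use True in auto)
    moreover have "0 \<le> exp t / fact (Suc m) * (1 / y) ^ Suc m" using True by simp
    ultimately show ?thesis unfolding t by linarith
  qed
  moreover have "(1 / y) ^ m / fact m = 1 / (fact m * y ^ m)" by (simp add: power_one_over field_simps)
  moreover have "0 < fact m * y ^ m" using True by simp
  ultimately have "1 \<le> exp (1 / y) * (fact m * y ^ m)" by (simp add: divide_le_eq)
  then have "exp (- 1 / y) * 1 \<le> exp (- 1 / y) * (exp (1 / y) * (fact m * y ^ m))" by (intro mult_left_mono) auto
  also have "\<dots> = fact m * y ^ m" by (simp add: mult.assoc[symmetric] exp_add[symmetric])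
  also have "\<dots> = (fact (k + 2) * y\<^sup>2) * y ^ k" unfolding m_def by (simp only: power_add mult.assoc mult.commute[of "y ^ k"])
  finally have "exp (- 1 / y) \<le> (fact (k + 2) * y\<^sup>2) * y ^ k" by simp
  then show ?thesis using True unfolding flat_def by (simp add: divide_le_eq del: fact_Suc)
qed (auto simp: flat_def)

lemma flat_deriv: "(flat k has_real_derivative flat (k + 2) y - real k * flat (k + 1) y) (at y)"
proof (cases "y = 0")
  case False
  show ?thesis
  proof (cases "0 < y")
    case True
    have D: "((\<lambda>y. exp (- 1 / y) / y ^ k) has_real_derivative
        exp (- 1 / y) / y ^ (k + 2) - real k * (exp (- 1 / y) / y ^ (k + 1))) (at y)"
    proof -
      have "((\<lambda>y. exp (- 1 / y) / y ^ k) has_real_derivative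
          ((1 / y\<^sup>2) * exp (- 1 / y) * y ^ k - exp (- 1 / y) * (real k * y ^ (k - 1))) / (y ^ k * y ^ k)) (at y)"
        using True by (auto intro!: derivative_eq_intros simp: power2_eq_square)
      moreover have "((1 / y\<^sup>2) * exp (- 1 / y) * y ^ k - exp (- 1 / y) * (real k * y ^ (k - 1))) / (y ^ k * y ^ k)
          = exp (- 1 / y) / y ^ (k + 2) - real k * (exp (- 1 / y) / y ^ (k + 1))"
        using True by (cases k) (auto simp: field_simps power2_eq_square)
      ultimately show ?thesis by simp
    qed
    have "(flat k has_real_derivative
        exp (- 1 / y) / y ^ (k + 2) - real k * (exp (- 1 / y) / y ^ (k + 1))) (at y)"
    proof (rule has_field_derivative_transform_within_open[OF D])
      show "open {0::real<..}" by (rule open_greaterThan)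
    qed (use True in \<open>simp_all add: flat_def\<close>)
    then show ?thesis using True by (simp add: flat_def)
  next
    case neg: False
    show ?thesis
    proof (rule has_field_derivative_transform_within_open[where f = "\<lambda>_. 0"])
      show "open {..<0::real}" by (rule open_lessThan)
      show "((\<lambda>_. 0) has_real_derivative flat (k + 2) y - real k * flat (k + 1) y) (at y)"
        using neg by (simp add: flat_def)
    qed (use neg False in \<open>simp_all add: flat_def\<close>)
  qed
next
  case True
  have "((\<lambda>h. (flat k (0 + h) - flat k 0) / h) \<longlongrightarrow> 0) (at 0)"
  proof (rule Lim_null_comparison)
    show "((\<lambda>h. fact (k + 2) * \<bar>h\<bar>) \<longlongrightarrow> 0) (at (0::real))" by (auto intro!: tendsto_eq_intros)
    show "\<forall>\<^sub>F h in at 0. norm ((flat k (0 + h) - flat k 0) / h) \<le> fact (k + 2) * \<bar>h\<bar>"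
      unfolding eventually_at_filter
    proof (intro always_eventually allI impI)
      fix h :: real assume "h \<noteq> 0"
      then show "norm ((flat k (0 + h) - flat k 0) / h) \<le> fact (k + 2) * \<bar>h\<bar>"
        using flat_le_square[of k h] by (simp add: flat_def[of k 0] abs_divide divide_le_eq power2_eq_square mult.assoc abs_mult_self_eq)
    qed
  qed
  then have "(flat k has_real_derivative 0) (at 0)" by (simp add: DERIV_def)
  then show ?thesis using True by (simp add: flat_def)
qed

inductive flat_poly :: "('a::euclidean_space \<Rightarrow> real) \<Rightarrow> bool" where
  const: "flat_poly (\<lambda>_. c)"
| flat: "flat_poly (\<lambda>x. flat k (x \<bullet> v + c))"
| add: "flat_poly f ==> flat_poly g ==> flat_poly (\<lambda>x. f x + g x)"
| mult: "flat_poly f ==> flat_poly g ==> flat_poly (\<lambda>x. f x * g x)"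

lemma flat_poly_derivative:
  "flat_poly f ==> \<exists>f'. (\<forall>x. (f has_derivative f' x) (at x)) \<and> (\<forall>v. flat_poly (\<lambda>x. f' x v))"
proof (induction rule: flat_poly.induct)
  case (const c)
  show ?case by (rule exI[of _ "\<lambda>_ _. 0"]) (auto intro: flat_poly.const)
next
  case (flat k w c)
  show ?case
  proof (intro exI conjI allI)
    fix x
    show "((\<lambda>x. flat k (x \<bullet> w + c)) has_derivative
        (\<lambda>v. (v \<bullet> w) * (flat (k + 2) (x \<bullet> w + c) + (- real k) * flat (k + 1) (x \<bullet> w + c)))) (at x)"
    proof -
      have "((\<lambda>x. x \<bullet> w + c) has_derivative (\<lambda>v. v \<bullet> w)) (at x)" by (auto intro!: derivative_eq_intros)
      from has_derivative_compose[OF this flat_deriv[unfolded has_field_derivative_def, of k "x \<bullet> w + c"]]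
      show ?thesis by (simp add: algebra_simps)
    qed
  next
    fix v
    show "flat_poly (\<lambda>x. (v \<bullet> w) * (flat (k + 2) (x \<bullet> w + c) + (- real k) * flat (k + 1) (x \<bullet> w + c)))"
      by (intro flat_poly.mult flat_poly.add flat_poly.const flat_poly.flat)
  qed
next
  case (add f g)
  then obtain f' g' where "\<forall>x. (f has_derivative f' x) (at x)" "\<forall>v. flat_poly (\<lambda>x. f' x v)"
    "\<forall>x. (g has_derivative g' x) (at x)" "\<forall>v. flat_poly (\<lambda>x. g' x v)" by blast
  then show ?case by (intro exI[of _ "\<lambda>x v. f' x v + g' x v"]) (auto intro: has_derivative_add flat_poly.add)
next
  case (mult f g)
  then obtain f' g' where "\<forall>x. (f has_derivative f' x) (at x)" "\<forall>v. flat_poly (\<lambda>x. f' x v)"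
    "\<forall>x. (g has_derivative g' x) (at x)" "\<forall>v. flat_poly (\<lambda>x. g' x v)" by blast
  then show ?case using mult.hyps by (intro exI[of _ "\<lambda>x v. f x * g' x v + f' x v * g x"])
      (auto intro!: has_derivative_mult flat_poly.add flat_poly.mult)
qed

lemma flat_poly_smooth:
  assumes "flat_poly f"
  shows "smooth f"
  using assms
proof (rule smooth.coinduct[of flat_poly])
  fix f :: "'a \<Rightarrow> real" assume "flat_poly f"
  then obtain f' where f': "\<And>x. (f has_derivative f' x) (at x)" "\<And>v. flat_poly (\<lambda>x. f' x v)"
    using flat_poly_derivative by blast
  have "flat_poly (\<lambda>x. frechet_derivative f (at x) i)" for i
    unfolding frechet_derivative_eqI[OF f'(1)] by (rule f'(2))
  then show "\<exists>g. f = g \<and> (\<forall>x. g differentiable (at x)) \<and>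
      (\<forall>i\<in>Basis. flat_poly (\<lambda>x. frechet_derivative g (at x) i) \<or> smooth (\<lambda>x. frechet_derivative g (at x) i))"
    using f'(1) by (auto simp: differentiable_def)
qed

lemma flat_poly_prod: "finite A ==> (\<And>i. i \<in> A ==> flat_poly (f i)) ==> flat_poly (\<lambda>x. \<Prod>i\<in>A. f i x)"
  by (induction A rule: finite_induct) (auto intro: flat_poly.const flat_poly.mult)

section \<open>Bumps supported in boxes\<close>

definition bump :: "'a::euclidean_space \<Rightarrow> 'a \<Rightarrow> nat \<Rightarrow> 'a \<Rightarrow> real" where
  "bump a b k x = (\<Prod>i\<in>Basis. flat 0 (real (Suc k) * (x \<bullet> i - a \<bullet> i)) * flat 0 (real (Suc k) * (b \<bullet> i - x \<bullet> i)))"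

lemma flat_poly_bump: "flat_poly (bump a b k)"
proof -
  have "flat_poly (\<lambda>x. flat 0 (real (Suc k) * (x \<bullet> i - a \<bullet> i)) * flat 0 (real (Suc k) * (b \<bullet> i - x \<bullet> i)))" for i
    using flat_poly.mult[OF flat_poly.flat[of 0 "real (Suc k) *\<^sub>R i" "- real (Suc k) * (a \<bullet> i)"]
        flat_poly.flat[of 0 "- real (Suc k) *\<^sub>R i" "real (Suc k) * (b \<bullet> i)"]]
    by (simp add: algebra_simps)
  then show ?thesis unfolding bump_def[abs_def] by (intro flat_poly_prod) auto
qed

lemma flat0_range: "0 \<le> flat 0 y" "flat 0 y \<le> 1"
  by (auto simp: flat_def)

lemma bump_range: "0 \<le> bump a b k x" "bump a b k x \<le> 1"
  unfolding bump_def by (auto intro!: prod_nonneg prod_le_1 mult_nonneg_nonneg mult_le_one flat0_range)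

lemma bump_outside: "x \<notin> box a b ==> bump a b k x = 0"
proof -
  assume "x \<notin> box a b"
  then obtain i where i: "i \<in> Basis" "x \<bullet> i \<le> a \<bullet> i \<or> b \<bullet> i \<le> x \<bullet> i" by (auto simp: mem_box not_less)
  then have "flat 0 (real (Suc k) * (x \<bullet> i - a \<bullet> i)) * flat 0 (real (Suc k) * (b \<bullet> i - x \<bullet> i)) = 0"
    by (auto simp: flat_def zero_less_mult_iff)
  then show ?thesis unfolding bump_def using i(1) by (intro prod_zero) auto
qed

lemma bump_test_fn:
  assumes "cbox a b \<subseteq> U"
  shows "test_fn U (bump a b k)"
proof -
  have "{x. bump a b k x \<noteq> 0} \<subseteq> cbox a b" using bump_outside[of _ a b k] box_subset_cbox[of a b] by blast
  then have "closure {x. bump a b k x \<noteq> 0} \<subseteq> cbox a b" by (rule closure_minimal) (rule closed_cbox)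
  then show ?thesis using assms flat_poly_smooth[OF flat_poly_bump[of a b k]] bounded_subset[OF bounded_cbox]
    unfolding test_fn_def compact_eq_bounded_closed by auto
qed

text \<open>For \<open>y > 0\<close> the value of \<open>flat 0\<close> at \<open>Suc k * y\<close>
  is \<open>exp (- 1 / (Suc k * y))\<close> and tends to \<open>1\<close>: dilating the argument
  fills each half line without moving its end point. The limit is the indicator of the open box,
  which also dominates the bumps.\<close>

lemma bump_tendsto: "(\<lambda>k. bump a b k x) \<longlonglongrightarrow> indicator (box a b) x"
proof (cases "x \<in> box a b")
  case True
  have l: "(\<lambda>k. flat 0 (real (Suc k) * y)) \<longlonglongrightarrow> 1" if "0 < y" for y
  proof -
    have "(\<lambda>k. exp (- (inverse (real (Suc k)) * (1 / y)))) \<longlonglongrightarrow> exp (- (0 * (1 / y)))"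
      by (intro tendsto_intros LIMSEQ_inverse_real_of_nat)
    moreover have "flat 0 (real (Suc k) * y) = exp (- (inverse (real (Suc k)) * (1 / y)))" for k
      using that by (simp add: flat_def inverse_eq_divide zero_less_mult_iff)
    ultimately show ?thesis by simp
  qed
  have "(\<lambda>k. bump a b k x) \<longlonglongrightarrow> (\<Prod>i\<in>(Basis :: 'a set). 1 * 1)"
    unfolding bump_def using True by (intro tendsto_prod tendsto_mult l) (auto simp: mem_box)
  then show ?thesis using True by simp
qed (simp add: bump_outside)

lemma bump_borel [measurable]: "bump a b k \<in> borel_measurable borel"
  by (intro borel_measurable_continuous_onI smooth_continuous flat_poly_smooth flat_poly_bump)

lemma bump_sqi: "sqi (bump a b k)"
  using test_fn_sqi[OF bump_test_fn[of a b UNIV]] by simp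

text \<open>The antiderivative of a difference of two bumps is the test function of the
  du Bois-Reymond argument.\<close>
lemma bump_difference_antiderivative:
  fixes c d h :: real and k :: nat
  assumes cd: "c < d" and h: "0 < h"
  defines "\<psi> \<equiv> (\<lambda>t. LINT \<sigma>|lborel. indicator {t - h<..<t} \<sigma> * bump c d k \<sigma>)"
  shows "\<And>t. (\<psi> has_real_derivative bump c d k t - bump c d k (t - h)) (at t)"
    and "{c..d + h} \<subseteq> U ==> test_fn U \<psi>"
proof -
  let ?\<rho> = "bump c d k"
  have cont: "continuous_on S ?\<rho>" for S by (intro smooth_continuous flat_poly_smooth flat_poly_bump)
  have out: "?\<rho> x = 0" if "x \<le> c \<or> d \<le> x" for x using bump_outside[of x c d k] that by (auto simp: box_real)
  \<comment> \<open>The lower limit \<open>c - 1\<close> lies to the left of the support, so every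
    \<open>t \<ge> c\<close> is interior to the interval to which the fundamental theorem is
    applied.\<close>
  define R where "R t = integral {c - 1..t} ?\<rho>" for t
  have R0: "R t = 0" if "t \<le> c" for t
    unfolding R_def using that out by (subst Henstock_Kurzweil_Integration.integral_cong[of _ _ "\<lambda>_. 0"]) auto
  have dR: "(R has_real_derivative ?\<rho> t) (at t)" for t
  proof (cases "t < c")
    case True
    show ?thesis
    proof (rule has_field_derivative_transform_within_open[where f = "\<lambda>_. 0"])
      show "open {..<c}" by (rule open_lessThan)
      show "((\<lambda>_. 0) has_real_derivative ?\<rho> t) (at t)" using True out[of t] by simp
    qed (use True R0 in simp_all)
  next
    case False
    have "(R has_real_derivative ?\<rho> t) (at t within {c - 1..t + 1})"
      unfolding R_def using False by (intro integral_has_real_derivative cont) auto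
    moreover have "at t within {c - 1..t + 1} = at t" by (rule at_within_interior) (use False in simp)
    ultimately show ?thesis by simp
  qed
  have \<psi>: "\<psi> t = R t - R (t - h)" for t
  proof -
    have "(LINT \<sigma>|lborel. ?\<rho> \<sigma> * indicator {t - h..t} \<sigma>) = R t - R (t - h)"
      by (rule integral_FTC_Icc_real) (use h dR cont[of UNIV] in \<open>auto simp: continuous_on_eq_continuous_at\<close>)
    moreover have "\<psi> t = (LINT \<sigma>|lborel. ?\<rho> \<sigma> * indicator {t - h..t} \<sigma>)" unfolding \<psi>_def
    proof (rule integral_cong_AE)
      show "AE \<sigma> in lborel. indicator {t - h<..<t} \<sigma> * ?\<rho> \<sigma> = ?\<rho> \<sigma> * indicator {t - h..t} \<sigma>"
        using AE_lborel_singleton[of t] AE_lborel_singleton[of "t - h"]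
        by eventually_elim (auto split: split_indicator)
    qed measurable
    ultimately show ?thesis by simp
  qed
  have \<psi>eq: "\<psi> = (\<lambda>t. R t - R (t - h))" using \<psi> by auto
  show d\<psi>: "(\<psi> has_real_derivative ?\<rho> t - ?\<rho> (t - h)) (at t)" for t
  proof -
    have "((\<lambda>t. t - h) has_real_derivative 1) (at t)" by (auto intro!: derivative_eq_intros)
    from DERIV_diff[OF dR[of t] DERIV_chain2[OF dR[of "t - h"] this]] show ?thesis unfolding \<psi>eq by simp
  qed
  have shift_bump: "?\<rho> (t - h) = bump (c + h) (d + h) k t" for t unfolding bump_def by (simp add: algebra_simps)
  have fp: "flat_poly (\<lambda>t. ?\<rho> t + (- 1) * ?\<rho> (t - h))"
    unfolding shift_bump by (intro flat_poly.add flat_poly.mult flat_poly.const flat_poly_bump)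
  have "frechet_derivative \<psi> (at t) i = (?\<rho> t + (- 1) * ?\<rho> (t - h)) * i" for t i
    using frechet_derivative_eqI[OF d\<psi>[unfolded has_field_derivative_def]] by simp
  then have "smooth \<psi>" using d\<psi> flat_poly_smooth[OF fp]
    by (intro smooth.intros) (auto simp: differentiable_def has_field_derivative_def)
  moreover have "\<psi> t = 0" if "t \<notin> {c..d + h}" for t
  proof -
    have z: "indicator {t - h<..<t} \<sigma> * ?\<rho> \<sigma> = 0" for \<sigma> using that out[of \<sigma>] by (auto split: split_indicator)
    show ?thesis unfolding \<psi>_def z by simp
  qed
  then have "{t. \<psi> t \<noteq> 0} \<subseteq> {c..d + h}" by blast
  then have "closure {t. \<psi> t \<noteq> 0} \<subseteq> {c..d + h}" by (rule closure_minimal) simp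
  ultimately show "{c..d + h} \<subseteq> U ==> test_fn U \<psi>"
    unfolding test_fn_def compact_eq_bounded_closed using bounded_subset[OF bounded_closed_interval[of c "d + h"]]
    by auto
qed

section \<open>Functions with vanishing integrals over boxes\<close>

text \<open>Dynkin's argument: boxes are stable under intersection and generate the Borel sets. The
  whole space is not a box, so the complement step takes its integral from
  \<open>total\<close>.\<close>

lemma AE_zero_if_box_integrals_zero:
  fixes f :: "'a::euclidean_space \<Rightarrow> real"
  assumes f: "integrable lborel f" and zero: "\<And>a b. (LINT x|lborel. indicator (box a b) x * f x) = 0"
    and total: "(LINT x|lborel. f x) = 0"
  shows "AE x in lborel. f x = 0"
proof (rule sigma_finite_measure.density_zero[OF sigma_finite_lborel f])
  fix A :: "'a set" assume "A \<in> sets lborel"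
  then have A: "A \<in> sigma_sets UNIV (range (\<lambda>(a, b). box a b))" by (simp add: borel_eq_box sets_measure_of)
  have int: "integrable lborel (\<lambda>x. indicator B x * f x)" if "B \<in> sets borel" for B
    using integrable_mult_indicator[OF _ f, of B] that by simp
  have b: "B \<in> sets borel" if "B \<in> sigma_sets UNIV (range (\<lambda>(a, b). box a b))" for B :: "'a set"
    using that by (simp add: borel_eq_box sets_measure_of)
  have "Int_stable (range (\<lambda>(a, b). box a b :: 'a set))" by (auto simp: Int_stable_def box_Int_box)
  moreover have "range (\<lambda>(a, b). box a b :: 'a set) \<subseteq> Pow UNIV" by simp
  ultimately have "(LINT x|lborel. indicator A x * f x) = 0" using A
  proof (induction rule: sigma_sets_induct_disjoint)
    case (basic A)
    then show ?case using zero by auto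
  next
    case (compl A)
    have "(LINT x|lborel. indicator (UNIV - A) x * f x) = (LINT x|lborel. f x - indicator A x * f x)"
      by (rule Bochner_Integration.integral_cong) (auto split: split_indicator)
    then show ?case using compl f int[OF b[OF compl(1)]] total by simp
  next
    case (union A)
    have Ab: "A i \<in> sets borel" for i using union(2) b by blast
    have "set_lebesgue_integral lborel (\<Union>i. A i) f = (\<Sum>i. set_lebesgue_integral lborel (A i) f)"
      using union(1) Ab int[of "\<Union>i. A i"]
      by (intro lebesgue_integral_countable_add) (auto simp: disjoint_family_on_def set_integrable_def)
    also have "\<dots> = 0" using union(3) by (simp add: set_lebesgue_integral_def)
    finally show ?case by (simp add: set_lebesgue_integral_def)
  qed auto
  then show "set_lebesgue_integral lborel A f = 0" by (simp add: set_lebesgue_integral_def)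
qed

section \<open>Weak time derivatives and difference quotients\<close>

lemma AE_zero_on_open_if_box_integrals_zero:
  fixes X :: "'a::euclidean_space lsq"
  assumes W: "open W" and zero: "\<And>a b. cbox a b \<subseteq> W ==> (LINT x|lborel. indicator (box a b) x * fn X x) = 0"
  shows "AE x in lborel. x \<in> W \<longrightarrow> fn X x = 0"
proof -
  have ind_sqi: "sqi (indicator (box a b) :: 'a \<Rightarrow> real)" for a b
    by (rule bounded_compact_support_sqi[where B = 1])
      (auto intro: bounded_subset[OF bounded_box, of _ a b] split: split_indicator)
  have int: "integrable lborel (\<lambda>x. indicator (box a b) x * fn X x)" for a b
  proof (rule integrable_cong_AE_imp[OF fn_mult_integrable[of "cls (indicator (box a b))" X]])
    show "AE x in lborel. fn (cls (indicator (box a b))) x * fn X x = indicator (box a b) x * fn X x"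
      using fn_cls[OF ind_sqi[of a b]] by eventually_elim simp
  qed measurable
  have loc: "AE x in lborel. x \<in> cbox a b \<longrightarrow> fn X x = 0" if ab: "cbox a b \<subseteq> W" for a b
  proof -
    have "AE x in lborel. indicator (box a b) x * fn X x = 0"
    proof (rule AE_zero_if_box_integrals_zero[OF int])
      show "(LINT x|lborel. indicator (box a b) x * fn X x) = 0" by (rule zero[OF ab])
      fix c d :: 'a
      obtain e f where ef: "box c d \<inter> box a b = box e f" by (simp add: box_Int_box)
      have "(LINT x|lborel. indicator (box c d) x * (indicator (box a b) x * fn X x))
          = (LINT x|lborel. indicator (box e f) x * fn X x)"
        unfolding ef[symmetric] by (rule Bochner_Integration.integral_cong) (auto split: split_indicator)
      also have "\<dots> = 0"
      \<comment> \<open>The hypothesis asks for the closed box to lie in \<open>W\<close>; when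
        \<open>box e f\<close> is nonempty, the closed box is its closure and hence contained in
        \<open>cbox a b\<close>.\<close>
      proof (cases "box e f = {}")
        case False
        have "cbox e f = closure (box e f)" using False by simp
        also have "\<dots> \<subseteq> closure (box a b)" unfolding ef[symmetric] by (rule closure_mono) simp
        also have "\<dots> \<subseteq> cbox a b" by (rule closure_minimal[OF box_subset_cbox closed_cbox])
        finally show ?thesis using ab by (intro zero) auto
      qed simp
      finally show "(LINT x|lborel. indicator (box c d) x * (indicator (box a b) x * fn X x)) = 0" .
    qed
    moreover have "AE x in lborel. x \<notin> cbox a b - box a b"
      using negligible_frontier_interval[of a b] AE_not_in[of "cbox a b - box a b" lebesgue]
      unfolding negligible_iff_null_sets by (simp add: AE_completion_iff)
    ultimately show ?thesis by eventually_elim (auto split: split_indicator_asm)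
  qed
  obtain \<D> where D: "countable \<D>" "\<And>X. X \<in> \<D> ==> \<exists>a b. X = cbox a b" "\<Union>\<D> = W"
    using open_countable_Union_open_cbox[OF W] by metis
  have "AE x in lborel. \<forall>S\<in>\<D>. x \<in> S \<longrightarrow> fn X x = 0"
  proof (subst AE_ball_countable[OF D(1)], rule ballI)
    fix S assume S: "S \<in> \<D>"
    then obtain a b where "S = cbox a b" using D(2) by blast
    moreover have "S \<subseteq> W" using S D(3) by blast
    ultimately show "AE x in lborel. x \<in> S \<longrightarrow> fn X x = 0" using loc by simp
  qed
  then show ?thesis by eventually_elim (use D(3) in blast)
qed

lemma AE_lborel_translate_euclidean:
  fixes P :: "'a::euclidean_space \<Rightarrow> bool"
  assumes "AE x in lborel. P x"
  shows "AE x in lborel. P (c + x)"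
proof -
  obtain N where N: "{x. \<not> P x} \<subseteq> N" "N \<in> null_sets lborel" using assms by (auto elim!: AE_E simp: null_sets_def)
  have [measurable]: "N \<in> sets borel" using N(2) by (auto simp: null_sets_def)
  have "AE x in distr lborel borel ((+) c). x \<notin> N" unfolding lborel_distr_plus using AE_not_in[OF N(2)] .
  then have "AE x in lborel. c + x \<notin> N" by (subst (asm) AE_distr_iff) auto
  then show ?thesis using N(1) by (auto elim!: eventually_mono)
qed

section \<open>Forward differences and weak derivatives in time\<close>

definition fdiff :: "real \<Rightarrow> real \<Rightarrow> (real \<times> 'b::euclidean_space) lsq \<Rightarrow> (real \<times> 'b) lsq" where
  "fdiff T h X = shift T (- h) (X - shift T h X)"

lemma fn_shift:
  fixes X :: "(real \<times> 'b::euclidean_space) lsq"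
  shows "AE p in lborel. fn (shift T h X) p
    = indicator {0<..<T} (fst p) * (indicator {0<..<T} (fst p - h) * fn X (fst p - h, snd p))"
  unfolding shift_def by (rule fn_cls[OF sqi_shift])

text \<open>\<open>fdiff\<close> compares \<open>t\<close> with \<open>t + h\<close> only when both
  lie in \<open>(0, T)\<close>. Unlike \<open>X - shift T h X\<close> it does not contain
  \<open>X\<close> itself near an end of the interval, so it can be of order \<open>h\<close> for
  controls and bounds without zero boundary values.\<close>

lemma fn_fdiff:
  fixes X :: "(real \<times> 'b::euclidean_space) lsq"
  shows "AE p in lborel. fn (fdiff T h X) p
    = indicator {0<..<T} (fst p) * (indicator {0<..<T} (fst p + h) * (fn X (fst p + h, snd p) - fn X p))"
proof -
  have e: "(h, 0) + p = (fst p + h, snd p)" for p :: "real \<times> 'b" by (simp add: prod_eq_iff add.commute)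
  note t = AE_lborel_translate_euclidean[where c = "(h, 0 :: 'b)"]
  show ?thesis unfolding fdiff_def
    using fn_shift[of T "- h" "X - shift T h X"] t[OF fn_diff[of X "shift T h X"]] t[OF fn_shift[of T h X]]
  proof eventually_elim
    case (elim p)
    then show ?case unfolding e by (auto split: split_indicator)
  qed
qed

lemma inner_fdiff: "fdiff T h X \<bullet> Y = X \<bullet> (shift T h Y - shift T (- h) (shift T h Y))"
  unfolding fdiff_def using shift_adjoint[of T "- h" "X - shift T h X" Y] shift_adjoint[of T h X "shift T h Y"]
  by (simp add: inner_diff_left inner_diff_right)

text \<open>Before the last \<open>h\<close> units of time, \<open>X - shift T (- h) X\<close> is
  minus the forward difference. Shifting it forth and back restricts it to that range, and shifts do
  not increase the norm.\<close>

lemma norm_fdiff_le_backward: "norm (fdiff T h X) \<le> norm (X - shift T (- h) X)"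
  for X :: "(real \<times> 'b::euclidean_space) lsq"
proof -
  have "fdiff T h X = - shift T (- h) (shift T h (X - shift T (- h) X))"
  proof (rule lsq_eqI_slice)
    let ?D = "X - shift T (- h) X"
    have tr: "AE t in lborel. Q (t + h)" if "AE t in lborel. Q t" for Q using AE_lborel_translate[OF that] .
    have u: "AE t in lborel. slice (- Z) t = - slice Z t" for Z :: "(real \<times> 'b) lsq"
      using slice_scale[of "-1" Z] by simp
    show "AE t in lborel. slice (fdiff T h X) t = slice (- shift T (- h) (shift T h ?D)) t" unfolding fdiff_def
      using slice_shift[of T "- h" "X - shift T h X"] tr[OF slice_diff[of X "shift T h X"]] tr[OF slice_shift[of T h X]]
        u[of "shift T (- h) (shift T h ?D)"] slice_shift[of T "- h" "shift T h ?D"] tr[OF slice_shift[of T h ?D]]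
        slice_diff[of X "shift T (- h) X"] slice_shift[of T "- h" X]
      by eventually_elim auto
  qed
  then have "norm (fdiff T h X) = norm (shift T (- h) (shift T h (X - shift T (- h) X)))" by simp
  also have "\<dots> \<le> norm (X - shift T (- h) X)" using norm_shift order_trans by blast
  finally show ?thesis .
qed

lemma tens_cls:
  fixes \<phi> :: "'b::euclidean_space \<Rightarrow> real"
  assumes "sqi \<phi>"
  shows "tens \<psi> (cls \<phi>) = cls (\<lambda>p. \<psi> (fst p) * \<phi> (snd p))"
  unfolding tens_def
proof (rule cls_cong_AE)
  obtain N where N: "{\<xi>. fn (cls \<phi>) \<xi> \<noteq> \<phi> \<xi>} \<subseteq> N" "N \<in> null_sets lborel"
    using fn_cls[OF assms] by (auto elim!: AE_E simp: null_sets_def)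
  have [measurable]: "N \<in> sets borel" using N(2) by (auto simp: null_sets_def)
  have "AE p in lborel. snd p \<notin> N" for p :: "real \<times> 'b"
    by (rule AE_lborel_pairI, measurable) (use AE_not_in[OF N(2)] in simp)
  then show "AE p in lborel. \<psi> (fst p) * fn (cls \<phi>) (snd p) = \<psi> (fst p) * \<phi> (snd p)"
    by (rule AE_mp) (use N(1) in \<open>auto intro!: AE_I2\<close>)
qed

definition wdt :: "real \<Rightarrow> 'b set \<Rightarrow> (real \<times> 'b::euclidean_space) lsq \<Rightarrow> (real \<times> 'b) lsq \<Rightarrow> bool" where
  "wdt T U X D \<longleftrightarrow> (\<forall>\<psi> \<phi>. test_fn {0<..<T} \<psi> \<longrightarrow> test_fn U \<phi> \<longrightarrow>
     X \<bullet> tens (deriv \<psi>) (cls \<phi>) = - (D \<bullet> tens \<psi> (cls \<phi>)))"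

lemma shift_tens:
  fixes y :: "'b::euclidean_space lsq"
  assumes \<psi>: "sqi \<psi>" "\<psi> \<in> borel_measurable borel" and \<psi>': "sqi \<psi>'" "\<psi>' \<in> borel_measurable borel"
    and eq: "\<And>t. \<psi>' t = (if t \<in> {0<..<T} \<and> t - h \<in> {0<..<T} then \<psi> (t - h) else 0)"
  shows "shift T h (tens \<psi> y) = tens \<psi>' y"
proof (rule lsq_eqI_slice)
  show "AE t in lborel. slice (shift T h (tens \<psi> y)) t = slice (tens \<psi>' y) t"
    using slice_shift[of T h "tens \<psi> y"] AE_lborel_translate[OF slice_tens[OF \<psi>, of y], of "- h"]
      slice_tens[OF \<psi>', of y]
    by eventually_elim (auto simp: eq)
qed

lemma tens_diff:
  fixes y :: "'b::euclidean_space lsq"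
  assumes \<psi>: "sqi \<psi>" "\<psi> \<in> borel_measurable borel" and \<omega>: "sqi \<omega>" "\<omega> \<in> borel_measurable borel"
  shows "tens \<psi> y - tens \<omega> y = tens (\<lambda>t. \<psi> t - \<omega> t) y"
proof (rule lsq_eqI_slice)
  show "AE t in lborel. slice (tens \<psi> y - tens \<omega> y) t = slice (tens (\<lambda>t. \<psi> t - \<omega> t) y) t"
    using slice_diff[of "tens \<psi> y" "tens \<omega> y"] slice_tens[OF \<psi>, of y] slice_tens[OF \<omega>, of y]
      slice_tens[OF sqi_diff[OF \<psi>(1) \<omega>(1)] borel_measurable_diff[OF \<psi>(2) \<omega>(2)], of y]
    by eventually_elim (simp add: scaleR_diff_left)
qed

lemma sqi_translate:
  fixes \<psi> :: "real \<Rightarrow> real"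
  assumes "sqi \<psi>" and [measurable]: "\<psi> \<in> borel_measurable borel"
  shows "sqi (\<lambda>t. \<psi> (t - h))"
proof (rule sqi_borelI)
  have "(\<integral>\<^sup>+t. ennreal ((\<psi> (t - h))\<^sup>2) \<partial>lborel) = (\<integral>\<^sup>+t. ennreal ((\<psi> t)\<^sup>2) \<partial>lborel)"
    by (subst (2) nn_integral_real_affine[of _ 1 "- h"]) simp_all
  then show "(\<integral>\<^sup>+t. ennreal ((\<psi> (t - h))\<^sup>2) \<partial>lborel) < \<infinity>" using assms(1) by (simp add: sqi_def)
qed measurable

lemma compact_support_margin:
  fixes S :: "real set"
  assumes "compact S" "S \<subseteq> {0<..<T}" "0 < T"
  shows "\<exists>m. 0 < m \<and> m < T \<and> (\<forall>t\<in>S. t + m < T)"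
proof (cases "S = {}")
  case False
  then obtain s where s: "s \<in> S" "\<And>t. t \<in> S ==> t \<le> s" using compact_attains_sup[OF assms(1)] by blast
  then have "0 < s" "s < T" using assms(2) by auto
  have "t + (T - s) / 2 < T" if "t \<in> S" for t using s(2)[OF that] \<open>s < T\<close> by (simp add: field_simps)
  then show ?thesis using \<open>0 < s\<close> \<open>s < T\<close> by (intro exI[of _ "(T - s) / 2"]) (auto simp: field_simps)
qed (use assms(3) in \<open>auto intro!: exI[of _ "T / 2"]\<close>)

text \<open>The support condition leaves room for a translation by \<open>h\<close> below
  \<open>T\<close>, so no shift of the tensor is truncated and the difference moves onto
  \<open>\<psi>\<close> as an exact translation.\<close>

lemma inner_fdiff_tens:
  fixes X :: "(real \<times> 'b::euclidean_space) lsq"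
  assumes \<psi>: "sqi \<psi>" "\<psi> \<in> borel_measurable borel" and h: "0 < h"
    and supp: "\<And>t. \<psi> t \<noteq> 0 ==> 0 < t \<and> t + h < T"
  shows "fdiff T h X \<bullet> tens \<psi> y = X \<bullet> tens (\<lambda>t. \<psi> (t - h) - \<psi> t) y"
proof -
  note [measurable] = \<psi>(2)
  have m: "(\<lambda>t. \<psi> (t - h)) \<in> borel_measurable borel" by measurable
  have 1: "shift T h (tens \<psi> y) = tens (\<lambda>t. \<psi> (t - h)) y"
    by (rule shift_tens[OF \<psi> sqi_translate[OF \<psi>] m]) (use supp h in force)
  have 2: "shift T (- h) (tens (\<lambda>t. \<psi> (t - h)) y) = tens \<psi> y"
    by (rule shift_tens[OF sqi_translate[OF \<psi>] m \<psi>]) (use supp h in force)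
  show ?thesis unfolding inner_fdiff 1 2 by (simp add: tens_diff[OF sqi_translate[OF \<psi>] m \<psi>])
qed

text \<open>\<open>D\<close> is a weak cluster point of the difference quotients. Against a tensor
  the quotient moves to \<open>\<psi>\<close> once \<open>h\<close> is smaller than the margin
  between its support and \<open>T\<close>; there it converges to \<open>- deriv \<psi>\<close>
  under a Lipschitz bound, and dominated convergence identifies the pairing.\<close>

lemma weak_derivative_if_differences_bounded:
  fixes X :: "(real \<times> 'b::euclidean_space) lsq"
  assumes T: "0 < T" and bd: "\<And>h. 0 < h ==> norm (fdiff T h X) \<le> c * h"
  shows "\<exists>D. norm D \<le> c \<and> wdt T U X D"
proof -
  define h where "h n = 1 / (real n + 1)" for n
  have h: "h n > 0" for n unfolding h_def by simp
  have h0: "h \<longlonglongrightarrow> 0" unfolding h_def using LIMSEQ_inverse_real_of_nat by (simp add: inverse_eq_divide add.commute)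
  define q where "q n = (1 / h n) *\<^sub>R fdiff T (h n) X" for n
  have qn: "norm (q n) \<le> c" for n
    using bd[OF h, of n] h[of n] unfolding q_def norm_scaleR by (simp add: field_simps)
  obtain d where d: "norm d \<le> c" "\<And>\<eta> L. (\<lambda>n. q n \<bullet> \<eta>) \<longlonglongrightarrow> L ==> d \<bullet> \<eta> = L"
    using weak_cluster_point[of q, OF qn] by blast
  have "wdt T U X d" unfolding wdt_def
  proof (intro allI impI)
    fix \<psi> \<phi> assume \<psi>: "test_fn {0<..<T} \<psi>" and \<phi>: "test_fn U \<phi>"
    have \<psi>s: "sqi \<psi>" "\<psi> \<in> borel_measurable borel" using test_fn_sqi[OF \<psi>] test_fn_borel[OF \<psi>] by simp_all
    have d\<psi>: "(\<psi> has_real_derivative deriv \<psi> t) (at t)" for t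
      using \<psi> by (intro smooth_real_deriv) (simp add: test_fn_def)
    have t': "test_fn {0<..<T} (deriv \<psi>)" by (rule test_fn_deriv[OF \<psi>])
    have \<psi>'s: "sqi (deriv \<psi>)" and [measurable]: "deriv \<psi> \<in> borel_measurable borel"
      using test_fn_sqi[OF t'] test_fn_borel[OF t'] by simp_all
    note [measurable] = \<psi>s(2)
    obtain B where B: "\<And>t. \<bar>deriv \<psi> t\<bar> \<le> B" using test_fn_bounded[OF t'] by blast
    obtain m where m: "0 < m" "m < T" "\<And>t. t \<in> closure {t. \<psi> t \<noteq> 0} ==> t + m < T"
      using compact_support_margin[of "closure {t. \<psi> t \<noteq> 0}" T] \<psi> T unfolding test_fn_def by blast
    have supp: "0 < t \<and> t + m < T" if "\<psi> t \<noteq> 0" for t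
      using that test_fn_outside[OF \<psi>, of t] m(3)[of t] closure_subset[of "{t. \<psi> t \<noteq> 0}"] by force
    have lip: "\<bar>\<psi> (t - k) - \<psi> t\<bar> \<le> B * k" if "0 < k" for t k
    proof -
      have "\<exists>z>t - k. z < t \<and> \<psi> t - \<psi> (t - k) = (t - (t - k)) * deriv \<psi> z" by (rule MVT2) (use d\<psi> that in auto)
      then obtain z where "\<psi> t - \<psi> (t - k) = (t - (t - k)) * deriv \<psi> z" by blast
      then have "\<bar>\<psi> (t - k) - \<psi> t\<bar> = k * \<bar>deriv \<psi> z\<bar>" using that by (simp add: abs_minus_commute abs_mult)
      also have "\<dots> \<le> k * B" using that B by (intro mult_left_mono) auto
      finally show ?thesis by (simp add: mult.commute)
    qed
    define y where "y = cls \<phi>"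
    have ev: "\<forall>\<^sub>F n in sequentially. h n < m" using h0 m(1) order_tendstoD(2) by blast
    have "(\<lambda>n. LINT t|lborel. (\<psi> (t - h n) - \<psi> t) / h n * (indicator {0<..<T} t * (slice X t \<bullet> y)))
        \<longlonglongrightarrow> (LINT t|lborel. - deriv \<psi> t * (indicator {0<..<T} t * (slice X t \<bullet> y)))"
    proof (rule integral_dominated_convergence)
      \<comment> \<open>The pairing with a slice is only square integrable in time;
        \<open>r \<le> 1 + r^2\<close> on the bounded interval turns this into an integrable
        majorant.\<close>
      show "integrable lborel (\<lambda>t. B * (indicator {0<..<T} t * (1 + (norm (slice X t))\<^sup>2 * (norm y)\<^sup>2)))"
      proof -
        have "integrable lborel (\<lambda>t. indicator {0<..<T} t * (1 :: real) + indicator {0<..<T} t * ((norm (slice X t))\<^sup>2 * (norm y)\<^sup>2))"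
        proof (rule Bochner_Integration.integrable_add)
          show "integrable lborel (\<lambda>t. indicator {0<..<T} t * (1 :: real))" using T by simp
          have "integrable lborel (\<lambda>t. indicator {0<..<T} t *\<^sub>R ((norm (slice X t))\<^sup>2 * (norm y)\<^sup>2))"
            by (rule integrable_mult_indicator) (auto intro: integrable_mult_left norm_slice_integrable)
          then show "integrable lborel (\<lambda>t. indicator {0<..<T} t * ((norm (slice X t))\<^sup>2 * (norm y)\<^sup>2))" by simp
        qed
        then show ?thesis by (intro integrable_mult_right) (simp add: distrib_left)
      qed
      show "AE t in lborel. (\<lambda>n. (\<psi> (t - h n) - \<psi> t) / h n * (indicator {0<..<T} t * (slice X t \<bullet> y)))
          \<longlonglongrightarrow> - deriv \<psi> t * (indicator {0<..<T} t * (slice X t \<bullet> y))"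
      proof (intro AE_I2 tendsto_mult tendsto_const)
        fix t
        have "(\<lambda>n. (\<psi> (t + (- h n)) - \<psi> t) / (- h n)) \<longlonglongrightarrow> deriv \<psi> t"
        proof (rule tendsto_compose_eventually[where f = "\<lambda>n. - h n" and g = "\<lambda>k. (\<psi> (t + k) - \<psi> t) / k"])
          show "((\<lambda>k. (\<psi> (t + k) - \<psi> t) / k) \<longlongrightarrow> deriv \<psi> t) (at 0)" using d\<psi>[of t] by (simp add: DERIV_def)
          show "(\<lambda>n. - h n) \<longlonglongrightarrow> 0" using tendsto_minus[OF h0] by simp
          show "\<forall>\<^sub>F n in sequentially. - h n \<noteq> 0" using h by (simp add: less_imp_neq[symmetric])
        qed
        from tendsto_minus[OF this] show "(\<lambda>n. (\<psi> (t - h n) - \<psi> t) / h n) \<longlonglongrightarrow> - deriv \<psi> t" by simp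
      qed
      show "AE t in lborel. norm ((\<psi> (t - h n) - \<psi> t) / h n * (indicator {0<..<T} t * (slice X t \<bullet> y)))
          \<le> B * (indicator {0<..<T} t * (1 + (norm (slice X t))\<^sup>2 * (norm y)\<^sup>2))" for n
      proof (intro AE_I2)
        fix t
        have "\<bar>slice X t \<bullet> y\<bar> \<le> norm (slice X t) * norm y" by (rule Cauchy_Schwarz_ineq2)
        also have "\<dots> \<le> 1 + (norm (slice X t))\<^sup>2 * (norm y)\<^sup>2"
        proof -
          have "r \<le> 1 + r\<^sup>2" if "0 \<le> r" for r :: real
            using zero_le_power2[of "r - 1"] that by (simp add: power2_eq_square algebra_simps)
          from this[of "norm (slice X t) * norm y"] show ?thesis by (simp add: power_mult_distrib)
        qed
        finally have a: "\<bar>slice X t \<bullet> y\<bar> \<le> 1 + (norm (slice X t))\<^sup>2 * (norm y)\<^sup>2" .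
        have b: "\<bar>(\<psi> (t - h n) - \<psi> t) / h n\<bar> \<le> B"
          using lip[OF h[of n], of t] h[of n] by (simp add: abs_divide divide_le_eq)
        show "norm ((\<psi> (t - h n) - \<psi> t) / h n * (indicator {0<..<T} t * (slice X t \<bullet> y)))
          \<le> B * (indicator {0<..<T} t * (1 + (norm (slice X t))\<^sup>2 * (norm y)\<^sup>2))"
          using mult_mono[OF b a] order_trans[OF abs_ge_zero b] by (auto simp: abs_mult split: split_indicator)
      qed
    qed measurable
    moreover have "\<forall>\<^sub>F n in sequentially. (LINT t|lborel. (\<psi> (t - h n) - \<psi> t) / h n * (indicator {0<..<T} t * (slice X t \<bullet> y))) = q n \<bullet> tens \<psi> y"
      using ev
    proof eventually_elim
      case (elim n)
      have s: "0 < t \<and> t + h n < T" if "\<psi> t \<noteq> 0" for t using supp[OF that] elim by simp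
      have z: "indicator {0<..<T} t * (\<psi> (t - h n) - \<psi> t) = \<psi> (t - h n) - \<psi> t" for t
        using s[of t] s[of "t - h n"] h[of n]
        by (cases "\<psi> t = 0"; cases "\<psi> (t - h n) = 0") (auto split: split_indicator)
      have "q n \<bullet> tens \<psi> y = (1 / h n) * (LINT t|lborel. (\<psi> (t - h n) - \<psi> t) * (slice X t \<bullet> y))"
      proof -
        have fd: "fdiff T (h n) X \<bullet> tens \<psi> y = X \<bullet> tens (\<lambda>t. \<psi> (t - h n) - \<psi> t) y"
          by (rule inner_fdiff_tens[OF \<psi>s h]) (rule s)
        have "X \<bullet> tens (\<lambda>t. \<psi> (t - h n) - \<psi> t) y = (LINT t|lborel. (\<psi> (t - h n) - \<psi> t) * (slice X t \<bullet> y))"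
          by (rule inner_tens[OF sqi_diff[OF sqi_translate[OF \<psi>s] \<psi>s(1)]]) measurable
        then show ?thesis unfolding q_def inner_scaleR_left fd by simp
      qed
      also have "\<dots> = (1 / h n) * (LINT t|lborel. indicator {0<..<T} t * (\<psi> (t - h n) - \<psi> t) * (slice X t \<bullet> y))"
        unfolding z ..
      also have "\<dots> = (LINT t|lborel. (1 / h n) * (indicator {0<..<T} t * (\<psi> (t - h n) - \<psi> t) * (slice X t \<bullet> y)))"
        by (rule integral_mult_right_zero[symmetric])
      also have "\<dots> = (LINT t|lborel. (\<psi> (t - h n) - \<psi> t) / h n * (indicator {0<..<T} t * (slice X t \<bullet> y)))"
        by (simp add: mult_ac)
      finally show ?case by simp
    qed
    ultimately have "(\<lambda>n. q n \<bullet> tens \<psi> y) \<longlonglongrightarrow> (LINT t|lborel. - deriv \<psi> t * (indicator {0<..<T} t * (slice X t \<bullet> y)))"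
      by (rule Lim_transform_eventually)
    then have "d \<bullet> tens \<psi> y = (LINT t|lborel. - deriv \<psi> t * (indicator {0<..<T} t * (slice X t \<bullet> y)))" by (rule d(2))
    also have "\<dots> = (LINT t|lborel. - (deriv \<psi> t * (slice X t \<bullet> y)))"
      by (rule Bochner_Integration.integral_cong) (use test_fn_outside[OF t'] in \<open>auto split: split_indicator\<close>)
    also have "\<dots> = - (X \<bullet> tens (deriv \<psi>) y)" by (simp add: inner_tens[OF \<psi>'s])
    finally show "X \<bullet> tens (deriv \<psi>) (cls \<phi>) = - (d \<bullet> tens \<psi> (cls \<phi>))" by (simp add: y_def)
  qed
  then show ?thesis using d(1) by blast
qed

text \<open>The kernel of integration over \<open>(t, t + h)\<close> with \<open>t + h < T\<close>,
  the counterpart of \<open>fdiff\<close> in the fundamental theorem.\<close>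

definition Kfor :: "real \<Rightarrow> real \<Rightarrow> (real \<times> real) set" where
  "Kfor T h = {(t, \<tau>). 0 < t \<and> t < \<tau> \<and> \<tau> < t + h \<and> t + h < T}"

lemma kset_Kfor: "0 \<le> h ==> kset h (Kfor T h)"
proof (rule kset_if_sections)
  have "Kfor T h = {p. 0 < fst p \<and> fst p < snd p \<and> snd p < fst p + h \<and> fst p + h < T}" by (auto simp: Kfor_def)
  also have "\<dots> \<in> sets borel" by measurable
  finally show "Kfor T h \<in> sets borel" .
  show "\<exists>a. {\<tau>. (t, \<tau>) \<in> Kfor T h} \<subseteq> {a..a + h}" for t by (rule exI[of _ t]) (auto simp: Kfor_def)
  show "\<exists>a. {t. (t, \<tau>) \<in> Kfor T h} \<subseteq> {a..a + h}" for \<tau> by (rule exI[of _ "\<tau> - h"]) (auto simp: Kfor_def)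
qed

lemma box_Pair: "box (c, a) (d, b) = box c d \<times> box a b"
  for a b :: "'a::euclidean_space" and c d :: "'b::euclidean_space"
  by (auto simp: box_def Basis_prod_def ball_Un)

text \<open>The du Bois-Reymond argument.\<close>
lemma fdiff_eq_kernel_if_weak_derivative:
  fixes X D :: "(real \<times> 'b::euclidean_space) lsq"
  assumes w: "wdt T U X D" and U: "open U" and h: "0 < h"
  shows "AE p in lborel. p \<in> {0<..<T - h} \<times> U \<longrightarrow> fn (fdiff T h X) p = fn (kop (Kfor T h) D) p"
proof -
  define Z where "Z = fdiff T h X - kop (Kfor T h) D"
  have K: "kset h (Kfor T h)" using h by (intro kset_Kfor) simp
  have "AE p in lborel. p \<in> {0<..<T - h} \<times> U \<longrightarrow> fn Z p = 0"
  proof (rule AE_zero_on_open_if_box_integrals_zero)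
    show "open ({0<..<T - h} \<times> U)" using U by (intro open_Times) auto
    fix l u :: "real \<times> 'b" assume lu: "cbox l u \<subseteq> {0<..<T - h} \<times> U"
    obtain c a d b where l: "l = (c, a)" and u: "u = (d, b)" by (metis surj_pair)
    show "(LINT x|lborel. indicator (box l u) x * fn Z x) = 0"
    proof (cases "box l u = {}")
      case False
      then have ne: "box c d \<noteq> {}" "box a b \<noteq> {}" unfolding l u box_Pair by auto
      then have cd: "c < d" by (simp add: box_real)
      have "cbox c d \<times> cbox a b \<subseteq> {0<..<T - h} \<times> U" using lu unfolding l u cbox_Pair_eq by simp
      moreover have "cbox c d \<noteq> {}" "cbox a b \<noteq> {}" using ne box_subset_cbox by blast+
      ultimately have sub: "cbox c d \<subseteq> {0<..<T - h}" "cbox a b \<subseteq> U" by (auto simp: times_subset_iff)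
      have "c \<in> {0<..<T - h}" "d \<in> {0<..<T - h}" using sub(1) cd by (auto simp: subset_eq)
      then have c0: "0 < c" and dT: "d + h < T" by auto
      \<comment> \<open>The weak derivative is tested with \<open>\<psi>\<close>, whose derivative
        is the bump minus its translate by \<open>h\<close>. Up to sign this is the forward
        difference transposed onto the bump, while \<open>\<psi>\<close> itself is the transposed
        kernel applied to the bump, so the two parts of \<open>Z\<close> cancel.\<close>
      have zero: "Z \<bullet> tens (bump c d k) (cls (bump a b k)) = 0" for k
      proof -
        let ?\<rho> = "bump c d k" and ?y = "cls (bump a b k)"
        define \<psi> where "\<psi> t = (LINT \<sigma>|lborel. indicator {t - h<..<t} \<sigma> * ?\<rho> \<sigma>)" for t
        have \<psi>: "test_fn {0<..<T} \<psi>" and d\<psi>: "\<And>t. (\<psi> has_real_derivative ?\<rho> t - ?\<rho> (t - h)) (at t)"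
          unfolding \<psi>_def[abs_def]
          using bump_difference_antiderivative[OF cd h, where k = k] c0 dT by (auto simp: subset_eq)
        have \<rho>out: "?\<rho> t = 0" if "t \<le> c \<or> d \<le> t" for t using bump_outside[of t c d k] that by (auto simp: box_real)
        have \<rho>supp: "0 < t \<and> t + h < T" if "?\<rho> t \<noteq> 0" for t
          using \<rho>out[of t] that c0 dT by (cases "t \<le> c \<or> d \<le> t") auto
        have \<psi>s: "sqi \<psi>" "\<psi> \<in> borel_measurable borel" using test_fn_sqi[OF \<psi>] test_fn_borel[OF \<psi>] by simp_all
        have \<rho>s: "sqi ?\<rho>" "?\<rho> \<in> borel_measurable borel" by (auto simp: bump_sqi)
        have "deriv \<psi> = (\<lambda>t. ?\<rho> t - ?\<rho> (t - h))" using d\<psi> by (auto intro: DERIV_imp_deriv)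
        then have "X \<bullet> tens (\<lambda>t. ?\<rho> t - ?\<rho> (t - h)) ?y = - (D \<bullet> tens \<psi> ?y)"
          using w \<psi> bump_test_fn[OF sub(2), of k] unfolding wdt_def by metis
        moreover have "tens (\<lambda>t. ?\<rho> (t - h) - ?\<rho> t) ?y = - tens (\<lambda>t. ?\<rho> t - ?\<rho> (t - h)) ?y"
        proof -
          have m: "(\<lambda>t. ?\<rho> (t - h)) \<in> borel_measurable borel" by measurable
          show ?thesis unfolding tens_diff[OF sqi_translate[OF \<rho>s, of h] m \<rho>s, of ?y, symmetric]
              tens_diff[OF \<rho>s sqi_translate[OF \<rho>s, of h] m, of ?y, symmetric] by simp
        qed
        moreover have "fdiff T h X \<bullet> tens ?\<rho> ?y = X \<bullet> tens (\<lambda>t. ?\<rho> (t - h) - ?\<rho> t) ?y"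
          by (rule inner_fdiff_tens[OF \<rho>s h \<rho>supp])
        ultimately have 1: "fdiff T h X \<bullet> tens ?\<rho> ?y = D \<bullet> tens \<psi> ?y" by simp
        have "kop ((Kfor T h)\<inverse>) (tens ?\<rho> ?y) = tens \<psi> ?y"
        proof (rule lsq_eqI_slice_inner)
          have [measurable]: "(Kfor T h)\<inverse> \<in> sets borel" using kset_converse[OF K] by (simp add: kset_def)
          show "AE t in lborel. \<forall>z. slice (kop ((Kfor T h)\<inverse>) (tens ?\<rho> ?y)) t \<bullet> z = slice (tens \<psi> ?y) t \<bullet> z"
            using slice_kop[OF kset_converse[OF K], of "tens ?\<rho> ?y"] slice_tens[OF \<psi>s, of ?y]
          proof eventually_elim
            case (elim t)
            show ?case
            proof
              fix z
              have "(LINT \<tau>|lborel. indicator ((Kfor T h)\<inverse>) (t, \<tau>) * (slice (tens ?\<rho> ?y) \<tau> \<bullet> z))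
                  = (LINT \<tau>|lborel. indicator {t - h<..<t} \<tau> * ?\<rho> \<tau> * (?y \<bullet> z))"
              proof (rule integral_cong_AE)
                show "AE \<tau> in lborel. indicator ((Kfor T h)\<inverse>) (t, \<tau>) * (slice (tens ?\<rho> ?y) \<tau> \<bullet> z)
                    = indicator {t - h<..<t} \<tau> * ?\<rho> \<tau> * (?y \<bullet> z)"
                  using slice_tens[OF \<rho>s, of ?y]
                proof eventually_elim
                  case (elim \<tau>)
                  show ?case
                  proof (cases "?\<rho> \<tau> = 0")
                    case False
                    then have "0 < \<tau>" "\<tau> + h < T" using \<rho>supp[of \<tau>] by simp_all
                    then show ?thesis using elim by (auto simp: Kfor_def split: split_indicator)
                  qed (use elim in simp)
                qed
              qed measurable
              also have "\<dots> = \<psi> t * (?y \<bullet> z)" unfolding \<psi>_def by simp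
              finally show "slice (kop ((Kfor T h)\<inverse>) (tens ?\<rho> ?y)) t \<bullet> z = slice (tens \<psi> ?y) t \<bullet> z"
                using elim by simp
            qed
          qed
        qed
        then have "kop (Kfor T h) D \<bullet> tens ?\<rho> ?y = D \<bullet> tens \<psi> ?y" by (simp add: kop_adjoint[OF K])
        then show ?thesis using 1 by (simp add: Z_def inner_diff_left)
      qed
      \<comment> \<open>Letting \<open>k\<close> grow replaces the products of bumps by the
        indicator of the box, which also supplies the majorant.\<close>
      have lim: "(\<lambda>k. LINT x|lborel. fn Z x * (bump c d k (fst x) * bump a b k (snd x)))
          \<longlonglongrightarrow> (LINT x|lborel. fn Z x * (indicator (box c d) (fst x) * indicator (box a b) (snd x)))"
      proof (rule integral_dominated_convergence)
        have isq: "sqi (indicator (box l u) :: real \<times> 'b \<Rightarrow> real)"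
          by (rule bounded_compact_support_sqi[where B = 1])
            (auto intro: bounded_subset[OF bounded_box, of _ l u] split: split_indicator)
        show "integrable lborel (\<lambda>x. \<bar>fn Z x\<bar> * indicator (box l u) x)"
        proof (rule integrable_cong_AE_imp[OF integrable_abs[OF fn_mult_integrable[of Z "cls (indicator (box l u))"]]])
          show "AE x in lborel. \<bar>fn Z x * fn (cls (indicator (box l u))) x\<bar> = \<bar>fn Z x\<bar> * indicator (box l u) x"
            using fn_cls[OF isq] by eventually_elim (auto split: split_indicator)
        qed measurable
        show "AE x in lborel. (\<lambda>k. fn Z x * (bump c d k (fst x) * bump a b k (snd x)))
            \<longlonglongrightarrow> fn Z x * (indicator (box c d) (fst x) * indicator (box a b) (snd x))"
          by (intro AE_I2 tendsto_mult tendsto_const bump_tendsto)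
        show "AE x in lborel. norm (fn Z x * (bump c d k (fst x) * bump a b k (snd x))) \<le> \<bar>fn Z x\<bar> * indicator (box l u) x" for k
        proof (intro AE_I2)
          fix x :: "real \<times> 'b"
          show "norm (fn Z x * (bump c d k (fst x) * bump a b k (snd x))) \<le> \<bar>fn Z x\<bar> * indicator (box l u) x"
          proof (cases "x \<in> box l u")
            case True
            have "\<bar>bump c d k (fst x) * bump a b k (snd x)\<bar> \<le> 1"
              using bump_range[of c d k "fst x"] bump_range[of a b k "snd x"] by (simp add: abs_mult mult_le_one)
            then show ?thesis using True mult_left_le[of "\<bar>bump c d k (fst x) * bump a b k (snd x)\<bar>" "\<bar>fn Z x\<bar>"]
              by (simp add: abs_mult)
          next
            case False
            then have "bump c d k (fst x) = 0 \<or> bump a b k (snd x) = 0"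
              using bump_outside[of "fst x" c d k] bump_outside[of "snd x" a b k] unfolding l u box_Pair by (cases x) auto
            then show ?thesis by auto
          qed
        qed
      qed measurable
      have z: "(LINT x|lborel. fn Z x * (bump c d k (fst x) * bump a b k (snd x))) = 0" for k
      proof -
        have s: "sqi (\<lambda>x. bump c d k (fst x) * bump a b k (snd x))"
        proof (rule bounded_compact_support_sqi[where B = 1])
          show "\<bar>bump c d k (fst x) * bump a b k (snd x)\<bar> \<le> 1" for x
            using bump_range[of c d k "fst x"] bump_range[of a b k "snd x"] by (simp add: abs_mult mult_le_one)
          have "{x. bump c d k (fst x) * bump a b k (snd x) \<noteq> 0} \<subseteq> box l u"
            using bump_outside[of _ c d k] bump_outside[of _ a b k] unfolding l u box_Pair by force
          then show "bounded {x. bump c d k (fst x) * bump a b k (snd x) \<noteq> 0}" by (rule bounded_subset[OF bounded_box])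
        qed measurable
        show ?thesis using zero[of k] unfolding tens_cls[OF bump_sqi] by (subst (asm) inner_fn_cls[OF s]) auto
      qed
      have "(LINT x|lborel. fn Z x * (indicator (box c d) (fst x) * indicator (box a b) (snd x))) = 0"
        using lim unfolding z by (simp add: LIMSEQ_const_iff)
      moreover have ind: "indicator (box l u) x * fn Z x = fn Z x * (indicator (box c d) (fst x) * indicator (box a b) (snd x))" for x
        unfolding l u box_Pair by (cases x) (auto split: split_indicator)
      ultimately show ?thesis unfolding ind by simp
    qed simp
  qed
  then show ?thesis using fn_diff[of "fdiff T h X" "kop (Kfor T h) D"] unfolding Z_def by eventually_elim simp
qed

section \<open>The fractional Sobolev space as a closed subspace\<close>

text \<open>The exponent is half that of the Gagliardo kernel, so squares and products of quotients
  reproduce the integrands of the seminorm and of \<open>frac_form\<close>.\<close>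

definition Dq :: "real \<Rightarrow> (real^'n \<Rightarrow> real) \<Rightarrow> (real^'n) \<times> (real^'n) \<Rightarrow> real" where
  "Dq s v p = (v (fst p) - v (snd p)) / norm (fst p - snd p) powr ((real CARD('n) + 2 * s) / 2)"

lemma Dq_sq:
  fixes v :: "real^'n \<Rightarrow> real"
  shows "(Dq s v p)\<^sup>2 = (v (fst p) - v (snd p))\<^sup>2 / norm (fst p - snd p) powr (real CARD('n) + 2 * s)"
proof -
  have "(norm (fst p - snd p) powr ((real CARD('n) + 2 * s) / 2))\<^sup>2 = norm (fst p - snd p) powr (real CARD('n) + 2 * s)"
    by (simp add: power2_eq_square powr_add[symmetric])
  then show ?thesis unfolding Dq_def power_divide by simp
qed

lemma Dq_mult:
  fixes v w :: "real^'n \<Rightarrow> real"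
  shows "Dq s v p * Dq s w p = (v (fst p) - v (snd p)) * (w (fst p) - w (snd p))
    / norm (fst p - snd p) powr (real CARD('n) + 2 * s)"
proof -
  have "norm (fst p - snd p) powr ((real CARD('n) + 2 * s) / 2) * norm (fst p - snd p) powr ((real CARD('n) + 2 * s) / 2)
    = norm (fst p - snd p) powr (real CARD('n) + 2 * s)"
    by (simp add: powr_add[symmetric])
  then show ?thesis unfolding Dq_def by (simp add: times_divide_times_eq)
qed

lemma Dq_linear:
  "Dq s (\<lambda>x. v x + w x) p = Dq s v p + Dq s w p"
  "Dq s (\<lambda>x. v x - w x) p = Dq s v p - Dq s w p"
  "Dq s (\<lambda>x. c * v x) p = c * Dq s v p"
  unfolding Dq_def
    apply (simp add: add_divide_distrib diff_divide_distrib)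
   apply (simp add: diff_divide_distrib)
  apply (simp add: right_diff_distrib[symmetric])
  done

lemma AE_lborel_fst_snd:
  fixes P :: "'a::euclidean_space \<Rightarrow> bool"
  assumes "AE x in lborel. P x"
  shows "AE p in (lborel :: ('a \<times> 'b::euclidean_space) measure). P (fst p)"
    and "AE p in (lborel :: ('b \<times> 'a) measure). P (snd p)"
proof -
  obtain N where N: "{x. \<not> P x} \<subseteq> N" "N \<in> null_sets lborel" using assms by (auto elim!: AE_E simp: null_sets_def)
  have [measurable]: "N \<in> sets borel" using N(2) by (auto simp: null_sets_def)
  have "AE p in (lborel :: ('a \<times> 'b) measure). fst p \<notin> N"
  proof (rule AE_lborel_pairI)
    have "(fst :: 'a \<times> 'b \<Rightarrow> 'a) -` (- N) \<inter> space borel \<in> sets borel"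
      by (rule measurable_sets[OF borel_fst]) measurable
    then show "{p :: 'a \<times> 'b. fst p \<notin> N} \<in> sets borel" by (simp add: vimage_def)
    show "AE x in lborel. AE y in (lborel :: 'b measure). fst (x, y) \<notin> N"
      using AE_not_in[OF N(2)] by eventually_elim simp
  qed
  then show "AE p in (lborel :: ('a \<times> 'b) measure). P (fst p)" by (rule AE_mp) (use N(1) in auto)
  have "AE p in (lborel :: ('b \<times> 'a) measure). snd p \<notin> N"
  proof (rule AE_lborel_pairI)
    have "(snd :: 'b \<times> 'a \<Rightarrow> 'a) -` (- N) \<inter> space borel \<in> sets borel"
      by (rule measurable_sets[OF borel_snd]) measurable
    then show "{p :: 'b \<times> 'a. snd p \<notin> N} \<in> sets borel" by (simp add: vimage_def)
    show "AE x in (lborel :: 'b measure). AE y in lborel. snd (x, y) \<notin> N" using AE_not_in[OF N(2)] by simp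
  qed
  then show "AE p in (lborel :: ('b \<times> 'a) measure). P (snd p)" by (rule AE_mp) (use N(1) in auto)
qed

lemma Dq_cong_AE:
  assumes "AE x in lborel. v x = w x"
  shows "AE p in lborel. Dq s v p = Dq s w p"
  using AE_lborel_fst_snd(1)[OF assms] AE_lborel_fst_snd(2)[OF assms] by eventually_elim (simp add: Dq_def)

lemma Dq_borel [measurable]:
  assumes [measurable]: "v \<in> borel_measurable borel"
  shows "Dq s v \<in> borel_measurable borel"
  unfolding Dq_def[abs_def] by measurable

lemma Dq_lebesgue:
  assumes "v \<in> borel_measurable lebesgue"
  shows "Dq s v \<in> borel_measurable lebesgue"
proof (rule lebesgue_measurable_cong_AE)
  show "Dq s (borel_rep v) \<in> borel_measurable lebesgue"
    using Dq_borel[OF borel_rep_measurable[OF assms]] by (auto intro: measurable_completion)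
  show "AE p in lborel. Dq s (borel_rep v) p = Dq s v p" by (rule Dq_cong_AE[OF borel_rep_AE[OF assms]])
qed

lemma in_Hs_iff: "in_Hs s v \<longleftrightarrow> sqi v \<and> sqi (Dq s v)"
  unfolding in_Hs_def sqi_def gagliardo_sq_def Dq_sq nn_integral_completion using Dq_lebesgue by blast

lemma Hs_norm_eq:
  assumes "in_Hs s v"
  shows "Hs_norm s v = norm (cls v, cls (Dq s v))"
proof -
  have s: "sqi v" "sqi (Dq s v)" using assms by (simp_all add: in_Hs_iff)
  have "enn2real (\<integral>\<^sup>+x. ennreal ((v x)\<^sup>2) \<partial>lebesgue) = (norm (cls v))\<^sup>2"
    unfolding nn_integral_completion norm_cls_nn[OF s(1), symmetric] by simp
  moreover have "enn2real (gagliardo_sq s v) = (norm (cls (Dq s v)))\<^sup>2"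
    unfolding gagliardo_sq_def nn_integral_completion Dq_sq[symmetric] norm_cls_nn[OF s(2), symmetric] by simp
  ultimately show ?thesis unfolding Hs_norm_def norm_prod_def by simp
qed

lemma frac_form_eq:
  fixes v w :: "real^'n \<Rightarrow> real"
  assumes "in_Hs s v" "in_Hs s w"
  shows "frac_form s v w = Cns CARD('n) s / 2 * (cls (Dq s v) \<bullet> cls (Dq s w))"
  using assms unfolding frac_form_def in_Hs_iff by (simp add: inner_cls Dq_mult)

lemma in_Hs_linear:
  assumes "in_Hs s v" "in_Hs s w"
  shows "in_Hs s (\<lambda>x. v x + w x)" "in_Hs s (\<lambda>x. v x - w x)" "in_Hs s (\<lambda>x. c * v x)"
proof -
  have "Dq s (\<lambda>x. v x + w x) = (\<lambda>p. Dq s v p + Dq s w p)" "Dq s (\<lambda>x. v x - w x) = (\<lambda>p. Dq s v p - Dq s w p)"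
    "Dq s (\<lambda>x. c * v x) = (\<lambda>p. c * Dq s v p)" by (auto simp: Dq_linear)
  then show "in_Hs s (\<lambda>x. v x + w x)" "in_Hs s (\<lambda>x. v x - w x)" "in_Hs s (\<lambda>x. c * v x)"
    using assms unfolding in_Hs_iff by (simp_all add: sqi_add sqi_diff sqi_mult_left)
qed

lemma cls_Dq_linear:
  assumes "in_Hs s v" "in_Hs s w"
  shows "cls (Dq s (\<lambda>x. v x + w x)) = cls (Dq s v) + cls (Dq s w)"
    and "cls (Dq s (\<lambda>x. v x - w x)) = cls (Dq s v) - cls (Dq s w)"
    and "cls (Dq s (\<lambda>x. c * v x)) = c *\<^sub>R cls (Dq s v)"
proof -
  have s: "sqi (Dq s v)" "sqi (Dq s w)" using assms by (simp_all add: in_Hs_iff)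
  have "Dq s (\<lambda>x. v x + w x) = (\<lambda>p. Dq s v p + Dq s w p)" "Dq s (\<lambda>x. v x - w x) = (\<lambda>p. Dq s v p - Dq s w p)"
    "Dq s (\<lambda>x. c * v x) = (\<lambda>p. c * Dq s v p)" by (auto simp: Dq_linear)
  then show "cls (Dq s (\<lambda>x. v x + w x)) = cls (Dq s v) + cls (Dq s w)"
    "cls (Dq s (\<lambda>x. v x - w x)) = cls (Dq s v) - cls (Dq s w)"
    "cls (Dq s (\<lambda>x. c * v x)) = c *\<^sub>R cls (Dq s v)"
    using s by (simp_all add: cls_add cls_diff cls_scale)
qed

lemma in_Hs_cong_AE:
  assumes "in_Hs s v" "AE x in lborel. w x = v x"
  shows "in_Hs s w"
  using assms sqi_cong_AE[of v w] sqi_cong_AE[OF _ Dq_cong_AE[OF assms(2)]] by (simp add: in_Hs_iff)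

section \<open>Test functions have finite Gagliardo seminorm\<close>

lemma nn_integral_indicator_cball:
  assumes "0 \<le> r" "0 \<le> c"
  shows "(\<integral>\<^sup>+x. ennreal c * indicator (cball (0::real^'n) r) x \<partial>lborel)
    = ennreal (c * (unit_ball_vol (real CARD('n)) * r ^ CARD('n)))"
  using assms by (simp add: nn_integral_cmult_indicator emeasure_cball ennreal_mult)

text \<open>Dyadic shells: near the origin the kernel is summable because \<open>s < 1\<close>, far from it because
  \<open>s > 0\<close>.\<close>
lemma truncated_kernel_integrable:
  fixes s L B :: real
  assumes s: "0 < s" "s < 1" and L: "0 \<le> L" and B: "0 \<le> B"
  shows "(\<integral>\<^sup>+h. ennreal (min (L * (norm h)\<^sup>2) B / norm h powr (real CARD('n) + 2 * s)) \<partial>(lborel :: (real^'n) measure)) < \<infinity>"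
proof -
  define N where "N = real CARD('n) + 2 * s"
  define n where "n = CARD('n)"
  have Nn: "N = real n + 2 * s" by (simp add: N_def n_def)
  have Npos: "0 < N" unfolding N_def using s by (simp add: add_nonneg_pos)
  define vol where "vol = unit_ball_vol (real n)"
  have vol: "0 \<le> vol" unfolding vol_def by simp
  \<comment> \<open>\<open>a j\<close> bounds the kernel on the shell
    \<open>2^(-j-1) < |h| \<le> 2^(-j)\<close> through the quadratic term, \<open>b j\<close> on the
    shell \<open>2^j \<le> |h| \<le> 2^(j+1)\<close> through the constant; each bound is spread over
    the full ball of the outer radius.\<close>
  define a where "a j = L * (1/2) ^ (2 * j) * (2 powr (real (Suc j) * N))" for j :: nat
  define b where "b j = B * 2 powr (- real j * N)" for j :: nat
  have pt: "ennreal (min (L * (norm h)\<^sup>2) B / norm h powr N)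
      \<le> (\<Sum>j. ennreal (a j) * indicator (cball 0 ((1/2) ^ j)) h + ennreal (b j) * indicator (cball 0 (2 ^ Suc j)) h)"
    for h :: "real^'n"
  proof (cases "h = 0")
    case False
    then have h: "0 < norm h" by simp
    let ?f = "\<lambda>j. ennreal (a j) * indicator (cball 0 ((1/2) ^ j)) h + ennreal (b j) * indicator (cball 0 (2 ^ Suc j)) h"
    have "\<exists>j. ennreal (min (L * (norm h)\<^sup>2) B / norm h powr N) \<le> ?f j"
    proof (cases "norm h \<le> 1")
      case True
      define k where "k = (LEAST k. (1/2) ^ k < norm h)"
      have ex: "\<exists>k. (1/2) ^ k < norm h" using real_arch_pow_inv[OF h, of "1/2"] by simp
      have k: "(1/2) ^ k < norm h" unfolding k_def by (rule LeastI_ex[OF ex])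
      then have "k \<noteq> 0" using True by (cases k) auto
      then obtain j where j: "k = Suc j" by (cases k) auto
      have "\<not> (1/2) ^ j < norm h" using not_less_Least[of j "\<lambda>k. (1/2) ^ k < norm h"] j by (simp add: k_def)
      then have le: "norm h \<le> (1/2) ^ j" by simp
      have p: "(1/2) powr (real (Suc j) * N) \<le> norm h powr N"
      proof -
        have "(1/2) powr (real (Suc j) * N) = ((1/2) ^ Suc j) powr N"
        proof -
          have "(1/2::real) ^ Suc j = (1/2) powr real (Suc j)" by (rule powr_realpow[symmetric]) simp
          then show ?thesis by (simp only: powr_powr)
        qed
        also have "\<dots> \<le> norm h powr N" using k j Npos by (intro powr_mono2) auto
        finally show ?thesis .
      qed
      have "min (L * (norm h)\<^sup>2) B / norm h powr N \<le> L * ((1/2) ^ j)\<^sup>2 / (1/2) powr (real (Suc j) * N)"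
      proof (rule frac_le)
        show "min (L * (norm h)\<^sup>2) B \<le> L * ((1/2) ^ j)\<^sup>2"
          using mult_left_mono[OF power_mono[OF le norm_ge_zero, of 2] L] by simp
      qed (use L p in auto)
      also have "\<dots> = a j" unfolding a_def by (simp add: power_mult[symmetric] mult.commute[of j 2] powr_divide)
      finally have "ennreal (min (L * (norm h)\<^sup>2) B / norm h powr N) \<le> ennreal (a j)" by (rule ennreal_leI)
      also have "\<dots> \<le> ?f j" using le by (simp add: indicator_def add_increasing2)
      finally show ?thesis by blast
    next
      case big: False
      define k where "k = (LEAST k. norm h \<le> 2 ^ k)"
      have ex: "\<exists>k. norm h \<le> 2 ^ k" using real_arch_pow[of 2 "norm h"] by (auto intro: less_imp_le)
      have k: "norm h \<le> 2 ^ k" unfolding k_def by (rule LeastI_ex[OF ex])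
      then have "k \<noteq> 0" using big by (cases k) auto
      then obtain j where j: "k = Suc j" by (cases k) auto
      have "\<not> norm h \<le> 2 ^ j" using not_less_Least[of j "\<lambda>k. norm h \<le> 2 ^ k"] j by (simp add: k_def)
      then have ge: "2 ^ j \<le> norm h" by simp
      have p: "2 powr (real j * N) \<le> norm h powr N"
      proof -
        have "2 powr (real j * N) = (2 ^ j) powr N" by (simp add: powr_powr[symmetric] powr_realpow)
        also have "\<dots> \<le> norm h powr N" using ge Npos by (intro powr_mono2) auto
        finally show ?thesis .
      qed
      have "min (L * (norm h)\<^sup>2) B / norm h powr N \<le> B / 2 powr (real j * N)" by (rule frac_le) (use B p in auto)
      also have "\<dots> = b j" unfolding b_def by (simp add: powr_minus_divide)
      finally have "ennreal (min (L * (norm h)\<^sup>2) B / norm h powr N) \<le> ennreal (b j)" by (rule ennreal_leI)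
      also have "\<dots> \<le> ?f j" using k j by (simp add: indicator_def add_increasing)
      finally show ?thesis by blast
    qed
    then obtain j where "ennreal (min (L * (norm h)\<^sup>2) B / norm h powr N) \<le> ?f j" by blast
    also have "\<dots> \<le> suminf ?f" using sum_le_suminf[of ?f "{j}"] by simp
    finally show ?thesis .
  qed (use B in simp)
  have [measurable]: "cball (0 :: real^'n) r \<in> sets borel" for r by (intro borel_closed closed_cball)
  have an: "0 \<le> a j" and bn: "0 \<le> b j" for j unfolding a_def b_def using L B by auto
  have "(\<integral>\<^sup>+h. ennreal (min (L * (norm h)\<^sup>2) B / norm h powr N) \<partial>(lborel :: (real^'n) measure))
      \<le> (\<integral>\<^sup>+h. (\<Sum>j. ennreal (a j) * indicator (cball 0 ((1/2) ^ j)) h + ennreal (b j) * indicator (cball 0 (2 ^ Suc j)) h) \<partial>(lborel :: (real^'n) measure))"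
    by (rule nn_integral_mono, rule pt)
  also have "\<dots> = (\<Sum>j. \<integral>\<^sup>+h. ennreal (a j) * indicator (cball 0 ((1/2) ^ j)) h + ennreal (b j) * indicator (cball 0 (2 ^ Suc j)) h \<partial>(lborel :: (real^'n) measure))"
    by (rule nn_integral_suminf) measurable
  also have "\<dots> = (\<Sum>j. ennreal (a j * (vol * ((1/2) ^ j) ^ n) + b j * (vol * (2 ^ Suc j) ^ n)))"
  proof (rule arg_cong[where f = suminf], rule ext)
    fix j
    have "(\<integral>\<^sup>+h. ennreal (a j) * indicator (cball 0 ((1/2) ^ j)) h + ennreal (b j) * indicator (cball 0 (2 ^ Suc j)) h \<partial>(lborel :: (real^'n) measure))
        = (\<integral>\<^sup>+h. ennreal (a j) * indicator (cball 0 ((1/2) ^ j)) h \<partial>(lborel :: (real^'n) measure))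
        + (\<integral>\<^sup>+h. ennreal (b j) * indicator (cball 0 (2 ^ Suc j)) h \<partial>(lborel :: (real^'n) measure))"
      by (rule nn_integral_add) measurable
    also have "\<dots> = ennreal (a j * (vol * ((1/2) ^ j) ^ n)) + ennreal (b j * (vol * (2 ^ Suc j) ^ n))"
      unfolding vol_def n_def by (subst (1 2) nn_integral_indicator_cball) (auto simp: an bn)
    also have "\<dots> = ennreal (a j * (vol * ((1/2) ^ j) ^ n) + b j * (vol * (2 ^ Suc j) ^ n))"
      using an bn vol by (simp add: ennreal_plus)
    finally show "(\<integral>\<^sup>+h. ennreal (a j) * indicator (cball 0 ((1/2) ^ j)) h + ennreal (b j) * indicator (cball 0 (2 ^ Suc j)) h \<partial>(lborel :: (real^'n) measure))
        = ennreal (a j * (vol * ((1/2) ^ j) ^ n) + b j * (vol * (2 ^ Suc j) ^ n))" .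
  qed
  also have "\<dots> < \<infinity>"
  proof -
    \<comment> \<open>After multiplication by the ball volumes the inner shells form a geometric
      series of ratio \<open>2^(2s-2)\<close> and the outer ones of ratio
      \<open>2^(-2s)\<close>.\<close>
    define \<alpha> where "\<alpha> = (2::real) powr (2 * s - 2)"
    define \<beta> where "\<beta> = (2::real) powr (- 2 * s)"
    have \<alpha>: "0 \<le> \<alpha>" "\<alpha> < 1" and \<beta>: "0 \<le> \<beta>" "\<beta> < 1"
      using powr_less_one[of 2 "2 * s - 2"] powr_less_one[of 2 "- 2 * s"] s unfolding \<alpha>_def \<beta>_def by auto
    have two: "(2::real) ^ m = 2 powr real m" "((1/2)::real) ^ m = 2 powr (- real m)" for m :: nat
      by (auto simp: powr_realpow powr_minus power_one_over inverse_eq_divide)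
    have aj: "a j * (vol * ((1/2) ^ j) ^ n) = (L * vol * 2 powr N) * \<alpha> ^ j" for j
    proof -
      have "a j * (vol * ((1/2) ^ j) ^ n) = L * vol * (2 powr (- real (2 * j)) * 2 powr (real (Suc j) * N) * 2 powr (- real (j * n)))"
        unfolding a_def unfolding power_mult[symmetric] unfolding two(2) by (simp add: mult_ac)
      also have "\<dots> = L * vol * 2 powr (- real (2 * j) + real (Suc j) * N + - real (j * n))"
        by (simp only: powr_add)
      also have "- real (2 * j) + real (Suc j) * N + - real (j * n) = N + real j * (2 * s - 2)"
        unfolding Nn by (simp add: algebra_simps)
      also have "2 powr (N + real j * (2 * s - 2)) = 2 powr N * \<alpha> ^ j"
        unfolding \<alpha>_def by (simp add: powr_add powr_powr[symmetric] powr_realpow mult.commute[of "real j"])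
      finally show ?thesis by simp
    qed
    have bj: "b j * (vol * (2 ^ Suc j) ^ n) = (B * vol * 2 ^ n) * \<beta> ^ j" for j
    proof -
      have "b j * (vol * (2 ^ Suc j) ^ n) = B * vol * (2 powr (- real j * N) * 2 powr real (Suc j * n))"
        unfolding b_def unfolding power_mult[symmetric] unfolding two(1) by (simp only: mult_ac)
      also have "\<dots> = B * vol * 2 powr (- real j * N + real (Suc j * n))" by (simp only: powr_add)
      also have "- real j * N + real (Suc j * n) = real n + real j * (- 2 * s)"
        unfolding Nn by (simp add: algebra_simps)
      also have "2 powr (real n + real j * (- 2 * s)) = 2 ^ n * \<beta> ^ j"
      proof -
        have "2 powr (real n + real j * (- 2 * s)) = 2 powr real n * (2 powr (- 2 * s)) powr real j"
          by (simp only: powr_add powr_powr mult.commute)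
        then show ?thesis unfolding \<beta>_def by (simp add: powr_realpow)
      qed
      finally show ?thesis by simp
    qed
    have "summable (\<lambda>j. a j * (vol * ((1/2) ^ j) ^ n) + b j * (vol * (2 ^ Suc j) ^ n))"
      unfolding aj bj by (intro summable_add summable_mult summable_geometric) (use \<alpha> \<beta> in auto)
    then show ?thesis using an bn vol by (subst suminf_ennreal2) auto
  qed
  finally show ?thesis by (simp add: N_def)
qed

lemma smooth_compact_support_lipschitz:
  fixes \<phi> :: "'a::euclidean_space \<Rightarrow> real"
  assumes "test_fn U \<phi>"
  shows "\<exists>L\<ge>0. \<forall>x y. \<bar>\<phi> x - \<phi> y\<bar> \<le> L * norm (x - y)"
proof -
  have sm: "smooth \<phi>" and cp: "compact (closure {x. \<phi> x \<noteq> 0})" using assms by (auto simp: test_fn_def)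
  have d: "(\<phi> has_derivative frechet_derivative \<phi> (at x)) (at x)" for x
    using smooth_differentiable[OF sm, of x] by (simp add: frechet_derivative_works)
  have "\<exists>B\<ge>0. \<forall>x. \<bar>frechet_derivative \<phi> (at x) i\<bar> \<le> B" if i: "i \<in> Basis" for i
  proof (rule continuous_compact_support_bounded)
    show "continuous_on UNIV (\<lambda>x. frechet_derivative \<phi> (at x) i)"
      by (rule smooth_continuous[OF smooth_partial[OF sm i]])
    have z: "frechet_derivative \<phi> (at x) i = 0" if "x \<notin> closure {x. \<phi> x \<noteq> 0}" for x
    proof -
      have "(\<phi> has_derivative (\<lambda>_. 0)) (at x)"
      proof (rule has_derivative_transform_within_open)
        show "((\<lambda>_. 0) has_derivative (\<lambda>_. 0)) (at x)" by simp
        show "open (- closure {x. \<phi> x \<noteq> 0})" by (intro open_Compl closed_closure)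
        show "x \<in> - closure {x. \<phi> x \<noteq> 0}" using that by simp
        show "0 = \<phi> y" if "y \<in> - closure {x. \<phi> x \<noteq> 0}" for y using that closure_subset[of "{x. \<phi> x \<noteq> 0}"] by auto
      qed
      then show ?thesis by (simp add: frechet_derivative_eqI)
    qed
    have "{x. frechet_derivative \<phi> (at x) i \<noteq> 0} \<subseteq> closure {x. \<phi> x \<noteq> 0}" using z by blast
    then have "closure {x. frechet_derivative \<phi> (at x) i \<noteq> 0} \<subseteq> closure {x. \<phi> x \<noteq> 0}"
      by (rule closure_minimal) (rule closed_closure)
    then show "compact (closure {x. frechet_derivative \<phi> (at x) i \<noteq> 0})"
      using cp unfolding compact_eq_bounded_closed by (auto intro: bounded_subset)
  qed
  then obtain B where B: "\<And>i. i \<in> Basis ==> 0 \<le> B i" "\<And>i x. i \<in> Basis ==> \<bar>frechet_derivative \<phi> (at x) i\<bar> \<le> B i"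
    by metis
  define L where "L = (\<Sum>i\<in>Basis. B i)"
  have L: "0 \<le> L" unfolding L_def using B(1) by (rule sum_nonneg)
  have dl: "\<bar>frechet_derivative \<phi> (at x) v\<bar> \<le> L * norm v" for x v
  proof -
    have lin: "linear (frechet_derivative \<phi> (at x))" using d has_derivative_linear by blast
    have "frechet_derivative \<phi> (at x) v = frechet_derivative \<phi> (at x) (\<Sum>i\<in>Basis. (v \<bullet> i) *\<^sub>R i)"
      by (simp add: euclidean_representation)
    also have "\<dots> = (\<Sum>i\<in>Basis. (v \<bullet> i) * frechet_derivative \<phi> (at x) i)"
      by (simp add: linear_sum[OF lin] linear_scale[OF lin])
    also have "\<bar>\<dots>\<bar> \<le> (\<Sum>i\<in>Basis. \<bar>(v \<bullet> i) * frechet_derivative \<phi> (at x) i\<bar>)" by (rule sum_abs)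
    also have "\<dots> \<le> (\<Sum>i\<in>Basis. norm v * B i)"
    proof (rule sum_mono)
      fix i :: 'a assume i: "i \<in> Basis"
      show "\<bar>(v \<bullet> i) * frechet_derivative \<phi> (at x) i\<bar> \<le> norm v * B i"
        unfolding abs_mult by (rule mult_mono[OF Basis_le_norm[OF i] B(2)[OF i]]) auto
    qed
    also have "\<dots> = L * norm v" unfolding L_def sum_distrib_right by (rule sum.cong) (simp_all add: mult.commute)
    finally show ?thesis .
  qed
  have "\<bar>\<phi> x - \<phi> y\<bar> \<le> L * norm (x - y)" for x y
  proof -
    have "norm (\<phi> x - \<phi> y) \<le> L * norm (x - y)"
    proof (rule differentiable_bound[of UNIV \<phi> "\<lambda>x. frechet_derivative \<phi> (at x)" L])
      show "onorm (frechet_derivative \<phi> (at z)) \<le> L" for z by (rule onorm_bound[OF L]) (simp add: dl)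
    qed (use d in auto)
    then show ?thesis by simp
  qed
  then show ?thesis using L by blast
qed

text \<open>The difference \<open>\<phi> x - \<phi> y\<close> is bounded both by
  \<open>L |x - y|\<close> and by \<open>2 B\<close>, and it vanishes unless \<open>x\<close> or
  \<open>y\<close> lies in the compact support \<open>K\<close>. By translation invariance each of
  these two cases contributes the measure of \<open>K\<close> times the truncated kernel
  integral.\<close>

lemma test_fn_in_Hs:
  fixes \<phi> :: "real^'n \<Rightarrow> real"
  assumes s: "0 < s" "s < 1" and \<phi>: "test_fn U \<phi>"
  shows "in_Hs s \<phi>"
  unfolding in_Hs_iff
proof
  show "sqi \<phi>" by (rule test_fn_sqi[OF \<phi>])
  have [measurable]: "\<phi> \<in> borel_measurable borel" by (rule test_fn_borel[OF \<phi>])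
  obtain L where L: "0 \<le> L" "\<And>x y. \<bar>\<phi> x - \<phi> y\<bar> \<le> L * norm (x - y)"
    using smooth_compact_support_lipschitz[OF \<phi>] by blast
  obtain B where B: "0 \<le> B" "\<And>x. \<bar>\<phi> x\<bar> \<le> B" using test_fn_bounded[OF \<phi>] by blast
  define K where "K = closure {x. \<phi> x \<noteq> 0}"
  have K: "compact K" "\<And>x. x \<notin> K ==> \<phi> x = 0"
    using \<phi> closure_subset[of "{x. \<phi> x \<noteq> 0}"] unfolding K_def test_fn_def by auto
  have [measurable]: "K \<in> sets borel" using K(1) by (simp add: compact_imp_closed)
  define g where "g h = ennreal (min (L\<^sup>2 * (norm h)\<^sup>2) (4 * B\<^sup>2) / norm h powr (real CARD('n) + 2 * s))" for h :: "real^'n"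
  have [measurable]: "g \<in> borel_measurable borel" unfolding g_def by measurable
  have gm: "g (- h) = g h" for h unfolding g_def by simp
  have G: "(\<integral>\<^sup>+h. g h \<partial>lborel) < \<infinity>"
    unfolding g_def using truncated_kernel_integrable[OF s, of "L\<^sup>2" "4 * B\<^sup>2"] by simp
  have le: "ennreal ((Dq s \<phi> p)\<^sup>2) \<le> indicator K (fst p) * g (snd p - fst p) + indicator K (snd p) * g (fst p - snd p)" for p
  proof (cases "fst p \<in> K \<or> snd p \<in> K")
    case True
    have "(\<phi> (fst p) - \<phi> (snd p))\<^sup>2 \<le> L\<^sup>2 * (norm (fst p - snd p))\<^sup>2"
      using power_mono[OF L(2)[of "fst p" "snd p"] abs_ge_zero, of 2] by (simp add: power_mult_distrib)
    moreover have "(\<phi> (fst p) - \<phi> (snd p))\<^sup>2 \<le> 4 * B\<^sup>2"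
    proof -
      have "\<bar>\<phi> (fst p) - \<phi> (snd p)\<bar> \<le> 2 * B" using B(2)[of "fst p"] B(2)[of "snd p"] by linarith
      from power_mono[OF this abs_ge_zero, of 2] show ?thesis by (simp add: power_mult_distrib)
    qed
    ultimately have "ennreal ((Dq s \<phi> p)\<^sup>2) \<le> g (fst p - snd p)"
      unfolding g_def Dq_sq by (intro ennreal_leI divide_right_mono) auto
    moreover have "g (snd p - fst p) = g (fst p - snd p)" using gm[of "fst p - snd p"] by simp
    ultimately show ?thesis using True by (auto simp: indicator_def add_increasing add_increasing2)
  next
    case False
    then show ?thesis using K(2) by (simp add: Dq_def)
  qed
  have part: "(\<integral>\<^sup>+x. \<integral>\<^sup>+y. indicator K x * g (y - x) \<partial>lborel \<partial>lborel) < \<infinity>"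
  proof -
    have "(\<integral>\<^sup>+y. g (y - x) \<partial>lborel) = (\<integral>\<^sup>+y. g y \<partial>lborel)" for x
    proof -
      have "(\<integral>\<^sup>+y. g y \<partial>lborel) = (\<integral>\<^sup>+y. g y \<partial>(distr lborel borel ((+) (- x))))" by (simp add: lborel_distr_plus)
      also have "\<dots> = (\<integral>\<^sup>+y. g (- x + y) \<partial>lborel)" by (rule nn_integral_distr) measurable
      finally show ?thesis by simp
    qed
    then have "(\<integral>\<^sup>+x. \<integral>\<^sup>+y. indicator K x * g (y - x) \<partial>lborel \<partial>lborel) = emeasure lborel K * (\<integral>\<^sup>+y. g y \<partial>lborel)"
      by (simp add: nn_integral_cmult nn_integral_multc)
    also have "\<dots> < \<infinity>"
      using G emeasure_bounded_finite[OF compact_imp_bounded[OF K(1)]] by (simp add: ennreal_mult_less_top)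
    finally show ?thesis .
  qed
  show "sqi (Dq s \<phi>)"
  proof (rule sqi_borelI)
    have "(\<integral>\<^sup>+p. ennreal ((Dq s \<phi> p)\<^sup>2) \<partial>lborel)
        \<le> (\<integral>\<^sup>+p. indicator K (fst p) * g (snd p - fst p) + indicator K (snd p) * g (fst p - snd p) \<partial>lborel)"
      by (rule nn_integral_mono, rule le)
    also have "\<dots> = (\<integral>\<^sup>+p. indicator K (fst p) * g (snd p - fst p) \<partial>(lborel :: ((real^'n) \<times> (real^'n)) measure))
        + (\<integral>\<^sup>+p. indicator K (snd p) * g (fst p - snd p) \<partial>(lborel :: ((real^'n) \<times> (real^'n)) measure))"
      by (rule nn_integral_add) measurable
    also have "(\<integral>\<^sup>+p. indicator K (fst p) * g (snd p - fst p) \<partial>(lborel :: ((real^'n) \<times> (real^'n)) measure))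
        = (\<integral>\<^sup>+x. \<integral>\<^sup>+y. indicator K x * g (y - x) \<partial>lborel \<partial>lborel)"
      by (subst nn_integral_lborel_pair(1)) simp_all
    also have "(\<integral>\<^sup>+p. indicator K (snd p) * g (fst p - snd p) \<partial>(lborel :: ((real^'n) \<times> (real^'n)) measure))
        = (\<integral>\<^sup>+x. \<integral>\<^sup>+y. indicator K x * g (y - x) \<partial>lborel \<partial>lborel)"
      by (subst nn_integral_lborel_pair(2)) simp_all
    finally show "(\<integral>\<^sup>+p. ennreal ((Dq s \<phi> p)\<^sup>2) \<partial>lborel) < \<infinity>" by (rule le_less_trans) (use part in simp)
  qed measurable
qed

section \<open>The closure of the test functions as a closed subspace\<close>

context
  fixes \<Omega> :: "(real^'n) set" and s :: real
  assumes s: "0 < s" "s < 1"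
begin

lemma tHs_in_Hs: "v \<in> tHs \<Omega> s ==> in_Hs s v"
  by (simp add: tHs_def)

definition emb :: "(real^'n \<Rightarrow> real) \<Rightarrow> (real^'n) lsq \<times> ((real^'n) \<times> (real^'n)) lsq" where
  "emb v = (cls v, cls (Dq s v))"

lemma emb_linear:
  assumes "in_Hs s v" "in_Hs s w"
  shows "emb (\<lambda>x. v x + w x) = emb v + emb w" "emb (\<lambda>x. v x - w x) = emb v - emb w"
    "emb (\<lambda>x. c * v x) = c *\<^sub>R emb v"
  using assms unfolding emb_def by (simp_all add: cls_Dq_linear[OF assms] cls_add cls_diff cls_scale in_Hs_iff)

lemma Hs_norm_emb: "in_Hs s v ==> Hs_norm s v = norm (emb v)"
  unfolding emb_def by (rule Hs_norm_eq)

lemma emb_cong_AE: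
  assumes "AE x in lborel. w x = v x"
  shows "emb w = emb v"
  unfolding emb_def using cls_cong_AE[OF assms] cls_cong_AE[OF Dq_cong_AE[OF assms]] by simp

text \<open>Test functions have finite seminorm, so the difference in the definition is a difference
  of embedded vectors. Approximation by one test function per tolerance is easier to pass to sums
  and limits than an approximating sequence.\<close>

lemma tHs_iff: "v \<in> tHs \<Omega> s \<longleftrightarrow> in_Hs s v \<and> (\<forall>e>0. \<exists>\<phi>. test_fn \<Omega> \<phi> \<and> norm (emb \<phi> - emb v) < e)"
proof -
  have n: "Hs_norm s (\<lambda>x. \<phi> x - v x) = norm (emb \<phi> - emb v)" if "in_Hs s v" "test_fn \<Omega> \<phi>" for \<phi> v
    using that test_fn_in_Hs[OF s that(2)] by (simp add: Hs_norm_emb in_Hs_linear emb_linear)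
  show ?thesis
  proof (intro iffI conjI allI impI)
    fix e :: real assume v: "v \<in> tHs \<Omega> s" and e: "0 < e"
    then obtain \<phi> :: "nat \<Rightarrow> real^'n \<Rightarrow> real" where \<phi>: "\<And>k. test_fn \<Omega> (\<phi> k)" "(\<lambda>k. Hs_norm s (\<lambda>x. \<phi> k x - v x)) \<longlonglongrightarrow> 0"
      unfolding tHs_def by blast
    have "\<forall>\<^sub>F k in sequentially. Hs_norm s (\<lambda>x. \<phi> k x - v x) < e" using order_tendstoD(2)[OF \<phi>(2) e] .
    then obtain k where "Hs_norm s (\<lambda>x. \<phi> k x - v x) < e" using eventually_happens by fastforce
    then show "\<exists>\<phi>. test_fn \<Omega> \<phi> \<and> norm (emb \<phi> - emb v) < e"
      using \<phi>(1)[of k] n[OF tHs_in_Hs[OF v] \<phi>(1)[of k]] by auto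
  next
    assume a: "in_Hs s v \<and> (\<forall>e>0. \<exists>\<phi>. test_fn \<Omega> \<phi> \<and> norm (emb \<phi> - emb v) < e)"
    then have "\<exists>\<phi>. test_fn \<Omega> \<phi> \<and> norm (emb \<phi> - emb v) < 1 / (real k + 1)" for k :: nat by simp
    then obtain \<phi> where \<phi>: "\<And>k. test_fn \<Omega> (\<phi> k)" "\<And>k. norm (emb (\<phi> k) - emb v) < 1 / (real k + 1)" by metis
    have inv: "(\<lambda>n. 1 / (real n + 1)) \<longlonglongrightarrow> 0"
      using LIMSEQ_inverse_real_of_nat by (simp add: inverse_eq_divide add.commute)
    have "(\<lambda>k. norm (emb (\<phi> k) - emb v)) \<longlonglongrightarrow> 0" by (rule tendsto_sandwich[OF _ _ tendsto_const inv])
        (intro always_eventually allI norm_ge_zero, intro always_eventually allI less_imp_le \<phi>(2))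
    then have "(\<lambda>k. Hs_norm s (\<lambda>x. \<phi> k x - v x)) \<longlonglongrightarrow> 0" using n a \<phi>(1) by simp
    then show "v \<in> tHs \<Omega> s" unfolding tHs_def using a \<phi>(1) by blast
  qed (simp add: tHs_in_Hs)
qed

lemma tHs_cong_AE:
  assumes "v \<in> tHs \<Omega> s" "AE x in lborel. w x = v x"
  shows "w \<in> tHs \<Omega> s"
  using assms in_Hs_cong_AE[OF _ assms(2)] unfolding tHs_iff emb_cong_AE[OF assms(2)] by blast

lemma test_fn_0: "test_fn \<Omega> (\<lambda>x. 0)"
  unfolding test_fn_def using flat_poly_smooth[OF flat_poly.const[of 0]] by simp

lemma tHs_linear:
  assumes v: "v \<in> tHs \<Omega> s" and w: "w \<in> tHs \<Omega> s"
  shows "(\<lambda>x. v x + w x) \<in> tHs \<Omega> s" "(\<lambda>x. c * v x) \<in> tHs \<Omega> s"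
proof -
  have Hs: "in_Hs s v" "in_Hs s w" using v w by (simp_all add: tHs_in_Hs)
  show "(\<lambda>x. v x + w x) \<in> tHs \<Omega> s" unfolding tHs_iff
  proof (intro conjI allI impI)
    fix e :: real assume "0 < e"
    then obtain \<phi> \<psi> where \<phi>: "test_fn \<Omega> \<phi>" "norm (emb \<phi> - emb v) < e / 2" and \<psi>: "test_fn \<Omega> \<psi>" "norm (emb \<psi> - emb w) < e / 2"
      using v w unfolding tHs_iff by (metis half_gt_zero)
    have "emb (\<lambda>x. \<phi> x + \<psi> x) - emb (\<lambda>x. v x + w x) = (emb \<phi> - emb v) + (emb \<psi> - emb w)"
      using emb_linear(1)[OF test_fn_in_Hs[OF s \<phi>(1)] test_fn_in_Hs[OF s \<psi>(1)]] emb_linear(1)[OF Hs] by simp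
    then have "norm (emb (\<lambda>x. \<phi> x + \<psi> x) - emb (\<lambda>x. v x + w x)) < e"
      using norm_triangle_lt[of "emb \<phi> - emb v" "emb \<psi> - emb w" e] \<phi>(2) \<psi>(2) by simp
    then show "\<exists>\<phi>. test_fn \<Omega> \<phi> \<and> norm (emb \<phi> - emb (\<lambda>x. v x + w x)) < e" using test_fn_add[OF \<phi>(1) \<psi>(1)] by blast
  qed (rule in_Hs_linear(1)[OF Hs])
  show "(\<lambda>x. c * v x) \<in> tHs \<Omega> s" unfolding tHs_iff
  proof (intro conjI allI impI)
    fix e :: real assume e: "0 < e"
    have "0 < e / (\<bar>c\<bar> + 1)" using e by (simp add: divide_pos_pos)
    then obtain \<phi> where \<phi>: "test_fn \<Omega> \<phi>" "norm (emb \<phi> - emb v) < e / (\<bar>c\<bar> + 1)"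
      using v unfolding tHs_iff by blast
    have "norm (emb (\<lambda>x. c * \<phi> x) - emb (\<lambda>x. c * v x)) = norm (c *\<^sub>R (emb \<phi> - emb v))"
      using emb_linear(3)[OF test_fn_in_Hs[OF s \<phi>(1)] test_fn_in_Hs[OF s \<phi>(1)], of c] emb_linear(3)[OF Hs, of c]
      by (simp add: scaleR_diff_right)
    also have "\<dots> \<le> (\<bar>c\<bar> + 1) * norm (emb \<phi> - emb v)" by (simp add: mult_right_mono)
    also have "\<dots> < e" using \<phi>(2) by (simp add: field_simps)
    finally show "\<exists>\<phi>. test_fn \<Omega> \<phi> \<and> norm (emb \<phi> - emb (\<lambda>x. c * v x)) < e" using test_fn_scale[OF \<phi>(1)] by blast
  qed (rule in_Hs_linear(3)[OF Hs])
qed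

lemma zero_tHs: "(\<lambda>x. 0) \<in> tHs \<Omega> s"
  unfolding tHs_iff using test_fn_in_Hs[OF s test_fn_0] test_fn_0 by auto

definition Vsp :: "((real^'n) lsq \<times> ((real^'n) \<times> (real^'n)) lsq) set" where
  "Vsp = emb ` tHs \<Omega> s"

lemma subspace_Vsp: "subspace Vsp"
proof (rule subspaceI)
  have "emb (\<lambda>x. 0) = 0" using emb_linear(3)[OF tHs_in_Hs[OF zero_tHs] tHs_in_Hs[OF zero_tHs], of 0] by simp
  then show "0 \<in> Vsp" unfolding Vsp_def using imageI[OF zero_tHs, of "emb"] by simp
  show "x + y \<in> Vsp" if xy: "x \<in> Vsp" "y \<in> Vsp" for x y
  proof -
    obtain v w where vw: "v \<in> tHs \<Omega> s" "w \<in> tHs \<Omega> s" "x = emb v" "y = emb w" using xy unfolding Vsp_def by blast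
    have eq: "x + y = emb (\<lambda>x. v x + w x)"
      unfolding vw(3,4) by (rule emb_linear(1)[OF tHs_in_Hs[OF vw(1)] tHs_in_Hs[OF vw(2)], symmetric])
    show ?thesis unfolding eq Vsp_def by (rule imageI[OF tHs_linear(1)[OF vw(1,2)]])
  qed
  show "c *\<^sub>R x \<in> Vsp" if x: "x \<in> Vsp" for c x
  proof -
    obtain v where v: "v \<in> tHs \<Omega> s" "x = emb v" using x unfolding Vsp_def by blast
    have eq: "c *\<^sub>R x = emb (\<lambda>x. c * v x)"
      unfolding v(2) by (rule emb_linear(3)[OF tHs_in_Hs[OF v(1)] tHs_in_Hs[OF v(1)], symmetric])
    show ?thesis unfolding eq Vsp_def by (rule imageI[OF tHs_linear(2)[OF v(1) v(1)]])
  qed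
qed

text \<open>Taking the difference quotient has a closed graph: along a subsequence both components
  converge almost everywhere, so the second limit is the quotient of the first. The limit is then
  approximated by test functions through the members of the sequence.\<close>

lemma closed_Vsp: "closed Vsp"
  unfolding closed_sequential_limits
proof (intro allI impI)
  fix x and l :: "(real^'n) lsq \<times> ((real^'n) \<times> (real^'n)) lsq"
  assume a: "(\<forall>n. x n \<in> Vsp) \<and> x \<longlonglongrightarrow> l"
  then have "\<forall>n. \<exists>v. v \<in> tHs \<Omega> s \<and> x n = emb v" unfolding Vsp_def by blast
  then obtain v where v: "\<And>n. v n \<in> tHs \<Omega> s" "\<And>n. x n = emb (v n)" by metis
  have lim: "x \<longlonglongrightarrow> l" using a by blast
  define w where "w = fn (fst l)"
  have "(\<lambda>n. fst (x n)) \<longlonglongrightarrow> fst l" using lim by (rule tendsto_fst)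
  then obtain r where r: "strict_mono r" "AE z in lborel. (\<lambda>n. fn (fst (x (r n))) z) \<longlonglongrightarrow> w z"
    using lsq_tendsto_AE_subseq unfolding w_def by blast
  have "(\<lambda>n. snd (x (r n))) \<longlonglongrightarrow> snd l" using LIMSEQ_subseq_LIMSEQ[OF tendsto_snd[OF lim] r(1)] by (simp add: o_def)
  then obtain q where q: "strict_mono q" "AE p in lborel. (\<lambda>n. fn (snd (x (r (q n)))) p) \<longlonglongrightarrow> fn (snd l) p"
    using lsq_tendsto_AE_subseq by blast
  have "AE z in lborel. \<forall>n. fn (fst (x n)) z = v n z" unfolding AE_all_countable
  proof
    fix n show "AE z in lborel. fn (fst (x n)) z = v n z"
      unfolding v(2) emb_def fst_conv using tHs_in_Hs[OF v(1)[of n]] by (intro fn_cls) (simp add: in_Hs_iff)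
  qed
  then have vw: "AE z in lborel. (\<lambda>n. v (r n) z) \<longlonglongrightarrow> w z" using r(2) by eventually_elim simp
  have "AE p in lborel. \<forall>n. fn (snd (x n)) p = Dq s (v n) p" unfolding AE_all_countable
  proof
    fix n show "AE p in lborel. fn (snd (x n)) p = Dq s (v n) p"
      unfolding v(2) emb_def snd_conv using tHs_in_Hs[OF v(1)[of n]] by (intro fn_cls) (simp add: in_Hs_iff)
  qed
  then have D: "AE p in lborel. fn (snd l) p = Dq s w p"
    using q(2) AE_lborel_fst_snd(1)[OF vw] AE_lborel_fst_snd(2)[OF vw]
  proof eventually_elim
    case (elim p)
    have "(\<lambda>n. Dq s (v (r n)) p) \<longlonglongrightarrow> Dq s w p" unfolding Dq_def using tendsto_divide_zero
      by (cases "fst p = snd p") (use elim in \<open>auto intro!: tendsto_intros\<close>)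
    from LIMSEQ_subseq_LIMSEQ[OF this q(1)] have "(\<lambda>n. Dq s (v (r (q n))) p) \<longlonglongrightarrow> Dq s w p" by (simp add: o_def)
    moreover have "(\<lambda>n. Dq s (v (r (q n))) p) \<longlonglongrightarrow> fn (snd l) p" using elim by simp
    ultimately show ?case using LIMSEQ_unique by blast
  qed
  have D': "AE p in lborel. Dq s w p = fn (snd l) p" using D by eventually_elim simp
  have Hs: "in_Hs s w"
    unfolding in_Hs_iff using sqi_cong_AE[OF fn_sqi D'] fn_sqi[of "fst l"] by (simp add: w_def)
  have ew: "emb w = l" unfolding emb_def using cls_cong_AE[OF D'] by (simp add: w_def)
  have "w \<in> tHs \<Omega> s" unfolding tHs_iff
  proof (intro conjI allI impI Hs)
    fix e :: real assume e: "0 < e"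
    obtain n where n: "norm (x n - l) < e / 2" using LIMSEQ_D[OF lim, of "e / 2"] e by auto
    obtain \<phi> where \<phi>: "test_fn \<Omega> \<phi>" "norm (emb \<phi> - emb (v n)) < e / 2"
      using v(1)[of n, unfolded tHs_iff] half_gt_zero[OF e] by blast
    have eq: "emb \<phi> - emb w = (emb \<phi> - emb (v n)) + (x n - l)" by (simp add: v(2) ew)
    have "norm (emb \<phi> - emb w) < e" unfolding eq by (rule norm_triangle_lt) (use \<phi>(2) n in simp)
    then show "\<exists>\<phi>. test_fn \<Omega> \<phi> \<and> norm (emb \<phi> - emb w) < e" using \<phi>(1) by blast
  qed
  then show "l \<in> Vsp" unfolding Vsp_def using ew by blast
qed

lemma Vsp_iff: "x \<in> Vsp \<longleftrightarrow> fn (fst x) \<in> tHs \<Omega> s \<and> snd x = cls (Dq s (fn (fst x)))"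
proof
  assume "x \<in> Vsp"
  then obtain v where v: "v \<in> tHs \<Omega> s" "x = emb v" unfolding Vsp_def by blast
  have ae: "AE z in lborel. fn (fst x) z = v z"
    unfolding v(2) emb_def fst_conv using tHs_in_Hs[OF v(1)] by (intro fn_cls) (simp add: in_Hs_iff)
  show "fn (fst x) \<in> tHs \<Omega> s \<and> snd x = cls (Dq s (fn (fst x)))"
    using tHs_cong_AE[OF v(1) ae] emb_cong_AE[OF ae] v(2) by (simp add: emb_def)
next
  assume a: "fn (fst x) \<in> tHs \<Omega> s \<and> snd x = cls (Dq s (fn (fst x)))"
  then have "x = emb (fn (fst x))" by (simp add: emb_def prod_eq_iff)
  then show "x \<in> Vsp" unfolding Vsp_def using a by blast
qed

text \<open>Restricting to the complement of \<open>\<Omega>\<close> annihilates the approximating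
  test functions, so the part of \<open>v\<close> there is no larger than the approximation
  error.\<close>

lemma tHs_outside:
  assumes "v \<in> tHs \<Omega> s" and \<Omega>: "\<Omega> \<in> sets borel"
  shows "AE x in lborel. x \<notin> \<Omega> \<longrightarrow> v x = 0"
proof -
  have Hs: "in_Hs s v" using assms by (simp add: tHs_in_Hs)
  then have vm: "sqi v" by (simp add: in_Hs_iff)
  define z where "z = cls (\<lambda>x. indicator (- \<Omega>) x * v x)"
  have "- \<Omega> \<in> sets borel" using \<Omega> by auto
  then have "- \<Omega> \<in> sets lebesgue" by (intro sets_completionI_sets) simp
  then have m: "(\<lambda>x. indicator (- \<Omega>) x * v x) \<in> borel_measurable lebesgue"
    using vm unfolding sqi_def by (intro borel_measurable_times) auto
  have small: "(\<integral>\<^sup>+x. ennreal ((indicator (- \<Omega>) x * v x)\<^sup>2) \<partial>lborel) \<le> ennreal (e\<^sup>2)" if e: "0 < e" for e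
  proof -
    obtain \<phi> where \<phi>: "test_fn \<Omega> \<phi>" "norm (emb \<phi> - emb v) < e" using assms e unfolding tHs_iff by blast
    have \<phi>s: "sqi \<phi>" by (rule test_fn_sqi[OF \<phi>(1)])
    have "norm (cls \<phi> - cls v) \<le> e"
      using norm_fst_le[of "cls \<phi> - cls v" "cls (Dq s \<phi>) - cls (Dq s v)"] \<phi>(2) by (simp add: emb_def)
    have "(\<integral>\<^sup>+x. ennreal ((indicator (- \<Omega>) x * v x)\<^sup>2) \<partial>lborel) \<le> (\<integral>\<^sup>+x. ennreal ((\<phi> x - v x)\<^sup>2) \<partial>lborel)"
      by (rule nn_integral_mono) (use test_fn_outside[OF \<phi>(1)] in \<open>auto split: split_indicator\<close>)
    also have "\<dots> = ennreal ((norm (cls \<phi> - cls v))\<^sup>2)"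
      unfolding cls_diff[OF \<phi>s vm, symmetric] by (rule norm_cls_nn[symmetric]) (rule sqi_diff[OF \<phi>s vm])
    also have "\<dots> \<le> ennreal (e\<^sup>2)" using \<open>norm (cls \<phi> - cls v) \<le> e\<close> by (intro ennreal_leI power_mono) auto
    finally show ?thesis .
  qed
  have sq: "sqi (\<lambda>x. indicator (- \<Omega>) x * v x)" unfolding sqi_def using m le_less_trans[OF small[of 1]] by simp
  have "(norm z)\<^sup>2 \<le> e\<^sup>2" if "0 < e" for e
    using small[OF that] unfolding z_def norm_cls_nn[OF sq, symmetric] by simp
  note zsq = this
  have ze: "norm z \<le> e" if "0 < e" for e by (rule power2_le_imp_le[OF zsq[OF that]]) (use that in simp)
  have "norm z \<le> 0" by (rule field_le_epsilon) (use ze in simp)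
  then have z0: "z = 0" by simp
  have "AE x in lborel. fn z x = indicator (- \<Omega>) x * v x" unfolding z_def by (rule fn_cls[OF sq])
  then show ?thesis unfolding z0 using fn_zero by eventually_elim (auto split: split_indicator_asm)
qed

text \<open>Elements of the space vanish on a ball \<open>S\<close> of radius \<open>R\<close>
  placed beyond \<open>\<Omega>\<close>. For \<open>x\<close> in \<open>\<Omega>\<close> and
  \<open>z\<close> in \<open>S\<close> one has \<open>|x - z| \<le> 4 R\<close>, so the squared
  quotient is at least the square of the value at \<open>x\<close> divided by
  \<open>(4 R)^N\<close>. Integrating over \<open>z\<close> in \<open>S\<close> gives the estimate
  with \<open>c = |S| / (4 R)^N\<close>.\<close>

lemma Vsp_poincare:
  assumes \<Omega>: "open \<Omega>" "bounded \<Omega>"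
  shows "\<exists>P\<ge>0. \<forall>v\<in>Vsp. norm (fst v) \<le> P * norm (snd v)"
proof -
  obtain R where R: "0 < R" "\<Omega> \<subseteq> ball 0 R" using bounded_subset_ballD[OF \<Omega>(2), of 0] by auto
  obtain e :: "real^'n" where e: "norm e = 1" using vector_choose_size[of 1] by auto
  define S where "S = ball ((2 * R) *\<^sub>R e) R"
  have dS: "z \<notin> \<Omega>" if "z \<in> S" for z
  proof
    assume "z \<in> \<Omega>"
    then have "norm z < R" using R(2) by auto
    moreover have "norm ((2 * R) *\<^sub>R e - z) < R" using that unfolding S_def by (simp add: dist_norm)
    moreover have "norm ((2 * R) *\<^sub>R e) \<le> norm ((2 * R) *\<^sub>R e - z) + norm z" using norm_triangle_ineq[of "(2 * R) *\<^sub>R e - z" z] by simp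
    ultimately show False using e R(1) by simp
  qed
  have near: "norm (x - z) \<le> 4 * R" if "x \<in> \<Omega>" "z \<in> S" for x z
  proof -
    have "norm x < R" using R(2) that by auto
    moreover have "norm ((2 * R) *\<^sub>R e - z) < R" using that unfolding S_def by (simp add: dist_norm)
    moreover have "norm (x - z) \<le> norm (x - (2 * R) *\<^sub>R e) + norm ((2 * R) *\<^sub>R e - z)"
      using norm_triangle_ineq[of "x - (2 * R) *\<^sub>R e" "(2 * R) *\<^sub>R e - z"] by simp
    moreover have "norm (x - (2 * R) *\<^sub>R e) \<le> norm x + 2 * R" using norm_triangle_ineq4[of x "(2 * R) *\<^sub>R e"] e R(1) by simp
    ultimately show ?thesis by simp
  qed
  define m where "m = measure lborel S"
  have m: "0 < m" "emeasure lborel S = ennreal m"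
  proof -
    show "0 < m" using content_ball_pos[OF R(1)] unfolding m_def S_def .
    show "emeasure lborel S = ennreal m"
      unfolding m_def S_def by (rule emeasure_eq_ennreal_measure) (use emeasure_lborel_ball_finite in \<open>simp add: less_top\<close>)
  qed
  define N where "N = real CARD('n) + 2 * s"
  have N: "0 < N" unfolding N_def using s by (simp add: add_nonneg_pos)
  define c where "c = m / (4 * R) powr N"
  have c: "0 < c" unfolding c_def using m R(1) by simp
  have key: "norm (fst v) \<le> (1 / sqrt c) * norm (snd v)" if v: "v \<in> Vsp" for v
  proof -
    define f where "f = fn (fst v)"
    have f: "f \<in> tHs \<Omega> s" "snd v = cls (Dq s f)" using v unfolding Vsp_iff f_def by auto
    have [measurable]: "f \<in> borel_measurable borel" unfolding f_def by measurable
    have [measurable]: "\<Omega> \<in> sets borel" "S \<in> sets borel" using \<Omega>(1) by (auto simp: S_def)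
    have out: "AE x in lborel. x \<notin> \<Omega> \<longrightarrow> f x = 0" by (rule tHs_outside[OF f(1)]) measurable
    have sD: "sqi (Dq s f)" using tHs_in_Hs[OF f(1)] by (simp add: in_Hs_iff)
    have "ennreal c * ennreal ((norm (fst v))\<^sup>2) = ennreal (1 / (4 * R) powr N) * ennreal m * ennreal ((norm (fst v))\<^sup>2)"
      unfolding c_def using m(1) by (simp add: ennreal_mult[symmetric])
    also have "\<dots> = ennreal (1 / (4 * R) powr N) * (\<integral>\<^sup>+x. ennreal ((f x)\<^sup>2) * emeasure lborel S \<partial>lborel)"
      unfolding norm_sq_lsq_nn f_def m(2) by (subst nn_integral_multc) (simp_all add: mult_ac)
    also have "\<dots> = ennreal (1 / (4 * R) powr N) * (\<integral>\<^sup>+x. \<integral>\<^sup>+z. ennreal ((f x)\<^sup>2) * indicator S z \<partial>lborel \<partial>lborel)"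
      by (simp add: nn_integral_cmult)
    also have "\<dots> = (\<integral>\<^sup>+x. \<integral>\<^sup>+z. ennreal (1 / (4 * R) powr N) * (ennreal ((f x)\<^sup>2) * indicator S z) \<partial>lborel \<partial>lborel)"
      by (subst nn_integral_cmult[symmetric], measurable) (intro nn_integral_cong nn_integral_cmult[symmetric], measurable)
    also have "\<dots> \<le> (\<integral>\<^sup>+x. \<integral>\<^sup>+z. ennreal ((Dq s f (x, z))\<^sup>2) \<partial>lborel \<partial>lborel)"
    proof (rule nn_integral_mono_AE, use out in eventually_elim)
      case (elim x)
      show ?case
      proof (rule nn_integral_mono_AE, use out in eventually_elim)
        case (elim z)
        show ?case
        proof (cases "z \<in> S \<and> x \<in> \<Omega>")
          case True
          then have fz: "f z = 0" using elim dS by blast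
          have "z \<noteq> x" using dS True by blast
          then have "norm (x - z) powr N \<le> (4 * R) powr N" using near True N by (intro powr_mono2) auto
          moreover have "0 < norm (x - z) powr N" using \<open>z \<noteq> x\<close> by simp
          ultimately have "1 / (4 * R) powr N * (f x)\<^sup>2 \<le> (f x)\<^sup>2 / norm (x - z) powr N" by (simp add: frac_le)
          then show ?thesis using True by (simp add: Dq_sq fz N_def ennreal_mult[symmetric] ennreal_leI)
        next
          case False
          then show ?thesis using \<open>x \<notin> \<Omega> \<longrightarrow> f x = 0\<close> by (auto simp: indicator_def)
        qed
      qed
    qed
    also have "\<dots> = (\<integral>\<^sup>+p. ennreal ((Dq s f p)\<^sup>2) \<partial>lborel)"
      by (rule nn_integral_lborel_pair(1)[symmetric]) measurable
    also have "\<dots> = ennreal ((norm (snd v))\<^sup>2)" unfolding f(2) by (rule norm_cls_nn[OF sD, symmetric])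
    finally have "c * (norm (fst v))\<^sup>2 \<le> (norm (snd v))\<^sup>2" using c by (simp add: ennreal_mult[symmetric])
    then have "(norm (fst v))\<^sup>2 \<le> ((1 / sqrt c) * norm (snd v))\<^sup>2"
      using c by (simp add: power_mult_distrib power_divide field_simps)
    then show ?thesis by (rule power2_le_imp_le) (use c in simp)
  qed
  show ?thesis by (rule exI[of _ "1 / sqrt c"]) (use key c in auto)
qed

end

section \<open>Functions on the space time cylinder\<close>

lemma lebesgue_integral_eq_lborel:
  fixes f g :: "'a::euclidean_space \<Rightarrow> real"
  assumes f: "f \<in> borel_measurable borel" and eq: "AE x in lborel. g x = f x"
  shows "(LINT x|lebesgue. g x) = (LINT x|lborel. f x)"
proof -
  have fl: "f \<in> borel_measurable lebesgue" using f by (auto intro: measurable_completion)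
  have "AE x in lborel. f x = g x" using eq by eventually_elim simp
  then have gl: "g \<in> borel_measurable lebesgue" by (rule lebesgue_measurable_cong_AE[OF fl])
  have "(LINT x|lebesgue. g x) = (LINT x|lebesgue. f x)"
    by (rule integral_cong_AE[OF gl fl]) (use eq in \<open>simp add: AE_completion_iff\<close>)
  also have "\<dots> = (LINT x|lborel. f x)" by (rule integral_completion) (use f in simp)
  finally show ?thesis .
qed

text \<open>Extension by zero from the cylinder to the whole of space time, as a class;
  \<open>oe\<close> does the same for \<open>\<Omega>\<close>. The L^2 spaces of the problem thereby
  sit inside spaces over full Euclidean space.\<close>

definition qe :: "real \<Rightarrow> (real^'n) set \<Rightarrow> (real \<Rightarrow> real^'n \<Rightarrow> real) \<Rightarrow> (real \<times> (real^'n)) lsq" where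
  "qe T \<Omega> z = cls (\<lambda>p. indicator (cyl T \<Omega>) p * z (fst p) (snd p))"

definition oe :: "(real^'n) set \<Rightarrow> (real^'n \<Rightarrow> real) \<Rightarrow> (real^'n) lsq" where
  "oe \<Omega> v = cls (\<lambda>x. indicator \<Omega> x * v x)"

lemma indicator_sq_ennreal: "ennreal ((indicator A x * y)\<^sup>2) = ennreal (y\<^sup>2) * indicator A x"
  by (auto split: split_indicator)

lemma in_L2Q_iff: "in_L2Q T \<Omega> z \<longleftrightarrow> sqi (\<lambda>p. indicator (cyl T \<Omega>) p * z (fst p) (snd p))"
  unfolding in_L2Q_def sqi_def set_borel_measurable_def nn_integral_completion indicator_sq_ennreal by simp

lemma in_L2_Omega_iff: "in_L2_Omega \<Omega> v \<longleftrightarrow> sqi (\<lambda>x. indicator \<Omega> x * v x)"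
  unfolding in_L2_Omega_def sqi_def set_borel_measurable_def nn_integral_completion indicator_sq_ennreal by simp

lemma L2Q_norm_eq:
  assumes "in_L2Q T \<Omega> z"
  shows "L2Q_norm T \<Omega> z = norm (qe T \<Omega> z)"
proof -
  have "(\<integral>\<^sup>+p\<in>cyl T \<Omega>. ennreal ((z (fst p) (snd p))\<^sup>2) \<partial>lebesgue) = ennreal ((norm (qe T \<Omega> z))\<^sup>2)"
    unfolding qe_def norm_cls_nn[OF assms[unfolded in_L2Q_iff]] nn_integral_completion indicator_sq_ennreal ..
  then show ?thesis unfolding L2Q_norm_def by simp
qed

lemma L2_Omega_norm_eq:
  assumes "in_L2_Omega \<Omega> v"
  shows "L2_Omega_norm \<Omega> v = norm (oe \<Omega> v)"
proof -
  have "(\<integral>\<^sup>+x\<in>\<Omega>. ennreal ((v x)\<^sup>2) \<partial>lebesgue) = ennreal ((norm (oe \<Omega> v))\<^sup>2)"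
    unfolding oe_def norm_cls_nn[OF assms[unfolded in_L2_Omega_iff]] nn_integral_completion indicator_sq_ennreal ..
  then show ?thesis unfolding L2_Omega_norm_def by simp
qed

lemma fn_qe: "in_L2Q T \<Omega> z ==> AE p in lborel. fn (qe T \<Omega> z) p = indicator (cyl T \<Omega>) p * z (fst p) (snd p)"
  unfolding qe_def in_L2Q_iff by (rule fn_cls)

lemma slice_qe:
  assumes z: "in_L2Q T \<Omega> z"
  shows "AE t in lborel. slice (qe T \<Omega> z) t = (if t \<in> {0<..<T} then oe \<Omega> (z t) else 0)
    \<and> (t \<in> {0<..<T} \<longrightarrow> in_L2_Omega \<Omega> (z t))"
  using AE_lborel_pair[OF fn_qe[OF z]] AE_slice_sqi[of "qe T \<Omega> z"]
proof eventually_elim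
  case (elim t)
  have c: "slice (qe T \<Omega> z) t = cls (\<lambda>x. indicator (cyl T \<Omega>) (t, x) * z t x)"
    unfolding slice_def by (rule cls_cong_AE) (use elim(1) in simp)
  have q: "sqi (\<lambda>x. indicator (cyl T \<Omega>) (t, x) * z t x)"
    using sqi_cong[of "\<lambda>\<xi>. fn (qe T \<Omega> z) (t, \<xi>)" "\<lambda>x. indicator (cyl T \<Omega>) (t, x) * z t x"] elim by simp
  show ?case
  proof (cases "t \<in> {0<..<T}")
    case True
    then have "indicator (cyl T \<Omega>) (t, x) = (indicator \<Omega> x :: real)" for x by (auto simp: cyl_def split: split_indicator)
    then show ?thesis using True c q by (simp add: oe_def in_L2_Omega_iff)
  next
    case False
    then have "indicator (cyl T \<Omega>) (t, x) = (0 :: real)" for x by (auto simp: cyl_def split: split_indicator)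
    then show ?thesis using False c unfolding zero_lsq_def by auto
  qed
qed

lemma qe_linear:
  assumes "in_L2Q T \<Omega> y" "in_L2Q T \<Omega> z"
  shows "in_L2Q T \<Omega> (\<lambda>t x. y t x + z t x)" "qe T \<Omega> (\<lambda>t x. y t x + z t x) = qe T \<Omega> y + qe T \<Omega> z"
    "in_L2Q T \<Omega> (\<lambda>t x. y t x - z t x)" "qe T \<Omega> (\<lambda>t x. y t x - z t x) = qe T \<Omega> y - qe T \<Omega> z"
  using assms sqi_add[OF assms[unfolded in_L2Q_iff]] sqi_diff[OF assms[unfolded in_L2Q_iff]]
    cls_add[OF assms[unfolded in_L2Q_iff]] cls_diff[OF assms[unfolded in_L2Q_iff]]
  unfolding in_L2Q_iff qe_def by (simp_all add: distrib_left right_diff_distrib)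

lemma oe_linear:
  assumes "in_L2_Omega \<Omega> y" "in_L2_Omega \<Omega> z"
  shows "in_L2_Omega \<Omega> (\<lambda>x. y x + z x)" "oe \<Omega> (\<lambda>x. y x + z x) = oe \<Omega> y + oe \<Omega> z"
    "in_L2_Omega \<Omega> (\<lambda>x. y x - z x)" "oe \<Omega> (\<lambda>x. y x - z x) = oe \<Omega> y - oe \<Omega> z"
  using assms sqi_add[OF assms[unfolded in_L2_Omega_iff]] sqi_diff[OF assms[unfolded in_L2_Omega_iff]]
    cls_add[OF assms[unfolded in_L2_Omega_iff]] cls_diff[OF assms[unfolded in_L2_Omega_iff]]
  unfolding in_L2_Omega_iff oe_def by (simp_all add: distrib_left right_diff_distrib)

lemma set_integral_oe:
  assumes "in_L2_Omega \<Omega> v" "sqi \<phi>"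
  shows "(LINT x:\<Omega>|lebesgue. v x * \<phi> x) = oe \<Omega> v \<bullet> cls \<phi>"
  using assms unfolding in_L2_Omega_iff oe_def by (simp add: inner_cls set_lebesgue_integral_def mult.assoc)

lemma oe_cong_AE:
  assumes "AE x in lborel. x \<in> \<Omega> \<longrightarrow> v x = w x"
  shows "oe \<Omega> v = oe \<Omega> w" and "in_L2_Omega \<Omega> w ==> in_L2_Omega \<Omega> v"
proof -
  have ae: "AE x in lborel. indicator \<Omega> x * v x = indicator \<Omega> x * w x"
    using assms by eventually_elim (auto split: split_indicator)
  show "oe \<Omega> v = oe \<Omega> w" unfolding oe_def by (rule cls_cong_AE[OF ae])
  show "in_L2_Omega \<Omega> w ==> in_L2_Omega \<Omega> v" unfolding in_L2_Omega_iff by (rule sqi_cong_AE[OF _ ae])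
qed

lemma cyl_borel: "\<Omega> \<in> sets borel ==> cyl T \<Omega> \<in> sets borel"
proof -
  assume \<Omega>: "\<Omega> \<in> sets borel"
  have "{0<..<T} \<times> \<Omega> \<in> sets (borel \<Otimes>\<^sub>M borel)" by (rule pair_measureI) (use \<Omega> in auto)
  then show ?thesis unfolding cyl_def by (simp only: borel_prod)
qed

lemma in_L2Q_fn:
  assumes \<Omega>: "\<Omega> \<in> sets borel"
  shows "in_L2Q T \<Omega> (\<lambda>t x. fn D (t, x))" "L2Q_norm T \<Omega> (\<lambda>t x. fn D (t, x)) \<le> norm D"
proof -
  have [measurable]: "cyl T \<Omega> \<in> sets borel" by (rule cyl_borel[OF \<Omega>])
  have le: "(\<integral>\<^sup>+p. ennreal ((indicator (cyl T \<Omega>) p * fn D (fst p, snd p))\<^sup>2) \<partial>lborel) \<le> ennreal ((norm D)\<^sup>2)"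
    unfolding norm_sq_lsq_nn by (rule nn_integral_mono) (auto split: split_indicator)
  show i: "in_L2Q T \<Omega> (\<lambda>t x. fn D (t, x))"
    unfolding in_L2Q_iff by (rule sqi_borelI, measurable) (rule le_less_trans[OF le], simp)
  have "(norm (qe T \<Omega> (\<lambda>t x. fn D (t, x))))\<^sup>2 \<le> (norm D)\<^sup>2"
    using le unfolding qe_def norm_cls_nn[OF i[unfolded in_L2Q_iff], symmetric] by simp
  then show "L2Q_norm T \<Omega> (\<lambda>t x. fn D (t, x)) \<le> norm D"
    unfolding L2Q_norm_eq[OF i] by (rule power2_le_imp_le) simp
qed

lemma sqi_tensor:
  fixes \<psi> :: "real \<Rightarrow> real" and \<phi> :: "'b::euclidean_space \<Rightarrow> real"
  assumes "sqi \<psi>" "\<psi> \<in> borel_measurable borel" "sqi \<phi>"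
  shows "sqi (\<lambda>p. \<psi> (fst p) * \<phi> (snd p))"
proof (rule sqi_cong_AE[OF sqi_tens[OF assms(1,2), of "cls \<phi>"]])
  show "AE p in lborel. \<psi> (fst p) * \<phi> (snd p) = \<psi> (fst p) * fn (cls \<phi>) (snd p)"
    using AE_lborel_fst_snd(2)[OF fn_cls[OF assms(3)]] by eventually_elim simp
qed

lemma wdt_if_has_dt_L2:
  assumes a: "in_L2Q T \<Omega> a" and da: "in_L2Q T \<Omega> da" and dt: "has_dt_L2 T \<Omega> a da"
  shows "wdt T \<Omega> (qe T \<Omega> a) (qe T \<Omega> da)"
  unfolding wdt_def
proof (intro allI impI)
  fix \<psi> \<phi> assume \<psi>: "test_fn {0<..<T} \<psi>" and \<phi>: "test_fn \<Omega> \<phi>"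
  have i: "qe T \<Omega> z \<bullet> tens \<theta> (cls \<phi>) = (LINT p:cyl T \<Omega>|lebesgue. z (fst p) (snd p) * \<theta> (fst p) * \<phi> (snd p))"
    if "in_L2Q T \<Omega> z" "test_fn {0<..<T} \<theta>" for z \<theta>
    unfolding tens_cls[OF test_fn_sqi[OF \<phi>]] qe_def
      inner_cls[OF that(1)[unfolded in_L2Q_iff] sqi_tensor[OF test_fn_sqi[OF that(2)] test_fn_borel[OF that(2)] test_fn_sqi[OF \<phi>]]]
    by (simp add: set_lebesgue_integral_def mult.assoc)
  show "qe T \<Omega> a \<bullet> tens (deriv \<psi>) (cls \<phi>) = - (qe T \<Omega> da \<bullet> tens \<psi> (cls \<phi>))"
    unfolding i[OF a test_fn_deriv[OF \<psi>]] i[OF da \<psi>] using dt \<psi> \<phi> unfolding has_dt_L2_def by simp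
qed

lemma has_dt_L2_if_wdt:
  assumes z: "in_L2Q T \<Omega> z" and w: "wdt T \<Omega> (qe T \<Omega> z) D"
  shows "has_dt_L2 T \<Omega> z (\<lambda>t x. fn D (t, x))"
  unfolding has_dt_L2_def
proof (intro allI impI)
  fix \<psi> \<phi> assume \<psi>: "test_fn {0<..<T} \<psi>" and \<phi>: "test_fn \<Omega> \<phi>"
  have [measurable]: "\<psi> \<in> borel_measurable borel" "\<phi> \<in> borel_measurable borel" using test_fn_borel[OF \<psi>] test_fn_borel[OF \<phi>] .
  have s: "sqi (\<lambda>p. \<psi> (fst p) * \<phi> (snd p))"
    by (rule sqi_tensor[OF test_fn_sqi[OF \<psi>] test_fn_borel[OF \<psi>] test_fn_sqi[OF \<phi>]])
  have s': "sqi (\<lambda>p. deriv \<psi> (fst p) * \<phi> (snd p))"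
    by (rule sqi_tensor[OF test_fn_sqi[OF test_fn_deriv[OF \<psi>]] test_fn_borel[OF test_fn_deriv[OF \<psi>]] test_fn_sqi[OF \<phi>]])
  have 1: "qe T \<Omega> z \<bullet> tens (deriv \<psi>) (cls \<phi>) = (LINT p:cyl T \<Omega>|lebesgue. z (fst p) (snd p) * deriv \<psi> (fst p) * \<phi> (snd p))"
    unfolding tens_cls[OF test_fn_sqi[OF \<phi>]] qe_def inner_cls[OF z[unfolded in_L2Q_iff] s']
    by (simp add: set_lebesgue_integral_def mult.assoc)
  have "(LINT p:cyl T \<Omega>|lebesgue. fn D (fst p, snd p) * \<psi> (fst p) * \<phi> (snd p)) = (LINT p|lborel. fn D p * (\<psi> (fst p) * \<phi> (snd p)))"
    unfolding set_lebesgue_integral_def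
  proof (rule lebesgue_integral_eq_lborel)
    show "AE p in lborel. indicator (cyl T \<Omega>) p *\<^sub>R (fn D (fst p, snd p) * \<psi> (fst p) * \<phi> (snd p)) = fn D p * (\<psi> (fst p) * \<phi> (snd p))"
    proof (rule AE_I2)
      fix p :: "real \<times> (real^'a)"
      show "indicator (cyl T \<Omega>) p *\<^sub>R (fn D (fst p, snd p) * \<psi> (fst p) * \<phi> (snd p)) = fn D p * (\<psi> (fst p) * \<phi> (snd p))"
        using test_fn_outside[OF \<psi>, of "fst p"] test_fn_outside[OF \<phi>, of "snd p"]
        by (cases p) (auto simp: cyl_def split: split_indicator)
    qed
  qed measurable
  also have "\<dots> = D \<bullet> tens \<psi> (cls \<phi>)"
    unfolding tens_cls[OF test_fn_sqi[OF \<phi>]] by (rule inner_fn_cls[OF s, symmetric]) measurable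
  finally show "(LINT p:cyl T \<Omega>|lebesgue. z (fst p) (snd p) * deriv \<psi> (fst p) * \<phi> (snd p)) =
      - (LINT p:cyl T \<Omega>|lebesgue. fn D (fst p, snd p) * \<psi> (fst p) * \<phi> (snd p))"
    using w \<psi> \<phi> 1 unfolding wdt_def by simp
qed

section \<open>The fundamental theorem for weak derivatives of continuous functions\<close>

text \<open>A subset of full measure is dense in the interval, and a continuous function that is
  constant on a dense set is constant.\<close>

lemma continuous_zero_if_AE_zero:
  fixes N :: "real \<Rightarrow> real"
  assumes c: "0 < c" and N: "continuous_on {0..c} N" and ae: "AE t in lborel. t \<in> {0<..<c} \<longrightarrow> N t = 0"
    and t: "t \<in> {0..c}"
  shows "N t = 0"
proof -
  define D where "D = {t \<in> {0<..<c}. N t = 0}"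
  have sub: "closure D \<subseteq> {0..c}" by (rule closure_minimal) (auto simp: D_def)
  have "t \<in> closure D" if t: "t \<in> {0..c}" for t unfolding closure_approachable
  proof (intro allI impI)
    fix e :: real assume e: "0 < e"
    define a where "a = max 0 (t - e)"
    define b where "b = min c (t + e)"
    have ab: "a < b" using t e c unfolding a_def b_def by auto
    show "\<exists>y\<in>D. dist y t < e"
    proof (rule ccontr)
      assume no: "\<not> (\<exists>y\<in>D. dist y t < e)"
      have "AE x in lborel. x \<notin> {a<..<b}" using ae
      proof eventually_elim
        case (elim x)
        show ?case
        proof
          assume x: "x \<in> {a<..<b}"
          then have "x \<in> D" using elim unfolding D_def a_def b_def by auto
          moreover have "dist x t < e" using x unfolding a_def b_def by (auto simp: dist_real_def)
          ultimately show False using no by blast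
        qed
      qed
      then have "emeasure lborel {a<..<b} = 0" by (subst (asm) AE_iff_measurable[of "{a<..<b}"]) auto
      then show False using ab by simp
    qed
  qed
  then have cl: "closure D = {0..c}" using sub by blast
  show ?thesis by (rule continuous_constant_on_closure[of D N 0 t]) (use cl N t in \<open>auto simp: D_def\<close>)
qed

text \<open>The du Bois-Reymond argument for classes is reused by tensoring with a unit vector
  \<open>y0\<close> and pairing with it afterwards. It yields the increment over each step
  \<open>h\<close> at almost every time; the difference \<open>m\<close> of \<open>y\<close> and the
  integral of \<open>G\<close> is continuous, so almost every time becomes every time.\<close>

lemma weak_derivative_FTC:
  fixes y G :: "real \<Rightarrow> real"
  assumes T: "0 < T" and y: "continuous_on {0..T} y" and [measurable]: "G \<in> borel_measurable borel"
    and sG: "sqi (\<lambda>t. indicator {0<..<T} t * G t)"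
    and weak: "\<And>\<psi>. test_fn {0<..<T} \<psi> ==>
      (LINT t|lborel. indicator {0<..<T} t * (y t * deriv \<psi> t)) = - (LINT t|lborel. indicator {0<..<T} t * (G t * \<psi> t))"
    and t: "0 \<le> t1" "t1 \<le> t2" "t2 \<le> T"
  shows "y t2 - y t1 = (LINT \<tau>|lborel. indicator {t1<..<t2} \<tau> * G \<tau>)"
proof -
  define Y where "Y t = indicator {0<..<T} t * y t" for t
  define G' where "G' t = indicator {0<..<T} t * G t" for t
  have Ym [measurable]: "Y \<in> borel_measurable borel"
    using borel_measurable_continuous_on_indicator[of "{0<..<T}" y] continuous_on_subset[OF y, of "{0<..<T}"]
    unfolding Y_def[abs_def] by (auto simp: subset_eq)
  have G'm [measurable]: "G' \<in> borel_measurable borel" unfolding G'_def[abs_def] by measurable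
  have sY: "sqi Y"
  proof -
    have "bounded (y ` {0..T})" by (intro compact_imp_bounded compact_continuous_image y compact_Icc)
    then have "\<exists>B. \<forall>t\<in>{0..T}. \<bar>y t\<bar> \<le> B" unfolding bounded_iff by simp
    then obtain B where B: "\<And>t. t \<in> {0..T} ==> \<bar>y t\<bar> \<le> B" by blast
    have B0: "0 \<le> B" using order_trans[OF abs_ge_zero B[of 0]] T by simp
    have sub: "{t. Y t \<noteq> 0} \<subseteq> {0..T}" unfolding Y_def by (auto split: split_indicator_asm)
    show ?thesis
    proof (rule bounded_compact_support_sqi[OF Ym])
      show "\<bar>Y t\<bar> \<le> B" for t using B[of t] B0 unfolding Y_def by (auto split: split_indicator)
      show "bounded {t. Y t \<noteq> 0}" by (rule bounded_subset[OF bounded_closed_interval sub])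
    qed
  qed
  have sG': "sqi G'" using sG unfolding G'_def[abs_def] .
  define y0 :: "real lsq" where "y0 = cls (indicator {0<..<1})"
  have s0: "sqi (indicator {0<..<1} :: real \<Rightarrow> real)" by (rule bounded_compact_support_sqi[where B = 1])
      (auto intro!: bounded_subset[OF bounded_closed_interval[of 0 1]] split: split_indicator split_indicator_asm)
  have y0: "y0 \<bullet> y0 = 1"
  proof -
    have "y0 \<bullet> y0 = (LINT x|lebesgue. indicator {0<..<1::real} x)" unfolding y0_def inner_cls[OF s0 s0]
      by (rule Bochner_Integration.integral_cong) (auto split: split_indicator)
    then show ?thesis by simp
  qed
  define X where "X = tens Y y0"
  define D where "D = tens G' y0"
  have pair: "tens F y0 \<bullet> tens \<theta> z = (LINT t|lborel. F t * \<theta> t) * (y0 \<bullet> z)"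
    if "sqi F" "F \<in> borel_measurable borel" "sqi \<theta>" "\<theta> \<in> borel_measurable borel" for F \<theta> z
  proof -
    note [measurable] = that(2,4)
    have "tens F y0 \<bullet> tens \<theta> z = (LINT t|lborel. \<theta> t * (slice (tens F y0) t \<bullet> z))" by (rule inner_tens[OF that(3,4)])
    also have "\<dots> = (LINT t|lborel. F t * \<theta> t * (y0 \<bullet> z))"
    proof (rule integral_cong_AE)
      show "AE t in lborel. \<theta> t * (slice (tens F y0) t \<bullet> z) = F t * \<theta> t * (y0 \<bullet> z)"
        using slice_tens[OF that(1,2), of y0] by eventually_elim simp
    qed measurable
    finally show ?thesis by simp
  qed
  have w: "wdt T UNIV X D" unfolding wdt_def
  proof (intro allI impI)
    fix \<psi> and \<phi> :: "real \<Rightarrow> real" assume \<psi>: "test_fn {0<..<T} \<psi>"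
    note \<psi>' = test_fn_deriv[OF \<psi>]
    have "(LINT t|lborel. Y t * deriv \<psi> t) = - (LINT t|lborel. G' t * \<psi> t)"
      using weak[OF \<psi>] unfolding Y_def G'_def by (simp add: mult.assoc)
    then show "X \<bullet> tens (deriv \<psi>) (cls \<phi>) = - (D \<bullet> tens \<psi> (cls \<phi>))"
      unfolding X_def D_def pair[OF sY Ym test_fn_sqi[OF \<psi>'] test_fn_borel[OF \<psi>']]
        pair[OF sG' G'm test_fn_sqi[OF \<psi>] test_fn_borel[OF \<psi>]] by simp
  qed
  have diff: "AE t in lborel. t \<in> {0<..<T - h} \<longrightarrow> y (t + h) - y t = (LINT \<tau>|lborel. indicator {t<..<t + h} \<tau> * G' \<tau>)"
    if h: "0 < h" for h
  proof -
    have K: "kset h (Kfor T h)" using h by (intro kset_Kfor) simp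
    have [measurable]: "Kfor T h \<in> sets borel" using K by (simp add: kset_def)
    have tr: "AE t in lborel. Q (t + h)" if "AE t in lborel. Q t" for Q using AE_lborel_translate[OF that] .
    have int: "(LINT \<tau>|lborel. indicator (Kfor T h) (t, \<tau>) * (slice D \<tau> \<bullet> y0)) = (LINT \<tau>|lborel. indicator (Kfor T h) (t, \<tau>) * G' \<tau>)" for t
    proof (rule integral_cong_AE)
      show "AE \<tau> in lborel. indicator (Kfor T h) (t, \<tau>) * (slice D \<tau> \<bullet> y0) = indicator (Kfor T h) (t, \<tau>) * G' \<tau>"
        using slice_tens[OF sG' G'm, of y0] unfolding D_def by eventually_elim (simp add: y0)
    qed measurable
    show ?thesis using AE_lborel_pair[OF fdiff_eq_kernel_if_weak_derivative[OF w open_UNIV h]]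
        slice_shift[of T "- h" "X - shift T h X"] tr[OF slice_diff[of X "shift T h X"]] tr[OF slice_shift[of T h X]]
        slice_tens[OF sY Ym, of y0] tr[OF slice_tens[OF sY Ym, of y0]] slice_kop[OF K, of D]
    proof eventually_elim
      case (elim t)
      show ?case
      proof
        assume t: "t \<in> {0<..<T - h}"
        then have tI: "t \<in> {0<..<T}" "t + h \<in> {0<..<T}" using h by auto
        have "slice (fdiff T h X) t = slice (kop (Kfor T h) D) t"
          unfolding slice_def by (rule cls_cong_AE) (use elim(1) t in \<open>auto elim!: eventually_mono\<close>)
        moreover have "slice (fdiff T h X) t = (Y (t + h) - Y t) *\<^sub>R y0"
          using elim(2-6) tI unfolding fdiff_def X_def by (simp add: scaleR_diff_left)
        ultimately have "slice (kop (Kfor T h) D) t = (Y (t + h) - Y t) *\<^sub>R y0" by simp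
        then have "slice (kop (Kfor T h) D) t \<bullet> y0 = Y (t + h) - Y t" by (simp only: y0 inner_scaleR_left mult_1_right)
        then have "Y (t + h) - Y t = (LINT \<tau>|lborel. indicator (Kfor T h) (t, \<tau>) * G' \<tau>)"
          using elim(7) by (simp add: int)
        moreover have "indicator (Kfor T h) (t, \<tau>) = (indicator {t<..<t + h} \<tau> :: real)" for \<tau>
          using t by (auto simp: Kfor_def split: split_indicator)
        ultimately show "y (t + h) - y t = (LINT \<tau>|lborel. indicator {t<..<t + h} \<tau> * G' \<tau>)"
          using tI by (simp add: Y_def)
      qed
    qed
  qed
  have G'i: "integrable lborel G'"
  proof (rule Bochner_Integration.integrable_bound)
    show "integrable lborel (\<lambda>t. indicator {0<..<T} t + (G' t)\<^sup>2)"
      using sG' T by (intro Bochner_Integration.integrable_add) (auto simp: sqi_iff_integrable)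
    have r: "\<bar>r\<bar> \<le> 1 + r\<^sup>2" for r :: real
      using zero_le_power2[of "\<bar>r\<bar> - 1"] abs_ge_zero[of r] by (simp add: power2_eq_square algebra_simps)
    show "AE t in lborel. norm (G' t) \<le> norm (indicator {0<..<T} t + (G' t)\<^sup>2)"
    proof (rule AE_I2)
      fix t show "norm (G' t) \<le> norm (indicator {0<..<T} t + (G' t)\<^sup>2)"
        using r[of "G t"] by (cases "t \<in> {0<..<T}") (simp_all add: G'_def)
    qed
  qed measurable
  have Gint: "integrable lborel (\<lambda>\<tau>. indicator S \<tau> * G' \<tau>)" if "S \<in> sets borel" for S
    using integrable_mult_indicator[OF _ G'i, of S] that by simp
  define \<Gamma> where "\<Gamma> t = (LINT \<tau>|lborel. indicator {0..t} \<tau> * G' \<tau>)" for t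
  have \<Gamma>c: "continuous_on {0..T} \<Gamma>"
  proof -
    have "\<Gamma> t = integral {0..t} G'" for t
      using set_borel_integral_eq_integral(2)[of "{0..t}" G'] Gint[of "{0..t}"]
      unfolding \<Gamma>_def set_integrable_def set_lebesgue_integral_def by simp
    moreover have "G' integrable_on {0..T}"
      using set_borel_integral_eq_integral(1)[of "{0..T}" G'] Gint[of "{0..T}"] unfolding set_integrable_def by simp
    ultimately show ?thesis using indefinite_integral_continuous_1[of G' 0 T] by simp
  qed
  have \<Gamma>d: "\<Gamma> b - \<Gamma> a = (LINT \<tau>|lborel. indicator {a<..<b} \<tau> * G' \<tau>)" if "0 \<le> a" "a \<le> b" for a b
  proof -
    have "\<Gamma> b - \<Gamma> a = (LINT \<tau>|lborel. indicator {0..b} \<tau> * G' \<tau> - indicator {0..a} \<tau> * G' \<tau>)"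
      unfolding \<Gamma>_def by (rule Bochner_Integration.integral_diff[symmetric]) (auto intro: Gint)
    also have "\<dots> = (LINT \<tau>|lborel. indicator {a<..<b} \<tau> * G' \<tau>)"
    proof (rule integral_cong_AE)
      show "AE \<tau> in lborel. indicator {0..b} \<tau> * G' \<tau> - indicator {0..a} \<tau> * G' \<tau> = indicator {a<..<b} \<tau> * G' \<tau>"
        using AE_lborel_singleton[of b] by eventually_elim (use that in \<open>auto split: split_indicator\<close>)
    qed measurable
    finally show ?thesis .
  qed
  define m where "m t = y t - \<Gamma> t" for t
  have mc: "continuous_on {0..T} m" unfolding m_def by (intro continuous_on_diff y \<Gamma>c)
  \<comment> \<open>Increments of length \<open>h\<close> are known at times in
    \<open>(0, T - h)\<close>, which is empty for \<open>h = T\<close>; the increment over the whole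
    interval is therefore split at \<open>T / 2\<close> afterwards.\<close>
  have step: "m b = m a" if ab: "0 \<le> a" "a < b" "b \<le> T" "b - a < T" for a b
  proof -
    define h where "h = b - a"
    have h: "0 < h" "h < T" using ab by (auto simp: h_def)
    have "m (a + h) - m a = 0"
    proof (rule continuous_zero_if_AE_zero[of "T - h" "\<lambda>t. m (t + h) - m t" a])
      show "continuous_on {0..T - h} (\<lambda>t. m (t + h) - m t)"
      proof (rule continuous_on_diff)
        show "continuous_on {0..T - h} m" by (rule continuous_on_subset[OF mc]) (use h in auto)
        show "continuous_on {0..T - h} (\<lambda>t. m (t + h))"
          by (rule continuous_on_compose2[OF mc]) (use h in \<open>auto intro!: continuous_intros\<close>)
      qed
      show "AE t in lborel. t \<in> {0<..<T - h} \<longrightarrow> m (t + h) - m t = 0" using diff[OF h(1)]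
      proof eventually_elim
        case (elim t)
        show ?case
        proof
          assume t: "t \<in> {0<..<T - h}"
          then show "m (t + h) - m t = 0" using elim \<Gamma>d[of t "t + h"] h by (simp add: m_def)
        qed
      qed
    qed (use h ab in \<open>auto simp: h_def\<close>)
    then show ?thesis by (simp add: h_def)
  qed
  have "m t2 = m t1"
  proof (cases "t1 = t2")
    case False
    then have lt: "t1 < t2" using t by simp
    show ?thesis
    proof (cases "t2 - t1 < T")
      case True
      then show ?thesis using step[of t1 t2] t lt by simp
    next
      case False
      then have "t1 = 0" "t2 = T" using t by auto
      then show ?thesis using step[of 0 "T / 2"] step[of "T / 2" T] T by simp
    qed
  qed simp
  then have "y t2 - y t1 = \<Gamma> t2 - \<Gamma> t1" by (simp add: m_def)
  also have "\<dots> = (LINT \<tau>|lborel. indicator {t1<..<t2} \<tau> * G' \<tau>)" by (rule \<Gamma>d[OF t(1,2)])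
  also have "\<dots> = (LINT \<tau>|lborel. indicator {t1<..<t2} \<tau> * G \<tau>)"
    by (rule Bochner_Integration.integral_cong) (use t in \<open>auto simp: G'_def split: split_indicator\<close>)
  finally show ?thesis .
qed

lemma integrable_if_sqi_on_interval:
  assumes "sqi (\<lambda>t. indicator {a<..<b::real} t * f t)"
  shows "integrable lebesgue (\<lambda>t. indicator {a<..<b} t * f t)"
proof -
  define g where "g = cls (\<lambda>t. indicator {a<..<b} t * f t)"
  have s1: "sqi (indicator {a<..<b} :: real \<Rightarrow> real)" by (rule bounded_compact_support_sqi[where B = 1])
      (auto intro!: bounded_subset[OF bounded_closed_interval[of a b]] split: split_indicator split_indicator_asm)
  have "integrable lborel (\<lambda>t. fn (cls (indicator {a<..<b})) t * fn g t)" by (rule fn_mult_integrable)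
  then have i: "integrable lebesgue (\<lambda>t. fn (cls (indicator {a<..<b})) t * fn g t)" by (subst integrable_completion) auto
  have "AE t in lborel. fn (cls (indicator {a<..<b})) t * fn g t = indicator {a<..<b} t * f t"
    using fn_cls[OF s1] fn_cls[OF assms] unfolding g_def by eventually_elim (auto split: split_indicator)
  then show ?thesis using i assms by (intro integrable_cong_AE_imp[OF i]) (auto simp: sqi_def AE_completion_iff)
qed

section \<open>The spaces of the weak formulation\<close>

context
  fixes \<Omega> :: "(real^'n) set" and s T :: real
  assumes s: "0 < s" "s < 1" and T: "0 < T" and \<Omega>: "open \<Omega>"
begin

lemma Hms_bound:
  assumes G: "in_Hms \<Omega> s G" and v: "v \<in> tHs \<Omega> s"
  shows "\<bar>G v\<bar> \<le> Hms_norm \<Omega> s G * Hs_norm s v"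
proof -
  obtain M where M: "\<And>v. v \<in> tHs \<Omega> s ==> \<bar>G v\<bar> \<le> M * Hs_norm s v" using G unfolding in_Hms_def by blast
  have H0: "0 \<le> Hs_norm s v" unfolding Hs_norm_def by simp
  show ?thesis
  proof (cases "Hs_norm s v = 0")
    case True
    then show ?thesis using M[OF v] by simp
  next
    case False
    then have Hp: "0 < Hs_norm s v" using H0 by simp
    define w where "w = (\<lambda>x. (1 / Hs_norm s v) * v x)"
    have w: "w \<in> tHs \<Omega> s" unfolding w_def by (rule tHs_linear(2)[OF s v v])
    have Hv: "in_Hs s v" by (rule tHs_in_Hs[OF s v])
    have ew: "emb s w = (1 / Hs_norm s v) *\<^sub>R emb s v" unfolding w_def by (rule emb_linear(3)[OF s Hv Hv])
    have "Hs_norm s w = norm ((1 / Hs_norm s v) *\<^sub>R emb s v)"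
      unfolding ew[symmetric] by (rule Hs_norm_emb[OF s tHs_in_Hs[OF s w]])
    also have "\<dots> = 1" using Hp by (simp add: Hs_norm_emb[OF s Hv])
    finally have w1: "Hs_norm s w = 1" .
    have bdd: "bdd_above {\<bar>G v\<bar> | v. v \<in> tHs \<Omega> s \<and> Hs_norm s v \<le> 1}"
    proof (rule bdd_aboveI[of _ "\<bar>M\<bar>"])
      fix r assume "r \<in> {\<bar>G v\<bar> | v. v \<in> tHs \<Omega> s \<and> Hs_norm s v \<le> 1}"
      then obtain v where v: "r = \<bar>G v\<bar>" "v \<in> tHs \<Omega> s" "Hs_norm s v \<le> 1" by auto
      have n: "0 \<le> Hs_norm s v" unfolding Hs_norm_def by simp
      have "M * Hs_norm s v \<le> \<bar>M\<bar> * Hs_norm s v" by (rule mult_right_mono[OF abs_ge_self n])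
      also have "\<dots> \<le> \<bar>M\<bar> * 1" by (rule mult_left_mono[OF v(3)]) simp
      finally show "r \<le> \<bar>M\<bar>" using M[OF v(2)] v(1) by simp
    qed
    have "\<bar>G w\<bar> \<le> Hms_norm \<Omega> s G" unfolding Hms_norm_def by (rule cSup_upper[OF _ bdd]) (use w w1 in auto)
    moreover have "G w = (1 / Hs_norm s v) * G v" unfolding w_def using G v unfolding in_Hms_def by blast
    ultimately show ?thesis using Hp by (simp add: abs_mult field_simps)
  qed
qed

lemma Hms_norm_le:
  assumes "\<And>v. v \<in> tHs \<Omega> s ==> \<bar>G v\<bar> \<le> M * Hs_norm s v" "0 \<le> M"
  shows "0 \<le> Hms_norm \<Omega> s G" "Hms_norm \<Omega> s G \<le> M"
proof -
  have z: "Hs_norm s (\<lambda>x::real^'n. 0) = 0" unfolding Hs_norm_def gagliardo_sq_def by simp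
  have mem: "\<bar>G (\<lambda>x. 0)\<bar> \<in> {\<bar>G v\<bar> | v. v \<in> tHs \<Omega> s \<and> Hs_norm s v \<le> 1}" using zero_tHs[OF s] z by force
  have up: "r \<le> M" if "r \<in> {\<bar>G v\<bar> | v. v \<in> tHs \<Omega> s \<and> Hs_norm s v \<le> 1}" for r
  proof -
    from that obtain v where v: "r = \<bar>G v\<bar>" "v \<in> tHs \<Omega> s" "Hs_norm s v \<le> 1" by auto
    have "M * Hs_norm s v \<le> M * 1" by (rule mult_left_mono[OF v(3) assms(2)])
    then show ?thesis using assms(1)[OF v(2)] v(1) by simp
  qed
  show "Hms_norm \<Omega> s G \<le> M" unfolding Hms_norm_def by (rule cSup_least) (use mem up in auto)
  have "\<bar>G (\<lambda>x. 0)\<bar> \<le> Hms_norm \<Omega> s G"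
    unfolding Hms_norm_def by (rule cSup_upper[OF mem]) (rule bdd_aboveI[of _ M], rule up)
  then show "0 \<le> Hms_norm \<Omega> s G" using abs_ge_zero order_trans by simp
qed

lemma Hms_norm_nonneg:
  assumes "in_Hms \<Omega> s G"
  shows "0 \<le> Hms_norm \<Omega> s G"
proof -
  obtain M where M: "\<And>v. v \<in> tHs \<Omega> s ==> \<bar>G v\<bar> \<le> M * Hs_norm s v" using assms unfolding in_Hms_def by blast
  have "\<bar>G v\<bar> \<le> \<bar>M\<bar> * Hs_norm s v" if "v \<in> tHs \<Omega> s" for v
  proof -
    have "M * Hs_norm s v \<le> \<bar>M\<bar> * Hs_norm s v" by (rule mult_right_mono) (simp_all add: Hs_norm_def)
    then show ?thesis using M[OF that] by simp
  qed
  then show ?thesis by (rule Hms_norm_le(1)[OF _ abs_ge_zero])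
qed

text \<open>Joint measurability of the quotient in time and both space points is obtained from a
  Borel representative \<open>U\<close> of the extension of \<open>u\<close> by zero. The
  integrability of \<open>Hs_norm s (u t)\<close> bounds both components, and since
  \<open>u t\<close> vanishes outside \<open>\<Omega>\<close> almost everywhere, the extension
  agrees with it.\<close>

lemma in_L2_tHs_VV:
  assumes u: "in_L2_tHs T \<Omega> s u"
  shows "\<exists>X\<in>VV T (Vsp \<Omega> s). in_L2Q T \<Omega> u \<and> fst X = qe T \<Omega> u \<and>
    (AE t in lborel. t \<in> {0<..<T} \<longrightarrow> u t \<in> tHs \<Omega> s \<and> (slice (fst X) t, slice (snd X) t) = emb s (u t))"
proof -
  have \<Omega>b: "\<Omega> \<in> sets borel" using \<Omega> by simp
  define F where "F p = indicator (cyl T \<Omega>) p * u (fst p) (snd p)" for p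
  have F: "F \<in> borel_measurable lebesgue" using u unfolding in_L2_tHs_def set_borel_measurable_def F_def by simp
  define U where "U = borel_rep F"
  have [measurable]: "U \<in> borel_measurable borel" unfolding U_def by (rule borel_rep_measurable[OF F])
  have UF: "AE p in lborel. U p = F p" unfolding U_def by (rule borel_rep_AE[OF F])
  have tH: "AE t in lborel. t \<in> {0<..<T} \<longrightarrow> u t \<in> tHs \<Omega> s"
    using u unfolding in_L2_tHs_def AE_completion_iff by blast
  have E: "AE t in lborel. (t \<in> {0<..<T} \<longrightarrow> u t \<in> tHs \<Omega> s \<and> (AE x in lborel. U (t, x) = u t x))
      \<and> (t \<notin> {0<..<T} \<longrightarrow> (AE x in lborel. U (t, x) = 0))"
    using AE_lborel_pair[OF UF] tH
  proof eventually_elim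
    case (elim t)
    show ?case
    proof (intro conjI impI)
      assume t: "t \<in> {0<..<T}"
      then show ut: "u t \<in> tHs \<Omega> s" using elim(2) by blast
      show "AE x in lborel. U (t, x) = u t x" using elim(1) tHs_outside[OF s ut \<Omega>b]
        by eventually_elim (use t in \<open>auto simp: F_def cyl_def split: split_indicator_asm\<close>)
    next
      assume t: "t \<notin> {0<..<T}"
      show "AE x in lborel. U (t, x) = 0" using elim(1) by eventually_elim (use t in \<open>auto simp: F_def cyl_def\<close>)
    qed
  qed
  define W where "W q = Dq s (\<lambda>x. U (fst q, x)) (snd q)" for q :: "real \<times> ((real^'n) \<times> (real^'n))"
  have Wm [measurable]: "W \<in> borel_measurable borel" unfolding W_def[abs_def] Dq_def by measurable
  have fin: "(\<integral>\<^sup>+t. ennreal ((Hs_norm s (u t))\<^sup>2) * indicator {0<..<T} t \<partial>lborel) < \<infinity>"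
    using u unfolding in_L2_tHs_def nn_integral_completion by blast
  have bnd: "(\<integral>\<^sup>+x. ennreal ((U (t, x))\<^sup>2) \<partial>lborel) \<le> ennreal ((Hs_norm s (u t))\<^sup>2) * indicator {0<..<T} t
      \<and> (\<integral>\<^sup>+p. ennreal ((W (t, p))\<^sup>2) \<partial>lborel) \<le> ennreal ((Hs_norm s (u t))\<^sup>2) * indicator {0<..<T} t"
    if "(t \<in> {0<..<T} \<longrightarrow> u t \<in> tHs \<Omega> s \<and> (AE x in lborel. U (t, x) = u t x))
      \<and> (t \<notin> {0<..<T} \<longrightarrow> (AE x in lborel. U (t, x) = 0))" for t
  proof (cases "t \<in> {0<..<T}")
    case True
    then have ut: "u t \<in> tHs \<Omega> s" and ae: "AE x in lborel. U (t, x) = u t x" using that by auto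
    have Hs: "in_Hs s (u t)" by (rule tHs_in_Hs[OF s ut])
    have q: "sqi (u t)" "sqi (Dq s (u t))" using Hs by (simp_all add: in_Hs_iff)
    have H: "(Hs_norm s (u t))\<^sup>2 = (norm (cls (u t)))\<^sup>2 + (norm (cls (Dq s (u t))))\<^sup>2"
      unfolding Hs_norm_emb[OF s Hs] norm_prod_def by (simp add: emb_def[OF s])
    have "(\<integral>\<^sup>+x. ennreal ((U (t, x))\<^sup>2) \<partial>lborel) = (\<integral>\<^sup>+x. ennreal ((u t x)\<^sup>2) \<partial>lborel)"
      by (rule nn_integral_cong_AE, use ae in eventually_elim) simp
    also have "\<dots> \<le> ennreal ((Hs_norm s (u t))\<^sup>2)" unfolding norm_cls_nn[OF q(1), symmetric] H by (rule ennreal_leI) simp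
    finally have 1: "(\<integral>\<^sup>+x. ennreal ((U (t, x))\<^sup>2) \<partial>lborel) \<le> ennreal ((Hs_norm s (u t))\<^sup>2)" .
    have "(\<integral>\<^sup>+p. ennreal ((W (t, p))\<^sup>2) \<partial>lborel) = (\<integral>\<^sup>+p. ennreal ((Dq s (u t) p)\<^sup>2) \<partial>lborel)"
      by (rule nn_integral_cong_AE, use Dq_cong_AE[OF ae, of s] in eventually_elim) (simp add: W_def)
    also have "\<dots> \<le> ennreal ((Hs_norm s (u t))\<^sup>2)" unfolding norm_cls_nn[OF q(2), symmetric] H by (rule ennreal_leI) simp
    finally show ?thesis using 1 True by simp
  next
    case False
    then have ae: "AE x in lborel. U (t, x) = 0" using that by blast
    have "(\<integral>\<^sup>+x. ennreal ((U (t, x))\<^sup>2) \<partial>lborel) = (\<integral>\<^sup>+x. 0 \<partial>(lborel :: (real^'n) measure))"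
      by (rule nn_integral_cong_AE, use ae in eventually_elim) simp
    moreover have "(\<integral>\<^sup>+p. ennreal ((W (t, p))\<^sup>2) \<partial>lborel) = (\<integral>\<^sup>+p. 0 \<partial>(lborel :: ((real^'n) \<times> (real^'n)) measure))"
      by (rule nn_integral_cong_AE, use Dq_cong_AE[OF ae, of s] in eventually_elim) (simp add: W_def Dq_def)
    ultimately show ?thesis by simp
  qed
  have sU: "sqi U"
  proof (rule sqi_borelI)
    have "(\<integral>\<^sup>+p. ennreal ((U p)\<^sup>2) \<partial>lborel) = (\<integral>\<^sup>+t. \<integral>\<^sup>+x. ennreal ((U (t, x))\<^sup>2) \<partial>lborel \<partial>lborel)"
      by (rule nn_integral_lborel_pair(1)) measurable
    also have "\<dots> \<le> (\<integral>\<^sup>+t. ennreal ((Hs_norm s (u t))\<^sup>2) * indicator {0<..<T} t \<partial>lborel)"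
      by (rule nn_integral_mono_AE, use E in eventually_elim) (use bnd in blast)
    finally show "(\<integral>\<^sup>+p. ennreal ((U p)\<^sup>2) \<partial>lborel) < \<infinity>" using fin by (rule le_less_trans)
  qed measurable
  have sW: "sqi W"
  proof (rule sqi_borelI)
    have "(\<integral>\<^sup>+p. ennreal ((W p)\<^sup>2) \<partial>lborel) = (\<integral>\<^sup>+t. \<integral>\<^sup>+x. ennreal ((W (t, x))\<^sup>2) \<partial>lborel \<partial>lborel)"
      by (rule nn_integral_lborel_pair(1)) measurable
    also have "\<dots> \<le> (\<integral>\<^sup>+t. ennreal ((Hs_norm s (u t))\<^sup>2) * indicator {0<..<T} t \<partial>lborel)"
      by (rule nn_integral_mono_AE, use E in eventually_elim) (use bnd in blast)
    finally show "(\<integral>\<^sup>+p. ennreal ((W p)\<^sup>2) \<partial>lborel) < \<infinity>" using fin by (rule le_less_trans)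
  qed measurable
  have uQ: "in_L2Q T \<Omega> u" unfolding in_L2Q_iff
  proof (rule sqi_cong_AE[OF sU])
    show "AE p in lborel. indicator (cyl T \<Omega>) p * u (fst p) (snd p) = U p" using UF by eventually_elim (simp add: F_def)
  qed
  have Uq: "cls U = qe T \<Omega> u" unfolding qe_def by (rule cls_cong_AE) (use UF in \<open>simp add: F_def\<close>)
  have sl: "AE t in lborel. (t \<in> {0<..<T} \<longrightarrow> u t \<in> tHs \<Omega> s \<and> (slice (cls U) t, slice (cls W) t) = emb s (u t))
      \<and> (t \<notin> {0<..<T} \<longrightarrow> (slice (cls U) t, slice (cls W) t) = 0)"
    using E slice_cls[OF sU] slice_cls[OF sW]
  proof eventually_elim
    case (elim t)
    have e: "(slice (cls U) t, slice (cls W) t) = emb s (\<lambda>x. U (t, x))"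
      using elim(2,3) unfolding emb_def[OF s] W_def by simp
    have z: "emb s (\<lambda>x::real^'n. 0) = 0" unfolding emb_def[OF s] Dq_def zero_prod_def zero_lsq_def by simp
    show ?case
    proof (intro conjI impI)
      assume t: "t \<in> {0<..<T}"
      then show "u t \<in> tHs \<Omega> s" using elim(1) by blast
      show "(slice (cls U) t, slice (cls W) t) = emb s (u t)"
        unfolding e by (rule emb_cong_AE[OF s]) (use elim(1) t in blast)
    next
      assume t: "t \<notin> {0<..<T}"
      show "(slice (cls U) t, slice (cls W) t) = 0"
        unfolding e z[symmetric] by (rule emb_cong_AE[OF s]) (use elim(1) t in blast)
    qed
  qed
  have "(cls U, cls W) \<in> VV T (Vsp \<Omega> s)"
    unfolding VV_def mem_Collect_eq using sl by eventually_elim (auto simp: Vsp_def[OF s])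
  moreover have "AE t in lborel. t \<in> {0<..<T} \<longrightarrow> u t \<in> tHs \<Omega> s \<and> (slice (cls U) t, slice (cls W) t) = emb s (u t)"
    using sl by eventually_elim blast
  ultimately show ?thesis using uQ Uq by (intro bexI[of _ "(cls U, cls W)"]) auto
qed

text \<open>Measurability and integrability of the norm in time are read off from the norms of the
  slices, with which it agrees almost everywhere. The values of \<open>u\<close> outside the
  cylinder are left free.\<close>

lemma VV_in_L2_tHs:
  assumes X: "X \<in> VV T (Vsp \<Omega> s)" and u: "AE p in lborel. u (fst p) (snd p) = fn (fst X) p \<or> p \<notin> cyl T \<Omega>"
    and um: "AE t in lborel. t \<in> {0<..<T} \<longrightarrow> u t \<in> tHs \<Omega> s \<and> (slice (fst X) t, slice (snd X) t) = emb s (u t)"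
  shows "in_L2_tHs T \<Omega> s u"
proof -
  have [measurable]: "cyl T \<Omega> \<in> sets borel" by (rule cyl_borel) (use \<Omega> in simp)
  have n: "AE t in lborel. t \<in> {0<..<T} \<longrightarrow> Hs_norm s (u t) = sqrt ((norm (slice (fst X) t))\<^sup>2 + (norm (slice (snd X) t))\<^sup>2)"
    using um
  proof eventually_elim
    case (elim t)
    show ?case
    proof
      assume "t \<in> {0<..<T}"
      then have a: "u t \<in> tHs \<Omega> s" "(slice (fst X) t, slice (snd X) t) = emb s (u t)" using elim by auto
      have "Hs_norm s (u t) = norm (slice (fst X) t, slice (snd X) t)"
        unfolding a(2) by (rule Hs_norm_emb[OF s tHs_in_Hs[OF s a(1)]])
      then show "Hs_norm s (u t) = sqrt ((norm (slice (fst X) t))\<^sup>2 + (norm (slice (snd X) t))\<^sup>2)"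
        by (simp add: norm_prod_def)
    qed
  qed
  show ?thesis unfolding in_L2_tHs_def
  proof (intro conjI)
    show "AE t in lebesgue. t \<in> {0<..<T} \<longrightarrow> u t \<in> tHs \<Omega> s"
      unfolding AE_completion_iff using um by eventually_elim blast
    show "set_borel_measurable lebesgue (cyl T \<Omega>) (\<lambda>p. u (fst p) (snd p))" unfolding set_borel_measurable_def
    proof (rule lebesgue_measurable_cong_AE)
      show "(\<lambda>p. indicator (cyl T \<Omega>) p * fn (fst X) p) \<in> borel_measurable lebesgue"
        by (rule measurable_completion) measurable
      show "AE p in lborel. indicator (cyl T \<Omega>) p * fn (fst X) p = indicator (cyl T \<Omega>) p *\<^sub>R u (fst p) (snd p)"
        using u by eventually_elim auto
    qed
    show "set_borel_measurable lebesgue {0<..<T} (\<lambda>t. Hs_norm s (u t))" unfolding set_borel_measurable_def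
    proof (rule lebesgue_measurable_cong_AE)
      show "(\<lambda>t. indicator {0<..<T} t * sqrt ((norm (slice (fst X) t))\<^sup>2 + (norm (slice (snd X) t))\<^sup>2)) \<in> borel_measurable lebesgue"
        by (rule measurable_completion) measurable
      show "AE t in lborel. indicator {0<..<T} t * sqrt ((norm (slice (fst X) t))\<^sup>2 + (norm (slice (snd X) t))\<^sup>2) = indicator {0<..<T} t *\<^sub>R Hs_norm s (u t)"
        using n by eventually_elim (auto split: split_indicator)
    qed
    have "(\<integral>\<^sup>+t. ennreal ((Hs_norm s (u t))\<^sup>2) * indicator {0<..<T} t \<partial>lborel)
        \<le> (\<integral>\<^sup>+t. ennreal ((norm (slice (fst X) t))\<^sup>2) + ennreal ((norm (slice (snd X) t))\<^sup>2) \<partial>lborel)"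
      by (rule nn_integral_mono_AE, use n in eventually_elim) (auto simp: ennreal_plus split: split_indicator)
    also have "\<dots> = ennreal ((norm (fst X))\<^sup>2) + ennreal ((norm (snd X))\<^sup>2)"
      by (simp add: nn_integral_add norm_slice_nn)
    also have "\<dots> < \<infinity>" by simp
    finally show "(\<integral>\<^sup>+t\<in>{0<..<T}. ennreal ((Hs_norm s (u t))\<^sup>2) \<partial>lebesgue) < \<infinity>"
      unfolding nn_integral_completion .
  qed
qed

lemma in_L2_Hms_sqi:
  assumes g: "in_L2_Hms T \<Omega> s g" and \<phi>: "\<phi> \<in> tHs \<Omega> s"
  shows "sqi (\<lambda>t. indicator {0<..<T} t * g t \<phi>)"
proof -
  have gm: "(\<lambda>t. indicator {0<..<T} t * g t \<phi>) \<in> borel_measurable lebesgue"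
    using g \<phi> unfolding in_L2_Hms_def set_borel_measurable_def by simp
  \<comment> \<open>The factor is moved to the left before integrating: the dual norm is not known
    to be measurable in \<open>t\<close>, so only monotonicity of the integral is used. Adding
    \<open>1\<close> keeps \<open>K\<close> positive.\<close>
  define K where "K = Hs_norm s \<phi> + 1"
  have K: "0 < K" "Hs_norm s \<phi> \<le> K" unfolding K_def Hs_norm_def by (auto simp: add_nonneg_pos)
  have gH: "AE t in lborel. t \<in> {0<..<T} \<longrightarrow> in_Hms \<Omega> s (g t)"
    using g unfolding in_L2_Hms_def AE_completion_iff by blast
  have "(\<integral>\<^sup>+t. ennreal (((1 / K) * (indicator {0<..<T} t * g t \<phi>))\<^sup>2) \<partial>lborel)
      \<le> (\<integral>\<^sup>+t. ennreal ((Hms_norm \<Omega> s (g t))\<^sup>2) * indicator {0<..<T} t \<partial>lborel)"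
  proof (rule nn_integral_mono_AE, use gH in eventually_elim)
    case (elim t)
    show ?case
    proof (cases "t \<in> {0<..<T}")
      case True
      then have G: "in_Hms \<Omega> s (g t)" using elim by blast
      have N0: "0 \<le> Hms_norm \<Omega> s (g t)" by (rule Hms_norm_nonneg[OF G])
      have "\<bar>g t \<phi>\<bar> \<le> Hms_norm \<Omega> s (g t) * K" using Hms_bound[OF G \<phi>] mult_left_mono[OF K(2) N0] by linarith
      then have "\<bar>(1 / K) * g t \<phi>\<bar> \<le> Hms_norm \<Omega> s (g t)" using K by (simp add: abs_mult field_simps)
      then have "((1 / K) * g t \<phi>)\<^sup>2 \<le> (Hms_norm \<Omega> s (g t))\<^sup>2" using N0 by (simp only: abs_le_square_iff[symmetric] abs_of_nonneg)
      then show ?thesis using True by (simp add: ennreal_leI)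
    qed simp
  qed
  also have "\<dots> < \<infinity>" using g unfolding in_L2_Hms_def nn_integral_completion by blast
  finally have "sqi (\<lambda>t. (1 / K) * (indicator {0<..<T} t * g t \<phi>))"
    unfolding sqi_def using borel_measurable_times[OF borel_measurable_const gm, of "1 / K"] by simp
  from sqi_mult_left[OF this, of K] show ?thesis using K(1) by simp
qed

text \<open>For fixed \<open>\<phi>\<close> the continuous trace \<open>w\<close> makes the pairing
  continuous on the closed interval, with weak derivative \<open>g t \<phi>\<close>. The scalar
  fundamental theorem then reaches \<open>0\<close> and \<open>T\<close>, where the initial and end
  conditions live.\<close>

lemma pairing_FTC:
  assumes g: "in_L2_Hms T \<Omega> s g" and dt: "has_dt_Hms T \<Omega> s u g"
    and w: "\<And>t. t \<in> {0..T} ==> in_L2_Omega \<Omega> (w t)"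
    and uw: "AE t in lborel. t \<in> {0<..<T} \<longrightarrow> (AE x in lborel. x \<in> \<Omega> \<longrightarrow> u t x = w t x)"
    and wc: "\<And>t1. t1 \<in> {0..T} ==> ((\<lambda>t. L2_Omega_norm \<Omega> (\<lambda>x. w t x - w t1 x)) \<longlongrightarrow> 0) (at t1 within {0..T})"
    and \<phi>: "\<phi> \<in> tHs \<Omega> s" and t: "0 \<le> t1" "t1 \<le> t2" "t2 \<le> T"
  shows "oe \<Omega> (w t2) \<bullet> cls \<phi> - oe \<Omega> (w t1) \<bullet> cls \<phi> = (LINT \<tau>|lebesgue. indicator {t1<..<t2} \<tau> * g \<tau> \<phi>)"
proof -
  have \<phi>s: "sqi \<phi>" using tHs_in_Hs[OF s \<phi>] by (simp add: in_Hs_iff)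
  define y where "y t = oe \<Omega> (w t) \<bullet> cls \<phi>" for t
  have y: "continuous_on {0..T} y" unfolding continuous_on_def
  proof
    fix t1 assume t1: "t1 \<in> {0..T}"
    show "(y \<longlongrightarrow> y t1) (at t1 within {0..T})"
    proof (rule LIM_zero_cancel, rule Lim_null_comparison)
      show "((\<lambda>t. L2_Omega_norm \<Omega> (\<lambda>x. w t x - w t1 x) * norm (cls \<phi>)) \<longlongrightarrow> 0) (at t1 within {0..T})"
        using tendsto_mult_left_zero[OF wc[OF t1], of "norm (cls \<phi>)"] .
      show "\<forall>\<^sub>F t in at t1 within {0..T}. norm (y t - y t1) \<le> L2_Omega_norm \<Omega> (\<lambda>x. w t x - w t1 x) * norm (cls \<phi>)"
        unfolding eventually_at_filter
      proof (rule always_eventually, intro allI impI)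
        fix t assume t: "t \<noteq> t1" "t \<in> {0..T}"
        have "y t - y t1 = oe \<Omega> (\<lambda>x. w t x - w t1 x) \<bullet> cls \<phi>"
          unfolding y_def oe_linear(4)[OF w[OF t(2)] w[OF t1]] by (rule inner_diff_left[symmetric])
        then show "norm (y t - y t1) \<le> L2_Omega_norm \<Omega> (\<lambda>x. w t x - w t1 x) * norm (cls \<phi>)"
          unfolding L2_Omega_norm_eq[OF oe_linear(3)[OF w[OF t(2)] w[OF t1]]] by (simp add: Cauchy_Schwarz_ineq2)
      qed
    qed
  qed
  have Ym [measurable]: "(\<lambda>t. indicator {0<..<T} t * y t) \<in> borel_measurable borel"
    using borel_measurable_continuous_on_indicator[of "{0<..<T}" y] continuous_on_subset[OF y, of "{0<..<T}"]
    by (auto simp: subset_eq)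
  have sg: "sqi (\<lambda>t. indicator {0<..<T} t * g t \<phi>)" by (rule in_L2_Hms_sqi[OF g \<phi>])
  define G where "G = borel_rep (\<lambda>t. indicator {0<..<T} t * g t \<phi>)"
  have gm: "(\<lambda>t. indicator {0<..<T} t * g t \<phi>) \<in> borel_measurable lebesgue" using sg by (simp add: sqi_def)
  have [measurable]: "G \<in> borel_measurable borel" unfolding G_def by (rule borel_rep_measurable[OF gm])
  have Gg: "AE t in lborel. G t = indicator {0<..<T} t * g t \<phi>" unfolding G_def by (rule borel_rep_AE[OF gm])
  have uy: "AE t in lborel. t \<in> {0<..<T} \<longrightarrow> (LINT x:\<Omega>|lebesgue. u t x * \<phi> x) = y t" using uw
  proof eventually_elim
    case (elim t)
    show ?case
    proof
      assume t: "t \<in> {0<..<T}"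
      then have ae: "AE x in lborel. x \<in> \<Omega> \<longrightarrow> u t x = w t x" using elim by blast
      have tc: "t \<in> {0..T}" using t by auto
      show "(LINT x:\<Omega>|lebesgue. u t x * \<phi> x) = y t" unfolding y_def oe_cong_AE(1)[OF ae, symmetric]
        by (rule set_integral_oe[OF oe_cong_AE(2)[OF ae w[OF tc]] \<phi>s])
    qed
  qed
  have "y t2 - y t1 = (LINT \<tau>|lborel. indicator {t1<..<t2} \<tau> * G \<tau>)"
  proof (rule weak_derivative_FTC[OF T y _ _ _ t])
    show "sqi (\<lambda>t. indicator {0<..<T} t * G t)"
      by (rule sqi_cong_AE[OF sg], use Gg in eventually_elim) (auto split: split_indicator)
    fix \<psi> assume \<psi>: "test_fn {0<..<T} \<psi>"
    have [measurable]: "\<psi> \<in> borel_measurable borel" "deriv \<psi> \<in> borel_measurable borel"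
      using test_fn_borel[OF \<psi>] test_fn_borel[OF test_fn_deriv[OF \<psi>]] .
    have "(LINT t:{0<..<T}|lebesgue. (LINT x:\<Omega>|lebesgue. u t x * \<phi> x) * deriv \<psi> t)
        = (LINT t|lborel. indicator {0<..<T} t * y t * deriv \<psi> t)"
      unfolding set_lebesgue_integral_def[of lebesgue "{0<..<T}"]
    proof (rule lebesgue_integral_eq_lborel)
      show "(\<lambda>t. indicator {0<..<T} t * y t * deriv \<psi> t) \<in> borel_measurable borel"
        using Ym by (rule borel_measurable_times) measurable
    qed (use uy in eventually_elim, auto split: split_indicator)
    moreover have "(LINT t:{0<..<T}|lebesgue. g t \<phi> * \<psi> t) = (LINT t|lborel. indicator {0<..<T} t * (G t * \<psi> t))"
      unfolding set_lebesgue_integral_def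
      by (rule lebesgue_integral_eq_lborel, measurable, use Gg in eventually_elim) (auto split: split_indicator)
    ultimately show "(LINT t|lborel. indicator {0<..<T} t * (y t * deriv \<psi> t)) = - (LINT t|lborel. indicator {0<..<T} t * (G t * \<psi> t))"
      using dt \<phi> \<psi> unfolding has_dt_Hms_def by (simp add: mult.assoc)
  qed measurable
  also have "\<dots> = (LINT \<tau>|lebesgue. indicator {t1<..<t2} \<tau> * g \<tau> \<phi>)"
    by (rule lebesgue_integral_eq_lborel[symmetric], measurable, use Gg in eventually_elim)
      (use t in \<open>auto split: split_indicator\<close>)
  finally show ?thesis by (simp add: y_def)
qed

end

section \<open>The weak equations of state and adjoint state\<close>

lemma sqi_mult_integrable:
  assumes "sqi f" "sqi g"
  shows "integrable lebesgue (\<lambda>x. f x * g x)"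
proof -
  have i: "integrable lebesgue (\<lambda>x. fn (cls f) x * fn (cls g) x)"
    using fn_mult_integrable[of "cls f" "cls g"] by (simp add: integrable_completion)
  have m: "(\<lambda>x. f x * g x) \<in> borel_measurable lebesgue"
    by (rule borel_measurable_times) (use assms in \<open>simp_all add: sqi_def\<close>)
  have "AE x in lborel. fn (cls f) x * fn (cls g) x = f x * g x"
    using fn_cls[OF assms(1)] fn_cls[OF assms(2)] by eventually_elim simp
  then show ?thesis by (intro integrable_cong_AE_imp[OF i m]) (simp add: AE_completion_iff)
qed

lemma indicator_interval_sqi:
  "sqi (indicator {a<..<b::real} :: real \<Rightarrow> real)" "(indicator {a<..<b} :: real \<Rightarrow> real) \<in> borel_measurable borel"
proof -
  show "sqi (indicator {a<..<b::real} :: real \<Rightarrow> real)" by (rule bounded_compact_support_sqi[where B = 1])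
      (auto intro!: bounded_subset[OF bounded_closed_interval[of a b]] split: split_indicator split_indicator_asm)
qed simp

lemma norm_tens_indicator:
  assumes "a \<le> b"
  shows "norm (tens (indicator {a<..<b}) y) = sqrt (b - a) * norm y"
proof -
  have "(LINT t|lborel. (indicator {a<..<b} t)\<^sup>2) = (LINT t|lborel. indicator {a<..<b::real} t :: real)"
    by (rule Bochner_Integration.integral_cong) (auto split: split_indicator)
  also have "\<dots> = b - a" using assms by simp
  finally have "(norm (tens (indicator {a<..<b}) y))\<^sup>2 = (sqrt (b - a) * norm y)\<^sup>2"
    using norm_tens[OF indicator_interval_sqi[of a b], of y] assms by (simp add: power_mult_distrib)
  then show ?thesis by (rule power2_eq_imp_eq) (use assms in simp_all)
qed

lemma slice_volt_tens:
  assumes T: "0 < T"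
  shows "AE t in lborel. t \<in> {0<..<T} \<longrightarrow> (\<forall>y. slice (volt T X) t \<bullet> y = X \<bullet> tens (indicator {0<..<t}) y)"
    and "AE t in lborel. t \<in> {0<..<T} \<longrightarrow> (\<forall>y. slice (volt' T X) t \<bullet> y = X \<bullet> tens (indicator {t<..<T}) y)"
proof -
  have K: "kset T (Klow T)" using T by (intro kset_Klow) simp
  show "AE t in lborel. t \<in> {0<..<T} \<longrightarrow> (\<forall>y. slice (volt T X) t \<bullet> y = X \<bullet> tens (indicator {0<..<t}) y)"
    using slice_kop[OF K, of X] unfolding volt_def
  proof eventually_elim
    case (elim t)
    have e: "indicator (Klow T) (t, \<tau>) = (indicator {0<..<t} \<tau> :: real)" if "t \<in> {0<..<T}" for \<tau>
      using that by (auto simp: Klow_def split: split_indicator)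
    show ?case
    proof (intro impI allI)
      fix y assume t: "t \<in> {0<..<T}"
      show "slice (kop (Klow T) X) t \<bullet> y = X \<bullet> tens (indicator {0<..<t}) y"
        unfolding inner_tens[OF indicator_interval_sqi] elim[rule_format] e[OF t] ..
    qed
  qed
  show "AE t in lborel. t \<in> {0<..<T} \<longrightarrow> (\<forall>y. slice (volt' T X) t \<bullet> y = X \<bullet> tens (indicator {t<..<T}) y)"
    using slice_kop[OF kset_converse[OF K], of X] unfolding volt'_def
  proof eventually_elim
    case (elim t)
    have e: "indicator ((Klow T)\<inverse>) (t, \<tau>) = (indicator {t<..<T} \<tau> :: real)" if "t \<in> {0<..<T}" for \<tau>
      using that by (auto simp: Klow_def split: split_indicator)
    show ?case
    proof (intro impI allI)
      fix y assume t: "t \<in> {0<..<T}"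
      show "slice (kop ((Klow T)\<inverse>) X) t \<bullet> y = X \<bullet> tens (indicator {t<..<T}) y"
        unfolding inner_tens[OF indicator_interval_sqi] elim[rule_format] e[OF t] ..
    qed
  qed
qed

lemma tens_pairing_integrable:
  fixes X :: "(real \<times> 'b::euclidean_space) lsq"
  assumes "sqi \<psi>" and [measurable]: "\<psi> \<in> borel_measurable borel"
  shows "integrable lborel (\<lambda>t. \<psi> t * (slice X t \<bullet> y))"
proof (rule integrable_cong_AE_imp[OF inner_slice_integrable[of X "tens \<psi> y"]])
  show "AE t in lborel. slice X t \<bullet> slice (tens \<psi> y) t = \<psi> t * (slice X t \<bullet> y)"
    using slice_tens[OF assms, of y] by eventually_elim simp
qed measurable

lemma restrict_integrable:
  assumes f: "sqi (\<lambda>t. indicator {0<..<T} t * f t)" and t: "0 \<le> t1" "t2 \<le> (T::real)"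
  shows "integrable lebesgue (\<lambda>t. indicator {t1<..<t2} t * f t)"
proof -
  have "integrable lebesgue (\<lambda>t. indicator {t1<..<t2} t * (indicator {0<..<T} t * f t))"
    using integrable_mult_indicator[OF _ integrable_if_sqi_on_interval[OF f], of "{t1<..<t2}"] by simp
  moreover have "indicator {t1<..<t2} t * (indicator {0<..<T} t * f t) = indicator {t1<..<t2} t * f t" for t
    using t by (auto split: split_indicator)
  ultimately show ?thesis by simp
qed

lemma value_at_oe:
  assumes "value_at T \<Omega> u t0 v" "in_L2_Omega \<Omega> v" "t0 \<in> {0..T}"
  shows "\<exists>w. (\<forall>t\<in>{0..T}. in_L2_Omega \<Omega> (w t)) \<and>
    (AE t in lborel. t \<in> {0<..<T} \<longrightarrow> (AE x in lborel. x \<in> \<Omega> \<longrightarrow> u t x = w t x)) \<and>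
    (\<forall>t1\<in>{0..T}. ((\<lambda>t. L2_Omega_norm \<Omega> (\<lambda>x. w t x - w t1 x)) \<longlongrightarrow> 0) (at t1 within {0..T})) \<and>
    oe \<Omega> (w t0) = oe \<Omega> v"
proof -
  from assms(1) obtain w where w: "\<forall>t\<in>{0..T}. in_L2_Omega \<Omega> (w t)"
     "AE t in lebesgue. t \<in> {0<..<T} \<longrightarrow> (AE x in lebesgue. x \<in> \<Omega> \<longrightarrow> u t x = w t x)"
     "\<forall>t1\<in>{0..T}. ((\<lambda>t. L2_Omega_norm \<Omega> (\<lambda>x. w t x - w t1 x)) \<longlongrightarrow> 0) (at t1 within {0..T})"
     "L2_Omega_norm \<Omega> (\<lambda>x. w t0 x - v x) = 0"
    unfolding value_at_def by blast
  have w0: "in_L2_Omega \<Omega> (w t0)" using w(1) assms(3) by blast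
  have "norm (oe \<Omega> (w t0) - oe \<Omega> v) = 0"
    using w(4) unfolding L2_Omega_norm_eq[OF oe_linear(3)[OF w0 assms(2)]] oe_linear(4)[OF w0 assms(2)] .
  then have "oe \<Omega> (w t0) = oe \<Omega> v" by simp
  moreover have "AE t in lborel. t \<in> {0<..<T} \<longrightarrow> (AE x in lborel. x \<in> \<Omega> \<longrightarrow> u t x = w t x)"
    using w(2) unfolding AE_completion_iff .
  ultimately show ?thesis using w(1,3) by blast
qed

lemma in_Hms_linear:
  assumes "in_Hms \<Omega> s G" "v \<in> tHs \<Omega> s" "w \<in> tHs \<Omega> s"
  shows "G (\<lambda>x. v x + w x) = G v + G w" "G (\<lambda>x. c * v x) = c * G v"
  using assms unfolding in_Hms_def by blast+

context
  fixes \<Omega> :: "(real^'n) set" and s T :: real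
  assumes s: "0 < s" "s < 1" and T: "0 < T" and \<Omega>: "open \<Omega>"
begin

text \<open>Elements of the dual act on functions, not on classes; boundedness makes them vanish on
  a difference of norm \<open>0\<close>, so they descend to classes.\<close>

lemma Hms_cong:
  assumes G: "in_Hms \<Omega> s G" and v: "v \<in> tHs \<Omega> s" and ae: "AE x in lborel. w x = v x"
  shows "G w = G v"
proof -
  have w: "w \<in> tHs \<Omega> s" by (rule tHs_cong_AE[OF s v ae])
  have m: "(\<lambda>x. (-1) * v x) \<in> tHs \<Omega> s" by (rule tHs_linear(2)[OF s v v])
  define d where "d = (\<lambda>x. w x + (-1) * v x)"
  have d: "d \<in> tHs \<Omega> s" unfolding d_def by (rule tHs_linear(1)[OF s w m])
  have "G d = G w + G (\<lambda>x. (-1) * v x)" unfolding d_def by (rule in_Hms_linear(1)[OF G w m])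
  also have "G (\<lambda>x. (-1) * v x) = (-1) * G v" by (rule in_Hms_linear(2)[OF G v v])
  finally have Gd: "G d = G w - G v" by simp
  have "AE x in lborel. d x = 0" using ae by eventually_elim (simp add: d_def)
  then have "emb s d = emb s (\<lambda>x. 0)" by (rule emb_cong_AE[OF s])
  also have "\<dots> = 0" unfolding emb_def[OF s] Dq_def zero_prod_def zero_lsq_def by simp
  finally have "Hs_norm s d = 0" unfolding Hs_norm_emb[OF s tHs_in_Hs[OF s d]] by simp
  then show ?thesis using Hms_bound[OF s T \<Omega> G d] Gd by simp
qed

lemma Hms_Vsp:
  assumes G: "in_Hms \<Omega> s G" and x: "x \<in> Vsp \<Omega> s" and y: "y \<in> Vsp \<Omega> s"
  shows "G (fn (fst x + fst y)) = G (fn (fst x)) + G (fn (fst y))"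
    "G (fn (c *\<^sub>R fst x)) = c * G (fn (fst x))"
    "\<bar>G (fn (fst x))\<bar> \<le> Hms_norm \<Omega> s G * norm x"
proof -
  have fx: "fn (fst x) \<in> tHs \<Omega> s" and fy: "fn (fst y) \<in> tHs \<Omega> s" using x y unfolding Vsp_iff[OF s] by auto
  show "G (fn (fst x + fst y)) = G (fn (fst x)) + G (fn (fst y))"
    unfolding in_Hms_linear(1)[OF G fx fy, symmetric] by (rule Hms_cong[OF G tHs_linear(1)[OF s fx fy] fn_add])
  show "G (fn (c *\<^sub>R fst x)) = c * G (fn (fst x))"
    unfolding in_Hms_linear(2)[OF G fx fx, symmetric] by (rule Hms_cong[OF G tHs_linear(2)[OF s fx fx] fn_scale])
  have "emb s (fn (fst x)) = x" using x unfolding Vsp_iff[OF s] emb_def[OF s] by (simp add: prod_eq_iff)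
  then show "\<bar>G (fn (fst x))\<bar> \<le> Hms_norm \<Omega> s G * norm x"
    using Hms_bound[OF s T \<Omega> G fx] Hs_norm_emb[OF s tHs_in_Hs[OF s fx]] by simp
qed

lemma Hms_fn_cls:
  assumes G: "in_Hms \<Omega> s G" and v: "v \<in> tHs \<Omega> s"
  shows "G (fn (cls v)) = G v"
  using tHs_in_Hs[OF s v] by (intro Hms_cong[OF G v] fn_cls) (simp add: in_Hs_iff)

text \<open>Neither \<open>t \<mapsto> Hms_norm (f t)\<close> nor the pairing of \<open>f\<close> with a general element of
  \<open>L\<^sup>2(0,T;H\<^sup>s)\<close> is known to be measurable, so the Riesz representative is taken on the
  subspace of those elements for which the pairing is.\<close>

lemma Hms_riesz:
  assumes f: "in_L2_Hms T \<Omega> s f"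
  shows "\<exists>r. norm r \<le> L2_Hms_norm T \<Omega> s f \<and> (\<forall>t1 t2 \<phi>. 0 \<le> t1 \<longrightarrow> t2 \<le> T \<longrightarrow> \<phi> \<in> tHs \<Omega> s \<longrightarrow>
    (LINT \<tau>|lebesgue. indicator {t1<..<t2} \<tau> * f \<tau> \<phi>)
      = fst r \<bullet> tens (indicator {t1<..<t2}) (cls \<phi>) + snd r \<bullet> tens (indicator {t1<..<t2}) (cls (Dq s \<phi>)))"
proof -
  note V = subspace_Vsp[OF s, of \<Omega>] closed_Vsp[OF s, of \<Omega>]
  define S :: "(real \<times> (real^'n)) lsq \<times> (real \<times> ((real^'n) \<times> (real^'n))) lsq \<Rightarrow> real \<Rightarrow> _"
    where "S \<Theta> t = (slice (fst \<Theta>) t, slice (snd \<Theta>) t)" for \<Theta> t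
  define F where "F \<Theta> t = indicator {0<..<T} t * f t (fn (fst (S \<Theta> t)))" for \<Theta> t
  define N where "N = (\<integral>\<^sup>+t. ennreal ((Hms_norm \<Omega> s (f t))\<^sup>2) * indicator {0<..<T} t \<partial>lborel)"
  have N: "N < \<infinity>" using f unfolding in_L2_Hms_def nn_integral_completion N_def by blast
  have NL: "L2_Hms_norm T \<Omega> s f = sqrt (enn2real N)" unfolding L2_Hms_norm_def nn_integral_completion N_def ..
  have fH: "AE t in lborel. t \<in> {0<..<T} \<longrightarrow> in_Hms \<Omega> s (f t)"
    using f unfolding in_L2_Hms_def AE_completion_iff by blast
  have SV: "AE t in lborel. t \<in> {0<..<T} \<longrightarrow> S \<Theta> t \<in> Vsp \<Omega> s" if "\<Theta> \<in> VV T (Vsp \<Omega> s)" for \<Theta>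
    using that unfolding VV_def mem_Collect_eq by eventually_elim (auto simp: S_def)
  have Fadd: "AE t in lborel. F \<Theta> t + F \<Xi> t = F (\<Theta> + \<Xi>) t"
    if "\<Theta> \<in> VV T (Vsp \<Omega> s)" "\<Xi> \<in> VV T (Vsp \<Omega> s)" for \<Theta> \<Xi>
    using SV[OF that(1)] SV[OF that(2)] fH slice_add[of "fst \<Theta>" "fst \<Xi>"]
  proof eventually_elim
    case (elim t)
    show ?case
    proof (cases "t \<in> {0<..<T}")
      case True
      have "fst (S (\<Theta> + \<Xi>) t) = fst (S \<Theta> t) + fst (S \<Xi> t)" unfolding S_def using elim(4) by simp
      then show ?thesis using Hms_Vsp(1)[of "f t" "S \<Theta> t" "S \<Xi> t"] elim True by (simp add: F_def)
    qed (simp add: F_def)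
  qed
  have Fscale: "AE t in lborel. c * F \<Theta> t = F (c *\<^sub>R \<Theta>) t" if "\<Theta> \<in> VV T (Vsp \<Omega> s)" for c \<Theta>
    using SV[OF that] fH slice_scale[of c "fst \<Theta>"]
  proof eventually_elim
    case (elim t)
    show ?case
    proof (cases "t \<in> {0<..<T}")
      case True
      have "fst (S (c *\<^sub>R \<Theta>) t) = c *\<^sub>R fst (S \<Theta> t)" unfolding S_def using elim(3) by simp
      then show ?thesis using Hms_Vsp(2)[of "f t" "S \<Theta> t" "S \<Theta> t" c] elim True by (simp add: F_def)
    qed (simp add: F_def)
  qed
  define I where "I = {\<Theta> \<in> VV T (Vsp \<Omega> s). F \<Theta> \<in> borel_measurable lebesgue}"
  have IV: "\<Theta> \<in> VV T (Vsp \<Omega> s)" "F \<Theta> \<in> borel_measurable lebesgue" if "\<Theta> \<in> I" for \<Theta> using that unfolding I_def by auto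
  define l where "l \<Theta> = (LINT t|lebesgue. F \<Theta> t)" for \<Theta>
  have key: "integrable lebesgue (F \<Theta>) \<and> \<bar>l \<Theta>\<bar> \<le> L2_Hms_norm T \<Omega> s f * norm \<Theta>" if \<Theta>: "\<Theta> \<in> I" for \<Theta>
  proof -
    define n where "n t = norm (S \<Theta> t)" for t
    have n_eq: "n t = sqrt ((norm (slice (fst \<Theta>) t))\<^sup>2 + (norm (slice (snd \<Theta>) t))\<^sup>2)" for t
      unfolding n_def S_def norm_prod_def by simp
    have [measurable]: "n \<in> borel_measurable borel" unfolding n_eq[abs_def] by measurable
    have "(\<integral>\<^sup>+t. ennreal ((n t)\<^sup>2) \<partial>lborel)
        = (\<integral>\<^sup>+t. ennreal ((norm (slice (fst \<Theta>) t))\<^sup>2) + ennreal ((norm (slice (snd \<Theta>) t))\<^sup>2) \<partial>lborel)"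
      by (rule nn_integral_cong) (simp add: n_eq)
    also have "\<dots> = ennreal ((norm (fst \<Theta>))\<^sup>2) + ennreal ((norm (snd \<Theta>))\<^sup>2)"
      by (simp add: nn_integral_add norm_slice_nn)
    also have "\<dots> = ennreal ((norm \<Theta>)\<^sup>2)" unfolding norm_prod_def[of \<Theta>] by simp
    finally have nn: "(\<integral>\<^sup>+t. ennreal ((n t)\<^sup>2) \<partial>lborel) = ennreal ((norm \<Theta>)\<^sup>2)" .
    have sn: "sqi n" by (rule sqi_borelI) (simp_all add: nn)
    have ncls: "norm (cls n) = norm \<Theta>"
      using norm_cls_nn[OF sn] unfolding nn by (intro power2_eq_imp_eq[of "norm (cls n)" "norm \<Theta>"]) simp_all
    \<comment> \<open>\<open>k\<close> is measurable, lies below the dual norm almost everywhere on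
      \<open>(0, T)\<close> and satisfies \<open>|F \<Theta> t| = k t * n t\<close>. Cauchy-Schwarz
      is applied to \<open>k\<close> and \<open>n\<close>, so the dual norm enters only through
      monotonicity of its integral. Where \<open>n\<close> vanishes so does
      \<open>F \<Theta>\<close>, and \<open>k\<close> is \<open>0\<close> by the convention for
      division.\<close>
    define k where "k t = \<bar>F \<Theta> t\<bar> / n t" for t
    have nl: "n \<in> borel_measurable lebesgue" by (rule measurable_completion) simp
    have km: "k \<in> borel_measurable lebesgue"
      unfolding k_def[abs_def] by (rule borel_measurable_divide[OF borel_measurable_abs[OF IV(2)[OF \<Theta>]] nl])
    have kb: "AE t in lborel. \<bar>F \<Theta> t\<bar> = k t * n t \<and> ennreal ((k t)\<^sup>2) \<le> ennreal ((Hms_norm \<Omega> s (f t))\<^sup>2) * indicator {0<..<T} t"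
      using SV[OF IV(1)[OF \<Theta>]] fH
    proof eventually_elim
      case (elim t)
      show ?case
      proof (cases "t \<in> {0<..<T}")
        case True
        have le: "\<bar>F \<Theta> t\<bar> \<le> Hms_norm \<Omega> s (f t) * n t"
          using Hms_Vsp(3)[of "f t" "S \<Theta> t"] elim True by (simp add: F_def n_def)
        show ?thesis
        proof (cases "n t = 0")
          case True
          then show ?thesis using le by (simp add: k_def)
        next
          case False
          then have np: "0 < n t" unfolding n_def by simp
          have k0: "0 \<le> k t" unfolding k_def using np by simp
          have "k t \<le> Hms_norm \<Omega> s (f t)" using le np unfolding k_def by (simp add: pos_divide_le_eq)
          then have "(k t)\<^sup>2 \<le> (Hms_norm \<Omega> s (f t))\<^sup>2" using k0 by (rule power_mono)
          then show ?thesis using \<open>t \<in> {0<..<T}\<close> np by (simp add: ennreal_leI k_def)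
        qed
      qed (simp add: F_def k_def)
    qed
    have kN: "(\<integral>\<^sup>+t. ennreal ((k t)\<^sup>2) \<partial>lborel) \<le> N"
      unfolding N_def by (rule nn_integral_mono_AE) (use kb in eventually_elim, blast)
    have sk: "sqi k" unfolding sqi_def using km le_less_trans[OF kN N] by simp
    have "ennreal ((norm (cls k))\<^sup>2) \<le> ennreal (enn2real N)"
      unfolding norm_cls_nn[OF sk] using kN N by (simp add: less_top)
    then have "(norm (cls k))\<^sup>2 \<le> enn2real N" by simp
    then have kL: "norm (cls k) \<le> L2_Hms_norm T \<Omega> s f" unfolding NL by (rule real_le_rsqrt)
    have kn: "integrable lebesgue (\<lambda>t. k t * n t)" by (rule sqi_mult_integrable[OF sk sn])
    have Fk: "AE t in lebesgue. \<bar>F \<Theta> t\<bar> = k t * n t" unfolding AE_completion_iff using kb by eventually_elim blast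
    have Fi: "integrable lebesgue (F \<Theta>)"
      by (rule Bochner_Integration.integrable_bound[OF kn IV(2)[OF \<Theta>]], use Fk in eventually_elim) simp
    have "\<bar>l \<Theta>\<bar> \<le> (LINT t|lebesgue. \<bar>F \<Theta> t\<bar>)" unfolding l_def by (rule integral_abs_bound)
    also have "\<dots> = (LINT t|lebesgue. k t * n t)"
      by (rule integral_cong_AE[OF borel_measurable_abs[OF IV(2)[OF \<Theta>]] borel_measurable_integrable[OF kn] Fk])
    also have "\<dots> = cls k \<bullet> cls n" by (rule inner_cls[OF sk sn, symmetric])
    also have "\<dots> \<le> norm (cls k) * norm (cls n)" by (rule norm_cauchy_schwarz)
    also have "\<dots> \<le> L2_Hms_norm T \<Omega> s f * norm \<Theta>" unfolding ncls by (rule mult_right_mono[OF kL]) simp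
    finally show ?thesis using Fi by blast
  qed
  have mA: "F (\<Theta> + \<Xi>) \<in> borel_measurable lebesgue" if "\<Theta> \<in> I" "\<Xi> \<in> I" for \<Theta> \<Xi>
    by (rule lebesgue_measurable_cong_AE[OF borel_measurable_add[OF IV(2)[OF that(1)] IV(2)[OF that(2)]] Fadd[OF IV(1)[OF that(1)] IV(1)[OF that(2)]]])
  have mS: "F (c *\<^sub>R \<Theta>) \<in> borel_measurable lebesgue" if "\<Theta> \<in> I" for c \<Theta>
    by (rule lebesgue_measurable_cong_AE[OF borel_measurable_times[OF borel_measurable_const IV(2)[OF that]] Fscale[OF IV(1)[OF that]]])
  note W = subspace_VV[OF V, of T]
  have subI: "subspace I"
  proof (rule subspaceI)
    have z: "0 \<in> VV T (Vsp \<Omega> s)" by (rule subspace_0[OF W])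
    have z0: "AE t in lborel. 0 = F 0 t" using Fscale[OF z, of 0] by simp
    have "F 0 \<in> borel_measurable lebesgue" by (rule lebesgue_measurable_cong_AE[OF borel_measurable_const z0])
    then show "0 \<in> I" using z unfolding I_def by simp
    show "x + y \<in> I" if "x \<in> I" "y \<in> I" for x y
      unfolding I_def using subspace_add[OF W IV(1)[OF that(1)] IV(1)[OF that(2)]] mA[OF that] by simp
    show "c *\<^sub>R x \<in> I" if "x \<in> I" for c x
      unfolding I_def using subspace_scale[OF W IV(1)[OF that]] mS[OF that] by simp
  qed
  have "\<exists>r. r \<in> closure ((\<lambda>i. i) ` I) \<and> norm r \<le> \<bar>L2_Hms_norm T \<Omega> s f\<bar> \<and> (\<forall>i\<in>I. r \<bullet> i = l i)"
  proof (rule riesz_indexed[OF subI])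
    fix x y assume xy: "x \<in> I" "y \<in> I"
    have "l (x + y) = (LINT t|lebesgue. F x t + F y t)"
      unfolding l_def by (rule integral_cong_AE[OF mA[OF xy] borel_measurable_add[OF IV(2)[OF xy(1)] IV(2)[OF xy(2)]]],
        unfold AE_completion_iff, use Fadd[OF IV(1)[OF xy(1)] IV(1)[OF xy(2)]] in eventually_elim) simp
    then show "l (x + y) = l x + l y" unfolding l_def using key[OF xy(1)] key[OF xy(2)] by simp
  next
    fix x c assume x: "x \<in> I"
    have "l (c *\<^sub>R x) = (LINT t|lebesgue. c * F x t)"
      unfolding l_def by (rule integral_cong_AE[OF mS[OF x] borel_measurable_times[OF borel_measurable_const IV(2)[OF x]]],
        unfold AE_completion_iff, use Fscale[OF IV(1)[OF x], of c] in eventually_elim) simp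
    then show "l (c *\<^sub>R x) = c * l x" unfolding l_def by simp
  next
    fix x assume "x \<in> I"
    then show "\<bar>l x\<bar> \<le> L2_Hms_norm T \<Omega> s f * norm x" using key by blast
  qed auto
  then obtain r where r: "norm r \<le> \<bar>L2_Hms_norm T \<Omega> s f\<bar>" "\<And>i. i \<in> I ==> r \<bullet> i = l i" by blast
  have "(LINT \<tau>|lebesgue. indicator {t1<..<t2} \<tau> * f \<tau> \<phi>)
      = fst r \<bullet> tens (indicator {t1<..<t2}) (cls \<phi>) + snd r \<bullet> tens (indicator {t1<..<t2}) (cls (Dq s \<phi>))"
    if t: "0 \<le> t1" "t2 \<le> T" and \<phi>: "\<phi> \<in> tHs \<Omega> s" for t1 t2 \<phi>
  proof -
    define \<psi> :: "real \<Rightarrow> real" where "\<psi> = indicator {t1<..<t2}"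
    have \<psi>: "sqi \<psi>" "\<psi> \<in> borel_measurable borel" unfolding \<psi>_def by (rule indicator_interval_sqi)+
    have \<psi>0: "\<psi> \<tau> = 0" if "\<tau> \<notin> {0<..<T}" for \<tau> using that t unfolding \<psi>_def by (auto split: split_indicator)
    define \<Theta> where "\<Theta> = (tens \<psi> (cls \<phi>), tens \<psi> (cls (Dq s \<phi>)))"
    have ev: "emb s \<phi> \<in> Vsp \<Omega> s" using \<phi> unfolding Vsp_def[OF s] by blast
    have \<Theta>V: "\<Theta> \<in> VV T (Vsp \<Omega> s)" using tens_VV[OF V ev \<psi> \<psi>0] unfolding \<Theta>_def emb_def[OF s] by simp
    have FE: "AE \<tau> in lborel. \<psi> \<tau> * f \<tau> \<phi> = F \<Theta> \<tau>" using fH slice_tens[OF \<psi>, of "cls \<phi>"]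
    proof eventually_elim
      case (elim \<tau>)
      show ?case
      proof (cases "\<tau> \<in> {0<..<T}")
        case True
        then have G: "in_Hms \<Omega> s (f \<tau>)" using elim by blast
        have "f \<tau> (fn (\<psi> \<tau> *\<^sub>R cls \<phi>)) = \<psi> \<tau> * f \<tau> \<phi>"
          using Hms_Vsp(2)[OF G ev ev, of "\<psi> \<tau>"] Hms_fn_cls[OF G \<phi>] unfolding emb_def[OF s] by simp
        then show ?thesis using elim(2) True by (simp add: F_def S_def \<Theta>_def)
      qed (simp add: F_def \<psi>0)
    qed
    have fi: "integrable lebesgue (\<lambda>\<tau>. \<psi> \<tau> * f \<tau> \<phi>)"
      unfolding \<psi>_def by (rule restrict_integrable[OF in_L2_Hms_sqi[OF s T \<Omega> f \<phi>] t])
    \<comment> \<open>This puts the tensor \<open>\<Theta>\<close> into \<open>I\<close>: its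
      pairing inherits measurability from \<open>f \<tau> \<phi>\<close> for a fixed
      \<open>\<phi>\<close>.\<close>
    have Fm: "F \<Theta> \<in> borel_measurable lebesgue"
      by (rule lebesgue_measurable_cong_AE[OF borel_measurable_integrable[OF fi] FE])
    have "(LINT \<tau>|lebesgue. \<psi> \<tau> * f \<tau> \<phi>) = l \<Theta>"
      unfolding l_def by (rule integral_cong_AE[OF borel_measurable_integrable[OF fi] Fm]) (use FE in \<open>simp add: AE_completion_iff\<close>)
    also have "\<dots> = r \<bullet> \<Theta>" using r(2)[of \<Theta>] \<Theta>V Fm unfolding I_def by simp
    finally show ?thesis unfolding \<Theta>_def \<psi>_def inner_prod_def by simp
  qed
  moreover have "norm r \<le> L2_Hms_norm T \<Omega> s f" using r(1) unfolding NL by simp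
  ultimately show ?thesis by blast
qed

text \<open>The derivative is split into a functional \<open>h\<close> and two pairings with slices,
  so that one integration in time serves both equations: \<open>h\<close> is \<open>f\<close> for
  the state and \<open>0\<close> for the adjoint state.\<close>

lemma weak_increment:
  assumes g: "in_L2_Hms T \<Omega> s g" and dt: "has_dt_Hms T \<Omega> s u g"
    and w: "\<And>t. t \<in> {0..T} ==> in_L2_Omega \<Omega> (w t)"
    and uw: "AE t in lborel. t \<in> {0<..<T} \<longrightarrow> (AE x in lborel. x \<in> \<Omega> \<longrightarrow> u t x = w t x)"
    and wc: "\<And>t1. t1 \<in> {0..T} ==> ((\<lambda>t. L2_Omega_norm \<Omega> (\<lambda>x. w t x - w t1 x)) \<longlongrightarrow> 0) (at t1 within {0..T})"
    and ge: "AE \<tau> in lborel. \<tau> \<in> {0<..<T} \<longrightarrow> (\<forall>\<phi>\<in>tHs \<Omega> s. g \<tau> \<phi> = h \<tau> \<phi> + slice A \<tau> \<bullet> cls \<phi> + slice B \<tau> \<bullet> cls (Dq s \<phi>))"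
    and h: "\<And>\<phi>. \<phi> \<in> tHs \<Omega> s ==> sqi (\<lambda>t. indicator {0<..<T} t * h t \<phi>)"
    and \<phi>: "\<phi> \<in> tHs \<Omega> s" and t: "0 \<le> t1" "t1 \<le> t2" "t2 \<le> T"
  shows "oe \<Omega> (w t2) \<bullet> cls \<phi> - oe \<Omega> (w t1) \<bullet> cls \<phi> = (LINT \<tau>|lebesgue. indicator {t1<..<t2} \<tau> * h \<tau> \<phi>)
    + A \<bullet> tens (indicator {t1<..<t2}) (cls \<phi>) + B \<bullet> tens (indicator {t1<..<t2}) (cls (Dq s \<phi>))"
proof -
  let ?i = "indicator {t1<..<t2} :: real \<Rightarrow> real"
  note ii = indicator_interval_sqi[of t1 t2]
  have hi: "integrable lebesgue (\<lambda>\<tau>. ?i \<tau> * h \<tau> \<phi>)" by (rule restrict_integrable[OF h[OF \<phi>] t(1,3)])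
  have gi: "integrable lebesgue (\<lambda>\<tau>. ?i \<tau> * g \<tau> \<phi>)" by (rule restrict_integrable[OF in_L2_Hms_sqi[OF s T \<Omega> g \<phi>] t(1,3)])
  have Ai: "integrable lebesgue (\<lambda>\<tau>. ?i \<tau> * (slice A \<tau> \<bullet> cls \<phi>))"
    using tens_pairing_integrable[OF ii, of A "cls \<phi>"] by (simp add: integrable_completion)
  have Bi: "integrable lebesgue (\<lambda>\<tau>. ?i \<tau> * (slice B \<tau> \<bullet> cls (Dq s \<phi>)))"
    using tens_pairing_integrable[OF ii, of B "cls (Dq s \<phi>)"] by (simp add: integrable_completion)
  have "oe \<Omega> (w t2) \<bullet> cls \<phi> - oe \<Omega> (w t1) \<bullet> cls \<phi> = (LINT \<tau>|lebesgue. ?i \<tau> * g \<tau> \<phi>)"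
    by (rule pairing_FTC[OF s T \<Omega> g dt w uw wc \<phi> t])
  also have "\<dots> = (LINT \<tau>|lebesgue. ?i \<tau> * h \<tau> \<phi> + ?i \<tau> * (slice A \<tau> \<bullet> cls \<phi>) + ?i \<tau> * (slice B \<tau> \<bullet> cls (Dq s \<phi>)))"
  proof (rule integral_cong_AE)
    show "AE \<tau> in lebesgue. ?i \<tau> * g \<tau> \<phi> = ?i \<tau> * h \<tau> \<phi> + ?i \<tau> * (slice A \<tau> \<bullet> cls \<phi>) + ?i \<tau> * (slice B \<tau> \<bullet> cls (Dq s \<phi>))"
      unfolding AE_completion_iff using ge
    proof eventually_elim
      case (elim \<tau>)
      show ?case
      proof (cases "\<tau> \<in> {t1<..<t2}")
        case True
        then have "\<tau> \<in> {0<..<T}" using t by auto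
        then show ?thesis using elim \<phi> True by simp
      qed simp
    qed
  qed (use gi hi Ai Bi in \<open>auto intro!: borel_measurable_integrable\<close>)
  also have "\<dots> = (LINT \<tau>|lebesgue. ?i \<tau> * h \<tau> \<phi>) + (LINT \<tau>|lebesgue. ?i \<tau> * (slice A \<tau> \<bullet> cls \<phi>))
      + (LINT \<tau>|lebesgue. ?i \<tau> * (slice B \<tau> \<bullet> cls (Dq s \<phi>)))"
    using hi Ai Bi by simp
  also have "(LINT \<tau>|lebesgue. ?i \<tau> * (slice A \<tau> \<bullet> cls \<phi>)) = A \<bullet> tens ?i (cls \<phi>)"
    unfolding inner_tens[OF ii] by (rule integral_completion) simp
  also have "(LINT \<tau>|lebesgue. ?i \<tau> * (slice B \<tau> \<bullet> cls (Dq s \<phi>))) = B \<bullet> tens ?i (cls (Dq s \<phi>))"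
    unfolding inner_tens[OF ii] by (rule integral_completion) simp
  finally show ?thesis .
qed

text \<open>Integration runs from \<open>t\<close> to the end time, where \<open>p\<close> vanishes,
  and so produces \<open>volt'\<close>. The minus sign of the derivative in the adjoint equation
  gives the form the same sign as in the state equation.\<close>

lemma adjoint_weak:
  assumes p: "is_adjoint T \<Omega> s u ud p" and u: "in_L2Q T \<Omega> u" and ud: "in_L2Q T \<Omega> ud"
  shows "\<exists>Y\<in>VV T (Vsp \<Omega> s). in_L2Q T \<Omega> p \<and> fst Y = qe T \<Omega> p \<and> (\<forall>\<Theta>\<in>VV T (Vsp \<Omega> s).
    fst Y \<bullet> fst \<Theta> + Cns CARD('n) s / 2 * (volt' T (snd Y) \<bullet> snd \<Theta>) = volt' T (qe T \<Omega> (\<lambda>t x. u t x - ud t x)) \<bullet> fst \<Theta>)"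
proof -
  define \<kappa> where "\<kappa> = Cns CARD('n) s / 2"
  note V = subspace_Vsp[OF s, of \<Omega>] closed_Vsp[OF s, of \<Omega>]
  define F where "F = qe T \<Omega> (\<lambda>t x. u t x - ud t x)"
  obtain g where g: "in_V_with T \<Omega> s p g" and eq: "AE t in lborel. t \<in> {0<..<T} \<longrightarrow> (\<forall>\<phi>\<in>tHs \<Omega> s.
        - g t \<phi> + frac_form s (p t) \<phi> = (LINT x:\<Omega>|lebesgue. (u t x - ud t x) * \<phi> x))"
    and val: "value_at T \<Omega> p T (\<lambda>x. 0)"
    using p unfolding is_adjoint_def AE_completion_iff by blast
  have gs: "in_L2_tHs T \<Omega> s p" "in_L2_Hms T \<Omega> s g" "has_dt_Hms T \<Omega> s p g" using g unfolding in_V_with_def by auto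
  obtain Y where Y: "Y \<in> VV T (Vsp \<Omega> s)" "in_L2Q T \<Omega> p" "fst Y = qe T \<Omega> p"
    and Ye: "AE t in lborel. t \<in> {0<..<T} \<longrightarrow> p t \<in> tHs \<Omega> s \<and> (slice (fst Y) t, slice (snd Y) t) = emb s (p t)"
    using in_L2_tHs_VV[OF s T \<Omega> gs(1)] by blast
  have z: "in_L2_Omega \<Omega> (\<lambda>x. 0)" unfolding in_L2_Omega_iff by (simp add: sqi_def)
  have oz: "oe \<Omega> (\<lambda>x. 0) = 0" unfolding oe_def zero_lsq_def by simp
  have TT: "T \<in> {0..T}" using T by simp
  obtain w where w': "\<forall>t\<in>{0..T}. in_L2_Omega \<Omega> (w t)"
    "AE t in lborel. t \<in> {0<..<T} \<longrightarrow> (AE x in lborel. x \<in> \<Omega> \<longrightarrow> p t x = w t x)"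
    "\<forall>t1\<in>{0..T}. ((\<lambda>t. L2_Omega_norm \<Omega> (\<lambda>x. w t x - w t1 x)) \<longlongrightarrow> 0) (at t1 within {0..T})"
    "oe \<Omega> (w T) = 0"
    using value_at_oe[OF val z TT] unfolding oz by blast
  note w = bspec[OF w'(1)] w'(2) bspec[OF w'(3)] w'(4)
  have ge: "AE \<tau> in lborel. \<tau> \<in> {0<..<T} \<longrightarrow> (\<forall>\<phi>\<in>tHs \<Omega> s. g \<tau> \<phi> = 0 + slice ((-1) *\<^sub>R F) \<tau> \<bullet> cls \<phi> + slice (\<kappa> *\<^sub>R snd Y) \<tau> \<bullet> cls (Dq s \<phi>))"
    using eq Ye slice_scale[of "-1" F] slice_scale[of \<kappa> "snd Y"] slice_qe[OF qe_linear(3)[OF u ud]]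
  proof eventually_elim
    case (elim \<tau>)
    show ?case
    proof (intro impI ballI)
      fix \<phi> assume t: "\<tau> \<in> {0<..<T}" and \<phi>: "\<phi> \<in> tHs \<Omega> s"
      have \<phi>H: "in_Hs s \<phi>" "sqi \<phi>" using tHs_in_Hs[OF s \<phi>] by (auto simp: in_Hs_iff)
      have pt: "in_Hs s (p \<tau>)" "snd Y = snd Y" "slice (snd Y) \<tau> = cls (Dq s (p \<tau>))"
        using elim(2) t tHs_in_Hs[OF s] unfolding emb_def[OF s] by auto
      have o: "in_L2_Omega \<Omega> (\<lambda>x. u \<tau> x - ud \<tau> x)" "slice F \<tau> = oe \<Omega> (\<lambda>x. u \<tau> x - ud \<tau> x)"
        using elim(5) t unfolding F_def by auto
      have "- g \<tau> \<phi> + \<kappa> * (cls (Dq s (p \<tau>)) \<bullet> cls (Dq s \<phi>)) = oe \<Omega> (\<lambda>x. u \<tau> x - ud \<tau> x) \<bullet> cls \<phi>"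
        using bspec[OF mp[OF elim(1) t] \<phi>] by (simp only: frac_form_eq[OF pt(1) \<phi>H(1)] set_integral_oe[OF o(1) \<phi>H(2)] \<kappa>_def)
      then show "g \<tau> \<phi> = 0 + slice ((-1) *\<^sub>R F) \<tau> \<bullet> cls \<phi> + slice (\<kappa> *\<^sub>R snd Y) \<tau> \<bullet> cls (Dq s \<phi>)"
        using elim(3,4) o(2) pt(3) by simp
    qed
  qed
  have hz: "sqi (\<lambda>t::real. indicator {0<..<T} t * 0)" by (simp add: sqi_def)
  have pw: "AE t in lborel. t \<in> {0<..<T} \<longrightarrow> (\<forall>v\<in>Vsp \<Omega> s. slice (fst Y) t \<bullet> fst v + slice (\<kappa> *\<^sub>R volt' T (snd Y)) t \<bullet> snd v
      = slice (volt' T F) t \<bullet> fst v + slice 0 t \<bullet> snd v)"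
    using slice_volt_tens(2)[OF T, of F] slice_volt_tens(2)[OF T, of "snd Y"] slice_scale[of \<kappa> "volt' T (snd Y)"] slice_zero[where 'b = "(real^'n) \<times> (real^'n)"]
      slice_qe[OF Y(2)] w(2)
  proof eventually_elim
    case (elim t)
    show ?case
    proof (intro impI ballI)
      fix v assume t: "t \<in> {0<..<T}" and "v \<in> Vsp \<Omega> s"
      then obtain \<phi> where \<phi>: "\<phi> \<in> tHs \<Omega> s" "v = emb s \<phi>" unfolding Vsp_def[OF s] by blast
      have v: "fst v = cls \<phi>" "snd v = cls (Dq s \<phi>)" unfolding \<phi>(2) emb_def[OF s] by simp_all
      have tt: "0 \<le> t" "t \<le> T" "T \<le> T" using t by auto
      have "oe \<Omega> (w T) \<bullet> cls \<phi> - oe \<Omega> (w t) \<bullet> cls \<phi> = (LINT \<tau>|lebesgue. indicator {t<..<T} \<tau> * 0)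
          + ((-1) *\<^sub>R F) \<bullet> tens (indicator {t<..<T}) (cls \<phi>) + (\<kappa> *\<^sub>R snd Y) \<bullet> tens (indicator {t<..<T}) (cls (Dq s \<phi>))"
        by (rule weak_increment[OF gs(2,3) w(1,2,3) ge hz \<phi>(1) tt])
      moreover have "slice (fst Y) t = oe \<Omega> (w t)"
        unfolding Y(3) using elim(5,6) t oe_cong_AE(1)[of \<Omega> "p t" "w t"] by auto
      ultimately show "slice (fst Y) t \<bullet> fst v + slice (\<kappa> *\<^sub>R volt' T (snd Y)) t \<bullet> snd v
          = slice (volt' T F) t \<bullet> fst v + slice 0 t \<bullet> snd v"
        using elim(1-4) t w(4) unfolding v by simp
    qed
  qed
  have "fst Y \<bullet> fst \<Theta> + \<kappa> * (volt' T (snd Y) \<bullet> snd \<Theta>) = volt' T F \<bullet> fst \<Theta>" if "\<Theta> \<in> VV T (Vsp \<Omega> s)" for \<Theta>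
    using VV_weak_if_pointwise[OF V pw that] by simp
  then show ?thesis using Y unfolding \<kappa>_def F_def by blast
qed

text \<open>Integration from \<open>0\<close> turns the initial value into an element constant in
  time on \<open>(0, T)\<close>. The representative \<open>r\<close> of \<open>f\<close> contributes
  to both components, since a functional on the fractional space acts on the function and on its
  quotient.\<close>

lemma state_weak:
  assumes st: "is_state T \<Omega> s f u0 z u" and f: "in_L2_Hms T \<Omega> s f" and u0: "in_L2_Omega \<Omega> u0" and zQ: "in_L2Q T \<Omega> z"
    and r: "\<And>t1 t2 \<phi>. 0 \<le> t1 ==> t2 \<le> T ==> \<phi> \<in> tHs \<Omega> s ==> (LINT \<tau>|lebesgue. indicator {t1<..<t2} \<tau> * f \<tau> \<phi>)
      = fst r \<bullet> tens (indicator {t1<..<t2}) (cls \<phi>) + snd r \<bullet> tens (indicator {t1<..<t2}) (cls (Dq s \<phi>))"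
  shows "\<exists>X\<in>VV T (Vsp \<Omega> s). in_L2Q T \<Omega> u \<and> fst X = qe T \<Omega> u \<and> (\<forall>\<Theta>\<in>VV T (Vsp \<Omega> s).
    fst X \<bullet> fst \<Theta> + Cns CARD('n) s / 2 * (volt T (snd X) \<bullet> snd \<Theta>)
      = tens (indicator {0<..<T}) (oe \<Omega> u0) \<bullet> fst \<Theta> + volt T (fst r + qe T \<Omega> z) \<bullet> fst \<Theta> + volt T (snd r) \<bullet> snd \<Theta>)"
proof -
  define \<kappa> where "\<kappa> = Cns CARD('n) s / 2"
  note V = subspace_Vsp[OF s, of \<Omega>] closed_Vsp[OF s, of \<Omega>]
  obtain g where g: "in_V_with T \<Omega> s u g" and eq: "AE t in lborel. t \<in> {0<..<T} \<longrightarrow> (\<forall>\<phi>\<in>tHs \<Omega> s.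
        g t \<phi> + frac_form s (u t) \<phi> = f t \<phi> + (LINT x:\<Omega>|lebesgue. z t x * \<phi> x))"
    and val: "value_at T \<Omega> u 0 u0"
    using st unfolding is_state_def AE_completion_iff by blast
  have gs: "in_L2_tHs T \<Omega> s u" "in_L2_Hms T \<Omega> s g" "has_dt_Hms T \<Omega> s u g" using g unfolding in_V_with_def by auto
  obtain X where X: "X \<in> VV T (Vsp \<Omega> s)" "in_L2Q T \<Omega> u" "fst X = qe T \<Omega> u"
    and Xe: "AE t in lborel. t \<in> {0<..<T} \<longrightarrow> u t \<in> tHs \<Omega> s \<and> (slice (fst X) t, slice (snd X) t) = emb s (u t)"
    using in_L2_tHs_VV[OF s T \<Omega> gs(1)] by blast
  have T0: "0 \<in> {0..T}" using T by simp
  obtain w where w': "\<forall>t\<in>{0..T}. in_L2_Omega \<Omega> (w t)"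
    "AE t in lborel. t \<in> {0<..<T} \<longrightarrow> (AE x in lborel. x \<in> \<Omega> \<longrightarrow> u t x = w t x)"
    "\<forall>t1\<in>{0..T}. ((\<lambda>t. L2_Omega_norm \<Omega> (\<lambda>x. w t x - w t1 x)) \<longlongrightarrow> 0) (at t1 within {0..T})"
    "oe \<Omega> (w 0) = oe \<Omega> u0"
    using value_at_oe[OF val u0 T0] by blast
  note w = bspec[OF w'(1)] w'(2) bspec[OF w'(3)] w'(4)
  have ge: "AE \<tau> in lborel. \<tau> \<in> {0<..<T} \<longrightarrow> (\<forall>\<phi>\<in>tHs \<Omega> s. g \<tau> \<phi> = f \<tau> \<phi> + slice (qe T \<Omega> z) \<tau> \<bullet> cls \<phi> + slice ((- \<kappa>) *\<^sub>R snd X) \<tau> \<bullet> cls (Dq s \<phi>))"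
    using eq Xe slice_scale[of "- \<kappa>" "snd X"] slice_qe[OF zQ]
  proof eventually_elim
    case (elim \<tau>)
    show ?case
    proof (intro impI ballI)
      fix \<phi> assume t: "\<tau> \<in> {0<..<T}" and \<phi>: "\<phi> \<in> tHs \<Omega> s"
      have \<phi>H: "in_Hs s \<phi>" "sqi \<phi>" using tHs_in_Hs[OF s \<phi>] by (auto simp: in_Hs_iff)
      have ut: "in_Hs s (u \<tau>)" "slice (snd X) \<tau> = cls (Dq s (u \<tau>))"
        using elim(2) t tHs_in_Hs[OF s] unfolding emb_def[OF s] by auto
      have o: "in_L2_Omega \<Omega> (z \<tau>)" "slice (qe T \<Omega> z) \<tau> = oe \<Omega> (z \<tau>)" using elim(4) t by auto
      have "g \<tau> \<phi> + \<kappa> * (cls (Dq s (u \<tau>)) \<bullet> cls (Dq s \<phi>)) = f \<tau> \<phi> + oe \<Omega> (z \<tau>) \<bullet> cls \<phi>"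
        using bspec[OF mp[OF elim(1) t] \<phi>] by (simp only: frac_form_eq[OF ut(1) \<phi>H(1)] set_integral_oe[OF o(1) \<phi>H(2)] \<kappa>_def)
      then show "g \<tau> \<phi> = f \<tau> \<phi> + slice (qe T \<Omega> z) \<tau> \<bullet> cls \<phi> + slice ((- \<kappa>) *\<^sub>R snd X) \<tau> \<bullet> cls (Dq s \<phi>)"
        using elim(3) o(2) ut(2) by simp
    qed
  qed
  let ?e = "tens (indicator {0<..<T}) (oe \<Omega> u0)"
  have pw: "AE t in lborel. t \<in> {0<..<T} \<longrightarrow> (\<forall>v\<in>Vsp \<Omega> s. slice (fst X) t \<bullet> fst v + slice (\<kappa> *\<^sub>R volt T (snd X)) t \<bullet> snd v
      = slice (?e + volt T (fst r + qe T \<Omega> z)) t \<bullet> fst v + slice (volt T (snd r)) t \<bullet> snd v)"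
    using slice_volt_tens(1)[OF T, of "fst r + qe T \<Omega> z"] slice_volt_tens(1)[OF T, of "snd X"] slice_volt_tens(1)[OF T, of "snd r"]
      slice_scale[of \<kappa> "volt T (snd X)"] slice_add[of ?e "volt T (fst r + qe T \<Omega> z)"]
      slice_tens[OF indicator_interval_sqi[of 0 T], of "oe \<Omega> u0"] slice_qe[OF X(2)] w(2)
  proof eventually_elim
    case (elim t)
    show ?case
    proof (intro impI ballI)
      fix v assume t: "t \<in> {0<..<T}" and "v \<in> Vsp \<Omega> s"
      then obtain \<phi> where \<phi>: "\<phi> \<in> tHs \<Omega> s" "v = emb s \<phi>" unfolding Vsp_def[OF s] by blast
      have v: "fst v = cls \<phi>" "snd v = cls (Dq s \<phi>)" unfolding \<phi>(2) emb_def[OF s] by simp_all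
      have tt: "0 \<le> (0::real)" "0 \<le> t" "t \<le> T" using t by auto
      have "oe \<Omega> (w t) \<bullet> cls \<phi> - oe \<Omega> (w 0) \<bullet> cls \<phi> = (LINT \<tau>|lebesgue. indicator {0<..<t} \<tau> * f \<tau> \<phi>)
          + qe T \<Omega> z \<bullet> tens (indicator {0<..<t}) (cls \<phi>) + ((- \<kappa>) *\<^sub>R snd X) \<bullet> tens (indicator {0<..<t}) (cls (Dq s \<phi>))"
        by (rule weak_increment[OF gs(2,3) w(1,2,3) ge in_L2_Hms_sqi[OF s T \<Omega> f] \<phi>(1) tt])
      moreover have "slice (fst X) t = oe \<Omega> (w t)"
        unfolding X(3) using elim(7,8) t oe_cong_AE(1)[of \<Omega> "u t" "w t"] by auto
      ultimately show "slice (fst X) t \<bullet> fst v + slice (\<kappa> *\<^sub>R volt T (snd X)) t \<bullet> snd v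
          = slice (?e + volt T (fst r + qe T \<Omega> z)) t \<bullet> fst v + slice (volt T (snd r)) t \<bullet> snd v"
        using elim(1-6) t w(4) r[OF tt(1,3) \<phi>(1)] unfolding v by (simp add: inner_add_left)
    qed
  qed
  have "fst X \<bullet> fst \<Theta> + \<kappa> * (volt T (snd X) \<bullet> snd \<Theta>)
      = ?e \<bullet> fst \<Theta> + volt T (fst r + qe T \<Omega> z) \<bullet> fst \<Theta> + volt T (snd r) \<bullet> snd \<Theta>" if "\<Theta> \<in> VV T (Vsp \<Omega> s)" for \<Theta>
    using VV_weak_if_pointwise[OF V pw that] by (simp add: inner_add_left)
  then show ?thesis using X unfolding \<kappa>_def by blast
qed

end

section \<open>Perturbed states\<close>

text \<open>The first summand need not be measurable, in which case its integral is a lower integral.\<close>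

lemma nn_integral_affine_le:
  assumes c: "0 < c" and [measurable]: "b \<in> borel_measurable M"
  shows "(\<integral>\<^sup>+x. ennreal c * A x + ennreal (b x) \<partial>M) \<le> ennreal c * (\<integral>\<^sup>+x. A x \<partial>M) + (\<integral>\<^sup>+x. ennreal (b x) \<partial>M)"
  unfolding nn_integral_def[of M "\<lambda>x. ennreal c * A x + ennreal (b x)"]
proof (rule SUP_least)
  fix g assume "g \<in> {g. simple_function M g \<and> g \<le> (\<lambda>x. ennreal c * A x + ennreal (b x))}"
  then have g: "simple_function M g" "\<And>x. g x \<le> ennreal c * A x + ennreal (b x)" by (auto simp: le_fun_def)
  have [measurable]: "g \<in> borel_measurable M" by (rule borel_measurable_simple_function[OF g(1)])
  have cc: "ennreal (1 / c) * ennreal c = 1" "ennreal c * ennreal (1 / c) = 1"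
    using c by (simp_all add: ennreal_mult[symmetric])
  \<comment> \<open>A measurable function below \<open>A\<close> which together with
    \<open>b\<close> still dominates the simple function \<open>g\<close>; it stands in for
    \<open>A\<close> where additivity of the integral needs measurability.\<close>
  define h where "h x = ennreal (1 / c) * (g x - ennreal (b x))" for x
  have [measurable]: "h \<in> borel_measurable M" unfolding h_def by measurable
  have hA: "h x \<le> A x" for x
  proof -
    have "g x - ennreal (b x) \<le> ennreal c * A x" using g(2)[of x] by (simp add: ennreal_minus_le_iff add.commute)
    then have "h x \<le> ennreal (1 / c) * (ennreal c * A x)" unfolding h_def by (rule mult_left_mono) simp
    also have "\<dots> = A x" by (simp only: mult.assoc[symmetric] cc mult_1)
    finally show ?thesis .
  qed
  have gh: "g x \<le> ennreal c * h x + ennreal (b x)" for x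
  proof (cases "ennreal (b x) \<le> g x")
    case True
    have "ennreal c * h x = g x - ennreal (b x)" unfolding h_def by (simp only: mult.assoc[symmetric] cc mult_1)
    then show ?thesis using diff_add_cancel_ennreal[OF True] by simp
  next
    case False
    then have "g x \<le> ennreal (b x)" by simp
    also have "\<dots> \<le> ennreal c * h x + ennreal (b x)" by (rule add_increasing) simp_all
    finally show ?thesis .
  qed
  have "integral\<^sup>S M g = (\<integral>\<^sup>+x. g x \<partial>M)" by (rule nn_integral_eq_simple_integral[OF g(1), symmetric])
  also have "\<dots> \<le> (\<integral>\<^sup>+x. ennreal c * h x + ennreal (b x) \<partial>M)" by (rule nn_integral_mono) (rule gh)
  also have "\<dots> = ennreal c * (\<integral>\<^sup>+x. h x \<partial>M) + (\<integral>\<^sup>+x. ennreal (b x) \<partial>M)"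
    by (simp add: nn_integral_add nn_integral_cmult)
  also have "\<dots> \<le> ennreal c * (\<integral>\<^sup>+x. A x \<partial>M) + (\<integral>\<^sup>+x. ennreal (b x) \<partial>M)"
    by (intro add_right_mono mult_left_mono nn_integral_mono hA) simp
  finally show "integral\<^sup>S M g \<le> ennreal c * (\<integral>\<^sup>+x. A x \<partial>M) + (\<integral>\<^sup>+x. ennreal (b x) \<partial>M)" .
qed

text \<open>As \<open>\<psi>\<close> vanishes at \<open>T\<close>, integrating its derivative from
  \<open>t\<close> to \<open>T\<close> gives \<open>- \<psi> t\<close>. Testing a time integrated
  equation with \<open>deriv \<psi>\<close> thereby returns the differentiated equation.\<close>

lemma volt'_tens_deriv:
  fixes y :: "'b::euclidean_space lsq"
  assumes T: "0 < T" and \<psi>: "test_fn {0<..<T} \<psi>"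
  shows "volt' T (tens (deriv \<psi>) y) = (-1) *\<^sub>R tens \<psi> y"
proof -
  note d = test_fn_deriv[OF \<psi>]
  note ds = test_fn_sqi[OF d] test_fn_borel[OF d]
  note [measurable] = test_fn_borel[OF d]
  define E where "E = (Klow T)\<inverse>"
  have K: "kset T E" unfolding E_def using T by (intro kset_converse kset_Klow) simp
  have [measurable]: "E \<in> sets borel" using K by (simp add: kset_def)
  have I: "(LINT \<tau>|lborel. indicator E (t, \<tau>) * deriv \<psi> \<tau>) = - \<psi> t" for t
  proof (cases "t \<in> {0<..<T}")
    case True
    have sm: "smooth \<psi>" "smooth (deriv \<psi>)" using \<psi> d unfolding test_fn_def by auto
    have "(LINT \<tau>|lborel. indicator E (t, \<tau>) * deriv \<psi> \<tau>) = (LINT \<tau>|lborel. deriv \<psi> \<tau> * indicator {t..T} \<tau>)"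
    proof (rule integral_cong_AE)
      show "AE \<tau> in lborel. indicator E (t, \<tau>) * deriv \<psi> \<tau> = deriv \<psi> \<tau> * indicator {t..T} \<tau>"
        using AE_lborel_singleton[of t] AE_lborel_singleton[of T]
        by eventually_elim (use True in \<open>auto simp: E_def Klow_def split: split_indicator\<close>)
    qed measurable
    also have "\<dots> = \<psi> T - \<psi> t"
    proof (rule integral_FTC_Icc_real)
      show "t \<le> T" using True by simp
      show "(\<psi> has_real_derivative deriv \<psi> x) (at x)" for x by (rule smooth_real_deriv(1)[OF sm(1)])
      show "isCont (deriv \<psi>) x" for x by (rule DERIV_isCont[OF smooth_real_deriv(1)[OF sm(2)]])
    qed
    finally show ?thesis using test_fn_outside[OF \<psi>, of T] by simp
  next
    case False
    then have "indicator E (t, \<tau>) = (0::real)" for \<tau> by (auto simp: E_def Klow_def split: split_indicator)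
    then show ?thesis using test_fn_outside[OF \<psi> False] by simp
  qed
  show ?thesis
  proof (rule lsq_eqI_slice)
    show "AE t in lborel. slice (volt' T (tens (deriv \<psi>) y)) t = slice ((-1) *\<^sub>R tens \<psi> y) t"
      using slice_kop[OF K, of "tens (deriv \<psi>) y"] slice_scale[of "-1" "tens \<psi> y"]
        slice_tens[OF test_fn_sqi[OF \<psi>] test_fn_borel[OF \<psi>], of y]
      unfolding volt'_def E_def[symmetric]
    proof eventually_elim
      case (elim t)
      show ?case
      proof (rule inner_eqI)
        fix z
        have "slice (kop E (tens (deriv \<psi>) y)) t \<bullet> z = (LINT \<tau>|lborel. indicator E (t, \<tau>) * deriv \<psi> \<tau> * (y \<bullet> z))"
          unfolding elim(1)[rule_format]
          by (rule integral_cong_AE, measurable, use slice_tens[OF ds, of y] in eventually_elim) simp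
        also have "\<dots> = - \<psi> t * (y \<bullet> z)" unfolding I[symmetric] by (rule integral_mult_left_zero)
        finally show "slice (kop E (tens (deriv \<psi>) y)) t \<bullet> z = slice ((-1) *\<^sub>R tens \<psi> y) t \<bullet> z"
          unfolding elim(2,3) by simp
      qed
    qed
  qed
qed

lemma oe_fn:
  assumes [measurable]: "\<Omega> \<in> sets borel"
  shows "in_L2_Omega \<Omega> (fn Z)" "norm (oe \<Omega> (fn Z)) \<le> norm Z"
proof -
  have le: "(\<integral>\<^sup>+x. ennreal ((indicator \<Omega> x * fn Z x)\<^sup>2) \<partial>lborel) \<le> ennreal ((norm Z)\<^sup>2)"
    unfolding norm_sq_lsq_nn by (rule nn_integral_mono) (auto split: split_indicator)
  show i: "in_L2_Omega \<Omega> (fn Z)"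
    unfolding in_L2_Omega_iff by (rule sqi_borelI, measurable) (rule le_less_trans[OF le], simp)
  have "(norm (oe \<Omega> (fn Z)))\<^sup>2 \<le> (norm Z)\<^sup>2"
    using le unfolding oe_def norm_cls_nn[OF i[unfolded in_L2_Omega_iff], symmetric] by simp
  then show "norm (oe \<Omega> (fn Z)) \<le> norm Z" by (rule power2_le_imp_le) simp
qed

text \<open>A class has no value at a single time. \<open>W t\<close> is the Riesz representative of
  pairing \<open>d\<close> with the indicator of \<open>(0, t)\<close> and thus exists for every
  \<open>t \<ge> 0\<close>; Cauchy-Schwarz over an interval gives Hoelder continuity of order one
  half.\<close>

lemma volt_trace:
  fixes d :: "(real \<times> 'b::euclidean_space) lsq"
  assumes T: "0 < T"
  shows "\<exists>W. (AE t in lborel. t \<in> {0<..<T} \<longrightarrow> slice (volt T d) t = W t) \<and> W 0 = 0 \<and>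
    (\<forall>t1\<ge>0. \<forall>t2\<ge>0. norm (W t2 - W t1) \<le> norm d * sqrt \<bar>t2 - t1\<bar>)"
proof -
  let ?i = "\<lambda>t. indicator {0<..<t} :: real \<Rightarrow> real"
  have ex: "\<exists>w. \<forall>y. w \<bullet> y = d \<bullet> tens (?i t) y" if "0 \<le> t" for t
  proof -
    have "\<exists>v. v \<in> closure ((\<lambda>y. y) ` UNIV) \<and> norm v \<le> \<bar>norm d * sqrt t\<bar> \<and> (\<forall>y\<in>UNIV. v \<bullet> y = d \<bullet> tens (?i t) y)"
    proof (rule riesz_indexed)
      fix x y :: "'b lsq" and c :: real
      show "d \<bullet> tens (?i t) (x + y) = d \<bullet> tens (?i t) x + d \<bullet> tens (?i t) y"
        unfolding inner_tens[OF indicator_interval_sqi]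
        by (simp add: inner_add_right distrib_left Bochner_Integration.integral_add tens_pairing_integrable[OF indicator_interval_sqi])
      show "d \<bullet> tens (?i t) (c *\<^sub>R x) = c * (d \<bullet> tens (?i t) x)"
        unfolding inner_tens[OF indicator_interval_sqi] by (simp add: mult.left_commute[of _ c])
      have "\<bar>d \<bullet> tens (?i t) x\<bar> \<le> norm d * norm (tens (?i t) x)" by (rule Cauchy_Schwarz_ineq2)
      then show "\<bar>d \<bullet> tens (?i t) x\<bar> \<le> norm d * sqrt t * norm x"
        unfolding norm_tens_indicator[OF that] by (simp add: mult.assoc)
    qed auto
    then show ?thesis by blast
  qed
  define W where "W t = (SOME w. \<forall>y. w \<bullet> y = d \<bullet> tens (?i t) y)" for t
  have W: "W t \<bullet> y = d \<bullet> tens (?i t) y" if "0 \<le> t" for t y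
    using someI_ex[OF ex[OF that]] unfolding W_def by blast
  have "AE t in lborel. t \<in> {0<..<T} \<longrightarrow> slice (volt T d) t = W t" using slice_volt_tens(1)[OF T, of d]
  proof eventually_elim
    case (elim t)
    show ?case
    proof
      assume t: "t \<in> {0<..<T}"
      then have t0: "0 \<le> t" by simp
      show "slice (volt T d) t = W t" by (rule inner_eqI) (simp only: W[OF t0] elim[rule_format, OF t])
    qed
  qed
  moreover have "W 0 = 0"
  proof -
    have "tens (?i 0) (W 0) = 0" using norm_tens_indicator[of 0 0 "W 0"] by simp
    then have "W 0 \<bullet> W 0 = 0" using W[of 0 "W 0"] by simp
    then show ?thesis by simp
  qed
  moreover have le: "norm (W t2 - W t1) \<le> norm d * sqrt (t2 - t1)" if t: "0 \<le> t1" "t1 \<le> t2" for t1 t2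
  proof -
    have t2: "0 \<le> t2" using t by simp
    define D where "D = W t2 - W t1"
    have "D \<bullet> D = d \<bullet> tens (?i t2) D - d \<bullet> tens (?i t1) D"
      unfolding W[OF t2, symmetric] W[OF t(1), symmetric] inner_diff_left[symmetric] D_def[symmetric] ..
    also have "\<dots> = (LINT \<tau>|lborel. ?i t2 \<tau> * (slice d \<tau> \<bullet> D) - ?i t1 \<tau> * (slice d \<tau> \<bullet> D))"
      unfolding inner_tens[OF indicator_interval_sqi]
      by (rule Bochner_Integration.integral_diff[symmetric]) (rule tens_pairing_integrable[OF indicator_interval_sqi])+
    also have "\<dots> = (LINT \<tau>|lborel. indicator {t1<..<t2} \<tau> * (slice d \<tau> \<bullet> D))"
      by (rule integral_cong_AE, measurable, use AE_lborel_singleton[of t1] in eventually_elim)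
        (use t in \<open>auto split: split_indicator\<close>)
    also have "\<dots> = d \<bullet> tens (indicator {t1<..<t2}) D" by (rule inner_tens[OF indicator_interval_sqi, symmetric])
    also have "\<dots> \<le> norm d * norm (tens (indicator {t1<..<t2}) D)" by (rule norm_cauchy_schwarz)
    also have "\<dots> = norm d * sqrt (t2 - t1) * norm D" unfolding norm_tens_indicator[OF t(2)] by simp
    finally have sq: "norm D * norm D \<le> (norm d * sqrt (t2 - t1)) * norm D" by (simp add: power2_norm_eq_inner[symmetric] power2_eq_square)
    show ?thesis
    proof (cases "norm D = 0")
      case True
      then show ?thesis using t unfolding D_def by simp
    next
      case False
      then have "0 < norm D" by simp
      with sq show ?thesis unfolding D_def[symmetric] by (rule mult_right_le_imp_le)
    qed
  qed
  have "norm (W t2 - W t1) \<le> norm d * sqrt \<bar>t2 - t1\<bar>" if "0 \<le> t1" "0 \<le> t2" for t1 t2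
  proof (cases "t1 \<le> t2")
    case True
    then show ?thesis using le[OF that(1) True] by simp
  next
    case False
    then show ?thesis using le[OF that(2), of t1] by (simp add: norm_minus_commute[of "W t2"])
  qed
  ultimately show ?thesis by blast
qed

context
  fixes \<Omega> :: "(real^'n) set" and s T :: real
  assumes s: "0 < s" "s < 1" and T: "0 < T" and \<Omega>: "open \<Omega>"
begin

lemma Hms_perturbation:
  fixes A :: "(real^'n) lsq" and B :: "((real^'n) \<times> (real^'n)) lsq"
  assumes G: "in_Hms \<Omega> s G"
  defines "G' \<equiv> \<lambda>\<phi>. G \<phi> + (A \<bullet> cls \<phi> - B \<bullet> cls (Dq s \<phi>))"
  shows "in_Hms \<Omega> s G'" "Hms_norm \<Omega> s G' \<le> Hms_norm \<Omega> s G + (norm A + norm B)"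
proof -
  have bd: "\<bar>G' v\<bar> \<le> (Hms_norm \<Omega> s G + (norm A + norm B)) * Hs_norm s v" if v: "v \<in> tHs \<Omega> s" for v
  proof -
    have e: "Hs_norm s v = norm (cls v, cls (Dq s v))" unfolding Hs_norm_emb[OF s tHs_in_Hs[OF s v]] emb_def[OF s] ..
    have "\<bar>A \<bullet> cls v\<bar> \<le> norm A * Hs_norm s v"
      unfolding e using Cauchy_Schwarz_ineq2[of A "cls v"] mult_left_mono[OF norm_fst_le[of "cls v" "cls (Dq s v)"] norm_ge_zero[of A]] by linarith
    moreover have "\<bar>B \<bullet> cls (Dq s v)\<bar> \<le> norm B * Hs_norm s v"
      unfolding e using Cauchy_Schwarz_ineq2[of B "cls (Dq s v)"] mult_left_mono[OF norm_snd_le[of "cls (Dq s v)" "cls v"] norm_ge_zero[of B]] by linarith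
    moreover have "\<bar>G' v\<bar> \<le> \<bar>G v\<bar> + \<bar>A \<bullet> cls v\<bar> + \<bar>B \<bullet> cls (Dq s v)\<bar>" unfolding G'_def by linarith
    ultimately show ?thesis using Hms_bound[OF s T \<Omega> G v] unfolding distrib_right by linarith
  qed
  have add: "G' (\<lambda>x. v x + w x) = G' v + G' w" if v: "v \<in> tHs \<Omega> s" and w: "w \<in> tHs \<Omega> s" for v w
  proof -
    note H = tHs_in_Hs[OF s v] tHs_in_Hs[OF s w]
    have q: "sqi v" "sqi w" using H by (auto simp: in_Hs_iff)
    show ?thesis unfolding G'_def in_Hms_linear(1)[OF G v w] cls_add[OF q] cls_Dq_linear(1)[OF H] inner_add_right by simp
  qed
  have scale: "G' (\<lambda>x. c * v x) = c * G' v" if v: "v \<in> tHs \<Omega> s" for v c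
  proof -
    note H = tHs_in_Hs[OF s v]
    have q: "sqi v" using H by (auto simp: in_Hs_iff)
    show ?thesis unfolding G'_def in_Hms_linear(2)[OF G v v] cls_scale[OF q] cls_Dq_linear(3)[OF H H]
      by (simp add: distrib_left right_diff_distrib)
  qed
  show "in_Hms \<Omega> s G'" unfolding in_Hms_def using add scale bd by blast
  show "Hms_norm \<Omega> s G' \<le> Hms_norm \<Omega> s G + (norm A + norm B)"
    by (rule Hms_norm_le(2)[OF s T \<Omega> bd]) (use Hms_norm_nonneg[OF s T \<Omega> G] in simp_all)
qed

text \<open>Squaring the triangle inequality bounds the new dual norm by an affine expression in the
  square of the old one. The old one is not known to be measurable in time, so the integral is split
  by \<open>nn_integral_affine_le\<close>.\<close>

lemma L2_Hms_perturbation: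
  assumes g: "in_L2_Hms T \<Omega> s g"
  shows "in_L2_Hms T \<Omega> s (\<lambda>t \<phi>. g t \<phi> + (slice A t \<bullet> cls \<phi> - slice B t \<bullet> cls (Dq s \<phi>)))" (is "in_L2_Hms T \<Omega> s ?g")
  unfolding in_L2_Hms_def
proof (intro conjI ballI)
  have gH: "AE t in lborel. t \<in> {0<..<T} \<longrightarrow> in_Hms \<Omega> s (g t)"
    using g unfolding in_L2_Hms_def AE_completion_iff by blast
  have H: "AE t in lborel. t \<in> {0<..<T} \<longrightarrow> in_Hms \<Omega> s (g t) \<and> in_Hms \<Omega> s (?g t) \<and>
      Hms_norm \<Omega> s (?g t) \<le> Hms_norm \<Omega> s (g t) + (norm (slice A t) + norm (slice B t))"
    using gH by eventually_elim (use Hms_perturbation in blast)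
  show "AE t in lebesgue. t \<in> {0<..<T} \<longrightarrow> in_Hms \<Omega> s (?g t)"
    unfolding AE_completion_iff using H by eventually_elim blast
  show "set_borel_measurable lebesgue {0<..<T} (\<lambda>t. ?g t \<phi>)" if \<phi>: "\<phi> \<in> tHs \<Omega> s" for \<phi>
  proof -
    have m1: "(\<lambda>t. indicator {0<..<T} t *\<^sub>R g t \<phi>) \<in> borel_measurable lebesgue"
      using g \<phi> unfolding in_L2_Hms_def set_borel_measurable_def by blast
    have m2: "(\<lambda>t. indicator {0<..<T} t * (slice A t \<bullet> cls \<phi> - slice B t \<bullet> cls (Dq s \<phi>))) \<in> borel_measurable lebesgue"
      by (rule measurable_completion) measurable
    show ?thesis unfolding set_borel_measurable_def using borel_measurable_add[OF m1 m2] by (simp add: distrib_left)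
  qed
  define b where "b t = 4 * (norm (slice A t))\<^sup>2 + 4 * (norm (slice B t))\<^sup>2" for t
  have [measurable]: "b \<in> borel_measurable borel" unfolding b_def by measurable
  have fin: "(\<integral>\<^sup>+t. ennreal ((Hms_norm \<Omega> s (g t))\<^sup>2) * indicator {0<..<T} t \<partial>lborel) < \<infinity>"
    using g unfolding in_L2_Hms_def nn_integral_completion by blast
  have bfin: "(\<integral>\<^sup>+t. ennreal (b t) \<partial>lborel) < \<infinity>"
  proof -
    have "integrable lborel b" unfolding b_def[abs_def] by (intro Bochner_Integration.integrable_add integrable_mult_right norm_slice_integrable)
    then show ?thesis by (subst nn_integral_eq_integral) (auto simp: b_def)
  qed
  have sq: "(x + (y + z))\<^sup>2 \<le> 2 * x\<^sup>2 + (4 * y\<^sup>2 + 4 * z\<^sup>2)" for x y z :: real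
  proof -
    have "2 * x\<^sup>2 + (4 * y\<^sup>2 + 4 * z\<^sup>2) - (x + (y + z))\<^sup>2 = (x - (y + z))\<^sup>2 + 2 * (y - z)\<^sup>2"
      by (simp add: power2_eq_square algebra_simps)
    moreover have "0 \<le> (x - (y + z))\<^sup>2 + 2 * (y - z)\<^sup>2" by simp
    ultimately show ?thesis by linarith
  qed
  have "(\<integral>\<^sup>+t. ennreal ((Hms_norm \<Omega> s (?g t))\<^sup>2) * indicator {0<..<T} t \<partial>lborel)
      \<le> (\<integral>\<^sup>+t. ennreal 2 * (ennreal ((Hms_norm \<Omega> s (g t))\<^sup>2) * indicator {0<..<T} t) + ennreal (b t) \<partial>lborel)"
  proof (rule nn_integral_mono_AE, use H in eventually_elim)
    case (elim t)
    show ?case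
    proof (cases "t \<in> {0<..<T}")
      case True
      then have h: "in_Hms \<Omega> s (?g t)" "Hms_norm \<Omega> s (?g t) \<le> Hms_norm \<Omega> s (g t) + (norm (slice A t) + norm (slice B t))"
        using elim by auto
      have "(Hms_norm \<Omega> s (?g t))\<^sup>2 \<le> (Hms_norm \<Omega> s (g t) + (norm (slice A t) + norm (slice B t)))\<^sup>2"
        by (rule power_mono[OF h(2) Hms_norm_nonneg[OF s T \<Omega> h(1)]])
      also have "\<dots> \<le> 2 * (Hms_norm \<Omega> s (g t))\<^sup>2 + b t" unfolding b_def by (rule sq)
      finally have "ennreal ((Hms_norm \<Omega> s (?g t))\<^sup>2) \<le> ennreal (2 * (Hms_norm \<Omega> s (g t))\<^sup>2 + b t)" by (rule ennreal_leI)
      also have "\<dots> = ennreal 2 * ennreal ((Hms_norm \<Omega> s (g t))\<^sup>2) + ennreal (b t)"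
        by (subst ennreal_plus) (simp_all add: b_def ennreal_mult)
      finally show ?thesis using True by simp
    qed simp
  qed
  also have "\<dots> \<le> ennreal 2 * (\<integral>\<^sup>+t. ennreal ((Hms_norm \<Omega> s (g t))\<^sup>2) * indicator {0<..<T} t \<partial>lborel) + (\<integral>\<^sup>+t. ennreal (b t) \<partial>lborel)"
    by (rule nn_integral_affine_le) simp_all
  also have "\<dots> < \<infinity>" using fin bfin by (simp add: ennreal_mult_less_top)
  finally show "(\<integral>\<^sup>+t\<in>{0<..<T}. ennreal ((Hms_norm \<Omega> s (?g t))\<^sup>2) \<partial>lebesgue) < \<infinity>"
    unfolding nn_integral_completion .
qed

text \<open>Pairing with tensors is the form in which the integrated equation delivers derivatives,
  so the weak derivative is expressed in it.\<close>

lemma has_dt_Hms_iff: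
  assumes u: "in_L2Q T \<Omega> u"
  shows "has_dt_Hms T \<Omega> s u g \<longleftrightarrow> (\<forall>\<phi>\<in>tHs \<Omega> s. \<forall>\<psi>. test_fn {0<..<T} \<psi> \<longrightarrow>
    qe T \<Omega> u \<bullet> tens (deriv \<psi>) (cls \<phi>) = - (LINT t|lebesgue. (indicator {0<..<T} t * g t \<phi>) * \<psi> t))"
proof -
  have "(LINT t:{0<..<T}|lebesgue. (LINT x:\<Omega>|lebesgue. u t x * \<phi> x) * deriv \<psi> t) = qe T \<Omega> u \<bullet> tens (deriv \<psi>) (cls \<phi>)"
    if \<phi>: "\<phi> \<in> tHs \<Omega> s" and \<psi>: "test_fn {0<..<T} \<psi>" for \<phi> \<psi>
  proof -
    note d = test_fn_deriv[OF \<psi>]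
    note [measurable] = test_fn_borel[OF d]
    have \<phi>q: "sqi \<phi>" using tHs_in_Hs[OF s \<phi>] by (simp add: in_Hs_iff)
    have "(LINT t:{0<..<T}|lebesgue. (LINT x:\<Omega>|lebesgue. u t x * \<phi> x) * deriv \<psi> t)
        = (LINT t|lborel. deriv \<psi> t * (slice (qe T \<Omega> u) t \<bullet> cls \<phi>))"
      unfolding set_lebesgue_integral_def[of lebesgue "{0<..<T}"]
    proof (rule lebesgue_integral_eq_lborel)
      show "AE t in lborel. indicator {0<..<T} t *\<^sub>R ((LINT x:\<Omega>|lebesgue. u t x * \<phi> x) * deriv \<psi> t)
          = deriv \<psi> t * (slice (qe T \<Omega> u) t \<bullet> cls \<phi>)"
        using slice_qe[OF u]
      proof eventually_elim
        case (elim t)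
        show ?case
        proof (cases "t \<in> {0<..<T}")
          case True
          then show ?thesis using elim set_integral_oe[of \<Omega> "u t" \<phi>] \<phi>q by simp
        next
          case False
          then show ?thesis using test_fn_outside[OF d False] by simp
        qed
      qed
    qed measurable
    then show ?thesis unfolding inner_tens[OF test_fn_sqi[OF d] test_fn_borel[OF d]] .
  qed
  moreover have "(LINT t:{0<..<T}|lebesgue. g t \<phi> * \<psi> t) = (LINT t|lebesgue. (indicator {0<..<T} t * g t \<phi>) * \<psi> t)" for \<phi> \<psi>
    unfolding set_lebesgue_integral_def by (simp add: mult.assoc)
  ultimately show ?thesis unfolding has_dt_Hms_def by simp
qed

text \<open>The increment \<open>fst X\<close> has source \<open>y\<close> and zero initial value;
  its representing function supplies actual values \<open>v t x\<close>. Lying in the range of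
  \<open>volt T\<close>, it has the continuous trace \<open>W\<close> with \<open>W 0 = 0\<close>,
  which gives the bound uniform in time and leaves the initial value \<open>u0\<close>
  unchanged.\<close>

lemma perturbed_state:
  assumes st: "is_state T \<Omega> s f u0 z u" and z: "in_L2Q T \<Omega> z" and y: "in_L2Q T \<Omega> y" and u0: "in_L2_Omega \<Omega> u0"
    and X: "X \<in> VV T (Vsp \<Omega> s)" and d: "fst X = volt T d"
    and eqX: "\<And>\<Theta>. \<Theta> \<in> VV T (Vsp \<Omega> s) ==>
      fst X \<bullet> fst \<Theta> + Cns CARD('n) s / 2 * (volt T (snd X) \<bullet> snd \<Theta>) = volt T (qe T \<Omega> y) \<bullet> fst \<Theta>"
  shows "is_state T \<Omega> s f u0 (\<lambda>t x. z t x + y t x) (\<lambda>t x. u t x + fn (fst X) (t, x))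
    \<and> in_L2Q T \<Omega> (\<lambda>t x. fn (fst X) (t, x)) \<and> qe T \<Omega> (\<lambda>t x. fn (fst X) (t, x)) = fst X"
proof -
  define \<kappa> where "\<kappa> = Cns CARD('n) s / 2"
  define v where "v t x = fn (fst X) (t, x)" for t x
  note V = subspace_Vsp[OF s, of \<Omega>] closed_Vsp[OF s, of \<Omega>]
  have \<Omega>b: "\<Omega> \<in> sets borel" using \<Omega> by simp
  obtain g where g: "in_V_with T \<Omega> s u g" and eq: "AE t in lborel. t \<in> {0<..<T} \<longrightarrow> (\<forall>\<phi>\<in>tHs \<Omega> s.
        g t \<phi> + frac_form s (u t) \<phi> = f t \<phi> + (LINT x:\<Omega>|lebesgue. z t x * \<phi> x))"
    and val: "value_at T \<Omega> u 0 u0"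
    using st unfolding is_state_def AE_completion_iff by blast
  have gs: "in_L2_tHs T \<Omega> s u" "in_L2_Hms T \<Omega> s g" "has_dt_Hms T \<Omega> s u g" "in_Linf_L2 T \<Omega> u"
    using g unfolding in_V_with_def by auto
  obtain U where U: "U \<in> VV T (Vsp \<Omega> s)" "in_L2Q T \<Omega> u" "fst U = qe T \<Omega> u"
    and Ue: "AE t in lborel. t \<in> {0<..<T} \<longrightarrow> u t \<in> tHs \<Omega> s \<and> (slice (fst U) t, slice (snd U) t) = emb s (u t)"
    using in_L2_tHs_VV[OF s T \<Omega> gs(1)] by blast
  have Xe: "AE t in lborel. t \<in> {0<..<T} \<longrightarrow> v t \<in> tHs \<Omega> s \<and> (slice (fst X) t, slice (snd X) t) = emb s (v t)"
    using X[unfolded VV_def mem_Collect_eq] fn_slice[of "fst X"]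
  proof eventually_elim
    case (elim t)
    show ?case
    proof
      assume "t \<in> {0<..<T}"
      then have "(slice (fst X) t, slice (snd X) t) \<in> Vsp \<Omega> s" using elim(1) by simp
      then have m: "fn (slice (fst X) t) \<in> tHs \<Omega> s" "slice (snd X) t = cls (Dq s (fn (slice (fst X) t)))"
        unfolding Vsp_iff[OF s] by auto
      have ae: "AE x in lborel. v t x = fn (slice (fst X) t) x" using elim(2) by eventually_elim (simp add: v_def)
      have "emb s (v t) = emb s (fn (slice (fst X) t))" by (rule emb_cong_AE[OF s ae])
      also have "\<dots> = (slice (fst X) t, slice (snd X) t)" unfolding emb_def[OF s] using m(2) by simp
      finally show "v t \<in> tHs \<Omega> s \<and> (slice (fst X) t, slice (snd X) t) = emb s (v t)"
        using tHs_cong_AE[OF s m(1) ae] by simp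
    qed
  qed
  have vQ: "in_L2Q T \<Omega> v" unfolding v_def[abs_def] by (rule in_L2Q_fn(1)[OF \<Omega>b])
  have qv: "qe T \<Omega> v = fst X"
  proof (rule lsq_eqI_slice)
    show "AE t in lborel. slice (qe T \<Omega> v) t = slice (fst X) t"
      using slice_qe[OF vQ] Xe X[unfolded VV_def mem_Collect_eq]
    proof eventually_elim
      case (elim t)
      show ?case
      proof (cases "t \<in> {0<..<T}")
        case True
        then have vt: "v t \<in> tHs \<Omega> s" "slice (fst X) t = cls (v t)" using elim(2) unfolding emb_def[OF s] by auto
        have "oe \<Omega> (v t) = cls (v t)"
          unfolding oe_def by (rule cls_cong_AE, use tHs_outside[OF s vt(1) \<Omega>b] in eventually_elim) (auto split: split_indicator)
        then show ?thesis using elim(1) True vt(2) by simp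
      next
        case False
        then have "slice (fst X) t = 0" using elim(3) by (auto simp: zero_prod_def)
        moreover have "slice (qe T \<Omega> v) t = 0" using elim(1) False by auto
        ultimately show ?thesis by simp
      qed
    qed
  qed
  define u' where "u' = (\<lambda>t x. u t x + v t x)"
  \<comment> \<open>The equation for \<open>X\<close> expresses the derivative of the increment by
    the source and the form; both are pairings with slices and hence bounded functionals.\<close>
  define g' where "g' = (\<lambda>t \<phi>. g t \<phi> + (slice (qe T \<Omega> y) t \<bullet> cls \<phi> - slice (\<kappa> *\<^sub>R snd X) t \<bullet> cls (Dq s \<phi>)))"
  have u'Q: "in_L2Q T \<Omega> u'" "qe T \<Omega> u' = fst U + fst X"
    unfolding u'_def using qe_linear(1,2)[OF U(2) vQ] U(3) qv by simp_all
  have L2tHs: "in_L2_tHs T \<Omega> s u'"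
  proof (rule VV_in_L2_tHs[OF s T \<Omega>])
    show "U + X \<in> VV T (Vsp \<Omega> s)" by (rule subspace_add[OF subspace_VV[OF V] U(1) X])
    show "AE p in lborel. u' (fst p) (snd p) = fn (fst (U + X)) p \<or> p \<notin> cyl T \<Omega>"
      using fn_add[of "fst U" "fst X"] fn_qe[OF U(2)]
      by eventually_elim (auto simp: u'_def v_def U(3) split: split_indicator)
    show "AE t in lborel. t \<in> {0<..<T} \<longrightarrow> u' t \<in> tHs \<Omega> s \<and> (slice (fst (U + X)) t, slice (snd (U + X)) t) = emb s (u' t)"
      using Ue Xe slice_add[of "fst U" "fst X"] slice_add[of "snd U" "snd X"]
    proof eventually_elim
      case (elim t)
      show ?case
      proof
        assume t: "t \<in> {0<..<T}"
        then have ut: "u t \<in> tHs \<Omega> s" and vt: "v t \<in> tHs \<Omega> s" using elim by auto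
        have "emb s (u' t) = emb s (u t) + emb s (v t)"
          unfolding u'_def by (rule emb_linear(1)[OF s tHs_in_Hs[OF s ut] tHs_in_Hs[OF s vt]])
        also have "\<dots> = (slice (fst U) t, slice (snd U) t) + (slice (fst X) t, slice (snd X) t)" using elim(1,2) t by simp
        finally show "u' t \<in> tHs \<Omega> s \<and> (slice (fst (U + X)) t, slice (snd (U + X)) t) = emb s (u' t)"
          using elim(3,4) tHs_linear(1)[OF s ut vt] unfolding u'_def by simp
      qed
    qed
  qed
  obtain W where W: "AE t in lborel. t \<in> {0<..<T} \<longrightarrow> slice (fst X) t = W t" "W 0 = 0"
      "\<And>t1 t2. 0 \<le> t1 ==> 0 \<le> t2 ==> norm (W t2 - W t1) \<le> norm d * sqrt \<bar>t2 - t1\<bar>"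
    using volt_trace[OF T, of d] unfolding d by blast
  have Linf: "in_Linf_L2 T \<Omega> u'"
  proof -
    obtain M where M: "AE t in lborel. t \<in> {0<..<T} \<longrightarrow> L2_Omega_norm \<Omega> (u t) \<le> M"
      using gs(4) unfolding in_Linf_L2_def AE_completion_iff by blast
    have "AE t in lborel. t \<in> {0<..<T} \<longrightarrow> L2_Omega_norm \<Omega> (u' t) \<le> M + norm d * sqrt T"
      using M W(1) slice_qe[OF U(2)] slice_qe[OF vQ]
    proof eventually_elim
      case (elim t)
      show ?case
      proof
        assume t: "t \<in> {0<..<T}"
        have o: "in_L2_Omega \<Omega> (u t)" "in_L2_Omega \<Omega> (v t)" "oe \<Omega> (v t) = W t" using elim t qv by auto
        have "norm (W t) \<le> norm d * sqrt t" using W(3)[of 0 t] W(2) t by simp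
        also have "\<dots> \<le> norm d * sqrt T" using t by (intro mult_left_mono) auto
        finally have "norm (W t) \<le> norm d * sqrt T" .
        moreover have "norm (oe \<Omega> (u t) + W t) \<le> norm (oe \<Omega> (u t)) + norm (W t)" by (rule norm_triangle_ineq)
        moreover have "L2_Omega_norm \<Omega> (u' t) = norm (oe \<Omega> (u t) + W t)"
          unfolding u'_def L2_Omega_norm_eq[OF oe_linear(1)[OF o(1,2)]] oe_linear(2)[OF o(1,2)] o(3) ..
        ultimately show "L2_Omega_norm \<Omega> (u' t) \<le> M + norm d * sqrt T"
          using elim(1) t unfolding L2_Omega_norm_eq[OF o(1)] by auto
      qed
    qed
    then show ?thesis unfolding in_Linf_L2_def AE_completion_iff by blast
  qed
  have dt: "has_dt_Hms T \<Omega> s u' g'" unfolding has_dt_Hms_iff[OF u'Q(1)]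
  proof (intro ballI allI impI)
    fix \<phi> \<psi> assume \<phi>: "\<phi> \<in> tHs \<Omega> s" and \<psi>: "test_fn {0<..<T} \<psi>"
    note \<psi>q = test_fn_sqi[OF \<psi>] test_fn_borel[OF \<psi>]
    note [measurable] = \<psi>q(2)
    note dd = test_fn_deriv[OF \<psi>]
    define A where "A = qe T \<Omega> y"
    define B where "B = \<kappa> *\<^sub>R snd X"
    have ev: "emb s \<phi> \<in> Vsp \<Omega> s" using \<phi> unfolding Vsp_def[OF s] by blast
    have \<Theta>: "(tens (deriv \<psi>) (cls \<phi>), tens (deriv \<psi>) (cls (Dq s \<phi>))) \<in> VV T (Vsp \<Omega> s)"
      using tens_VV[OF V ev test_fn_sqi[OF dd] test_fn_borel[OF dd] test_fn_outside[OF dd]] unfolding emb_def[OF s] by simp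
    have 1: "fst X \<bullet> tens (deriv \<psi>) (cls \<phi>) = B \<bullet> tens \<psi> (cls (Dq s \<phi>)) - A \<bullet> tens \<psi> (cls \<phi>)"
      using eqX[OF \<Theta>] unfolding A_def B_def \<kappa>_def fst_conv snd_conv volt_adjoint[OF T] volt'_tens_deriv[OF T \<psi>] by simp
    have 2: "fst U \<bullet> tens (deriv \<psi>) (cls \<phi>) = - (LINT t|lebesgue. (indicator {0<..<T} t * g t \<phi>) * \<psi> t)"
      using gs(3) \<phi> \<psi> unfolding has_dt_Hms_iff[OF U(2)] U(3) by blast
    have gi: "integrable lebesgue (\<lambda>t. (indicator {0<..<T} t * g t \<phi>) * \<psi> t)"
      by (rule sqi_mult_integrable[OF in_L2_Hms_sqi[OF s T \<Omega> gs(2) \<phi>] \<psi>q(1)])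
    have Ai: "integrable lebesgue (\<lambda>t. \<psi> t * (slice A t \<bullet> cls \<phi>))"
      using tens_pairing_integrable[OF \<psi>q, of A "cls \<phi>"] by (simp add: integrable_completion)
    have Bi: "integrable lebesgue (\<lambda>t. \<psi> t * (slice B t \<bullet> cls (Dq s \<phi>)))"
      using tens_pairing_integrable[OF \<psi>q, of B "cls (Dq s \<phi>)"] by (simp add: integrable_completion)
    have "(LINT t|lebesgue. (indicator {0<..<T} t * g' t \<phi>) * \<psi> t)
        = (LINT t|lebesgue. (indicator {0<..<T} t * g t \<phi>) * \<psi> t + (\<psi> t * (slice A t \<bullet> cls \<phi>) - \<psi> t * (slice B t \<bullet> cls (Dq s \<phi>))))"
    proof (rule Bochner_Integration.integral_cong[OF refl])
      fix t
      show "(indicator {0<..<T} t * g' t \<phi>) * \<psi> t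
          = (indicator {0<..<T} t * g t \<phi>) * \<psi> t + (\<psi> t * (slice A t \<bullet> cls \<phi>) - \<psi> t * (slice B t \<bullet> cls (Dq s \<phi>)))"
      proof (cases "t \<in> {0<..<T}")
        case True
        then show ?thesis unfolding g'_def A_def B_def by (simp add: algebra_simps)
      next
        case False
        then show ?thesis using test_fn_outside[OF \<psi> False] by simp
      qed
    qed
    also have "\<dots> = (LINT t|lebesgue. (indicator {0<..<T} t * g t \<phi>) * \<psi> t)
        + ((LINT t|lebesgue. \<psi> t * (slice A t \<bullet> cls \<phi>)) - (LINT t|lebesgue. \<psi> t * (slice B t \<bullet> cls (Dq s \<phi>))))"
      using gi Ai Bi by simp
    also have "(LINT t|lebesgue. \<psi> t * (slice A t \<bullet> cls \<phi>)) = A \<bullet> tens \<psi> (cls \<phi>)"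
      unfolding inner_tens[OF \<psi>q] by (rule integral_completion) simp
    also have "(LINT t|lebesgue. \<psi> t * (slice B t \<bullet> cls (Dq s \<phi>))) = B \<bullet> tens \<psi> (cls (Dq s \<phi>))"
      unfolding inner_tens[OF \<psi>q] by (rule integral_completion) simp
    finally show "qe T \<Omega> u' \<bullet> tens (deriv \<psi>) (cls \<phi>) = - (LINT t|lebesgue. (indicator {0<..<T} t * g' t \<phi>) * \<psi> t)"
      unfolding u'Q(2) inner_add_left 1 2 by simp
  qed
  have eq': "AE t in lborel. t \<in> {0<..<T} \<longrightarrow> (\<forall>\<phi>\<in>tHs \<Omega> s.
        g' t \<phi> + frac_form s (u' t) \<phi> = f t \<phi> + (LINT x:\<Omega>|lebesgue. (z t x + y t x) * \<phi> x))"
    using eq Ue Xe slice_qe[OF z] slice_qe[OF y] slice_scale[of \<kappa> "snd X"]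
  proof eventually_elim
    case (elim t)
    show ?case
    proof (intro impI ballI)
      fix \<phi> assume t: "t \<in> {0<..<T}" and \<phi>: "\<phi> \<in> tHs \<Omega> s"
      note \<phi>H = tHs_in_Hs[OF s \<phi>]
      have \<phi>q: "sqi \<phi>" using \<phi>H by (simp add: in_Hs_iff)
      have H: "in_Hs s (u t)" "in_Hs s (v t)" "slice (snd X) t = cls (Dq s (v t))"
        using elim(2,3) t tHs_in_Hs[OF s] unfolding emb_def[OF s] by auto
      have o: "in_L2_Omega \<Omega> (z t)" "in_L2_Omega \<Omega> (y t)" "slice (qe T \<Omega> y) t = oe \<Omega> (y t)" using elim(4,5) t by auto
      have 1: "g t \<phi> + \<kappa> * (cls (Dq s (u t)) \<bullet> cls (Dq s \<phi>)) = f t \<phi> + oe \<Omega> (z t) \<bullet> cls \<phi>"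
        using bspec[OF mp[OF elim(1) t] \<phi>] by (simp only: frac_form_eq[OF H(1) \<phi>H] set_integral_oe[OF o(1) \<phi>q] \<kappa>_def)
      have 2: "frac_form s (u' t) \<phi> = \<kappa> * ((cls (Dq s (u t)) + cls (Dq s (v t))) \<bullet> cls (Dq s \<phi>))"
        unfolding u'_def frac_form_eq[OF in_Hs_linear(1)[OF H(1,2)] \<phi>H] cls_Dq_linear(1)[OF H(1,2)] \<kappa>_def ..
      have 3: "(LINT x:\<Omega>|lebesgue. (z t x + y t x) * \<phi> x) = (oe \<Omega> (z t) + oe \<Omega> (y t)) \<bullet> cls \<phi>"
        unfolding set_integral_oe[OF oe_linear(1)[OF o(1,2)] \<phi>q] oe_linear(2)[OF o(1,2)] ..
      show "g' t \<phi> + frac_form s (u' t) \<phi> = f t \<phi> + (LINT x:\<Omega>|lebesgue. (z t x + y t x) * \<phi> x)"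
        using 1 unfolding 2 3 g'_def o(3) elim(6) H(3) by (simp add: inner_add_left distrib_left)
    qed
  qed
  have T0: "0 \<in> {0..T}" using T by simp
  obtain w where w: "\<forall>t\<in>{0..T}. in_L2_Omega \<Omega> (w t)"
    "AE t in lborel. t \<in> {0<..<T} \<longrightarrow> (AE x in lborel. x \<in> \<Omega> \<longrightarrow> u t x = w t x)"
    "\<forall>t1\<in>{0..T}. ((\<lambda>t. L2_Omega_norm \<Omega> (\<lambda>x. w t x - w t1 x)) \<longlongrightarrow> 0) (at t1 within {0..T})"
    "oe \<Omega> (w 0) = oe \<Omega> u0"
    using value_at_oe[OF val u0 T0] by blast
  define w' where "w' t x = w t x + fn (W t) x" for t x
  note fW = oe_fn[OF \<Omega>b]
  have w'L: "in_L2_Omega \<Omega> (w' t)" "oe \<Omega> (w' t) = oe \<Omega> (w t) + oe \<Omega> (fn (W t))" if "t \<in> {0..T}" for t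
    unfolding w'_def[abs_def] using oe_linear(1,2)[OF bspec[OF w(1) that] fW(1)] by simp_all
  have val': "value_at T \<Omega> u' 0 u0" unfolding value_at_def
  proof (intro exI[of _ w'] conjI ballI)
    show "in_L2_Omega \<Omega> (w' t)" if "t \<in> {0..T}" for t by (rule w'L(1)[OF that])
    show "AE t in lebesgue. t \<in> {0<..<T} \<longrightarrow> (AE x in lebesgue. x \<in> \<Omega> \<longrightarrow> u' t x = w' t x)"
      unfolding AE_completion_iff using w(2) W(1) fn_slice[of "fst X"]
    proof eventually_elim
      case (elim t)
      show ?case
      proof
        assume t: "t \<in> {0<..<T}"
        then have a: "AE x in lborel. x \<in> \<Omega> \<longrightarrow> u t x = w t x" "slice (fst X) t = W t" using elim(1,2) by auto
        show "AE x in lborel. x \<in> \<Omega> \<longrightarrow> u' t x = w' t x"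
          using a(1) elim(3) unfolding a(2) by eventually_elim (auto simp: u'_def w'_def v_def)
      qed
    qed
    show "((\<lambda>t. L2_Omega_norm \<Omega> (\<lambda>x. w' t x - w' t1 x)) \<longlongrightarrow> 0) (at t1 within {0..T})" if t1: "t1 \<in> {0..T}" for t1
    proof (rule Lim_null_comparison)
      have "((\<lambda>t. norm d * sqrt \<bar>t - t1\<bar>) \<longlongrightarrow> norm d * sqrt \<bar>t1 - t1\<bar>) (at t1 within {0..T})"
        by (intro tendsto_intros)
      then show "((\<lambda>t. L2_Omega_norm \<Omega> (\<lambda>x. w t x - w t1 x) + norm d * sqrt \<bar>t - t1\<bar>) \<longlongrightarrow> 0) (at t1 within {0..T})"
        using tendsto_add[OF bspec[OF w(3) t1]] by fastforce
      show "\<forall>\<^sub>F t in at t1 within {0..T}. norm (L2_Omega_norm \<Omega> (\<lambda>x. w' t x - w' t1 x))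
          \<le> L2_Omega_norm \<Omega> (\<lambda>x. w t x - w t1 x) + norm d * sqrt \<bar>t - t1\<bar>"
        unfolding eventually_at_filter
      proof (rule always_eventually, intro allI impI)
        fix t assume t: "t \<noteq> t1" "t \<in> {0..T}"
        note wt = bspec[OF w(1) t(2)] bspec[OF w(1) t1]
        have "oe \<Omega> (fn (W t)) - oe \<Omega> (fn (W t1)) = oe \<Omega> (\<lambda>x. fn (W t) x - fn (W t1) x)"
          by (rule oe_linear(4)[OF fW(1) fW(1), symmetric])
        also have "\<dots> = oe \<Omega> (fn (W t - W t1))"
          by (rule oe_cong_AE(1), use fn_diff[of "W t" "W t1"] in eventually_elim) simp
        finally have "norm (oe \<Omega> (fn (W t)) - oe \<Omega> (fn (W t1))) \<le> norm (W t - W t1)" using fW(2) by simp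
        also have "\<dots> \<le> norm d * sqrt \<bar>t - t1\<bar>" using W(3)[of t1 t] t t1 by simp
        finally have b: "norm (oe \<Omega> (fn (W t)) - oe \<Omega> (fn (W t1))) \<le> norm d * sqrt \<bar>t - t1\<bar>" .
        have "norm (oe \<Omega> (w' t) - oe \<Omega> (w' t1)) = norm ((oe \<Omega> (w t) - oe \<Omega> (w t1)) + (oe \<Omega> (fn (W t)) - oe \<Omega> (fn (W t1))))"
          unfolding w'L(2)[OF t(2)] w'L(2)[OF t1] by (simp add: add_diff_add)
        also have "\<dots> \<le> norm (oe \<Omega> (w t) - oe \<Omega> (w t1)) + norm (oe \<Omega> (fn (W t)) - oe \<Omega> (fn (W t1)))" by (rule norm_triangle_ineq)
        finally show "norm (L2_Omega_norm \<Omega> (\<lambda>x. w' t x - w' t1 x)) \<le> L2_Omega_norm \<Omega> (\<lambda>x. w t x - w t1 x) + norm d * sqrt \<bar>t - t1\<bar>"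
          unfolding L2_Omega_norm_eq[OF oe_linear(3)[OF w'L(1)[OF t(2)] w'L(1)[OF t1]]] oe_linear(4)[OF w'L(1)[OF t(2)] w'L(1)[OF t1]]
            L2_Omega_norm_eq[OF oe_linear(3)[OF wt]] oe_linear(4)[OF wt] using b by simp
      qed
    qed
    have "oe \<Omega> (fn (W 0)) = 0" using fW(2)[of "W 0"] W(2) by simp
    then show "L2_Omega_norm \<Omega> (\<lambda>x. w' 0 x - u0 x) = 0"
      unfolding L2_Omega_norm_eq[OF oe_linear(3)[OF w'L(1)[OF T0] u0]] oe_linear(4)[OF w'L(1)[OF T0] u0] w'L(2)[OF T0] w(4) by simp
  qed
  have L2Hms: "in_L2_Hms T \<Omega> s g'" unfolding g'_def by (rule L2_Hms_perturbation[OF gs(2)])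
  have "is_state T \<Omega> s f u0 (\<lambda>t x. z t x + y t x) u'"
    unfolding is_state_def in_V_with_def AE_completion_iff using L2tHs Linf L2Hms dt eq' val' by blast
  then show ?thesis using vQ qv unfolding u'_def v_def by simp
qed

end

section \<open>The optimal control is a projection of the adjoint state\<close>

lemma sqi_max_min:
  assumes "sqi f" "sqi g"
  shows "sqi (\<lambda>x. max (f x) (g x))" "sqi (\<lambda>x. min (f x) (g x))"
proof -
  have d: "sqi (\<lambda>x. \<bar>f x - g x\<bar>)" using sqi_diff[OF assms] unfolding sqi_def by (simp add: borel_measurable_abs)
  have "sqi (\<lambda>x. (1 / 2) * (f x + g x + \<bar>f x - g x\<bar>))" by (rule sqi_mult_left[OF sqi_add[OF sqi_add[OF assms] d]])
  moreover have "(1 / 2) * (f x + g x + \<bar>f x - g x\<bar>) = max (f x) (g x)" for x by (simp add: max_def)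
  ultimately show "sqi (\<lambda>x. max (f x) (g x))" by simp
  have "sqi (\<lambda>x. (1 / 2) * (f x + g x - \<bar>f x - g x\<bar>))" by (rule sqi_mult_left[OF sqi_diff[OF sqi_add[OF assms] d]])
  moreover have "(1 / 2) * (f x + g x - \<bar>f x - g x\<bar>) = min (f x) (g x)" for x by (simp add: min_def)
  ultimately show "sqi (\<lambda>x. min (f x) (g x))" by simp
qed

lemma norm_mono_AE:
  assumes "AE x in lborel. \<bar>fn X x\<bar> \<le> \<bar>fn Y x\<bar>"
  shows "norm X \<le> norm Y"
proof -
  have "ennreal ((norm X)\<^sup>2) \<le> ennreal ((norm Y)\<^sup>2)" unfolding norm_sq_lsq_nn
    by (rule nn_integral_mono_AE, use assms in eventually_elim) (simp add: ennreal_leI abs_le_square_iff)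
  then have "(norm X)\<^sup>2 \<le> (norm Y)\<^sup>2" by simp
  then show ?thesis by (rule power2_le_imp_le) simp
qed

lemma norm_le_norms_AE:
  assumes ae: "AE x in lborel. \<bar>fn X x\<bar> \<le> \<bar>fn A x\<bar> + \<bar>fn B x\<bar> + c * \<bar>fn C x\<bar>" and c: "0 \<le> c"
  shows "norm X \<le> norm A + norm B + c * norm C"
proof -
  define m where "m Z = cls (\<lambda>x. \<bar>fn Z x\<bar>)" for Z :: "'a lsq"
  have m: "AE x in lborel. fn (m Z) x = \<bar>fn Z x\<bar>" for Z :: "'a lsq"
    unfolding m_def by (rule fn_cls) (use fn_sqi[of Z] in \<open>simp add: sqi_def borel_measurable_abs\<close>)
  have "norm X \<le> norm (m A + m B + c *\<^sub>R m C)"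
  proof (rule norm_mono_AE)
    show "AE x in lborel. \<bar>fn X x\<bar> \<le> \<bar>fn (m A + m B + c *\<^sub>R m C) x\<bar>"
      using ae m[of A] m[of B] m[of C] fn_add[of "m A + m B" "c *\<^sub>R m C"] fn_add[of "m A" "m B"] fn_scale[of c "m C"]
      by eventually_elim (simp, rule order_trans[OF _ abs_ge_self], assumption)
  qed
  also have "\<dots> \<le> norm (m A) + norm (m B) + norm (c *\<^sub>R m C)"
    using norm_triangle_ineq[of "m A + m B" "c *\<^sub>R m C"] norm_triangle_ineq[of "m A" "m B"] by linarith
  also have "\<dots> = norm A + norm B + c * norm C" using c unfolding m_def by (simp add: norm_cls_abs)
  finally show ?thesis .
qed

lemma inner_nonpos_if_AE:
  assumes "AE x in lborel. fn X x * fn Y x \<le> 0"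
  shows "X \<bullet> Y \<le> 0"
proof -
  have "0 \<le> (LINT x|lborel. - (fn X x * fn Y x))" by (rule integral_nonneg_AE) (use assms in simp)
  then show ?thesis unfolding inner_lsq_def by simp
qed

text \<open>The right side of the assumption exceeds the left by
  \<open>\<epsilon> * (q + \<epsilon> * r)\<close>, with \<open>q\<close> the quantity in question
  and \<open>r \<ge> 0\<close>; a negative \<open>q\<close> is contradicted by a small
  \<open>\<epsilon>\<close>.\<close>

lemma first_order_condition:
  fixes F V Z \<zeta> :: "'a::real_inner"
  assumes "\<And>\<epsilon>. 0 < \<epsilon> ==> \<epsilon> \<le> 1 ==> (norm F)\<^sup>2 / 2 + \<mu> / 2 * (norm Z)\<^sup>2
      \<le> (norm (F + \<epsilon> *\<^sub>R V))\<^sup>2 / 2 + \<mu> / 2 * (norm (Z + \<epsilon> *\<^sub>R \<zeta>))\<^sup>2" and \<mu>: "0 < \<mu>"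
  shows "0 \<le> F \<bullet> V + \<mu> * (Z \<bullet> \<zeta>)"
proof (rule ccontr)
  define q where "q = F \<bullet> V + \<mu> * (Z \<bullet> \<zeta>)"
  define r where "r = ((norm V)\<^sup>2 + \<mu> * (norm \<zeta>)\<^sup>2) / 2"
  assume "\<not> 0 \<le> F \<bullet> V + \<mu> * (Z \<bullet> \<zeta>)"
  then have q: "q < 0" unfolding q_def by simp
  have r: "0 \<le> r" unfolding r_def using \<mu> by simp
  have ex: "(norm (A + \<epsilon> *\<^sub>R B))\<^sup>2 = (norm A)\<^sup>2 + 2 * \<epsilon> * (A \<bullet> B) + \<epsilon>\<^sup>2 * (norm B)\<^sup>2" for A B :: 'a and \<epsilon>
    unfolding power2_norm_eq_inner by (simp add: inner_add_left inner_add_right inner_commute[of B A] power2_eq_square algebra_simps)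
  \<comment> \<open>With \<open>r + 1\<close> in the denominator one gets
    \<open>q + \<epsilon> * r \<le> - \<epsilon> < 0\<close>, also for \<open>r = 0\<close>.\<close>
  define \<epsilon> where "\<epsilon> = min 1 (- q / (r + 1))"
  have e: "0 < \<epsilon>" "\<epsilon> \<le> 1" "\<epsilon> \<le> - q / (r + 1)" unfolding \<epsilon>_def using q r by (auto simp: divide_neg_pos)
  have "(norm F)\<^sup>2 / 2 + \<mu> / 2 * (norm Z)\<^sup>2 + \<epsilon> * (q + \<epsilon> * r)
      = (norm (F + \<epsilon> *\<^sub>R V))\<^sup>2 / 2 + \<mu> / 2 * (norm (Z + \<epsilon> *\<^sub>R \<zeta>))\<^sup>2"
    unfolding ex q_def r_def by (simp add: power2_eq_square field_simps)
  then have "0 \<le> \<epsilon> * (q + \<epsilon> * r)" using assms(1)[OF e(1,2)] by linarith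
  then have "0 \<le> q + \<epsilon> * r" using e(1) by (simp add: zero_le_mult_iff)
  moreover have "\<epsilon> * (r + 1) \<le> - q" by (rule iffD1[OF pos_le_divide_eq e(3)]) (use r in simp)
  ultimately show False using e(1) by (simp add: distrib_left)
qed

text \<open>With \<open>w\<close> the projection of \<open>-p / \<mu>\<close> to \<open>[a, b]\<close>, this is the obtuse angle criterion.\<close>

lemma projection_inequality:
  fixes a b p z \<mu> :: real
  assumes "a \<le> z" "z \<le> b" "0 < \<mu>"
  defines "w \<equiv> max a (min b (- (1 / \<mu>) * p))"
  shows "(w - z) * (p + \<mu> * z + \<mu> * (w - z)) \<le> 0"
proof -
  define q where "q = - (1 / \<mu>) * p"
  have p: "p = - \<mu> * q" unfolding q_def using assms(3) by simp
  have w: "w = max a (min b q)" unfolding w_def q_def ..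
  have "(w - z) * (w - q) \<le> 0"
  proof -
    consider "q \<le> a" | "b \<le> q" | "a < q" "q < b" by linarith
    then show ?thesis
    proof cases
      case 1
      then have "w = a" unfolding w by (intro max_absorb1) (rule order_trans[OF min.cobounded2])
      then show ?thesis using assms(1) 1 by (intro mult_nonpos_nonneg) auto
    next
      case 2
      have "a \<le> b" using assms(1,2) by linarith
      then have "w = b" unfolding w min_absorb1[OF 2] by (rule max_absorb2)
      then show ?thesis using assms(2) 2 by (intro mult_nonneg_nonpos) auto
    next
      case 3
      then have "w = q" unfolding w by simp
      then show ?thesis by simp
    qed
  qed
  then have "\<mu> * ((w - z) * (w - q)) \<le> 0" using assms(3) by (simp add: mult_le_0_iff)
  moreover have "(w - z) * (p + \<mu> * z + \<mu> * (w - z)) = \<mu> * ((w - z) * (w - q))" unfolding p by (simp add: algebra_simps)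
  ultimately show ?thesis by linarith
qed

lemma qe_scale:
  assumes "in_L2Q T \<Omega> z"
  shows "in_L2Q T \<Omega> (\<lambda>t x. c * z t x)" "qe T \<Omega> (\<lambda>t x. c * z t x) = c *\<^sub>R qe T \<Omega> z"
  using sqi_mult_left[OF assms[unfolded in_L2Q_iff], of c] cls_scale[OF assms[unfolded in_L2Q_iff], of c]
  unfolding in_L2Q_iff qe_def by (simp_all add: mult.left_commute)

definition clip :: "real \<Rightarrow> (real \<Rightarrow> real^'n \<Rightarrow> real) \<Rightarrow> (real \<Rightarrow> real^'n \<Rightarrow> real) \<Rightarrow> (real \<Rightarrow> real^'n \<Rightarrow> real)
    \<Rightarrow> real \<Rightarrow> real^'n \<Rightarrow> real" where
  "clip \<mu> a b p t x = max (a t x) (min (b t x) (- (1 / \<mu>) * p t x))"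

lemma in_L2Q_clip:
  assumes "in_L2Q T \<Omega> a" "in_L2Q T \<Omega> b" "in_L2Q T \<Omega> p"
  shows "in_L2Q T \<Omega> (clip \<mu> a b p)"
proof -
  have "sqi (\<lambda>P. max (indicator (cyl T \<Omega>) P * a (fst P) (snd P)) (min (indicator (cyl T \<Omega>) P * b (fst P) (snd P))
      (indicator (cyl T \<Omega>) P * (- (1 / \<mu>) * p (fst P) (snd P)))))"
    using assms(1,2) qe_scale(1)[OF assms(3), of "- (1 / \<mu>)"] unfolding in_L2Q_iff by (intro sqi_max_min)
  moreover have "max (indicator (cyl T \<Omega>) P * a (fst P) (snd P)) (min (indicator (cyl T \<Omega>) P * b (fst P) (snd P))
      (indicator (cyl T \<Omega>) P * (- (1 / \<mu>) * p (fst P) (snd P)))) = indicator (cyl T \<Omega>) P * clip \<mu> a b p (fst P) (snd P)" for P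
    unfolding clip_def by (auto split: split_indicator)
  ultimately show ?thesis unfolding in_L2Q_iff by simp
qed

section \<open>Time differences of the data\<close>

text \<open>The projection is Lipschitz jointly in both bounds and in the projected value, so the
  time differences of \<open>a\<close> and \<open>b\<close> enter besides those of \<open>p\<close>.
  The comparison is pointwise; all differences vanish unless both times are admissible.\<close>

lemma norm_fdiff_clip:
  assumes a: "in_L2Q T \<Omega> a" and b: "in_L2Q T \<Omega> b" and p: "in_L2Q T \<Omega> p" and \<mu>: "0 < \<mu>"
  shows "norm (fdiff T h (qe T \<Omega> (clip \<mu> a b p)))
    \<le> norm (fdiff T h (qe T \<Omega> a)) + norm (fdiff T h (qe T \<Omega> b)) + (1 / \<mu>) * norm (fdiff T h (qe T \<Omega> p))"
proof (rule norm_le_norms_AE)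
  let ?W = "qe T \<Omega> (clip \<mu> a b p)"
  let ?c = "\<lambda>P. max (fn (qe T \<Omega> a) P) (min (fn (qe T \<Omega> b) P) (- (1 / \<mu>) * fn (qe T \<Omega> p) P))"
  have W: "AE P in lborel. fn ?W P = ?c P"
    using fn_qe[OF in_L2Q_clip[OF a b p, of \<mu>]] fn_qe[OF a] fn_qe[OF b] fn_qe[OF p]
    by eventually_elim (auto simp: clip_def split: split_indicator)
  have W': "AE P in lborel. fn ?W (fst P + h, snd P) = ?c (fst P + h, snd P)"
  proof -
    have e: "(h, 0) + P = (fst P + h, snd P)" for P :: "real \<times> (real^'a)" by (simp add: prod_eq_iff add.commute)
    show ?thesis using AE_lborel_translate_euclidean[OF W, where c = "(h, 0 :: real^'a)"] unfolding e .
  qed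
  have lip: "\<bar>max \<alpha>' (min \<beta>' (- (1 / \<mu>) * \<pi>')) - max \<alpha> (min \<beta> (- (1 / \<mu>) * \<pi>))\<bar> \<le> \<bar>\<alpha>' - \<alpha>\<bar> + \<bar>\<beta>' - \<beta>\<bar> + 1 / \<mu> * \<bar>\<pi>' - \<pi>\<bar>"
    for \<alpha> \<beta> \<pi> \<alpha>' \<beta>' \<pi>' :: real
  proof -
    have mx: "\<bar>max x' y' - max x y\<bar> \<le> \<bar>x' - x\<bar> + \<bar>y' - y\<bar>" for x y x' y' :: real by linarith
    have mn: "\<bar>min x' y' - min x y\<bar> \<le> \<bar>x' - x\<bar> + \<bar>y' - y\<bar>" for x y x' y' :: real by linarith
    have e: "\<bar>- (1 / \<mu>) * \<pi>' - - (1 / \<mu>) * \<pi>\<bar> = 1 / \<mu> * \<bar>\<pi>' - \<pi>\<bar>"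
    proof -
      have "- (1 / \<mu>) * \<pi>' - - (1 / \<mu>) * \<pi> = - (1 / \<mu>) * (\<pi>' - \<pi>)" by (simp add: right_diff_distrib)
      then show ?thesis using \<mu> by (simp only: abs_mult) simp
    qed
    show ?thesis using mx[of \<alpha>' "min \<beta>' (- (1 / \<mu>) * \<pi>')" \<alpha> "min \<beta> (- (1 / \<mu>) * \<pi>)"]
        mn[of \<beta>' "- (1 / \<mu>) * \<pi>'" \<beta> "- (1 / \<mu>) * \<pi>"] unfolding e by argo
  qed
  show "AE P in lborel. \<bar>fn (fdiff T h ?W) P\<bar>
      \<le> \<bar>fn (fdiff T h (qe T \<Omega> a)) P\<bar> + \<bar>fn (fdiff T h (qe T \<Omega> b)) P\<bar> + 1 / \<mu> * \<bar>fn (fdiff T h (qe T \<Omega> p)) P\<bar>"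
    using W W' fn_fdiff[of T h ?W] fn_fdiff[of T h "qe T \<Omega> a"] fn_fdiff[of T h "qe T \<Omega> b"] fn_fdiff[of T h "qe T \<Omega> p"]
  proof eventually_elim
    case (elim P)
    show ?case
    proof (cases "fst P \<in> {0<..<T} \<and> fst P + h \<in> {0<..<T}")
      case True
      then have i: "indicator {0<..<T} (fst P) = (1::real)" "indicator {0<..<T} (fst P + h) = (1::real)" by auto
      show ?thesis unfolding elim(3-6) i mult_1 elim(1) elim(2) by (rule lip)
    next
      case False
      then have "indicator {0<..<T} (fst P) = (0::real) \<or> indicator {0<..<T} (fst P + h) = (0::real)" by (auto split: split_indicator)
      then show ?thesis unfolding elim(3-6) by auto
    qed
  qed
qed (use \<mu> in simp)

text \<open>Over \<open>\<Omega>\<close> and before \<open>T - h\<close> the forward difference is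
  the integral of the derivative over \<open>(t, t + h)\<close>, and elsewhere it is zero. The Schur
  bound of that kernel gives the factor \<open>h\<close>.\<close>

lemma norm_fdiff_le_weak_derivative:
  assumes a: "in_L2Q T \<Omega> a" and da: "in_L2Q T \<Omega> da" and dt: "has_dt_L2 T \<Omega> a da" and \<Omega>: "open \<Omega>" and h: "0 < h"
  shows "norm (fdiff T h (qe T \<Omega> a)) \<le> h * L2Q_norm T \<Omega> da"
proof -
  let ?K = "kop (Kfor T h) (qe T \<Omega> da)"
  have A': "AE P in lborel. fn (qe T \<Omega> a) (fst P + h, snd P) = indicator (cyl T \<Omega>) (fst P + h, snd P) * a (fst P + h) (snd P)"
  proof -
    have e: "(h, 0) + P = (fst P + h, snd P)" for P :: "real \<times> (real^'a)" by (simp add: prod_eq_iff add.commute)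
    show ?thesis using AE_lborel_translate_euclidean[OF fn_qe[OF a], where c = "(h, 0 :: real^'a)"] unfolding e by simp
  qed
  have "norm (fdiff T h (qe T \<Omega> a)) \<le> norm ?K"
  proof (rule norm_mono_AE)
    show "AE P in lborel. \<bar>fn (fdiff T h (qe T \<Omega> a)) P\<bar> \<le> \<bar>fn ?K P\<bar>"
      using fdiff_eq_kernel_if_weak_derivative[OF wdt_if_has_dt_L2[OF a da dt] \<Omega> h] fn_fdiff[of T h "qe T \<Omega> a"] fn_qe[OF a] A'
    proof eventually_elim
      case (elim P)
      show ?case
      proof (cases "P \<in> {0<..<T - h} \<times> \<Omega>")
        case True
        then show ?thesis using elim(1) by simp
      next
        case False
        have "fn (fdiff T h (qe T \<Omega> a)) P = 0"
          unfolding elim(2,3,4) using False h by (cases P) (auto simp: cyl_def split: split_indicator)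
        then show ?thesis by simp
      qed
    qed
  qed
  also have "\<dots> \<le> h * norm (qe T \<Omega> da)" by (rule norm_kop[OF kset_Kfor]) (use h in simp)
  finally show ?thesis unfolding L2Q_norm_eq[OF da] .
qed

lemma H1L2_bounds:
  assumes a: "in_H1L2 T \<Omega> a" and \<Omega>: "open \<Omega>"
  shows "in_L2Q T \<Omega> a" "norm (qe T \<Omega> a) \<le> H1L2_norm T \<Omega> a"
    "0 < h ==> norm (fdiff T h (qe T \<Omega> a)) \<le> h * H1L2_norm T \<Omega> a"
proof -
  \<comment> \<open>\<open>H1L2_norm\<close> refers to a derivative selected by \<open>SOME\<close>;
    the selected function is itself a weak derivative, which is all that the difference bound
    uses.\<close>
  define da where "da = (SOME da. in_L2Q T \<Omega> da \<and> has_dt_L2 T \<Omega> a da)"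
  have ex: "\<exists>da. in_L2Q T \<Omega> da \<and> has_dt_L2 T \<Omega> a da" using a unfolding in_H1L2_def by blast
  have da: "in_L2Q T \<Omega> da \<and> has_dt_L2 T \<Omega> a da" unfolding da_def by (rule someI_ex[OF ex])
  show aQ: "in_L2Q T \<Omega> a" using a unfolding in_H1L2_def by blast
  have H: "H1L2_norm T \<Omega> a = sqrt ((L2Q_norm T \<Omega> a)\<^sup>2 + (L2Q_norm T \<Omega> da)\<^sup>2)" unfolding H1L2_norm_def da_def ..
  show "norm (qe T \<Omega> a) \<le> H1L2_norm T \<Omega> a" unfolding H L2Q_norm_eq[OF aQ] by (rule real_le_rsqrt) simp
  have d: "L2Q_norm T \<Omega> da \<le> H1L2_norm T \<Omega> a" unfolding H by (rule real_le_rsqrt) simp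
  assume h: "0 < h"
  have "norm (fdiff T h (qe T \<Omega> a)) \<le> h * L2Q_norm T \<Omega> da"
    by (rule norm_fdiff_le_weak_derivative[OF aQ _ _ \<Omega> h]) (use da in blast)+
  also have "\<dots> \<le> h * H1L2_norm T \<Omega> a" using h by (intro mult_left_mono d) simp
  finally show "norm (fdiff T h (qe T \<Omega> a)) \<le> h * H1L2_norm T \<Omega> a" .
qed

lemma norm_qe_between:
  assumes a: "in_L2Q T \<Omega> a" and b: "in_L2Q T \<Omega> b" and z: "z \<in> Zad T \<Omega> a b"
  shows "norm (qe T \<Omega> z) \<le> norm (qe T \<Omega> a) + norm (qe T \<Omega> b)"
proof -
  have zQ: "in_L2Q T \<Omega> z" and ae: "AE P in lborel. P \<in> cyl T \<Omega> \<longrightarrow> a (fst P) (snd P) \<le> z (fst P) (snd P) \<and> z (fst P) (snd P) \<le> b (fst P) (snd P)"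
    using z unfolding Zad_def AE_completion_iff by auto
  have "norm (qe T \<Omega> z) \<le> norm (qe T \<Omega> a) + norm (qe T \<Omega> b) + 0 * norm (qe T \<Omega> b)"
  proof (rule norm_le_norms_AE)
    show "AE P in lborel. \<bar>fn (qe T \<Omega> z) P\<bar> \<le> \<bar>fn (qe T \<Omega> a) P\<bar> + \<bar>fn (qe T \<Omega> b) P\<bar> + 0 * \<bar>fn (qe T \<Omega> b) P\<bar>"
      using ae fn_qe[OF zQ] fn_qe[OF a] fn_qe[OF b] by eventually_elim (auto split: split_indicator)
  qed simp
  then show ?thesis by simp
qed

section \<open>The optimality system\<close>

context
  fixes \<Omega> :: "(real^'n) set" and s T \<mu> P \<kappa> :: real
  assumes s: "0 < s" "s < 1" and T: "0 < T" and \<Omega>: "open \<Omega>" and \<mu>: "0 < \<mu>"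
    and P: "\<And>v. v \<in> Vsp \<Omega> s ==> norm (fst v) \<le> P * norm (snd v)" "0 \<le> P"
    and \<kappa>: "0 < \<kappa>" "\<kappa> = Cns CARD('n) s / 2"
begin

text \<open>Let \<open>w\<close> be the projection and \<open>\<zeta> = w - z\<close>. The convex
  combinations \<open>z + \<epsilon> \<zeta>\<close> are admissible, so minimality and duality give
  \<open>\<zeta> \<bullet> (p + \<mu> z) \<ge> 0\<close>, while the pointwise inequality for the
  projection gives \<open>\<zeta> \<bullet> (p + \<mu> z + \<mu> \<zeta>) \<le> 0\<close>.
  Subtracting leaves \<open>\<mu> |\<zeta>|^2 \<le> 0\<close>. The single direction
  \<open>\<zeta>\<close> suffices.\<close>

lemma optimal_control_eq_clip:
  assumes opt: "is_optimal T \<Omega> s \<mu> f u0 ud a b z u"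
    and Y: "Y \<in> VV T (Vsp \<Omega> s)" "fst Y = qe T \<Omega> p"
    and eqY: "\<And>\<Theta>. \<Theta> \<in> VV T (Vsp \<Omega> s) ==> fst Y \<bullet> fst \<Theta> + \<kappa> * (volt' T (snd Y) \<bullet> snd \<Theta>)
      = volt' T (qe T \<Omega> (\<lambda>t x. u t x - ud t x)) \<bullet> fst \<Theta>"
    and u: "in_L2Q T \<Omega> u" and ud: "in_L2Q T \<Omega> ud" and p: "in_L2Q T \<Omega> p" and a: "in_L2Q T \<Omega> a" and b: "in_L2Q T \<Omega> b"
    and u0: "in_L2_Omega \<Omega> u0"
  shows "qe T \<Omega> z = qe T \<Omega> (clip \<mu> a b p)"
proof -
  note V = subspace_Vsp[OF s, of \<Omega>] closed_Vsp[OF s, of \<Omega>]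
  have st: "is_state T \<Omega> s f u0 z u" and zZ: "z \<in> Zad T \<Omega> a b"
    and minimal: "\<And>z' u'. z' \<in> Zad T \<Omega> a b ==> is_state T \<Omega> s f u0 z' u' ==> cost T \<Omega> \<mu> ud u z \<le> cost T \<Omega> \<mu> ud u' z'"
    using opt unfolding is_optimal_def by blast+
  have zQ: "in_L2Q T \<Omega> z" and ae: "AE Q in lborel. Q \<in> cyl T \<Omega> \<longrightarrow> a (fst Q) (snd Q) \<le> z (fst Q) (snd Q) \<and> z (fst Q) (snd Q) \<le> b (fst Q) (snd Q)"
    using zZ unfolding Zad_def AE_completion_iff by auto
  define w where "w = clip \<mu> a b p"
  have w: "in_L2Q T \<Omega> w" unfolding w_def by (rule in_L2Q_clip[OF a b p])
  define y where "y = (\<lambda>t x. w t x - z t x)"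
  have y: "in_L2Q T \<Omega> y" "qe T \<Omega> y = qe T \<Omega> w - qe T \<Omega> z" unfolding y_def by (rule qe_linear(3,4)[OF w zQ])+
  define \<zeta> where "\<zeta> = qe T \<Omega> y"
  define F where "F = qe T \<Omega> (\<lambda>t x. u t x - ud t x)"
  have Fe: "F = qe T \<Omega> u - qe T \<Omega> ud" unfolding F_def by (rule qe_linear(4)[OF u ud])
  obtain X where X: "X \<in> VV T (Vsp \<Omega> s)"
    and eqX': "\<forall>\<Theta>\<in>VV T (Vsp \<Omega> s). fst X \<bullet> fst \<Theta> + \<kappa> * (volt T (snd X) \<bullet> snd \<Theta>) = volt T \<zeta> \<bullet> fst \<Theta>"
    using evolution_exists[OF T V P \<kappa>(1), of \<zeta>] by blast
  note eqX = bspec[OF eqX']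
  have "norm (fst X - shift T \<sigma> (fst X)) \<le> norm \<zeta> * \<sigma>" if "0 < \<sigma>" for \<sigma>
    using evolution_regularity[OF T V P \<kappa>(1) X _ eqX] that by simp
  \<comment> \<open>The Lipschitz bound puts the increment into the range of \<open>volt T\<close>,
    the form in which \<open>perturbed_state\<close> constructs its trace.\<close>
  then obtain d where d: "fst X = volt T d" using volt_range_if_lipschitz[OF T, of "fst X" "norm \<zeta>"] by auto
  have cost_eq: "cost T \<Omega> \<mu> ud u' z' = (norm (qe T \<Omega> u' - qe T \<Omega> ud))\<^sup>2 / 2 + \<mu> / 2 * (norm (qe T \<Omega> z'))\<^sup>2"
    if "in_L2Q T \<Omega> u'" "in_L2Q T \<Omega> z'" for u' z'
    unfolding cost_def L2Q_norm_eq[OF qe_linear(3)[OF that(1) ud]] L2Q_norm_eq[OF that(2)] qe_linear(4)[OF that(1) ud] ..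
  have "0 \<le> F \<bullet> fst X + \<mu> * (qe T \<Omega> z \<bullet> \<zeta>)"
  proof (rule first_order_condition[OF _ \<mu>])
    fix \<epsilon> :: real assume e: "0 < \<epsilon>" "\<epsilon> \<le> 1"
    define y' where "y' = (\<lambda>t x. \<epsilon> * y t x)"
    define z' where "z' = (\<lambda>t x. z t x + y' t x)"
    define u' where "u' = (\<lambda>t x. u t x + fn (fst (\<epsilon> *\<^sub>R X)) (t, x))"
    have y': "in_L2Q T \<Omega> y'" "qe T \<Omega> y' = \<epsilon> *\<^sub>R \<zeta>" unfolding y'_def \<zeta>_def by (rule qe_scale[OF y(1)])+
    have z': "in_L2Q T \<Omega> z'" "qe T \<Omega> z' = qe T \<Omega> z + \<epsilon> *\<^sub>R \<zeta>" unfolding z'_def using qe_linear(1,2)[OF zQ y'(1)] y'(2) by simp_all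
    have Xe: "\<epsilon> *\<^sub>R X \<in> VV T (Vsp \<Omega> s)" by (rule subspace_scale[OF subspace_VV[OF V] X])
    have de: "fst (\<epsilon> *\<^sub>R X) = volt T (\<epsilon> *\<^sub>R d)" using d by (simp add: linear_scale[OF linear_volt[OF T]])
    have eqe: "fst (\<epsilon> *\<^sub>R X) \<bullet> fst \<Theta> + Cns CARD('n) s / 2 * (volt T (snd (\<epsilon> *\<^sub>R X)) \<bullet> snd \<Theta>) = volt T (qe T \<Omega> y') \<bullet> fst \<Theta>"
      if "\<Theta> \<in> VV T (Vsp \<Omega> s)" for \<Theta>
    proof -
      have "\<epsilon> * (fst X \<bullet> fst \<Theta> + \<kappa> * (volt T (snd X) \<bullet> snd \<Theta>)) = \<epsilon> * (volt T \<zeta> \<bullet> fst \<Theta>)" using eqX[OF that] by simp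
      then show ?thesis unfolding y'(2) \<kappa>(2)[symmetric]
        by (simp add: linear_scale[OF linear_volt[OF T]] distrib_left mult.left_commute)
    qed
    have ps: "is_state T \<Omega> s f u0 z' u'" "in_L2Q T \<Omega> (\<lambda>t x. fn (fst (\<epsilon> *\<^sub>R X)) (t, x))"
      "qe T \<Omega> (\<lambda>t x. fn (fst (\<epsilon> *\<^sub>R X)) (t, x)) = \<epsilon> *\<^sub>R fst X"
      using perturbed_state[OF s T \<Omega> st zQ y'(1) u0 Xe de eqe] unfolding z'_def u'_def by simp_all
    have u': "in_L2Q T \<Omega> u'" "qe T \<Omega> u' = qe T \<Omega> u + \<epsilon> *\<^sub>R fst X"
      unfolding u'_def using qe_linear(1,2)[OF u ps(2)] ps(3) by simp_all
    have "AE Q in lborel. Q \<in> cyl T \<Omega> \<longrightarrow> a (fst Q) (snd Q) \<le> z' (fst Q) (snd Q) \<and> z' (fst Q) (snd Q) \<le> b (fst Q) (snd Q)"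
      using ae
    proof eventually_elim
      case (elim Q)
      show ?case
      proof
        assume "Q \<in> cyl T \<Omega>"
        then have le: "a (fst Q) (snd Q) \<le> z (fst Q) (snd Q)" "z (fst Q) (snd Q) \<le> b (fst Q) (snd Q)" using elim by auto
        define \<alpha> \<beta> \<xi> \<omega> where "\<alpha> = a (fst Q) (snd Q)" and "\<beta> = b (fst Q) (snd Q)" and "\<xi> = z (fst Q) (snd Q)" and "\<omega> = w (fst Q) (snd Q)"
        have k: "\<alpha> \<le> \<xi>" "\<xi> \<le> \<beta>" using le unfolding \<alpha>_def \<beta>_def \<xi>_def .
        have o: "\<alpha> \<le> \<omega>" "\<omega> \<le> \<beta>" using k unfolding \<omega>_def w_def clip_def \<alpha>_def[symmetric] \<beta>_def[symmetric] by auto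
        have c: "z' (fst Q) (snd Q) = (1 - \<epsilon>) * \<xi> + \<epsilon> * \<omega>" unfolding z'_def y'_def y_def \<xi>_def \<omega>_def by (simp add: algebra_simps)
        have "(1 - \<epsilon>) * \<alpha> + \<epsilon> * \<alpha> \<le> (1 - \<epsilon>) * \<xi> + \<epsilon> * \<omega>" using e k o by (intro add_mono mult_left_mono) auto
        moreover have "(1 - \<epsilon>) * \<xi> + \<epsilon> * \<omega> \<le> (1 - \<epsilon>) * \<beta> + \<epsilon> * \<beta>" using e k o by (intro add_mono mult_left_mono) auto
        ultimately show "a (fst Q) (snd Q) \<le> z' (fst Q) (snd Q) \<and> z' (fst Q) (snd Q) \<le> b (fst Q) (snd Q)"
          unfolding c \<alpha>_def[symmetric] \<beta>_def[symmetric] by (simp add: algebra_simps)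
      qed
    qed
    then have zad: "z' \<in> Zad T \<Omega> a b" unfolding Zad_def AE_completion_iff using z'(1) by simp
    have Fx: "qe T \<Omega> u + \<epsilon> *\<^sub>R fst X - qe T \<Omega> ud = F + \<epsilon> *\<^sub>R fst X" unfolding Fe by simp
    from minimal[OF zad ps(1)] show "(norm F)\<^sup>2 / 2 + \<mu> / 2 * (norm (qe T \<Omega> z))\<^sup>2
        \<le> (norm (F + \<epsilon> *\<^sub>R fst X))\<^sup>2 / 2 + \<mu> / 2 * (norm (qe T \<Omega> z + \<epsilon> *\<^sub>R \<zeta>))\<^sup>2"
      unfolding cost_eq[OF u zQ] cost_eq[OF u'(1) z'(1)] u'(2) z'(2) Fx Fe[symmetric] .
  qed
  moreover have "F \<bullet> fst X = \<zeta> \<bullet> fst Y" by (rule evolution_duality[OF T V P \<kappa>(1) X Y(1) eqX eqY[folded F_def]])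
  ultimately have vi: "0 \<le> \<zeta> \<bullet> (qe T \<Omega> p + \<mu> *\<^sub>R qe T \<Omega> z)"
    unfolding Y(2) by (simp add: inner_add_right inner_commute[of "qe T \<Omega> z"])
  have "\<zeta> \<bullet> (qe T \<Omega> p + \<mu> *\<^sub>R qe T \<Omega> z + \<mu> *\<^sub>R \<zeta>) \<le> 0"
  proof (rule inner_nonpos_if_AE)
    show "AE Q in lborel. fn \<zeta> Q * fn (qe T \<Omega> p + \<mu> *\<^sub>R qe T \<Omega> z + \<mu> *\<^sub>R \<zeta>) Q \<le> 0"
      using ae fn_qe[OF y(1)] fn_qe[OF p] fn_qe[OF zQ] fn_add[of "qe T \<Omega> p + \<mu> *\<^sub>R qe T \<Omega> z" "\<mu> *\<^sub>R \<zeta>"]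
        fn_add[of "qe T \<Omega> p" "\<mu> *\<^sub>R qe T \<Omega> z"] fn_scale[of \<mu> "qe T \<Omega> z"] fn_scale[of \<mu> \<zeta>]
    proof eventually_elim
      case (elim Q)
      show ?case
      proof (cases "Q \<in> cyl T \<Omega>")
        case True
        have le: "a (fst Q) (snd Q) \<le> z (fst Q) (snd Q)" "z (fst Q) (snd Q) \<le> b (fst Q) (snd Q)" using elim(1) True by auto
        show ?thesis using projection_inequality[OF le \<mu>, of "p (fst Q) (snd Q)"] True elim(2-8)
          unfolding \<zeta>_def[symmetric] by (simp add: y_def w_def clip_def)
      next
        case False
        then show ?thesis using elim(2) unfolding \<zeta>_def[symmetric] by simp
      qed
    qed
  qed
  then have "\<mu> * (\<zeta> \<bullet> \<zeta>) \<le> 0" using vi unfolding inner_add_right[of \<zeta> _ "\<mu> *\<^sub>R \<zeta>"] by simp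
  then have "\<zeta> \<bullet> \<zeta> \<le> 0" using \<mu> by (simp add: mult_le_0_iff)
  then have "\<zeta> = 0" using inner_ge_zero[of \<zeta>] inner_eq_zero_iff[of \<zeta>] by linarith
  then show ?thesis using y(2) unfolding \<zeta>_def w_def by simp
qed

lemma optimal_regularity:
  assumes f: "in_L2_Hms T \<Omega> s f" and u0: "in_L2_Omega \<Omega> u0" and ud: "in_L2Q T \<Omega> ud"
    and a: "in_H1L2 T \<Omega> a" and b: "in_H1L2 T \<Omega> b"
    and opt: "is_optimal T \<Omega> s \<mu> f u0 ud a b z u" and adj: "is_adjoint T \<Omega> s u ud p"
  defines "K \<equiv> ((1 + T) + ((P + T * P + T) / \<kappa> + T / (2 * \<kappa>)) + 1)"
  shows "\<exists>dz dp. in_L2Q T \<Omega> dz \<and> has_dt_L2 T \<Omega> z dz \<and> in_L2Q T \<Omega> dp \<and> has_dt_L2 T \<Omega> p dp \<and>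
    L2Q_norm T \<Omega> dz + L2Q_norm T \<Omega> dp \<le> (1 + (1 / \<mu> + 1) * (K * (sqrt T + 2) + 1)) *
      (sqrt ((L2_Omega_norm \<Omega> u0)\<^sup>2 + (L2_Hms_norm T \<Omega> s f)\<^sup>2) + L2Q_norm T \<Omega> ud + H1L2_norm T \<Omega> a + H1L2_norm T \<Omega> b)"
proof -
  note V = subspace_Vsp[OF s, of \<Omega>] closed_Vsp[OF s, of \<Omega>]
  have \<Omega>b: "\<Omega> \<in> sets borel" using \<Omega> by simp
  have st: "is_state T \<Omega> s f u0 z u" and zZ: "z \<in> Zad T \<Omega> a b" using opt unfolding is_optimal_def by blast+
  have zQ: "in_L2Q T \<Omega> z" using zZ unfolding Zad_def by blast
  obtain r where r: "norm r \<le> L2_Hms_norm T \<Omega> s f"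
    and rp': "\<forall>t1 t2 \<phi>. 0 \<le> t1 \<longrightarrow> t2 \<le> T \<longrightarrow> \<phi> \<in> tHs \<Omega> s \<longrightarrow> (LINT \<tau>|lebesgue. indicator {t1<..<t2} \<tau> * f \<tau> \<phi>)
      = fst r \<bullet> tens (indicator {t1<..<t2}) (cls \<phi>) + snd r \<bullet> tens (indicator {t1<..<t2}) (cls (Dq s \<phi>))"
    using Hms_riesz[OF s T \<Omega> f] by blast
  note rp = rp'[rule_format]
  obtain X where X: "X \<in> VV T (Vsp \<Omega> s)" "in_L2Q T \<Omega> u" "fst X = qe T \<Omega> u"
    and eqX': "\<forall>\<Theta>\<in>VV T (Vsp \<Omega> s). fst X \<bullet> fst \<Theta> + \<kappa> * (volt T (snd X) \<bullet> snd \<Theta>)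
      = tens (indicator {0<..<T}) (oe \<Omega> u0) \<bullet> fst \<Theta> + volt T (fst r + qe T \<Omega> z) \<bullet> fst \<Theta> + volt T (snd r) \<bullet> snd \<Theta>"
    using state_weak[OF s T \<Omega> st f u0 zQ rp] unfolding \<kappa>(2)[symmetric] by blast
  note eqX = bspec[OF eqX']
  define F where "F = qe T \<Omega> (\<lambda>t x. u t x - ud t x)"
  obtain Y where Y: "Y \<in> VV T (Vsp \<Omega> s)" "in_L2Q T \<Omega> p" "fst Y = qe T \<Omega> p"
    and eqY': "\<forall>\<Theta>\<in>VV T (Vsp \<Omega> s). fst Y \<bullet> fst \<Theta> + \<kappa> * (volt' T (snd Y) \<bullet> snd \<Theta>) = volt' T F \<bullet> fst \<Theta>"
    using adjoint_weak[OF s T \<Omega> adj X(2) ud] unfolding \<kappa>(2)[symmetric] F_def by blast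
  note eqY = bspec[OF eqY']
  note A = H1L2_bounds[OF a \<Omega>]
  note B = H1L2_bounds[OF b \<Omega>]
  have zc: "qe T \<Omega> z = qe T \<Omega> (clip \<mu> a b p)"
    by (rule optimal_control_eq_clip[OF opt Y(1,3) eqY[unfolded F_def] X(2) ud Y(2) A(1) B(1) u0])
  \<comment> \<open>The end value \<open>0\<close> makes the backward shift the right one: the
    backward estimate bounds the full truncated difference, whose restriction is the forward
    difference up to sign.\<close>
  have dp: "norm (fdiff T h (qe T \<Omega> p)) \<le> norm F * h" if h: "0 < h" for h
    using norm_fdiff_le_backward[of T h "fst Y"] evolution_regularity_backward[OF T V P \<kappa>(1) Y(1) _ eqY, of h] h
    unfolding Y(3) by linarith
  define Ha Hb where "Ha = H1L2_norm T \<Omega> a" and "Hb = H1L2_norm T \<Omega> b"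
  have dz: "norm (fdiff T h (qe T \<Omega> z)) \<le> (Ha + Hb + 1 / \<mu> * norm F) * h" if h: "0 < h" for h
  proof -
    have "norm (fdiff T h (qe T \<Omega> z)) \<le> norm (fdiff T h (qe T \<Omega> a)) + norm (fdiff T h (qe T \<Omega> b)) + 1 / \<mu> * norm (fdiff T h (qe T \<Omega> p))"
      unfolding zc by (rule norm_fdiff_clip[OF A(1) B(1) Y(2) \<mu>])
    also have "\<dots> \<le> h * Ha + h * Hb + 1 / \<mu> * (norm F * h)"
      unfolding Ha_def Hb_def using A(3)[OF h] B(3)[OF h] dp[OF h] \<mu> by (intro add_mono mult_left_mono) auto
    finally show ?thesis by (simp add: algebra_simps)
  qed
  obtain Dp where Dp: "norm Dp \<le> norm F" "wdt T \<Omega> (qe T \<Omega> p) Dp"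
    using weak_derivative_if_differences_bounded[OF T dp] by blast
  obtain Dz where Dz: "norm Dz \<le> Ha + Hb + 1 / \<mu> * norm F" "wdt T \<Omega> (qe T \<Omega> z) Dz"
    using weak_derivative_if_differences_bounded[OF T dz] by blast
  define S where "S = sqrt ((L2_Omega_norm \<Omega> u0)\<^sup>2 + (L2_Hms_norm T \<Omega> s f)\<^sup>2)"
  define D where "D = S + L2Q_norm T \<Omega> ud + Ha + Hb"
  have S: "norm (oe \<Omega> u0) \<le> S" "norm r \<le> S"
  proof -
    show "norm (oe \<Omega> u0) \<le> S" unfolding S_def L2_Omega_norm_eq[OF u0] by (rule real_le_rsqrt) simp
    have "L2_Hms_norm T \<Omega> s f \<le> S" unfolding S_def by (rule real_le_rsqrt) simp
    then show "norm r \<le> S" using r by simp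
  qed
  have K: "0 \<le> K" unfolding K_def using T P(2) \<kappa>(1) by (intro add_nonneg_nonneg divide_nonneg_nonneg mult_nonneg_nonneg) auto
  have udn: "L2Q_norm T \<Omega> ud = norm (qe T \<Omega> ud)" by (rule L2Q_norm_eq[OF ud])
  have nn: "0 \<le> Ha" "0 \<le> Hb" "0 \<le> S" "0 \<le> norm (qe T \<Omega> ud)" "0 \<le> sqrt T"
    using order_trans[OF norm_ge_zero A(2)] order_trans[OF norm_ge_zero B(2)] order_trans[OF norm_ge_zero S(2)] T
    unfolding Ha_def Hb_def by auto
  have e: "norm (tens (indicator {0<..<T}) (oe \<Omega> u0)) \<le> sqrt T * S"
    using norm_tens_indicator[of 0 T "oe \<Omega> u0"] T S(1) by (simp add: mult_left_mono)
  have r1: "norm (fst r) \<le> S" "norm (snd r) \<le> S"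
    using norm_fst_le[of "fst r" "snd r"] norm_snd_le[of "snd r" "fst r"] S(2) by auto
  \<comment> \<open>The control is a source in the state equation. Its norm is controlled by the two
    bounds alone, which closes the estimate without a further use of optimality.\<close>
  have z: "norm (qe T \<Omega> z) \<le> Ha + Hb"
    using norm_qe_between[OF A(1) B(1) zZ] A(2) B(2) unfolding Ha_def Hb_def by linarith
  \<comment> \<open>The factor \<open>sqrt T\<close> comes from extending \<open>u0\<close>
    constantly over \<open>(0, T)\<close>, the \<open>2\<close> from the two components of the
    representative of \<open>f\<close>.\<close>
  have "norm (tens (indicator {0<..<T}) (oe \<Omega> u0)) + norm (fst r + qe T \<Omega> z) + norm (snd r) \<le> sqrt T * S + 2 * S + (Ha + Hb)"
    using e r1 z norm_triangle_ineq[of "fst r" "qe T \<Omega> z"] by linarith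
  also have "\<dots> \<le> (sqrt T + 2) * D"
  proof -
    have "0 \<le> sqrt T * (norm (qe T \<Omega> ud) + Ha + Hb)" using nn by (intro mult_nonneg_nonneg) auto
    then show ?thesis unfolding D_def udn using nn by (simp add: algebra_simps)
  qed
  finally have data: "norm (tens (indicator {0<..<T}) (oe \<Omega> u0)) + norm (fst r + qe T \<Omega> z) + norm (snd r) \<le> (sqrt T + 2) * D" .
  have "norm (qe T \<Omega> u) \<le> K * (norm (tens (indicator {0<..<T}) (oe \<Omega> u0)) + norm (fst r + qe T \<Omega> z) + norm (snd r))"
    unfolding K_def X(3)[symmetric] by (rule evolution_energy[OF T V P \<kappa>(1) X(1) eqX])
  also have "\<dots> \<le> K * ((sqrt T + 2) * D)" by (rule mult_left_mono[OF data K])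
  finally have un: "norm (qe T \<Omega> u) \<le> K * (sqrt T + 2) * D" by (simp add: mult.assoc)
  have "norm F \<le> norm (qe T \<Omega> u) + norm (qe T \<Omega> ud)" unfolding F_def qe_linear(4)[OF X(2) ud] by (rule norm_triangle_ineq4)
  also have "\<dots> \<le> K * (sqrt T + 2) * D + D" using un nn unfolding D_def udn by linarith
  finally have Fn: "norm F \<le> (K * (sqrt T + 2) + 1) * D" by (simp add: distrib_right)
  have "L2Q_norm T \<Omega> (\<lambda>t x. fn Dz (t, x)) + L2Q_norm T \<Omega> (\<lambda>t x. fn Dp (t, x)) \<le> norm Dz + norm Dp"
    by (intro add_mono in_L2Q_fn(2)[OF \<Omega>b])
  \<comment> \<open>\<open>norm F\<close> counts once for the adjoint state and
    \<open>1 / \<mu>\<close> times for the control; \<open>Ha + Hb\<close> is absorbed in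
    \<open>D\<close>.\<close>
  also have "\<dots> \<le> D + (1 / \<mu> + 1) * norm F" using Dz(1) Dp(1) nn unfolding D_def udn distrib_right by linarith
  also have "\<dots> \<le> D + (1 / \<mu> + 1) * ((K * (sqrt T + 2) + 1) * D)" using Fn \<mu> by (intro add_left_mono mult_left_mono) auto
  also have "\<dots> = (1 + (1 / \<mu> + 1) * (K * (sqrt T + 2) + 1)) * D" by (simp only: distrib_right mult.assoc mult_1)
  finally have "L2Q_norm T \<Omega> (\<lambda>t x. fn Dz (t, x)) + L2Q_norm T \<Omega> (\<lambda>t x. fn Dp (t, x))
      \<le> (1 + (1 / \<mu> + 1) * (K * (sqrt T + 2) + 1)) * (S + L2Q_norm T \<Omega> ud + H1L2_norm T \<Omega> a + H1L2_norm T \<Omega> b)"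
    unfolding D_def Ha_def Hb_def .
  then show ?thesis unfolding S_def by (intro exI[of _ "\<lambda>t x. fn Dz (t, x)"] exI[of _ "\<lambda>t x. fn Dp (t, x)"] conjI
      has_dt_L2_if_wdt[OF zQ Dz(2)] has_dt_L2_if_wdt[OF Y(2) Dp(2)] in_L2Q_fn(1)[OF \<Omega>b])
qed

end

theorem theorem4p7:
  fixes \<Omega> :: "(real^'n) set" and s T \<mu> :: real
  assumes "lipschitz_domain \<Omega>" and "0 < s" and "s < 1" and "0 < T" and "0 < \<mu>"
  shows "\<exists>C. \<forall>f u0 ud a b zbar ubar pbar.
     in_L2_Hms T \<Omega> s f \<longrightarrow> in_L2_Omega \<Omega> u0 \<longrightarrow> in_L2Q T \<Omega> ud \<longrightarrow>
     in_H1L2 T \<Omega> a \<longrightarrow> in_H1L2 T \<Omega> b \<longrightarrow>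
     (AE p in lebesgue. p \<in> cyl T \<Omega> \<longrightarrow> a (fst p) (snd p) \<le> b (fst p) (snd p)) \<longrightarrow>
     is_optimal T \<Omega> s \<mu> f u0 ud a b zbar ubar \<longrightarrow>
     is_adjoint T \<Omega> s ubar ud pbar \<longrightarrow>
     (\<exists>dz dp. in_L2Q T \<Omega> dz \<and> has_dt_L2 T \<Omega> zbar dz \<and>
              in_L2Q T \<Omega> dp \<and> has_dt_L2 T \<Omega> pbar dp \<and>
        L2Q_norm T \<Omega> dz + L2Q_norm T \<Omega> dp \<le>
          C * (sqrt ((L2_Omega_norm \<Omega> u0)\<^sup>2 + (L2_Hms_norm T \<Omega> s f)\<^sup>2)
               + L2Q_norm T \<Omega> ud + H1L2_norm T \<Omega> a + H1L2_norm T \<Omega> b))"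
proof -
  have \<Omega>: "open \<Omega>" "bounded \<Omega>" using assms(1) unfolding lipschitz_domain_def by auto
  note s = assms(2,3)
  \<comment> \<open>\<open>P\<close> and \<open>\<kappa>\<close> depend only on
    \<open>\<Omega>\<close>, \<open>s\<close> and the dimension, so the constant is fixed before the
    data are quantified.\<close>
  obtain P where P: "0 \<le> P" "\<And>v. v \<in> Vsp \<Omega> s ==> norm (fst v) \<le> P * norm (snd v)"
    using Vsp_poincare[OF s \<Omega>] by blast
  define \<kappa> where "\<kappa> = Cns CARD('n) s / 2"
  have "0 < \<kappa>"
    unfolding \<kappa>_def Cns_def using s by (intro divide_pos_pos mult_pos_pos Gamma_real_pos) (auto simp: add_pos_nonneg)
  from optimal_regularity[OF s assms(4) \<Omega>(1) assms(5) P(2,1) this \<kappa>_def] show ?thesis by blast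
qed

end
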